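(* Let $\mathcal{L}$ be an indecomposable semisimple Leibniz algebra with a given Levi decomposition $\mathcal{L}=\mathcal{S}\dot{+}\mathcal{I}$, where $\mathcal{I}=\mathrm{span}\{[x,x]:x\in\mathcal{L}\}\neq\{0\}$ and $\mathcal{S}$ is a semisimple Lie subalgebra. Then there are decompositions with the following properties: (a) $\mathcal{S}=\bigoplus_{i=1}^m\mathcal{S}_i$, where each $\mathcal{S}_i$ is a simple Lie algebra (a simple ideal of $\mathcal{S}$); (b) $\mathcal{I}=\bigoplus_{i=1}^n\mathcal{I}_i$, where each $\mathcal{I}_i$ is an irreducible $\mathcal{S}$-module with $[\mathcal{I}_i,\mathcal{S}]=\mathcal{I}_i$; (c) $\mathcal{L}=\mathcal{S}\ltimes\mathcal{I}$; (d) for any $1\le i\le n$ and $1\le j\le m$ there is an irreducible $\mathcal{S}_j$-module $\mathcal{I}_{ij}$ such that $\mathcal{I}_i\cong\bigotimes_{j=1}^m\mathcal{I}_{ij}$ as $\mathcal{S}$-modules for every $1\le i\le n$; (e) any $\mathcal{S}_i$ and $\mathcal{S}_j$ ($1\le i,j\le m$) are connected.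
   Context: All vector spaces and algebras are finite-dimensional over $\mathbb{C}$. A (right) Leibniz algebra is a vector space $\mathcal{L}$ with a bilinear bracket satisfying $[x,[y,z]]=[[x,y],z]-[[x,z],y]$ for all $x,y,z$. The subspace $\mathcal{I}=\mathrm{span}\{[x,x]:x\in\mathcal{L}\}$ is an ideal, $[\mathcal{L},\mathcal{I}]=0$, and $\mathcal{L}/\mathcal{I}$ is a Lie algebra, called the liezation of $\mathcal{L}$. $\mathcal{L}$ is semisimple if $\mathcal{L}/\mathcal{I}$ is a semisimple Lie algebra. In that case $\mathcal{L}=\mathcal{S}\dot{+}\mathcal{I}$ (direct sum of subspaces) for some semisimple Lie subalgebra $\mathcal{S}$ of $\mathcal{L}$; this is called a Levi decomposition. $\mathcal{I}$ is a right $\mathcal{S}$-module via $v.g=[v,g]$. A right module $\mathcal{V}$ over a Lie algebra $\mathcal{G}$ satisfies $v.[g,h]=(v.g).h-(v.h).g$. For such a module, $\mathcal{G}\ltimes\mathcal{V}$ denotes the Leibniz algebra on the vector space $\mathcal{G}\oplus\mathcal{V}$ with bracket $[(g_1,v_1),(g_2,v_2)]=([g_1,g_2],v_1.g_2)$. A semisimple Leibniz algebra is decomposable if it is a direct sum of two ideals $(\mathcal{S}_1\dot{+}\mathcal{I}_1)\oplus(\mathcal{S}_2\dot{+}\mathcal{I}_2)$, both summands being nontrivial (nonzero) semisimple Leibniz algebras; otherwise it is indecomposable. Here the summands $\mathcal{S}_k\dot{+}\mathcal{I}_k$ may be Lie algebras, i.e. $\mathcal{I}_k=0$ is allowed. Given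 decompositions of $\mathcal{S}$ into simple ideals $\mathcal{S}_i$ and of $\mathcal{I}$ into irreducible $\mathcal{S}$-modules $\mathcal{I}_k$: $\mathcal{S}_i$ and $\mathcal{S}_j$ are adjacent if there exists $\mathcal{I}_k$ with $[\mathcal{I}_k,\mathcal{S}_i]=[\mathcal{I}_k,\mathcal{S}_j]=\mathcal{I}_k$. $\mathcal{S}_i$ and $\mathcal{S}_j$ are connected if there exist $\mathcal{S}_{k_1}=\mathcal{S}_i,\mathcal{S}_{k_2},\dots,\mathcal{S}_{k_r}=\mathcal{S}_j$ such that $\mathcal{S}_{k_l}$ and $\mathcal{S}_{k_{l+1}}$ are adjacent for all $1\le l<r$. If $\mathcal{V}_j$ is an $\mathcal{S}_j$-module for each $j$, then $\bigotimes_j\mathcal{V}_j$ is an $\mathcal{S}$-module in which $x=x_1+\dots+x_m$ ($x_j\in\mathcal{S}_j$) acts as the sum over $j$ of the action of $x_j$ on the $j$-th tensor factor. *)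

theory Defs
  imports Complex_Main "HOL-Library.FuncSet" "HOL-Algebra.AbelCoset" "Jordan_Normal_Form.VS_Connect"
begin

abbreviation complex_field :: "complex ring"
  where "complex_field \<equiv> class_ring"

subsection \<open>Quotient spaces and internal direct sums\<close>

text \<open>An operation on cosets is the union of the cosets of the results on representatives.
  As usual for \<^const>\<open>vectorspace\<close>, the fields \<open>mult\<close> and \<open>one\<close> inherited from the ring record
  carry no meaning.\<close>

definition quotient_space ::
  "(complex, 'v, 'x) module_scheme \<Rightarrow> 'v set \<Rightarrow> (complex, 'v set) module" where
  "quotient_space V W =
    \<lparr>carrier = a_rcosets\<^bsub>V\<^esub> W, mult = (\<lambda>X Y. W), one = W, zero = W,
     add = (\<lambda>X Y. X <+>\<^bsub>V\<^esub> Y),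
     smult = (\<lambda>c X. \<Union>x\<in>X. W +>\<^bsub>V\<^esub> (c \<odot>\<^bsub>V\<^esub> x))\<rparr>"

definition complementary ::
  "(complex, 'v, 'x) module_scheme \<Rightarrow> 'v set \<Rightarrow> 'v set \<Rightarrow> bool" where
  "complementary V U W \<longleftrightarrow>
    subspace complex_field U V \<and> subspace complex_field W V \<and>
    U \<inter> W = {\<zero>\<^bsub>V\<^esub>} \<and> U <+>\<^bsub>V\<^esub> W = carrier V"

definition internal_direct_sum ::
  "(complex, 'v, 'x) module_scheme \<Rightarrow> 'i set \<Rightarrow> ('i \<Rightarrow> 'v set) \<Rightarrow> bool" where
  "internal_direct_sum V A W \<longleftrightarrow>
    finite A \<and> (\<forall>i\<in>A. subspace complex_field (W i) V) \<and>
    (\<forall>x\<in>carrier V. \<exists>!w. w \<in> (\<Pi>\<^sub>E i\<in>A. W i) \<and> x = finsum V w A)"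

definition component ::
  "(complex, 'v, 'x) module_scheme \<Rightarrow> 'i set \<Rightarrow> ('i \<Rightarrow> 'v set) \<Rightarrow> 'i \<Rightarrow> 'v \<Rightarrow> 'v" where
  "component V A W i x = (THE w. w \<in> (\<Pi>\<^sub>E i\<in>A. W i) \<and> x = finsum V w A) i"

subsection \<open>Leibniz algebras\<close>

record 'a bracket_algebra = "(complex, 'a) module" +
  bracket :: "['a, 'a] \<Rightarrow> 'a" ("\<lbrace>_, _\<rbrace>\<index>")

locale leibniz_algebra = vectorspace complex_field L
  for L :: "('a, 'x) bracket_algebra_scheme" (structure) +
  assumes fin_dim: "fin_dim"
    and bracket_closed:
      "\<lbrakk>x \<in> carrier L; y \<in> carrier L\<rbrakk> \<Longrightarrow> \<lbrace>x, y\<rbrace>\<^bsub>L\<^esub> \<in> carrier L"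
    and bracket_add_left:
      "\<lbrakk>x \<in> carrier L; y \<in> carrier L; z \<in> carrier L\<rbrakk> \<Longrightarrow>
        \<lbrace>x \<oplus>\<^bsub>L\<^esub> y, z\<rbrace>\<^bsub>L\<^esub> = \<lbrace>x, z\<rbrace>\<^bsub>L\<^esub> \<oplus>\<^bsub>L\<^esub> \<lbrace>y, z\<rbrace>\<^bsub>L\<^esub>"
    and bracket_add_right:
      "\<lbrakk>x \<in> carrier L; y \<in> carrier L; z \<in> carrier L\<rbrakk> \<Longrightarrow>
        \<lbrace>x, y \<oplus>\<^bsub>L\<^esub> z\<rbrace>\<^bsub>L\<^esub> = \<lbrace>x, y\<rbrace>\<^bsub>L\<^esub> \<oplus>\<^bsub>L\<^esub> \<lbrace>x, z\<rbrace>\<^bsub>L\<^esub>"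
    and bracket_smult_left:
      "\<lbrakk>x \<in> carrier L; y \<in> carrier L\<rbrakk> \<Longrightarrow>
        \<lbrace>c \<odot>\<^bsub>L\<^esub> x, y\<rbrace>\<^bsub>L\<^esub> = c \<odot>\<^bsub>L\<^esub> \<lbrace>x, y\<rbrace>\<^bsub>L\<^esub>"
    and bracket_smult_right:
      "\<lbrakk>x \<in> carrier L; y \<in> carrier L\<rbrakk> \<Longrightarrow>
        \<lbrace>x, c \<odot>\<^bsub>L\<^esub> y\<rbrace>\<^bsub>L\<^esub> = c \<odot>\<^bsub>L\<^esub> \<lbrace>x, y\<rbrace>\<^bsub>L\<^esub>"
    and leibniz_identity:
      "\<lbrakk>x \<in> carrier L; y \<in> carrier L; z \<in> carrier L\<rbrakk> \<Longrightarrow>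
        \<lbrace>x, \<lbrace>y, z\<rbrace>\<^bsub>L\<^esub>\<rbrace>\<^bsub>L\<^esub>
          = \<lbrace>\<lbrace>x, y\<rbrace>\<^bsub>L\<^esub>, z\<rbrace>\<^bsub>L\<^esub> \<ominus>\<^bsub>L\<^esub> \<lbrace>\<lbrace>x, z\<rbrace>\<^bsub>L\<^esub>, y\<rbrace>\<^bsub>L\<^esub>"

text \<open>For an alternating bracket the Leibniz identity is the Jacobi identity.\<close>

locale lie_algebra = leibniz_algebra +
  assumes bracket_self: "x \<in> carrier L \<Longrightarrow> \<lbrace>x, x\<rbrace>\<^bsub>L\<^esub> = \<zero>\<^bsub>L\<^esub>"

definition bracket_span ::
  "('a, 'x) bracket_algebra_scheme \<Rightarrow> 'a set \<Rightarrow> 'a set \<Rightarrow> 'a set" where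
  "bracket_span L X Y =
    LinearCombinations.module.span complex_field L {\<lbrace>x, y\<rbrace>\<^bsub>L\<^esub> | x y. x \<in> X \<and> y \<in> Y}"

definition subalgebra :: "'a set \<Rightarrow> ('a, 'x) bracket_algebra_scheme \<Rightarrow> bool" where
  "subalgebra A L \<longleftrightarrow>
    subspace complex_field A L \<and> (\<forall>x\<in>A. \<forall>y\<in>A. \<lbrace>x, y\<rbrace>\<^bsub>L\<^esub> \<in> A)"

definition bracket_ideal :: "'a set \<Rightarrow> ('a, 'x) bracket_algebra_scheme \<Rightarrow> bool" where
  "bracket_ideal J L \<longleftrightarrow>
    subspace complex_field J L \<and>
    (\<forall>x\<in>carrier L. \<forall>y\<in>J. \<lbrace>x, y\<rbrace>\<^bsub>L\<^esub> \<in> J \<and> \<lbrace>y, x\<rbrace>\<^bsub>L\<^esub> \<in> J)"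

primrec derived_series ::
  "('a, 'x) bracket_algebra_scheme \<Rightarrow> 'a set \<Rightarrow> nat \<Rightarrow> 'a set" where
  "derived_series L J 0 = J"
| "derived_series L J (Suc k) =
    bracket_span L (derived_series L J k) (derived_series L J k)"

text \<open>Semisimple means that the radical vanishes: there is no nonzero solvable ideal.\<close>

definition semisimple_lie :: "('a, 'x) bracket_algebra_scheme \<Rightarrow> bool" where
  "semisimple_lie L \<longleftrightarrow>
    lie_algebra L \<and>
    (\<forall>J. bracket_ideal J L \<and> (\<exists>k. derived_series L J k = {\<zero>\<^bsub>L\<^esub>}) \<longrightarrow> J = {\<zero>\<^bsub>L\<^esub>})"

definition simple_lie :: "('a, 'x) bracket_algebra_scheme \<Rightarrow> bool" where
  "simple_lie L \<longleftrightarrow>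
    lie_algebra L \<and>
    (\<exists>x\<in>carrier L. \<exists>y\<in>carrier L. \<lbrace>x, y\<rbrace>\<^bsub>L\<^esub> \<noteq> \<zero>\<^bsub>L\<^esub>) \<and>
    (\<forall>J. bracket_ideal J L \<longrightarrow> J = {\<zero>\<^bsub>L\<^esub>} \<or> J = carrier L)"

definition leibniz_kernel :: "('a, 'x) bracket_algebra_scheme \<Rightarrow> 'a set" where
  "leibniz_kernel L = LinearCombinations.module.span complex_field L {\<lbrace>x, x\<rbrace>\<^bsub>L\<^esub> | x. x \<in> carrier L}"

definition quotient_algebra ::
  "('a, 'x) bracket_algebra_scheme \<Rightarrow> 'a set \<Rightarrow> 'a set bracket_algebra" where
  "quotient_algebra L J =
    module.extend (quotient_space L J)
      (bracket_algebra.fields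
        (\<lambda>X Y. \<Union>x\<in>X. \<Union>y\<in>Y. J +>\<^bsub>L\<^esub> \<lbrace>x, y\<rbrace>\<^bsub>L\<^esub>))"

definition semisimple_leibniz :: "('a, 'x) bracket_algebra_scheme \<Rightarrow> bool" where
  "semisimple_leibniz L \<longleftrightarrow>
    leibniz_algebra L \<and> semisimple_lie (quotient_algebra L (leibniz_kernel L))"

text \<open>The Leibniz kernel of a summand is computed in that summand and may be zero.\<close>

definition decomposable :: "('a, 'x) bracket_algebra_scheme \<Rightarrow> bool" where
  "decomposable L \<longleftrightarrow>
    (\<exists>A B. bracket_ideal A L \<and> bracket_ideal B L \<and> complementary L A B \<and>
      A \<noteq> {\<zero>\<^bsub>L\<^esub>} \<and> B \<noteq> {\<zero>\<^bsub>L\<^esub>} \<and>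
      semisimple_leibniz (L\<lparr>carrier := A\<rparr>) \<and> semisimple_leibniz (L\<lparr>carrier := B\<rparr>))"

definition levi_decomposition :: "('a, 'x) bracket_algebra_scheme \<Rightarrow> 'a set \<Rightarrow> bool" where
  "levi_decomposition L S \<longleftrightarrow>
    subalgebra S L \<and> semisimple_lie (L\<lparr>carrier := S\<rparr>) \<and> complementary L S (leibniz_kernel L)"

definition algebra_iso ::
  "('a, 'x) bracket_algebra_scheme \<Rightarrow> ('b, 'y) bracket_algebra_scheme \<Rightarrow> ('a \<Rightarrow> 'b) \<Rightarrow> bool" where
  "algebra_iso L M f \<longleftrightarrow>
    linear_map complex_field L M f \<and> bij_betw f (carrier L) (carrier M) \<and>
    (\<forall>x\<in>carrier L. \<forall>y\<in>carrier L. f \<lbrace>x, y\<rbrace>\<^bsub>L\<^esub> = \<lbrace>f x, f y\<rbrace>\<^bsub>M\<^esub>)"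

subsection \<open>Right modules over Lie algebras\<close>

record ('g, 'v) right_module = "(complex, 'v) module" +
  act :: "['v, 'g] \<Rightarrow> 'v"

locale lie_module = lie?: lie_algebra G + vectorspace complex_field V
  for G :: "('g, 'x) bracket_algebra_scheme" and V :: "('g, 'v, 'y) right_module_scheme" +
  assumes fin_dim_module: "vectorspace.fin_dim complex_field V"
    and act_closed:
      "\<lbrakk>v \<in> carrier V; g \<in> carrier G\<rbrakk> \<Longrightarrow> act V v g \<in> carrier V"
    and act_add_left:
      "\<lbrakk>v \<in> carrier V; w \<in> carrier V; g \<in> carrier G\<rbrakk> \<Longrightarrow>
        act V (v \<oplus>\<^bsub>V\<^esub> w) g = act V v g \<oplus>\<^bsub>V\<^esub> act V w g"
    and act_smult_left:
      "\<lbrakk>v \<in> carrier V; g \<in> carrier G\<rbrakk> \<Longrightarrow>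
        act V (c \<odot>\<^bsub>V\<^esub> v) g = c \<odot>\<^bsub>V\<^esub> act V v g"
    and act_add_right:
      "\<lbrakk>v \<in> carrier V; g \<in> carrier G; h \<in> carrier G\<rbrakk> \<Longrightarrow>
        act V v (g \<oplus>\<^bsub>G\<^esub> h) = act V v g \<oplus>\<^bsub>V\<^esub> act V v h"
    and act_smult_right:
      "\<lbrakk>v \<in> carrier V; g \<in> carrier G\<rbrakk> \<Longrightarrow>
        act V v (c \<odot>\<^bsub>G\<^esub> g) = c \<odot>\<^bsub>V\<^esub> act V v g"
    and act_bracket:
      "\<lbrakk>v \<in> carrier V; g \<in> carrier G; h \<in> carrier G\<rbrakk> \<Longrightarrow>
        act V v \<lbrace>g, h\<rbrace>\<^bsub>G\<^esub> = act V (act V v g) h \<ominus>\<^bsub>V\<^esub> act V (act V v h) g"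

definition irreducible_module ::
  "('g, 'x) bracket_algebra_scheme \<Rightarrow> ('g, 'v, 'y) right_module_scheme \<Rightarrow> bool" where
  "irreducible_module G V \<longleftrightarrow>
    lie_module G V \<and> carrier V \<noteq> {\<zero>\<^bsub>V\<^esub>} \<and>
    (\<forall>W. subspace complex_field W V \<and> (\<forall>w\<in>W. \<forall>g\<in>carrier G. act V w g \<in> W) \<longrightarrow>
      W = {\<zero>\<^bsub>V\<^esub>} \<or> W = carrier V)"

definition isomorphic_modules ::
  "('g, 'x) bracket_algebra_scheme \<Rightarrow> ('g, 'v, 'y) right_module_scheme \<Rightarrow>
    ('g, 'w, 'z) right_module_scheme \<Rightarrow> bool" where
  "isomorphic_modules G V W \<longleftrightarrow>
    (\<exists>f. linear_map complex_field V W f \<and> bij_betw f (carrier V) (carrier W) \<and>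
      (\<forall>v\<in>carrier V. \<forall>g\<in>carrier G. f (act V v g) = act W (f v) g))"

definition bracket_module ::
  "('a, 'x) bracket_algebra_scheme \<Rightarrow> 'a set \<Rightarrow> ('a, 'a) right_module" where
  "bracket_module L W =
    module.extend (module.truncate (L\<lparr>carrier := W\<rparr>)) (right_module.fields (bracket L))"

definition semidirect ::
  "('g, 'x) bracket_algebra_scheme \<Rightarrow> ('g, 'v, 'y) right_module_scheme \<Rightarrow>
    ('g \<times> 'v) bracket_algebra" where
  "semidirect G V =
    module.extend (direct_sum G V)
      (bracket_algebra.fields
        (\<lambda>(g\<^sub>1, v\<^sub>1) (g\<^sub>2, v\<^sub>2). (\<lbrace>g\<^sub>1, g\<^sub>2\<rbrace>\<^bsub>G\<^esub>, act V v\<^sub>1 g\<^sub>2)))"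

subsection \<open>Tensor products\<close>

text \<open>The tensor product of a finite family of spaces is the free vector space on the
  product of their carriers (finitely supported functions) modulo the relations of
  multilinearity.\<close>

definition free_space :: "'b set \<Rightarrow> (complex, 'b \<Rightarrow> complex) module" where
  "free_space B =
    \<lparr>carrier = {f. finite {b. f b \<noteq> 0} \<and> {b. f b \<noteq> 0} \<subseteq> B},
     mult = (\<lambda>f g b. 0), one = (\<lambda>b. 0), zero = (\<lambda>b. 0),
     add = (\<lambda>f g b. f b + g b), smult = (\<lambda>c f b. c * f b)\<rparr>"

definition free_gen :: "'b \<Rightarrow> 'b \<Rightarrow> complex" where
  "free_gen b = (\<lambda>b'. if b' = b then 1 else 0)"

definition multilinear_relations ::
  "'i set \<Rightarrow> ('i \<Rightarrow> (complex, 'v, 'y) module_scheme) \<Rightarrow> (('i \<Rightarrow> 'v) \<Rightarrow> complex) set" where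
  "multilinear_relations A V =
    LinearCombinations.module.span complex_field (free_space (\<Pi>\<^sub>E i\<in>A. carrier (V i)))
      ({(\<lambda>u. free_gen (v(j := x \<oplus>\<^bsub>V j\<^esub> y)) u - free_gen (v(j := x)) u - free_gen (v(j := y)) u)
          | v j x y. v \<in> (\<Pi>\<^sub>E i\<in>A. carrier (V i)) \<and> j \<in> A \<and>
              x \<in> carrier (V j) \<and> y \<in> carrier (V j)} \<union>
       {(\<lambda>u. free_gen (v(j := c \<odot>\<^bsub>V j\<^esub> x)) u - c * free_gen (v(j := x)) u)
          | v j x c. v \<in> (\<Pi>\<^sub>E i\<in>A. carrier (V i)) \<and> j \<in> A \<and> x \<in> carrier (V j)})"

definition tensor_space ::
  "'i set \<Rightarrow> ('i \<Rightarrow> (complex, 'v, 'y) module_scheme) \<Rightarrow>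
    (complex, (('i \<Rightarrow> 'v) \<Rightarrow> complex) set) module" where
  "tensor_space A V =
    quotient_space (free_space (\<Pi>\<^sub>E i\<in>A. carrier (V i))) (multilinear_relations A V)"

text \<open>\<open>G\<close> is the direct sum of its subalgebras \<open>H i\<close>, and \<open>V i\<close> is an \<open>H i\<close>-module. On
  the free space, \<open>x\<close> sends the generator \<open>v\<close> to the sum over \<open>j\<close> of the generators
  obtained from \<open>v\<close> by letting the \<open>j\<close>-th component of \<open>x\<close> act on the \<open>j\<close>-th entry; on
  the tensor product it acts by the induced map.\<close>

definition free_action ::
  "('g, 'x) bracket_algebra_scheme \<Rightarrow> 'i set \<Rightarrow> ('i \<Rightarrow> 'g set) \<Rightarrow>
    ('i \<Rightarrow> ('g, 'v, 'y) right_module_scheme) \<Rightarrow>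
    (('i \<Rightarrow> 'v) \<Rightarrow> complex) \<Rightarrow> 'g \<Rightarrow> (('i \<Rightarrow> 'v) \<Rightarrow> complex)" where
  "free_action G A H V f x =
    (\<lambda>u. \<Sum>v | f v \<noteq> 0. f v * (\<Sum>j\<in>A. free_gen (v(j := act (V j) (v j) (component G A H j x))) u))"

definition tensor_module ::
  "('g, 'x) bracket_algebra_scheme \<Rightarrow> 'i set \<Rightarrow> ('i \<Rightarrow> 'g set) \<Rightarrow>
    ('i \<Rightarrow> ('g, 'v, 'y) right_module_scheme) \<Rightarrow>
    ('g, (('i \<Rightarrow> 'v) \<Rightarrow> complex) set) right_module" where
  "tensor_module G A H V =
    module.extend (tensor_space A V)
      (right_module.fields
        (\<lambda>X x. \<Union>f\<in>X. multilinear_relations A V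
            +>\<^bsub>free_space (\<Pi>\<^sub>E i\<in>A. carrier (V i))\<^esub> free_action G A H V f x))"

subsection \<open>Connectedness\<close>

definition adjacent ::
  "('a, 'x) bracket_algebra_scheme \<Rightarrow> 'k set \<Rightarrow> ('k \<Rightarrow> 'a set) \<Rightarrow> 'a set \<Rightarrow> 'a set \<Rightarrow> bool" where
  "adjacent L K I S T \<longleftrightarrow>
    (\<exists>k\<in>K. bracket_span L (I k) S = I k \<and> bracket_span L (I k) T = I k)"

text \<open>The reflexive closure accounts for chains consisting of a single summand.\<close>

definition connected_summands ::
  "('a, 'x) bracket_algebra_scheme \<Rightarrow> 'k set \<Rightarrow> ('k \<Rightarrow> 'a set) \<Rightarrow> 'i set \<Rightarrow> ('i \<Rightarrow> 'a set) \<Rightarrow>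
    'i \<Rightarrow> 'i \<Rightarrow> bool" where
  "connected_summands L K I A S i j \<longleftrightarrow>
    (i, j) \<in> {(a, b). a \<in> A \<and> b \<in> A \<and> adjacent L K I (S a) (S b)}\<^sup>*"

end

theory Submission
  imports Defs "HOL-Library.Function_Algebras" "HOL-Library.Product_Plus"
    "HOL-Computational_Algebra.Fundamental_Theorem_Algebra"
begin

text \<open>
  Everything rests on the semisimple Lie algebra \<open>S\<close>.
  Cartan's criterion, obtained from the trace against the complex conjugate of the semisimple part
  of an operator, makes the trace form of a faithful module nondegenerate. Orthogonal
  complements of ideals then split \<open>S\<close> into simple ideals, and the Casimir operator, through the
  Fitting decomposition, kills the cocycles that obstruct complete reducibility; so \<open>I\<close> splits
  into irreducible modules. None of them is trivial, since \<open>I\<close> is spanned by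
  squares \<open>[g + v, g + v] = [v, g]\<close>. An irreducible \<open>W\<close> over a sum \<open>X \<oplus> Y\<close> of commuting ideals is
  \<open>U \<otimes> Hom\<^sub>X(U, W)\<close> for an \<open>X\<close>-irreducible \<open>U \<subseteq> W\<close>, which gives the tensor factors one simple ideal at
  a time. Finally, a connected component of simple ideals, together with the irreducible modules on
  which it acts nontrivially, is an ideal of \<open>L\<close> complemented by the one formed from the remaining
  simple ideals and modules, so indecomposability leaves a single component.
\<close>

subsection \<open>Complex vector spaces\<close>

text \<open>The statement concerns records over an arbitrary type and wants all tensor factors in
  one fixed type. Coordinates serve both ends: \<open>L\<close> is copied to a subspace of
  \<open>nat \<Rightarrow> complex\<close>, and the linear algebra is done with subspaces of types
  that are vector spaces as a whole. The space of \<open>X\<close>-maps from \<open>U\<close> to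
  \<open>W\<close> is represented by its values at one fixed nonzero vector of \<open>U\<close>, so
  all tensor factors of an irreducible \<open>W\<close> are again subspaces of \<open>W\<close>.

  Semisimplicity enters as the absence of nonzero abelian ideals, and Cartan's criterion is used for
  a contradiction, not for solvability. A minimal nonzero ideal on which the trace form of a
  faithful module vanishes is perfect, hence acts by nilpotent operators; Engel's theorem, stated
  relative to a submodule, then forces it to act by zero. Neither the radical nor Lie's theorem is
  involved.\<close>

class cvs = ab_group_add +
  fixes csc :: "complex \<Rightarrow> 'a \<Rightarrow> 'a" (infixr "*\<^sub>c" 75)
  assumes csc_add_right: "c *\<^sub>c (x + y) = c *\<^sub>c x + c *\<^sub>c y"
    and csc_add_left: "(c + d) *\<^sub>c x = c *\<^sub>c x + d *\<^sub>c x"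
    and csc_csc: "c *\<^sub>c d *\<^sub>c x = (c * d) *\<^sub>c x"
    and csc_one: "1 *\<^sub>c x = x"

instantiation complex :: cvs
begin
definition csc_complex :: "complex \<Rightarrow> complex \<Rightarrow> complex" where "csc_complex = (*)"
instance by standard (simp_all add: csc_complex_def algebra_simps)
end

instantiation "fun" :: (type, cvs) cvs
begin
definition csc_fun :: "complex \<Rightarrow> ('a \<Rightarrow> 'b) \<Rightarrow> 'a \<Rightarrow> 'b" where "csc_fun c f = (\<lambda>x. c *\<^sub>c f x)"
instance by standard
  (simp_all add: csc_fun_def plus_fun_def csc_add_right csc_add_left csc_csc csc_one)
end

lemma csc_complex_eq [simp]: "(c::complex) *\<^sub>c d = c * d"
  by (simp add: csc_complex_def)

lemma csc_fun_apply [simp]: "(c *\<^sub>c f) x = c *\<^sub>c f x"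
  by (simp add: csc_fun_def)

lemma sum_fun_apply: "(\<Sum>i\<in>A. f i) x = (\<Sum>i\<in>A. (f i x :: 'b::ab_group_add))"
  by (induction A rule: infinite_finite_induct) auto

interpretation cvs: vector_space "csc :: complex \<Rightarrow> 'a::cvs \<Rightarrow> 'a"
  by unfold_locales (simp_all add: csc_add_right csc_add_left csc_csc csc_one)

interpretation cvp: vector_space_pair "csc :: complex \<Rightarrow> 'a::cvs \<Rightarrow> 'a" "csc :: complex \<Rightarrow> 'b::cvs \<Rightarrow> 'b" ..

abbreviation clin :: "('a::cvs \<Rightarrow> 'b::cvs) \<Rightarrow> bool" where "clin \<equiv> Vector_Spaces.linear csc csc"

lemma clin_iff: "clin f \<longleftrightarrow> (\<forall>x y. f (x + y) = f x + f y) \<and> (\<forall>c x. f (c *\<^sub>c x) = c *\<^sub>c f x)"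
  unfolding Vector_Spaces.linear_iff by (simp add: cvs.vector_space_axioms)

lemma clinI: "(\<And>x y. f (x + y) = f x + f y) \<Longrightarrow> (\<And>c x. f (c *\<^sub>c x) = c *\<^sub>c f x) \<Longrightarrow> clin f"
  by (simp add: clin_iff)

lemma clin_add: "clin f \<Longrightarrow> f (x + y) = f x + f y"
  and clin_scale: "clin f \<Longrightarrow> f (c *\<^sub>c x) = c *\<^sub>c f x"
  by (simp_all add: clin_iff)

lemma clin_0: "clin f \<Longrightarrow> f 0 = 0" by (rule cvp.linear_0)
lemma clin_diff: "clin f \<Longrightarrow> f (x - y) = f x - f y" by (rule cvp.linear_diff)
lemma clin_neg: "clin f \<Longrightarrow> f (- x) = - f x" by (rule cvp.linear_neg)
lemma clin_sum: "clin f \<Longrightarrow> f (\<Sum>i\<in>A. g i) = (\<Sum>i\<in>A. f (g i))" by (rule cvp.linear_sum)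

lemmas clin_simps = clin_add clin_scale clin_0 clin_diff clin_neg clin_sum

named_theorems clin_intros

lemma clin_id [clin_intros]: "clin (\<lambda>x. x)" by (simp add: clin_iff)
lemma clin_zero [clin_intros]: "clin (\<lambda>x. 0)" by (simp add: clin_iff)
lemma clin_plus [clin_intros]: "clin f \<Longrightarrow> clin g \<Longrightarrow> clin (\<lambda>x. f x + g x)"
  by (simp add: clin_iff algebra_simps cvs.scale_right_distrib)
lemma clin_minus [clin_intros]: "clin f \<Longrightarrow> clin g \<Longrightarrow> clin (\<lambda>x. f x - g x)"
  by (simp add: clin_iff algebra_simps cvs.scale_right_diff_distrib)
lemma clin_csc [clin_intros]: "clin f \<Longrightarrow> clin (\<lambda>x. c *\<^sub>c f x)"
  by (simp add: clin_iff cvs.scale_right_distrib cvs.scale_left_commute)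
lemma clin_compose: "clin f \<Longrightarrow> clin g \<Longrightarrow> clin (\<lambda>x. f (g x))"
  by (simp add: clin_iff)
lemma clin_sum_fun [clin_intros]: "(\<And>i. i \<in> A \<Longrightarrow> clin (f i)) \<Longrightarrow> clin (\<lambda>x. \<Sum>i\<in>A. f i x)"
  by (induction A rule: infinite_finite_induct) (auto intro: clin_zero clin_plus)
lemma clin_funpow [clin_intros]: "clin (f :: 'a::cvs \<Rightarrow> 'a) \<Longrightarrow> clin (f ^^ n)"
  by (induction n) (simp_all add: clin_iff)

lemma subspace_image: "clin f \<Longrightarrow> cvs.subspace S \<Longrightarrow> cvs.subspace (f ` S)"
  by (rule cvp.linear_subspace_image)

lemma eq_on_span: "clin f \<Longrightarrow> clin g \<Longrightarrow> (\<And>x. x \<in> S \<Longrightarrow> f x = g x) \<Longrightarrow> x \<in> cvs.span S \<Longrightarrow> f x = g x"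
  by (rule cvp.linear_eq_on)

lemma span_image_subset: "clin f \<Longrightarrow> cvs.subspace T \<Longrightarrow> (\<And>x. x \<in> S \<Longrightarrow> f x \<in> T) \<Longrightarrow> x \<in> cvs.span S \<Longrightarrow> f x \<in> T"
  using cvs.span_minimal[of "f ` S" T] cvp.linear_span_image[of f S] by blast

lemma subspace_Collect: "clin f \<Longrightarrow> cvs.subspace T \<Longrightarrow> cvs.subspace {x. f x \<in> T}"
  by (rule cvp.linear_subspace_linear_preimage)

section \<open>Finite-dimensional subspaces, bases and dimension\<close>

definition fds :: "'a::cvs set \<Rightarrow> bool" where
  "fds W \<longleftrightarrow> cvs.subspace W \<and> (\<exists>B. finite B \<and> W \<subseteq> cvs.span B)"

definition is_basis :: "'a::cvs set \<Rightarrow> 'a set \<Rightarrow> bool" where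
  "is_basis W B \<longleftrightarrow> finite B \<and> cvs.independent B \<and> cvs.span B = W"

lemma fds_subspace: "fds W \<Longrightarrow> cvs.subspace W" by (simp add: fds_def)

lemma fds_mono: "fds W \<Longrightarrow> cvs.subspace U \<Longrightarrow> U \<subseteq> W \<Longrightarrow> fds U"
  unfolding fds_def by blast

lemma fds_span: "finite B \<Longrightarrow> fds (cvs.span B)"
  unfolding fds_def by auto

lemma basis_extend:
  assumes "fds W" "S \<subseteq> W" "cvs.independent S"
  obtains B where "is_basis W B" "S \<subseteq> B"
proof -
  obtain B0 where B0: "finite B0" "W \<subseteq> cvs.span B0" using assms(1) by (auto simp: fds_def)
  obtain B where B: "S \<subseteq> B" "B \<subseteq> W" "cvs.independent B" "W \<subseteq> cvs.span B"
    using cvs.maximal_independent_subset_extend[OF assms(2,3)] by blast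
  have "finite B" using cvs.independent_span_bound[OF B0(1) B(3)] B(2) B0(2) by auto
  moreover have "cvs.span B = W" using cvs.span_subspace[OF B(2,4)] assms(1) by (simp add: fds_def)
  ultimately show ?thesis using B that by (auto simp: is_basis_def)
qed

lemma basis_ex: assumes "fds W" obtains B where "is_basis W B"
  using basis_extend[OF assms, of "{}"] by (auto simp: cvs.independent_empty)

lemma is_basis_dim: "is_basis W B \<Longrightarrow> cvs.dim W = card B"
  using cvs.dim_span_eq_card_independent by (auto simp: is_basis_def)

lemma fds_dim_mono: assumes "fds W" "cvs.subspace U" "U \<subseteq> W" shows "cvs.dim U \<le> cvs.dim W"
proof -
  obtain B where B: "is_basis W B" using basis_ex[OF assms(1)] .
  obtain C where C: "is_basis U C" using basis_ex[OF fds_mono[OF assms]] .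
  have "card C \<le> card B" using cvs.independent_span_bound[of B C] B C assms(3) cvs.span_superset[of C]
    by (auto simp: is_basis_def)
  then show ?thesis using is_basis_dim[OF B] is_basis_dim[OF C] by simp
qed

lemma fds_dim_less: assumes "fds W" "cvs.subspace U" "U \<subseteq> W" "U \<noteq> W" shows "cvs.dim U < cvs.dim W"
proof -
  obtain B where B: "is_basis W B" using basis_ex[OF assms(1)] .
  obtain C where C: "is_basis U C" using basis_ex[OF fds_mono[OF assms(1-3)]] .
  obtain x where x: "x \<in> W" "x \<notin> U" using assms by blast
  have i: "cvs.independent (insert x C)" using cvs.independent_insertI[of x C] C x by (auto simp: is_basis_def)
  have "card (insert x C) \<le> card B" using cvs.independent_span_bound[OF _ i, of B] B C assms(3) x cvs.span_superset[of C]
    by (auto simp: is_basis_def)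
  moreover have "x \<notin> C" using x C cvs.span_superset[of C] by (auto simp: is_basis_def)
  ultimately show ?thesis using is_basis_dim[OF B] is_basis_dim[OF C] C by (simp add: is_basis_def)
qed

lemma fds_dim_eq: "fds W \<Longrightarrow> cvs.subspace U \<Longrightarrow> U \<subseteq> W \<Longrightarrow> cvs.dim W \<le> cvs.dim U \<Longrightarrow> U = W"
  using fds_dim_less by fastforce

lemma fds_dim_0: assumes "fds W" shows "cvs.dim W = 0 \<longleftrightarrow> W = {0}"
proof -
  obtain B where B: "is_basis W B" using basis_ex[OF assms(1)] .
  show ?thesis
  proof
    assume "cvs.dim W = 0"
    then have "B = {}" using B is_basis_dim[OF B] by (simp add: is_basis_def)
    then show "W = {0}" using B by (simp add: is_basis_def)
  next
    assume "W = {0}"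
    then show "cvs.dim W = 0" using cvs.dim_span[of "{}"] cvs.dim_le_card[of "{0::'a}" "{}"] by simp
  qed
qed

lemma sub_basis: "is_basis W B \<Longrightarrow> b \<in> B \<Longrightarrow> b \<in> W"
  using cvs.span_base by (auto simp: is_basis_def)

lemma rep_sum: "is_basis W B \<Longrightarrow> w \<in> W \<Longrightarrow> (\<Sum>b\<in>B. cvs.representation B w b *\<^sub>c b) = w"
  unfolding is_basis_def using cvs.sum_representation_eq[of B w B] by auto

section \<open>Projections, and injectivity against surjectivity in finite dimension\<close>

lemma projection_ex:
  assumes "cvs.subspace U"
  obtains p :: "'a::cvs \<Rightarrow> 'a" where "clin p" "\<And>x. p x \<in> U" "\<And>x. x \<in> U \<Longrightarrow> p x = x"
proof -
  obtain g :: "'a \<Rightarrow> 'a" where "range g \<subseteq> U" "clin g" "\<forall>v\<in>U. g v = v"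
    using cvp.linear_exists_left_inverse_on[OF clin_id assms] by auto
  then show ?thesis by (intro that[of g]) auto
qed

text \<open>Let \<open>q\<close> project onto \<open>W\<close>. Then \<open>x - q x\<close> kills
  \<open>W\<close>, and it is injective on \<open>U\<close> because two elements of \<open>U\<close>
  with the same image differ by an element of \<open>U \<inter> W\<close>. Following it by a left
  inverse with range in \<open>U\<close> gives the projection. \<open>U + W\<close> may be a proper
  subspace.\<close>

lemma projection_along_ex:
  assumes "cvs.subspace U" "cvs.subspace W" "U \<inter> W \<subseteq> {0}"
  obtains p :: "'a::cvs \<Rightarrow> 'a" where "clin p" "\<And>x. p x \<in> U" "\<And>x. x \<in> U \<Longrightarrow> p x = x"
    "\<And>x. x \<in> W \<Longrightarrow> p x = 0"
proof -
  obtain q :: "'a \<Rightarrow> 'a" where q: "clin q" "\<And>x. q x \<in> W" "\<And>x. x \<in> W \<Longrightarrow> q x = x"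
    using projection_ex[OF assms(2)] by blast
  have l: "clin (\<lambda>x. x - q x)" by (intro clin_intros q)
  have "inj_on (\<lambda>x. x - q x) U"
  proof (rule inj_onI)
    fix x y assume "x \<in> U" "y \<in> U" "x - q x = y - q y"
    then have "x - y = q (x - y)" by (simp add: clin_diff[OF q(1)] algebra_simps)
    then have "x - y \<in> U \<inter> W" using q(2)[of "x - y"] \<open>x \<in> U\<close> \<open>y \<in> U\<close> cvs.subspace_diff[OF assms(1)] by auto
    then show "x = y" using assms(3) by auto
  qed
  then obtain g where g: "range g \<subseteq> U" "clin g" "\<forall>v\<in>U. g (v - q v) = v"
    using cvp.linear_exists_left_inverse_on[OF l assms(1)] by blast
  show ?thesis
  proof (rule that[of "\<lambda>x. g (x - q x)"])
    show "clin (\<lambda>x. g (x - q x))" by (rule clin_compose[OF g(2) l])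
    show "g (x - q x) = 0" if "x \<in> W" for x using q(3)[OF that] clin_0[OF g(2)] by simp
  qed (use g in auto)
qed

text \<open>Complete a nonzero kernel vector to a basis of \<open>R\<close>. The images of the other
  basis vectors already span \<open>R\<close>, one vector too few for its dimension.\<close>

lemma surj_on_imp_inj_on:
  assumes "fds R" "clin f" "f ` R = R" "x \<in> R" "f x = 0"
  shows "x = 0"
proof (rule ccontr)
  assume "x \<noteq> 0"
  then obtain B where B: "is_basis R B" "{x} \<subseteq> B"
    using basis_extend[OF assms(1), of "{x}"] assms(4) by auto
  then have fin: "finite B" by (simp add: is_basis_def)
  have "R = cvs.span (f ` B)" using cvp.linear_span_image[OF assms(2), of B] B assms(3) by (simp add: is_basis_def)
  also have "f ` B = insert 0 (f ` (B - {x}))" using B(2) assms(5) by auto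
  finally have "R \<subseteq> cvs.span (f ` (B - {x}))" using cvs.span_insert_0 by blast
  then have "cvs.dim R \<le> card (f ` (B - {x}))" by (rule cvs.dim_le_card) (simp add: fin)
  also have "\<dots> \<le> card (B - {x})" using fin by (simp add: card_image_le)
  also have "\<dots> < card B" using fin B(2) by (meson card_Diff1_less insert_subset)
  finally show False using is_basis_dim[OF B(1)] by simp
qed

lemma dim_image_inj_on:
  assumes "fds R" "clin f" "\<And>x. x \<in> R \<Longrightarrow> f x = 0 \<Longrightarrow> x = 0"
  shows "cvs.dim (f ` R) = cvs.dim R"
proof -
  obtain B where B: "is_basis R B" using basis_ex[OF assms(1)] .
  have inj: "inj_on f R"
  proof (rule inj_onI)
    fix x y assume "x \<in> R" "y \<in> R" "f x = f y"
    then show "x = y" using assms(3)[of "x - y"] cvs.subspace_diff[OF fds_subspace[OF assms(1)]]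
      by (simp add: clin_diff[OF assms(2)])
  qed
  have "cvs.independent (f ` B)"
    using cvp.linear_independent_injective_image[OF assms(2), of B] B inj by (auto simp: is_basis_def)
  moreover have "cvs.span (f ` B) = f ` R" using cvp.linear_span_image[OF assms(2), of B] B by (simp add: is_basis_def)
  ultimately have "is_basis (f ` R) (f ` B)" using B by (simp add: is_basis_def)
  then have "cvs.dim (f ` R) = card (f ` B)" by (rule is_basis_dim)
  also have "\<dots> = card B" using inj B cvs.span_superset[of B] by (intro card_image) (auto simp: is_basis_def inj_on_def)
  finally show ?thesis using is_basis_dim[OF B] by simp
qed

subsection \<open>The trace of an endomorphism of a finite-dimensional subspace\<close>

text \<open>The basis is an arbitrary choice; \<open>ctr_basis\<close> shows that it does not matter
  for linear maps that preserve \<open>W\<close>.\<close>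

definition ctr :: "'a::cvs set \<Rightarrow> ('a \<Rightarrow> 'a) \<Rightarrow> complex" where
  "ctr W f = (let B = SOME B. is_basis W B in \<Sum>b\<in>B. cvs.representation B (f b) b)"

lemma clin_rep: assumes "is_basis W B" "\<And>x. x \<in> A \<Longrightarrow> g x \<in> W"
  shows "cvs.representation B (\<Sum>x\<in>A. u x *\<^sub>c g x) b = (\<Sum>x\<in>A. u x * cvs.representation B (g x) b)"
proof -
  have i: "cvs.independent B" and s: "\<And>x. x \<in> A \<Longrightarrow> g x \<in> cvs.span B" using assms by (auto simp: is_basis_def)
  have "cvs.representation B (\<Sum>x\<in>A. u x *\<^sub>c g x) b = (\<Sum>x\<in>A. cvs.representation B (u x *\<^sub>c g x) b)"
    using cvs.representation_sum[OF i, of A "\<lambda>x. u x *\<^sub>c g x"] s by (simp add: cvs.span_scale)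
  also have "\<dots> = (\<Sum>x\<in>A. u x * cvs.representation B (g x) b)"
    by (rule sum.cong) (auto simp: cvs.representation_scale[OF i s])
  finally show ?thesis .
qed

lemma rep_expand:
  assumes "is_basis W B" "is_basis W C" "clin f" "\<And>w. w \<in> W \<Longrightarrow> f w \<in> W" "w \<in> W"
  shows "cvs.representation B (f w) b = (\<Sum>c\<in>C. cvs.representation C w c * cvs.representation B (f c) b)"
proof -
  have "f w = f (\<Sum>c\<in>C. cvs.representation C w c *\<^sub>c c)" using rep_sum[OF assms(2,5)] by simp
  also have "\<dots> = (\<Sum>c\<in>C. cvs.representation C w c *\<^sub>c f c)" by (simp add: clin_simps assms)
  finally show ?thesis using clin_rep[OF assms(1), of C f] assms(4) sub_basis[OF assms(2)] by simp
qed

text \<open>Expanding through both bases writes the trace as a double sum over \<open>C\<close> and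
  \<open>B\<close>; exchanging the two sums turns one diagonal sum into the other.\<close>

lemma ctr_basis:
  assumes B: "is_basis W B" and f: "clin f" "\<And>w. w \<in> W \<Longrightarrow> f w \<in> W"
  shows "ctr W f = (\<Sum>b\<in>B. cvs.representation B (f b) b)"
proof -
  define C where "C = (SOME B. is_basis W B)"
  have C: "is_basis W C" unfolding C_def using B by (rule someI)
  have "ctr W f = (\<Sum>c\<in>C. cvs.representation C (f c) c)" by (simp add: ctr_def C_def Let_def)
  also have "\<dots> = (\<Sum>c\<in>C. \<Sum>b\<in>B. cvs.representation B c b * cvs.representation C (f b) c)"
    by (rule sum.cong[OF refl], rule rep_expand[OF C B f sub_basis[OF C]])
  also have "\<dots> = (\<Sum>b\<in>B. \<Sum>c\<in>C. cvs.representation C (f b) c * cvs.representation B c b)"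
    by (subst sum.swap) (simp add: mult.commute)
  also have "\<dots> = (\<Sum>b\<in>B. cvs.representation B (f b) b)"
    by (rule sum.cong[OF refl], rule rep_expand[OF B C clin_id, symmetric]) (use f sub_basis[OF B] in auto)
  finally show ?thesis .
qed

lemma ctr_comp:
  assumes W: "fds W" and f: "clin f" "\<And>w. w \<in> W \<Longrightarrow> f w \<in> W" and g: "clin g" "\<And>w. w \<in> W \<Longrightarrow> g w \<in> W"
  shows "ctr W (\<lambda>x. f (g x)) = ctr W (\<lambda>x. g (f x))"
proof -
  obtain B where B: "is_basis W B" using basis_ex[OF W] .
  have "ctr W (\<lambda>x. f (g x)) = (\<Sum>b\<in>B. cvs.representation B (f (g b)) b)"
    by (rule ctr_basis[OF B clin_compose[OF f(1) g(1)]]) (use f g in auto)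
  also have "\<dots> = (\<Sum>b\<in>B. \<Sum>c\<in>B. cvs.representation B (g b) c * cvs.representation B (f c) b)"
    by (rule sum.cong[OF refl], rule rep_expand[OF B B f]) (use g sub_basis[OF B] in auto)
  also have "\<dots> = (\<Sum>c\<in>B. \<Sum>b\<in>B. cvs.representation B (f c) b * cvs.representation B (g b) c)"
    by (subst sum.swap) (simp add: mult.commute)
  also have "\<dots> = (\<Sum>c\<in>B. cvs.representation B (g (f c)) c)"
    by (rule sum.cong[OF refl], rule rep_expand[OF B B g, symmetric]) (use f sub_basis[OF B] in auto)
  also have "\<dots> = ctr W (\<lambda>x. g (f x))"
    by (rule ctr_basis[OF B clin_compose[OF g(1) f(1)], symmetric]) (use f g in auto)
  finally show ?thesis .
qed

lemma ctr_cong: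
  assumes W: "fds W" and "\<And>w. w \<in> W \<Longrightarrow> f w = g w"
  shows "ctr W f = ctr W g"
proof -
  define B where "B = (SOME B. is_basis W B)"
  have "is_basis W B" unfolding B_def using basis_ex[OF W] by (metis someI_ex)
  then have "f b = g b" if "b \<in> B" for b using sub_basis that assms(2) by blast
  then show ?thesis unfolding ctr_def B_def[symmetric] Let_def
    by (intro sum.cong) simp_all
qed

lemma ctr_add:
  assumes W: "fds W" and f: "clin f" "\<And>w. w \<in> W \<Longrightarrow> f w \<in> W" and g: "clin g" "\<And>w. w \<in> W \<Longrightarrow> g w \<in> W"
  shows "ctr W (\<lambda>x. f x + g x) = ctr W f + ctr W g"
proof -
  obtain B where B: "is_basis W B" using basis_ex[OF W] .
  have "cvs.subspace W" using W by (simp add: fds_def)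
  have i: "cvs.independent B" "cvs.span B = W" using B by (auto simp: is_basis_def)
  have "ctr W (\<lambda>x. f x + g x) = (\<Sum>b\<in>B. cvs.representation B (f b + g b) b)"
    by (rule ctr_basis[OF B clin_plus[OF f(1) g(1)]]) (use f g cvs.subspace_add[OF \<open>cvs.subspace W\<close>] in auto)
  also have "\<dots> = (\<Sum>b\<in>B. cvs.representation B (f b) b + cvs.representation B (g b) b)"
    by (rule sum.cong) (use f g sub_basis[OF B] cvs.representation_add[OF i(1)] i(2) in auto)
  finally show ?thesis using ctr_basis[OF B f] ctr_basis[OF B g] by (simp add: sum.distrib)
qed

lemma ctr_csc:
  assumes W: "fds W" and f: "clin f" "\<And>w. w \<in> W \<Longrightarrow> f w \<in> W"
  shows "ctr W (\<lambda>x. c *\<^sub>c f x) = c * ctr W f"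
proof -
  obtain B where B: "is_basis W B" using basis_ex[OF W] .
  have "cvs.subspace W" using W by (simp add: fds_def)
  have i: "cvs.independent B" "cvs.span B = W" using B by (auto simp: is_basis_def)
  have "ctr W (\<lambda>x. c *\<^sub>c f x) = (\<Sum>b\<in>B. cvs.representation B (c *\<^sub>c f b) b)"
    by (rule ctr_basis[OF B clin_csc[OF f(1)]]) (use f cvs.subspace_scale[OF \<open>cvs.subspace W\<close>] in auto)
  also have "\<dots> = (\<Sum>b\<in>B. c * cvs.representation B (f b) b)"
    by (rule sum.cong) (use f sub_basis[OF B] cvs.representation_scale[OF i(1)] i(2) in auto)
  finally show ?thesis using ctr_basis[OF B f] by (simp add: sum_distrib_left)
qed

lemma ctr_diff:
  assumes W: "fds W" and f: "clin f" "\<And>w. w \<in> W \<Longrightarrow> f w \<in> W" and g: "clin g" "\<And>w. w \<in> W \<Longrightarrow> g w \<in> W"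
  shows "ctr W (\<lambda>x. f x - g x) = ctr W f - ctr W g"
proof -
  have "ctr W (\<lambda>x. f x + (-1) *\<^sub>c g x) = ctr W f + ctr W (\<lambda>x. (-1) *\<^sub>c g x)"
    by (rule ctr_add[OF W f clin_csc[OF g(1)]]) (use g(2) cvs.subspace_scale[OF fds_subspace[OF W]] in blast)+
  then show ?thesis using ctr_csc[OF W g, of "-1"] by simp
qed

lemma ctr_sum:
  assumes W: "fds W" and f: "\<And>i. i \<in> A \<Longrightarrow> clin (f i)" "\<And>i w. i \<in> A \<Longrightarrow> w \<in> W \<Longrightarrow> f i w \<in> W"
  shows "ctr W (\<lambda>x. \<Sum>i\<in>A. f i x) = (\<Sum>i\<in>A. ctr W (f i))"
  using f
proof (induction A rule: infinite_finite_induct)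
  case (insert a A)
  have "ctr W (\<lambda>x. \<Sum>i\<in>insert a A. f i x) = ctr W (\<lambda>x. f a x + (\<Sum>i\<in>A. f i x))"
    using insert by simp
  also have "\<dots> = ctr W (f a) + ctr W (\<lambda>x. \<Sum>i\<in>A. f i x)"
    by (rule ctr_add[OF W _ _ clin_sum_fun]) (use insert in \<open>auto intro!: cvs.subspace_sum[OF fds_subspace[OF W]]\<close>)
  finally show ?case using insert by simp
qed (use ctr_csc[OF W clin_id, of 0] in \<open>auto\<close>)

lemma ctr_ident: assumes "fds W" shows "ctr W (\<lambda>x. x) = of_nat (cvs.dim W)"
proof -
  obtain B where B: "is_basis W B" using basis_ex[OF assms] .
  then have "ctr W (\<lambda>x. x) = (\<Sum>b\<in>B. 1)"
    using ctr_basis[OF B clin_id] cvs.representation_basis[of B] by (simp add: is_basis_def)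
  then show ?thesis using is_basis_dim[OF B] by simp
qed

text \<open>In a basis of \<open>W\<close> that extends one of \<open>U\<close>, images have
  coordinates only along the basis of \<open>U\<close>, so the remaining diagonal entries
  vanish.\<close>

lemma ctr_range:
  assumes W: "fds W" and f: "clin f" "\<And>w. w \<in> W \<Longrightarrow> f w \<in> U" and U: "cvs.subspace U" "U \<subseteq> W"
  shows "ctr W f = ctr U f"
proof -
  have fU: "fds U" using fds_mono[OF W U] .
  obtain C where C: "is_basis U C" using basis_ex[OF fU] .
  then have ic: "cvs.independent C" "cvs.span C = U" "finite C" by (auto simp: is_basis_def)
  obtain B where B: "is_basis W B" "C \<subseteq> B"
    using basis_extend[OF W, of C] U(2) ic cvs.span_superset[of C] by blast
  then have ib: "cvs.independent B" "finite B" by (auto simp: is_basis_def)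
  have r: "cvs.representation B (f b) = cvs.representation C (f b)" if "b \<in> B" for b
    using cvs.representation_extend[OF ib(1), of "f b" C] B(2) ic f(2) sub_basis[OF B(1) that] by auto
  have "ctr W f = (\<Sum>b\<in>B. cvs.representation C (f b) b)"
    using ctr_basis[OF B(1) f(1)] f(2) U r by (simp add: subset_iff)
  also have "\<dots> = (\<Sum>b\<in>C. cvs.representation C (f b) b)"
    by (rule sum.mono_neutral_right) (use ib B cvs.representation_ne_zero in auto)
  also have "\<dots> = ctr U f" by (rule ctr_basis[OF C f(1), symmetric]) (use f U in auto)
  finally show ?thesis .
qed

lemma ctr_nilpotent:
  assumes "fds W" "clin f" "\<And>w. w \<in> W \<Longrightarrow> f w \<in> W" "\<And>w. w \<in> W \<Longrightarrow> \<exists>n. (f ^^ n) w = 0"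
  shows "ctr W f = 0"
  using assms(1,3,4)
proof (induction "cvs.dim W" arbitrary: W rule: less_induct)
  case less
  have s: "cvs.subspace (f ` W)" by (rule subspace_image[OF assms(2) fds_subspace[OF less(2)]])
  have "f ` W \<subseteq> W" using less(3) by auto
  show ?case
  proof (cases "f ` W = W")
    case True
    have inj: "x = 0" if "x \<in> W" "f x = 0" for x using surj_on_imp_inj_on[OF less(2) assms(2) True that] .
    have "x = 0" if "x \<in> W" "(f ^^ n) x = 0" for x n
      using that by (induction n arbitrary: x) (auto simp: funpow_swap1 inj less(3))
    then have "W \<subseteq> {0}" using less(4) by blast
    then have "ctr W f = ctr W (\<lambda>x. 0 *\<^sub>c x)" by (intro ctr_cong[OF less(2)]) (auto simp: clin_0[OF assms(2)])
    then show ?thesis using ctr_csc[OF less(2) clin_id, of 0] by simp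
  next
    case False
    have "ctr W f = ctr (f ` W) f" by (rule ctr_range[OF less(2) assms(2) _ s]) (use less(3) in auto)
    also have "\<dots> = 0"
      using less.hyps[OF fds_dim_less[OF less(2) s \<open>f ` W \<subseteq> W\<close> False] fds_mono[OF less(2) s \<open>f ` W \<subseteq> W\<close>]] less(3,4)
      by blast
    finally show ?thesis .
  qed
qed

subsection \<open>Fitting and generalized eigenspace decompositions\<close>

lemma funpow_zero_mono:
  fixes f :: "'a::cvs \<Rightarrow> 'a"
  assumes "clin f" "(f ^^ n) w = 0" "n \<le> m" shows "(f ^^ m) w = 0"
proof -
  have "(f ^^ (m - n)) ((f ^^ n) w) = 0" using assms clin_0[OF clin_funpow[OF assms(1)]] by simp
  then show ?thesis using assms(3) by (simp flip: funpow_add[THEN fun_cong, unfolded comp_def])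
qed

lemma funpow_closed: fixes f :: "'a \<Rightarrow> 'a" shows "(\<And>w. w \<in> W \<Longrightarrow> f w \<in> W) \<Longrightarrow> w \<in> W \<Longrightarrow> (f ^^ n) w \<in> W"
  by (induction n) auto

lemma funpow_commute:
  fixes f g :: "'a \<Rightarrow> 'a"
  assumes "\<And>w. w \<in> W \<Longrightarrow> f w \<in> W" "\<And>w. w \<in> W \<Longrightarrow> g (f w) = f (g w)" "w \<in> W"
  shows "g ((f ^^ n) w) = (f ^^ n) (g w)"
  using assms(3)
proof (induction n)
  case (Suc n)
  have "g ((f ^^ Suc n) w) = f (g ((f ^^ n) w))" using assms(2) funpow_closed[of W f, OF assms(1) Suc(2)] by simp
  then show ?case using Suc by simp
qed simp

text \<open>The Fitting null component; the exponent may depend on the vector.\<close>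

definition gker :: "'a::cvs set \<Rightarrow> ('a \<Rightarrow> 'a) \<Rightarrow> 'a set" where
  "gker W f = {w \<in> W. \<exists>n. (f ^^ n) w = 0}"

lemma subspace_gker: assumes "clin f" "cvs.subspace W" shows "cvs.subspace (gker W f)"
proof (rule cvs.subspaceI)
  show "0 \<in> gker W f" using cvs.subspace_0[OF assms(2)] by (auto simp: gker_def intro: exI[of _ 0])
  fix x y assume "x \<in> gker W f" "y \<in> gker W f"
  then obtain n m where "(f ^^ n) x = 0" "(f ^^ m) y = 0" "x \<in> W" "y \<in> W" by (auto simp: gker_def)
  moreover from this have "(f ^^ (n + m)) x = 0" "(f ^^ (n + m)) y = 0"
    using funpow_zero_mono[OF assms(1)] by (metis le_add1 le_add2)+
  ultimately show "x + y \<in> gker W f" using cvs.subspace_add[OF assms(2)]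
    clin_add[OF clin_funpow[OF assms(1)]] by (auto simp: gker_def intro!: exI[of _ "n + m"])
next
  fix c x assume "x \<in> gker W f"
  then show "c *\<^sub>c x \<in> gker W f" using cvs.subspace_scale[OF assms(2)]
    clin_scale[OF clin_funpow[OF assms(1)]] by (auto simp: gker_def)
qed

lemma gker_commute:
  assumes "clin g" "\<And>w. w \<in> W \<Longrightarrow> f w \<in> W" "\<And>w. w \<in> W \<Longrightarrow> g w \<in> W" "\<And>w. w \<in> W \<Longrightarrow> g (f w) = f (g w)"
    "w \<in> gker W f"
  shows "g w \<in> gker W f"
proof -
  obtain n where n: "(f ^^ n) w = 0" "w \<in> W" using assms(5) by (auto simp: gker_def)
  have "(f ^^ n) (g w) = g ((f ^^ n) w)" using funpow_commute[of W f g, OF assms(2,4) n(2)] by simp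
  then show ?thesis using n assms(3) clin_0[OF assms(1)] by (auto simp: gker_def)
qed

text \<open>For \<open>N\<close> with an image of least dimension, \<open>f\<close> maps
  \<open>R\<close> onto itself and is therefore injective there, so no power kills a nonzero element
  of \<open>R\<close>. Since \<open>(f ^^ N) w\<close> is also \<open>(f ^^ N) r\<close> for some
  \<open>r\<close> in \<open>R\<close>, the difference \<open>w - r\<close> lies in the null
  component. \<open>R\<close> is given as a concrete image so that operators commuting with
  \<open>f\<close> are seen to preserve it.\<close>

lemma fitting:
  assumes W: "fds W" and f: "clin f" and fW: "\<forall>w\<in>W. f w \<in> W"
  shows "\<exists>N R. R = (f ^^ N) ` W \<and> cvs.subspace R \<and> R \<subseteq> W \<and> f ` R = R \<and> gker W f \<inter> R = {0} \<and>
    (\<forall>w\<in>W. \<exists>k\<in>gker W f. \<exists>r\<in>R. w = k + r)"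
proof -
  have f: "clin f" "\<And>w. w \<in> W \<Longrightarrow> f w \<in> W" using f fW by simp_all
  have sW: "cvs.subspace W" using W by (simp add: fds_def)
  obtain N where N: "\<And>n. cvs.dim ((f ^^ N) ` W) \<le> cvs.dim ((f ^^ n) ` W)"
    using ex_has_least_nat[of "\<lambda>_. True" _ "\<lambda>n. cvs.dim ((f ^^ n) ` W)"] by auto
  define R where "R = (f ^^ N) ` W"
  have sR: "cvs.subspace R" unfolding R_def by (rule subspace_image[OF clin_funpow[OF f(1)] sW])
  have RW: "R \<subseteq> W" unfolding R_def using funpow_closed[of W f, OF f(2)] by auto
  have fR: "fds R" by (rule fds_mono[OF W sR RW])
  have sub: "f ` R \<subseteq> R" unfolding R_def using f(2) by (auto simp: funpow_swap1)
  have "f ` R = (f ^^ Suc N) ` W" by (auto simp: R_def)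
  then have fRR: "f ` R = R"
    using fds_dim_eq[OF fR subspace_image[OF f(1) sR] sub] N[of "Suc N"] by (simp add: R_def)
  have inj: "x = 0" if "x \<in> R" "(f ^^ n) x = 0" for x n
    using that by (induction n arbitrary: x)
      (use sub in \<open>auto simp: funpow_swap1 intro: surj_on_imp_inj_on[OF fR f(1) fRR]\<close>)
  have pow: "(f ^^ n) ` R = R" for n by (induction n) (simp_all only: funpow.simps image_id id_def image_ident image_comp[symmetric] fRR)
  show ?thesis
  proof (intro exI[of _ N] exI[of _ R] conjI ballI)
    show "gker W f \<inter> R = {0}" using inj cvs.subspace_0[OF sR] cvs.subspace_0[OF subspace_gker[OF f(1) sW]]
      by (auto simp: gker_def)
    fix w assume w: "w \<in> W"
    have "(f ^^ N) w \<in> (f ^^ N) ` R" using w pow[of N] by (simp add: R_def)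
    then obtain r where r: "r \<in> R" "(f ^^ N) w = (f ^^ N) r" by auto
    then have "w - r \<in> gker W f" using w RW cvs.subspace_diff[OF sW]
      by (auto simp: gker_def clin_diff[OF clin_funpow[OF f(1)]] intro!: exI[of _ N])
    then show "\<exists>k\<in>gker W f. \<exists>r\<in>R. w = k + r" using r by (intro bexI[of _ "w - r"] bexI[of _ r]) auto
  qed (use sR RW fRR R_def in auto)
qed

definition shift :: "('a::cvs \<Rightarrow> 'a) \<Rightarrow> complex \<Rightarrow> 'a \<Rightarrow> 'a" where
  "shift f l = (\<lambda>x. f x - l *\<^sub>c x)"

lemma clin_shift [clin_intros]: "clin f \<Longrightarrow> clin (shift f l)"
  unfolding shift_def by (intro clin_intros)

lemma shift_closed: "cvs.subspace W \<Longrightarrow> (\<And>w. w \<in> W \<Longrightarrow> f w \<in> W) \<Longrightarrow> w \<in> W \<Longrightarrow> shift f l w \<in> W"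
  by (simp add: shift_def cvs.subspace_diff cvs.subspace_scale)

lemma shift_commute: "clin g \<Longrightarrow> g (f w) = f (g w) \<Longrightarrow> g (shift f l w) = shift f l (g w)"
  by (simp add: shift_def clin_simps)

text \<open>The generalized eigenspace. It is defined for every complex \<open>l\<close>, eigenvalue
  or not, so that unions may range over all of them.\<close>

definition gsp :: "'a::cvs set \<Rightarrow> ('a \<Rightarrow> 'a) \<Rightarrow> complex \<Rightarrow> 'a set" where
  "gsp W f l = gker W (shift f l)"

lemma subspace_gsp: "clin f \<Longrightarrow> cvs.subspace W \<Longrightarrow> cvs.subspace (gsp W f l)"
  unfolding gsp_def by (intro subspace_gker clin_shift)

lemma gsp_subset: "gsp W f l \<subseteq> W" by (auto simp: gsp_def gker_def)

lemma gsp_mono: "R \<subseteq> W \<Longrightarrow> gsp R f l \<subseteq> gsp W f l" by (auto simp: gsp_def gker_def)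

lemma gsp_Int: "R \<subseteq> W \<Longrightarrow> v \<in> gsp W f l \<Longrightarrow> v \<in> R \<Longrightarrow> v \<in> gsp R f l" by (auto simp: gsp_def gker_def)

lemma gsp_commute:
  assumes "clin g" "cvs.subspace W" "\<And>w. w \<in> W \<Longrightarrow> f w \<in> W" "\<And>w. w \<in> W \<Longrightarrow> g w \<in> W"
    "\<And>w. w \<in> W \<Longrightarrow> g (f w) = f (g w)" "w \<in> gsp W f l"
  shows "g w \<in> gsp W f l"
proof -
  have "g (shift f l w) = shift f l (g w)" if "w \<in> W" for w
    by (rule shift_commute[OF assms(1)]) (rule assms(5)[OF that])
  moreover have "shift f l w \<in> W" if "w \<in> W" for w
    by (rule shift_closed[OF assms(2) _ that]) (rule assms(3))
  ultimately show ?thesis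
    using gker_commute[of g W "shift f l" w] assms(1,4,6) unfolding gsp_def by blast
qed

text \<open>The last nonzero iterate \<open>y\<close> of \<open>x\<close> under
  \<open>shift f l\<close> is an eigenvector for \<open>l\<close>, so \<open>shift f m\<close>
  multiplies it by \<open>l - m\<close> and no power can kill it. But the two shifts commute, so a
  power that kills \<open>x\<close> also kills \<open>y\<close>.\<close>

lemma gsp_disjoint:
  assumes f: "clin f" and "l \<noteq> m" "x \<in> gsp W f l" "x \<in> gsp W f m"
  shows "x = 0"
proof (rule ccontr)
  assume "x \<noteq> 0"
  let ?g = "shift f l" and ?h = "shift f m"
  obtain n k where n: "(?g ^^ n) x = 0" and k: "(?h ^^ k) x = 0" using assms by (auto simp: gsp_def gker_def)
  define N where "N = (LEAST n. (?g ^^ n) x = 0)"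
  have N: "(?g ^^ N) x = 0" unfolding N_def using n by (rule LeastI)
  then obtain M where M: "N = Suc M" using \<open>x \<noteq> 0\<close> by (cases N) auto
  define y where "y = (?g ^^ M) x"
  have "y \<noteq> 0" using not_less_Least[of M "\<lambda>n. (?g ^^ n) x = 0"] M by (auto simp: y_def N_def)
  have "?g y = 0" using N M by (simp add: y_def)
  then have hy: "?h y = (l - m) *\<^sub>c y" by (simp add: shift_def cvs.scale_left_diff_distrib)
  have "(?h ^^ j) y = ((l - m) ^ j) *\<^sub>c y" for j
  proof (induction j)
    case (Suc j)
    then show ?case by (simp add: clin_scale[OF clin_shift[OF f]] hy csc_csc mult.commute)
  qed (simp add: csc_one)
  moreover have "(?h ^^ k) y = (?g ^^ M) ((?h ^^ k) x)" unfolding y_def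
  proof (rule sym, rule funpow_commute[of UNIV])
    have "?h (?g w) = ?g (?h w)" for w
      by (simp add: shift_def clin_simps[OF f] algebra_simps cvs.scale_right_diff_distrib csc_csc)
    then have "?h ((?g ^^ M) w) = (?g ^^ M) (?h w)" for w
      using funpow_commute[of UNIV ?g ?h w M] by simp
    then show "(?g ^^ M) (?h w) = ?h ((?g ^^ M) w)" for w by simp
  qed auto
  ultimately show False using k \<open>y \<noteq> 0\<close> \<open>l \<noteq> m\<close> clin_0[OF clin_funpow[OF clin_shift[OF f]]] by simp
qed

section \<open>Polynomials in an operator and existence of eigenvectors\<close>

definition evalp :: "complex poly \<Rightarrow> ('a::cvs \<Rightarrow> 'a) \<Rightarrow> 'a \<Rightarrow> 'a" where
  "evalp p f w = (\<Sum>i\<le>degree p. coeff p i *\<^sub>c (f ^^ i) w)"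

lemma evalp_bound: "degree p \<le> n \<Longrightarrow> evalp p f w = (\<Sum>i\<le>n. coeff p i *\<^sub>c (f ^^ i) w)"
  unfolding evalp_def by (rule sum.mono_neutral_left) (auto simp: coeff_eq_0)

lemma evalp_linear_factor:
  assumes f: "clin f" shows "evalp ([:-a, 1:] * q) f w = shift f a (evalp q f w)"
proof -
  have "evalp ([:-a, 1:] * q) f w = (\<Sum>i\<le>Suc (degree q). coeff ([:-a, 1:] * q) i *\<^sub>c (f ^^ i) w)"
    by (rule evalp_bound, rule order_trans[OF degree_mult_le]) simp
  also have "\<dots> = (\<Sum>i\<le>Suc (degree q). (- a * coeff q i) *\<^sub>c (f ^^ i) w)
      + (\<Sum>i\<le>Suc (degree q). coeff (pCons 0 q) i *\<^sub>c (f ^^ i) w)"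
    unfolding sum.distrib[symmetric] by (rule sum.cong) (auto simp: csc_add_left[symmetric] coeff_pCons algebra_simps split: nat.split)
  also have "(\<Sum>i\<le>Suc (degree q). (- a * coeff q i) *\<^sub>c (f ^^ i) w) = - (a *\<^sub>c evalp q f w)"
  proof -
    have e: "evalp q f w = (\<Sum>i\<le>Suc (degree q). coeff q i *\<^sub>c (f ^^ i) w)" by (rule evalp_bound) simp
    show ?thesis unfolding e cvs.scale_sum_right sum_negf[symmetric] csc_csc
      by (rule sum.cong) (simp_all add: cvs.scale_minus_left)
  qed
  also have "(\<Sum>i\<le>Suc (degree q). coeff (pCons 0 q) i *\<^sub>c (f ^^ i) w) = f (evalp q f w)"
    unfolding sum.atMost_Suc_shift evalp_def by (simp add: clin_simps[OF f])
  finally show ?thesis by (simp add: shift_def)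
qed

text \<open>Linear factors are removed one at a time. Either the cofactor \<open>q\<close> still
  annihilates \<open>w\<close>, or \<open>evalp q f w\<close> is a nonzero vector killed by
  \<open>f - a\<close>.\<close>

lemma eigenvector_of_poly:
  assumes f: "clin f" "\<And>w. w \<in> W \<Longrightarrow> f w \<in> W" and W: "cvs.subspace W"
  shows "p \<noteq> 0 \<Longrightarrow> w \<in> W \<Longrightarrow> w \<noteq> 0 \<Longrightarrow> evalp p f w = 0 \<Longrightarrow> \<exists>l. \<exists>u\<in>W. u \<noteq> 0 \<and> f u = l *\<^sub>c u"
proof (induction "degree p" arbitrary: p rule: less_induct)
  case less
  show ?case
  proof (cases "degree p = 0")
    case True
    then obtain c where "p = [:c:]" by (rule degree_eq_zeroE)
    then have "c *\<^sub>c w = 0" "c \<noteq> 0" using less(2,5) by (auto simp: evalp_def)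
    then show ?thesis using less(4) by simp
  next
    case False
    then obtain a where "poly p a = 0" using fundamental_theorem_of_algebra[of p] constant_degree[of p] by auto
    then obtain q where q: "p = [:-a, 1:] * q" by (auto simp: poly_eq_0_iff_dvd dvd_def)
    then have "q \<noteq> 0" using less(2) by auto
    then have "degree q < degree p" unfolding q by (subst degree_mult_eq) auto
    have e: "shift f a (evalp q f w) = 0" using less(5) evalp_linear_factor[OF f(1)] q by simp
    show ?thesis
    proof (cases "evalp q f w = 0")
      case True then show ?thesis using less.hyps[OF \<open>degree q < degree p\<close> \<open>q \<noteq> 0\<close> less(3,4)] by simp
    next
      case False
      moreover have "evalp q f w \<in> W" unfolding evalp_def
        by (intro cvs.subspace_sum[OF W] cvs.subspace_scale[OF W] funpow_closed[of W f, OF f(2) less(3)])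
      ultimately show ?thesis using e by (auto simp: shift_def)
    qed
  qed
qed

text \<open>The iterates of \<open>w\<close> up to exponent \<open>card B\<close> are one more than
  \<open>B\<close> can keep independent, so some nonzero polynomial in \<open>f\<close> annihilates
  \<open>w\<close>.\<close>

lemma eigenvector_ex:
  assumes W: "fds W" "W \<noteq> {0}" and f: "clin f" "\<And>w. w \<in> W \<Longrightarrow> f w \<in> W"
  obtains l u where "u \<in> W" "u \<noteq> 0" "f u = l *\<^sub>c u"
proof -
  have sW: "cvs.subspace W" using W by (simp add: fds_def)
  obtain w where w: "w \<in> W" "w \<noteq> 0" using W(2) cvs.subspace_0[OF sW] by blast
  obtain B where B: "finite B" "W \<subseteq> cvs.span B" using W by (auto simp: fds_def)
  let ?n = "card B"
  have "\<exists>p. p \<noteq> 0 \<and> evalp p f w = 0"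
  \<comment> \<open>Dependence speaks of the set of iterates, which loses repetitions; a repetition
    is treated separately and gives a difference of two monomials.\<close>
  proof (cases "inj_on (\<lambda>i. (f ^^ i) w) {..?n}")
    case True
    have "cvs.dependent ((\<lambda>i. (f ^^ i) w) ` {..?n})"
    proof (rule ccontr)
      assume "\<not> ?thesis"
      then have "card ((\<lambda>i. (f ^^ i) w) ` {..?n}) \<le> card B"
        using cvs.independent_span_bound[OF B(1)] funpow_closed[of W f, OF f(2) w(1)] B(2) by blast
      then show False using card_image[OF True] by simp
    qed
    then obtain u i where u: "(\<Sum>v\<in>(\<lambda>i. (f ^^ i) w) ` {..?n}. u v *\<^sub>c v) = 0" "i \<le> ?n" "u ((f ^^ i) w) \<noteq> 0"
      using cvs.dependent_finite[of "(\<lambda>i. (f ^^ i) w) ` {..?n}"] by auto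
    define p where "p = (\<Sum>i\<le>?n. monom (u ((f ^^ i) w)) i)"
    have c: "coeff p i = (if i \<le> ?n then u ((f ^^ i) w) else 0)" for i
      by (simp add: p_def coeff_sum)
    have "degree p \<le> ?n" by (rule degree_le) (simp add: c)
    then have "evalp p f w = (\<Sum>i\<le>?n. u ((f ^^ i) w) *\<^sub>c (f ^^ i) w)" by (simp add: evalp_bound c)
    also have "\<dots> = 0" using u(1) sum.reindex[OF True, of "\<lambda>v. u v *\<^sub>c v"] by simp
    finally show ?thesis using c[of i] u by (intro exI[of _ p]) auto
  next
    case False
    then obtain i j where ij: "i \<noteq> j" "(f ^^ i) w = (f ^^ j) w" by (auto simp: inj_on_def)
    define p :: "complex poly" where "p = monom 1 i - monom 1 j"
    have "degree p \<le> max i j" unfolding p_def by (rule degree_diff_le_max[THEN order_trans]) (auto simp: degree_monom_eq)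
    then have "evalp p f w = (\<Sum>k\<le>max i j. (coeff (monom 1 i) k *\<^sub>c (f ^^ k) w - coeff (monom 1 j) k *\<^sub>c (f ^^ k) w))"
      by (simp add: evalp_bound p_def cvs.scale_left_diff_distrib)
    also have "\<dots> = (f ^^ i) w - (f ^^ j) w"
      unfolding sum_subtractf by (simp add: if_distrib[of "\<lambda>c. c *\<^sub>c _"] sum.delta csc_one cong: if_cong)
    moreover have "coeff p i \<noteq> 0" using ij by (simp add: p_def)
    ultimately show ?thesis using ij by (intro exI[of _ p]) auto
  qed
  then show ?thesis using eigenvector_of_poly[OF f sW _ w] that by blast
qed

text \<open>One generalized eigenspace is split off per step, with the Fitting complement of
  \<open>f - l\<close> as \<open>R\<close>. The spectrum never has to be listed, and the dimension
  drops because \<open>l\<close> comes with an eigenvector.\<close>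

lemma spectral_induct [consumes 3, case_names zero step]:
  assumes "fds W" "clin f" "\<forall>w\<in>W. f w \<in> W"
    and zero: "P {0}"
    and step: "\<And>W l R. fds W \<Longrightarrow> (\<And>w. w \<in> W \<Longrightarrow> f w \<in> W) \<Longrightarrow> cvs.subspace R \<Longrightarrow> R \<subseteq> W \<Longrightarrow>
      (\<And>w. w \<in> R \<Longrightarrow> f w \<in> R) \<Longrightarrow> gsp W f l \<noteq> {0} \<Longrightarrow> gsp W f l \<inter> R = {0} \<Longrightarrow>
      (\<And>w. w \<in> W \<Longrightarrow> \<exists>k\<in>gsp W f l. \<exists>r\<in>R. w = k + r) \<Longrightarrow> P R \<Longrightarrow> P W"
  shows "P W"
  using assms(1,3)
proof (induction "cvs.dim W" arbitrary: W rule: less_induct)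
  case less
  have sW: "cvs.subspace W" using less by (simp add: fds_def)
  have fW: "f w \<in> W" if "w \<in> W" for w using less(3) that by blast
  show ?case
  proof (cases "W = {0}")
    case True then show ?thesis using zero by simp
  next
    case False
    obtain l u where u: "u \<in> W" "u \<noteq> 0" "f u = l *\<^sub>c u"
      using eigenvector_ex[OF less(2) False assms(2) fW] by blast
    have uk: "u \<in> gsp W f l" using u by (auto simp: gsp_def gker_def shift_def intro!: exI[of _ 1])
    have sh: "\<forall>w\<in>W. shift f l w \<in> W" using shift_closed[OF sW, of f] less(3) by simp
    from fitting[OF less(2) clin_shift[OF assms(2)] sh]
    obtain N R where R: "R = (shift f l ^^ N) ` W" "cvs.subspace R" "R \<subseteq> W" "gker W (shift f l) \<inter> R = {0}"
      and R': "\<forall>w\<in>W. \<exists>k\<in>gker W (shift f l). \<exists>r\<in>R. w = k + r"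
      by (elim exE conjE) (rule that)
    have fR: "f w \<in> R" if wR: "w \<in> R" for w
    proof -
      obtain x where x: "x \<in> W" "w = (shift f l ^^ N) x" using wR unfolding R(1) by blast
      have "f w = (shift f l ^^ N) (f x)" unfolding x(2)
        by (rule funpow_commute[of UNIV]) (auto simp: shift_commute[OF assms(2)])
      then show ?thesis using fW x R(1) by auto
    qed
    have "R \<noteq> W" using uk u R(4) by (auto simp: gsp_def)
    then have "P R" using less.hyps[OF fds_dim_less[OF less(2) R(2,3)] fds_mono[OF less(2) R(2,3)] ballI[OF fR]] by blast
    then show ?thesis using step[OF less(2) fW R(2,3) fR _ R(4)[folded gsp_def] bspec[OF R'[folded gsp_def]]] uk u(2) by blast
  qed
qed

lemma gsp_span:
  assumes "fds W" "clin f" "\<forall>w\<in>W. f w \<in> W"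
  shows "W \<subseteq> cvs.span (\<Union>l. gsp W f l)"
  using assms
proof (induction rule: spectral_induct)
  case zero show ?case by (simp add: cvs.span_zero)
next
  case (step W l R)
  show ?case
  proof
    fix w assume "w \<in> W"
    then obtain k r where kr: "k \<in> gsp W f l" "r \<in> R" "w = k + r" using step(8) by blast
    have "(\<Union>l. gsp R f l) \<subseteq> (\<Union>l. gsp W f l)" using gsp_mono[OF step(4)] by blast
    then have "r \<in> cvs.span (\<Union>l. gsp W f l)" using step(9) kr(2) cvs.span_mono by blast
    moreover have "k \<in> cvs.span (\<Union>l. gsp W f l)" using kr(1) cvs.span_base by blast
    ultimately show "w \<in> cvs.span (\<Union>l. gsp W f l)" using kr(3) cvs.span_add by blast
  qed
qed

text \<open>The complex conjugate of the semisimple part of \<open>f\<close>. Pairing with it detects nilpotency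
  because the trace of the product is the sum of the \<open>\<bar>\<lambda>\<bar>\<^sup>2\<close> over the eigenvalues.\<close>

lemma conjugate_semisimple_part:
  fixes f :: "'a::cvs \<Rightarrow> 'a"
  assumes "fds W" "clin f" "\<forall>w\<in>W. f w \<in> W"
  shows "\<exists>s. clin s \<and> (\<forall>w\<in>W. s w \<in> W) \<and> (\<forall>l. \<forall>v\<in>gsp W f l. s v = cnj l *\<^sub>c v) \<and>
    (\<exists>r\<ge>0. ctr W (\<lambda>x. f (s x)) = complex_of_real r \<and> (r = 0 \<longrightarrow> W \<subseteq> gsp W f 0))"
  using assms
proof (induction rule: spectral_induct)
  case zero
  have fd: "fds {0::'a}" using fds_span[of "{}"] by simp
  have "ctr {0} (\<lambda>x. f 0) = ctr {0::'a} (\<lambda>x. x)"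
    by (rule ctr_cong[OF fd]) (simp add: clin_0[OF assms(2)])
  also have "\<dots> = 0" unfolding ctr_ident[OF fd] using fds_dim_0[OF fd] by simp
  finally have t: "ctr {0} (\<lambda>x. f 0) = 0" .
  have g: "{0} \<subseteq> gsp {0} f 0" by (auto simp: gsp_def gker_def intro: exI[of _ 0])
  have "v = 0" if "v \<in> gsp {0} f l" for v l using that gsp_subset[of "{0}" f l] by blast
  then have "\<forall>l. \<forall>v\<in>gsp {0} f l. (0::'a) = cnj l *\<^sub>c v" by (metis cvs.scale_zero_right)
  then show ?case using g t
    by (intro exI[of _ "\<lambda>x. 0"] conjI exI[of _ 0]) (simp_all add: clin_zero)
next
  case (step W l R)
  let ?K = "gsp W f l"
  have sW: "cvs.subspace W" using step by (simp add: fds_def)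
  note f = assms(2) step(2)
  have sK: "cvs.subspace ?K" by (rule subspace_gsp[OF assms(2) sW])
  have KW: "?K \<subseteq> W" by (rule gsp_subset)
  have fK: "f w \<in> ?K" if "w \<in> ?K" for w using gsp_commute[OF assms(2) sW step(2) step(2) _ that] by simp
  obtain s where s: "clin s" "\<forall>w\<in>R. s w \<in> R" "\<And>l v. v\<in>gsp R f l \<Longrightarrow> s v = cnj l *\<^sub>c v"
    and "\<exists>r\<ge>0. ctr R (\<lambda>x. f (s x)) = complex_of_real r \<and> (r = 0 \<longrightarrow> R \<subseteq> gsp R f 0)"
    using step(9) by blast
  then obtain r where r: "r \<ge> 0" "ctr R (\<lambda>x. f (s x)) = complex_of_real r" "r = 0 \<Longrightarrow> R \<subseteq> gsp R f 0" by blast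
  obtain p where p: "clin p" "\<And>x. p x \<in> ?K" "\<And>x. x \<in> ?K \<Longrightarrow> p x = x" "\<And>x. x \<in> R \<Longrightarrow> p x = 0"
    using projection_along_ex[OF sK step(3)] step(7) by blast
  have pR: "x - p x \<in> R" if x: "x \<in> W" for x
  proof -
    obtain k r where "k \<in> ?K" "r \<in> R" "x = k + r" using step(8)[OF x] by blast
    then show ?thesis using p by (simp add: clin_simps)
  qed
  have pf: "p (f x) = f (p x)" if x: "x \<in> W" for x
  proof -
    have "p (f (x - p x)) = 0" using p(4) step(5) pR[OF x] by blast
    moreover have "p (f (p x)) = f (p x)" using p(3) fK p(2) by blast
    ultimately show ?thesis using p(1) assms(2) by (simp add: clin_simps)
  qed
  have pW: "p x \<in> W" for x using p(2) KW by blast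
  \<comment> \<open>The operator is \<open>cnj l\<close> on the eigenspace split off and the
    operator of the induction hypothesis on the complement \<open>R\<close>.\<close>
  define t where "t = (\<lambda>x. cnj l *\<^sub>c p x + s (x - p x))"
  have t: "clin t" unfolding t_def by (intro clin_intros p clin_compose[OF s(1)])
  have tW: "t w \<in> W" if "w \<in> W" for w unfolding t_def
    using that pW pR s(2) step(4) cvs.subspace_add[OF sW] cvs.subspace_scale[OF sW] by blast
  have tv: "t v = cnj m *\<^sub>c v" if v: "v \<in> gsp W f m" for v m
  proof (cases "m = l")
    case True
    then show ?thesis using v p(3) by (simp add: t_def clin_0[OF s(1)])
  next
    case False
    \<comment> \<open>The projection \<open>p\<close> commutes with \<open>f\<close> on
      \<open>W\<close>, so it preserves the eigenspace for \<open>m\<close> while taking values in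
      the one for \<open>l\<close>; these are disjoint, so \<open>v\<close> lies in
      \<open>R\<close>.\<close>
    have "p v \<in> gsp W f m" by (rule gsp_commute[OF p(1) sW step(2) pW pf v])
    then have "p v = 0" using gsp_disjoint[OF assms(2) _ p(2), of m v] False by metis
    moreover have "v \<in> gsp R f m" using gsp_Int[OF step(4) v] pR[of v] v gsp_subset[of W f m] \<open>p v = 0\<close> by auto
    ultimately show ?thesis using s(3) by (simp add: t_def)
  qed
  have fdK: "fds ?K" by (rule fds_mono[OF step(1) sK KW])
  \<comment> \<open>Only the scalar part contributes to the trace on the eigenspace, since
    \<open>f - l\<close> is nilpotent there.\<close>
  have "ctr ?K f = ctr ?K (\<lambda>x. l *\<^sub>c x + shift f l x)" by (simp add: shift_def)
  also have "\<dots> = l * of_nat (cvs.dim ?K) + ctr ?K (shift f l)"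
    using ctr_add[OF fdK clin_csc[OF clin_id] cvs.subspace_scale[OF sK] clin_shift[OF assms(2)] shift_closed[OF sK fK]]
      ctr_csc[OF fdK clin_id] ctr_ident[OF fdK] by simp
  also have "ctr ?K (shift f l) = 0"
    by (rule ctr_nilpotent[OF fdK clin_shift[OF assms(2)] shift_closed[OF sK fK]]) (auto simp: gsp_def gker_def)
  finally have trK: "ctr ?K f = l * of_nat (cvs.dim ?K)" by simp
  have c1: "clin (\<lambda>x. f (p x))" and c2: "clin (\<lambda>x. f (s (x - p x)))"
    by (intro clin_compose[OF assms(2)] p clin_compose[OF s(1)] clin_intros)+
  have m2: "f (s (w - p w)) \<in> R" if "w \<in> W" for w using that pR s(2) step(5) by blast
  have m1: "f (p w) \<in> W" for w using step(2) pW by blast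
  have "ctr W (\<lambda>x. f (t x)) = ctr W (\<lambda>x. cnj l *\<^sub>c f (p x) + f (s (x - p x)))"
    by (simp add: t_def clin_simps[OF assms(2)])
  also have "\<dots> = cnj l * ctr W (\<lambda>x. f (p x)) + ctr W (\<lambda>x. f (s (x - p x)))"
    using ctr_add[OF step(1) clin_csc[OF c1] cvs.subspace_scale[OF sW m1] c2 subsetD[OF step(4) m2], of "cnj l"]
      ctr_csc[OF step(1) c1 m1, of "cnj l"] by simp
  also have "ctr W (\<lambda>x. f (p x)) = ctr ?K (\<lambda>x. f (p x))"
    by (rule ctr_range[OF step(1) c1 _ sK KW]) (use fK p in blast)
  also have "\<dots> = ctr ?K f" by (rule ctr_cong[OF fdK]) (simp add: p(3))
  also have "ctr W (\<lambda>x. f (s (x - p x))) = ctr R (\<lambda>x. f (s (x - p x)))"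
    by (rule ctr_range[OF step(1) c2 m2 step(3,4)])
  also have "\<dots> = ctr R (\<lambda>x. f (s x))" by (rule ctr_cong[OF fds_mono[OF step(1,3,4)]]) (simp add: p(4))
  also have "cnj l * ctr ?K f + ctr R (\<lambda>x. f (s x)) = complex_of_real ((cmod l)\<^sup>2 * cvs.dim ?K + r)"
  proof -
    have "complex_of_real ((cmod l)\<^sup>2 * cvs.dim ?K + r) = (l * cnj l) * of_nat (cvs.dim ?K) + complex_of_real r"
      unfolding complex_norm_square[symmetric] of_real_add of_real_mult of_real_of_nat_eq ..
    then show "cnj l * ctr ?K f + ctr R (\<lambda>x. f (s x)) = complex_of_real ((cmod l)\<^sup>2 * cvs.dim ?K + r)"
      unfolding trK r(2) by (simp only: mult_ac)
  qed
  finally have tr: "ctr W (\<lambda>x. f (t x)) = complex_of_real ((cmod l)\<^sup>2 * cvs.dim ?K + r)" .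
  \<comment> \<open>Both summands are nonnegative, so both vanish; the eigenspace is not zero, hence
    \<open>l = 0\<close>.\<close>
  have "W \<subseteq> gsp W f 0" if "(cmod l)\<^sup>2 * cvs.dim ?K + r = 0"
  proof -
    have nn: "0 \<le> (cmod l)\<^sup>2 * cvs.dim ?K" by simp
    then have "(cmod l)\<^sup>2 * cvs.dim ?K = 0" "r = 0" using that r(1) by linarith+
    moreover have "cvs.dim ?K \<noteq> 0" using fds_dim_0[OF fdK] step(6) by simp
    ultimately have "l = 0" "R \<subseteq> gsp R f 0" using r(3) by auto
    show "W \<subseteq> gsp W f 0"
    proof
      fix w assume "w \<in> W"
      then obtain k r where kr: "k \<in> ?K" "r \<in> R" "w = k + r" using step(8) by blast
      then have "r \<in> gsp W f 0" using \<open>R \<subseteq> gsp R f 0\<close> gsp_mono[OF step(4)] by blast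
      then show "w \<in> gsp W f 0" using kr \<open>l = 0\<close> cvs.subspace_add[OF sK] by blast
    qed
  qed
  then show ?case using t tW tv tr r(1) by (intro exI[of _ t]) (auto intro!: exI[of _ "(cmod l)\<^sup>2 * cvs.dim ?K + r"])
qed

subsection \<open>Nondegenerate bilinear forms\<close>

definition cbil :: "('a::cvs \<Rightarrow> 'b::cvs \<Rightarrow> 'c::cvs) \<Rightarrow> bool" where
  "cbil B \<longleftrightarrow> (\<forall>x. clin (B x)) \<and> (\<forall>y. clin (\<lambda>x. B x y))"

text \<open>Sending \<open>x\<close> to the values \<open>B x b\<close> on a basis \<open>C\<close>
  of \<open>I\<close> is injective by nondegeneracy. The functions supported on \<open>C\<close>
  form a space of dimension at most \<open>card C\<close>, so every such function is attained, in
  particular the values of \<open>\<phi>\<close>.\<close>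

lemma functional_represented:
  fixes B :: "'a::cvs \<Rightarrow> 'a \<Rightarrow> complex"
  assumes I: "fds I" and B: "\<And>x. x \<in> I \<Longrightarrow> clin (B x)" "\<And>y. y \<in> I \<Longrightarrow> clin (\<lambda>x. B x y)"
    and nd: "\<And>x. x \<in> I \<Longrightarrow> (\<And>y. y \<in> I \<Longrightarrow> B x y = 0) \<Longrightarrow> x = 0" and \<phi>: "clin \<phi>"
  shows "\<exists>x\<in>I. \<forall>y\<in>I. B x y = \<phi> y"
proof -
  obtain C where C: "is_basis I C" using basis_ex[OF I] .
  then have fC: "finite C" and sC: "cvs.span C = I" by (auto simp: is_basis_def)
  define T where "T = (\<lambda>x b. if b \<in> C then B x b else 0)"
  have T: "clin T" by (rule clinI; rule ext) (use sub_basis[OF C] B(2) in \<open>auto simp: T_def clin_add[of "\<lambda>x. B x _"] clin_scale[of "\<lambda>x. B x _"]\<close>)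
  define E where "E = cvs.span ((\<lambda>b c. if c = b then 1 else 0 :: complex) ` C)"
  have fE: "fds E" unfolding E_def by (rule fds_span) (simp add: fC)
  have inE: "g \<in> E" if "\<And>b. b \<notin> C \<Longrightarrow> g b = 0" for g :: "'a \<Rightarrow> complex"
  proof -
    have "g = (\<Sum>b\<in>C. g b *\<^sub>c (\<lambda>c. if c = b then 1 else 0))"
    proof (rule ext)
      fix c
      have "(\<Sum>b\<in>C. g b *\<^sub>c (\<lambda>c. if c = b then 1 else 0 :: complex)) c = (\<Sum>b\<in>C. if c = b then g b else 0)"
        unfolding sum_fun_apply by (rule sum.cong) auto
      also have "\<dots> = g c" using that[of c] fC by simp
      finally show "g c = (\<Sum>b\<in>C. g b *\<^sub>c (\<lambda>c. if c = b then 1 else 0 :: complex)) c" by simp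
    qed
    also have "\<dots> \<in> E" unfolding E_def
      by (intro cvs.span_sum cvs.span_scale cvs.span_base imageI)
    finally show ?thesis .
  qed
  have ext_eq: "B x y = \<psi> y" if "x \<in> I" "clin \<psi>" "\<And>b. b \<in> C \<Longrightarrow> B x b = \<psi> b" "y \<in> I" for x y \<psi>
    by (rule eq_on_span[OF B(1)[OF that(1)] that(2,3), of C]) (use that(4) sC in simp_all)
  have "cvs.dim (T ` I) = cvs.dim I"
  proof (rule dim_image_inj_on[OF I T])
    fix x assume "x \<in> I" "T x = 0"
    then have 0: "B x b = 0" if "b \<in> C" for b using that fun_cong[OF \<open>T x = 0\<close>, of b] unfolding T_def by simp
    show "x = 0" by (rule nd[OF \<open>x \<in> I\<close>], rule ext_eq[OF \<open>x \<in> I\<close> clin_zero 0])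
  qed
  moreover have "cvs.dim E \<le> card C" unfolding E_def
    by (rule order_trans[OF cvs.dim_le_card card_image_le]) (use fC in auto)
  moreover have "T ` I \<subseteq> E" using inE by (auto simp: T_def)
  ultimately have "T ` I = E"
    using fds_dim_eq[OF fE subspace_image[OF T fds_subspace[OF I]]] is_basis_dim[OF C] by simp
  moreover have "(\<lambda>b. if b \<in> C then \<phi> b else 0) \<in> E" by (rule inE) auto
  ultimately obtain x where x: "x \<in> I" "T x = (\<lambda>b. if b \<in> C then \<phi> b else 0)"  by force
  have e: "B x b = \<phi> b" if "b \<in> C" for b using fun_cong[OF x(2), of b] that by (simp add: T_def)
  show ?thesis by (rule bexI[OF _ x(1)], rule ballI, rule ext_eq[OF x(1) \<phi> e])
qed

subsection \<open>Lie algebras and their right modules\<close>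

definition subalg :: "('g::cvs \<Rightarrow> 'g \<Rightarrow> 'g) \<Rightarrow> 'g set \<Rightarrow> 'g set \<Rightarrow> bool" where
  "subalg br H G \<longleftrightarrow> cvs.subspace H \<and> H \<subseteq> G \<and> (\<forall>x\<in>H. \<forall>y\<in>H. br x y \<in> H)"

text \<open>One side suffices by antisymmetry, see \<open>ideal_left\<close>. In this form an ideal
  is the same as a submodule of the adjoint right module.\<close>

definition lie_ideal :: "('g::cvs \<Rightarrow> 'g \<Rightarrow> 'g) \<Rightarrow> 'g set \<Rightarrow> 'g set \<Rightarrow> bool" where
  "lie_ideal br J G \<longleftrightarrow> cvs.subspace J \<and> J \<subseteq> G \<and> (\<forall>x\<in>J. \<forall>y\<in>G. br x y \<in> J)"

text \<open>Bilinearity is required on the whole type, closure and the identities only on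
  \<open>G\<close>. Thus subalgebras keep the same bracket and no linear map ever has to be
  restricted.\<close>

locale liealg =
  fixes G :: "'g::cvs set" and br :: "'g \<Rightarrow> 'g \<Rightarrow> 'g"
  assumes G_fds: "fds G"
    and br_left: "clin (\<lambda>x. br x y)"
    and br_right: "clin (br x)"
    and br_closed: "x \<in> G \<Longrightarrow> y \<in> G \<Longrightarrow> br x y \<in> G"
    and br_self: "x \<in> G \<Longrightarrow> br x x = 0"
    and br_jacobi: "x \<in> G \<Longrightarrow> y \<in> G \<Longrightarrow> z \<in> G \<Longrightarrow> br x (br y z) = br (br x y) z - br (br x z) y"
begin

lemmas G_sub = fds_subspace[OF G_fds]
lemmas br_simps = clin_simps[OF br_left] clin_simps[OF br_right]

lemma br_anti: assumes "x \<in> G" "y \<in> G" shows "br x y = - br y x"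
proof -
  have "br (x + y) (x + y) = 0" using br_self cvs.subspace_add[OF G_sub assms] by blast
  then have "br x x + br x y + (br y x + br y y) = 0" by (simp add: br_simps algebra_simps)
  then show ?thesis using assms br_self by (simp add: eq_neg_iff_add_eq_0)
qed

lemma liealg_subalg:
  assumes "subalg br H G" shows "liealg H br"
proof -
  have H: "cvs.subspace H" "H \<subseteq> G" "\<And>x y. x \<in> H \<Longrightarrow> y \<in> H \<Longrightarrow> br x y \<in> H"
    using assms by (auto simp: subalg_def)
  show ?thesis
    by (rule liealg.intro)
      (rule fds_mono[OF G_fds H(1,2)] br_left br_right H(3) br_self[OF subsetD[OF H(2)]]
        br_jacobi[OF subsetD[OF H(2)] subsetD[OF H(2)] subsetD[OF H(2)]]; assumption?)+
qed

lemma ideal_subalg: "lie_ideal br J G \<Longrightarrow> subalg br J G"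
  unfolding subalg_def lie_ideal_def by blast

lemma ideal_left: "lie_ideal br J G \<Longrightarrow> x \<in> J \<Longrightarrow> y \<in> G \<Longrightarrow> br y x \<in> J"
  using br_anti[of y x] cvs.subspace_neg[of J] unfolding lie_ideal_def by (metis subsetD)

lemma ideal_span_br:
  assumes J: "lie_ideal br J G"
  shows "lie_ideal br (cvs.span {br a b | a b. a \<in> J \<and> b \<in> J}) G"
    and "cvs.span {br a b | a b. a \<in> J \<and> b \<in> J} \<subseteq> J"
proof -
  let ?X = "{br a b | a b. a \<in> J \<and> b \<in> J}"
  have sJ: "cvs.subspace J" and JG: "J \<subseteq> G" and Jc: "\<And>x y. x \<in> J \<Longrightarrow> y \<in> G \<Longrightarrow> br x y \<in> J"
    using J by (auto simp: lie_ideal_def)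
  show sub: "cvs.span ?X \<subseteq> J"
    by (rule cvs.span_minimal[OF _ sJ]) (use Jc JG in blast)
  have "br x y \<in> cvs.span ?X" if y: "y \<in> G" and x: "x \<in> cvs.span ?X" for x y
  proof (rule span_image_subset[OF br_left cvs.subspace_span _ x])
    fix u assume "u \<in> ?X"
    then obtain a b where ab: "u = br a b" "a \<in> J" "b \<in> J" by blast
    moreover from this have "a \<in> G" "b \<in> G" using JG by blast+
    ultimately have "br u y = br a (br b y) + br (br a y) b" using br_jacobi[of a b y] y by simp
    moreover have "br a (br b y) \<in> cvs.span ?X" "br (br a y) b \<in> cvs.span ?X"
      using ab Jc[OF ab(2) y] Jc[OF ab(3) y] cvs.span_base[of _ ?X] by blast+
    ultimately show "br u y \<in> cvs.span ?X" using cvs.span_add by simp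
  qed
  then show "lie_ideal br (cvs.span ?X) G" using sub JG by (auto simp: lie_ideal_def)
qed

end

text \<open>Linearity in the algebra argument is asked only for vectors of \<open>V\<close>. The
  module of maps in \<open>weyl\<close> needs this: there the action on a function \<open>f\<close>
  is linear in the algebra argument because \<open>f\<close> is linear.\<close>

locale liemod = liealg G br for G :: "'g::cvs set" and br +
  fixes V :: "'v::cvs set" and ac :: "'v \<Rightarrow> 'g \<Rightarrow> 'v"
  assumes V_fds: "fds V"
    and ac_left: "clin (\<lambda>v. ac v x)"
    and ac_right: "v \<in> V \<Longrightarrow> clin (ac v)"
    and ac_closed: "v \<in> V \<Longrightarrow> x \<in> G \<Longrightarrow> ac v x \<in> V"
    and ac_br: "v \<in> V \<Longrightarrow> x \<in> G \<Longrightarrow> y \<in> G \<Longrightarrow> ac v (br x y) = ac (ac v x) y - ac (ac v y) x"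
begin

lemmas V_sub = fds_subspace[OF V_fds]
lemmas ac_left_simps = clin_simps[OF ac_left]

lemma liemod_subalg:
  assumes "subalg br H G" shows "liemod H br V ac"
proof -
  have H: "H \<subseteq> G" using assms by (auto simp: subalg_def)
  show ?thesis
    by (intro liemod.intro liealg_subalg[OF assms] liemod_axioms.intro)
      (rule V_fds ac_left ac_right ac_closed[OF _ subsetD[OF H]] ac_br[OF _ subsetD[OF H] subsetD[OF H]]; assumption?)+
qed

lemma liemod_submodule:
  assumes "cvs.subspace U" "U \<subseteq> V" "\<And>u x. u \<in> U \<Longrightarrow> x \<in> G \<Longrightarrow> ac u x \<in> U"
  shows "liemod G br U ac"
  by (intro liemod.intro liealg_axioms liemod_axioms.intro)
    (rule fds_mono[OF V_fds assms(1,2)] ac_left ac_right[OF subsetD[OF assms(2)]] assms(3)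
      ac_br[OF subsetD[OF assms(2)]]; assumption?)+

end

context liealg begin

lemma adjoint: "liemod G br G br"
  by (intro liemod.intro liealg_axioms liemod_axioms.intro) (rule G_fds br_left br_right br_closed br_jacobi; assumption?)+

end

section \<open>Weights, the trace form and its invariance, Cartan's criterion\<close>

context liemod begin

text \<open>On \<open>ac v b\<close> the operator for \<open>x\<close> shifted by
  \<open>l + n\<close> obeys a product rule: it is shifted by \<open>l\<close> on \<open>v\<close>
  plus shifted by \<open>n\<close> on \<open>b\<close>. If \<open>m\<close> steps kill
  \<open>v\<close> and \<open>k\<close> steps kill \<open>b\<close>, then \<open>m + k\<close> steps
  kill \<open>ac v b\<close>. Induction on the total exponent replaces a binomial expansion.\<close>

lemma weight_space_action:
  assumes x: "x \<in> G" and b: "b \<in> gsp G (\<lambda>b. br b x) n" and v: "v \<in> gsp V (\<lambda>v. ac v x) l"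
  shows "ac v b \<in> gsp V (\<lambda>v. ac v x) (l + n)"
proof -
  let ?S = "shift (\<lambda>v. ac v x) l" and ?T = "shift (\<lambda>b. br b x) n" and ?U = "shift (\<lambda>v. ac v x) (l + n)"
  have cS: "clin ?S" and cT: "clin ?T" and cU: "clin ?U" by (intro clin_shift ac_left br_left)+
  have SV: "?S v \<in> V" if "v \<in> V" for v
    by (rule shift_closed[OF V_sub _ that]) (rule ac_closed[OF _ x])
  have TG: "?T b \<in> G" if "b \<in> G" for b
    by (rule shift_closed[OF G_sub _ that]) (rule br_closed[OF _ x])
  have step: "?U (ac v b) = ac (?S v) b + ac v (?T b)" if "v \<in> V" "b \<in> G" for v b
    using ac_br[OF that x]
    by (simp add: shift_def ac_left_simps clin_diff[OF ac_right[OF that(1)]] clin_scale[OF ac_right[OF that(1)]]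
        cvs.scale_left_distrib)
  have main: "(?U ^^ N) (ac v b) = 0"
    if "N = m + k" "(?S ^^ m) v = 0" "(?T ^^ k) b = 0" "v \<in> V" "b \<in> G" for N m k v b
    using that
  proof (induction N arbitrary: m k v b)
    case 0
    then show ?case using clin_0[OF ac_left] by simp
  next
    case (Suc N)
    show ?case
    proof (cases "v = 0 \<or> b = 0")
      case True
      then have "ac v b = 0" using clin_0[OF ac_left] clin_0[OF ac_right[OF Suc(5)]] by auto
      then show ?thesis using clin_0[OF clin_funpow[OF cU]] by (simp only:)
    next
      case False
      then obtain m' k' where mk: "m = Suc m'" "k = Suc k'" using Suc(3,4) by (cases m; cases k) auto
      have a: "(?U ^^ N) (ac (?S v) b) = 0"
        by (rule Suc.IH[of m' k]) (use Suc mk SV in \<open>auto simp: funpow_swap1\<close>)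
      have b: "(?U ^^ N) (ac v (?T b)) = 0"
        by (rule Suc.IH[of m k']) (use Suc mk TG in \<open>auto simp: funpow_swap1\<close>)
      have "(?U ^^ Suc N) (ac v b) = (?U ^^ N) (?U (ac v b))" by (simp add: funpow_swap1)
      also have "\<dots> = (?U ^^ N) (ac (?S v) b) + (?U ^^ N) (ac v (?T b))"
        unfolding step[OF Suc(5,6)] by (rule clin_add[OF clin_funpow[OF cU]])
      finally show ?thesis using a b by simp
    qed
  qed
  obtain m k where "(?S ^^ m) v = 0" "(?T ^^ k) b = 0" "v \<in> V" "b \<in> G"
    using b v by (auto simp: gsp_def gker_def)
  then show ?thesis using main[of "m + k" m k v b] ac_closed unfolding gsp_def gker_def by blast
qed

end

text \<open>Precomposing with a projection onto \<open>G\<close> makes the trace form bilinear on the whole type.\<close>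

definition proj :: "'a::cvs set \<Rightarrow> 'a \<Rightarrow> 'a" where
  "proj U = (SOME p. clin p \<and> (\<forall>x. p x \<in> U) \<and> (\<forall>x\<in>U. p x = x))"

lemma proj:
  assumes "cvs.subspace U"
  shows "clin (proj U)" "proj U x \<in> U" "x \<in> U \<Longrightarrow> proj U x = x"
proof -
  have "\<exists>p. clin p \<and> (\<forall>x. p x \<in> U) \<and> (\<forall>x\<in>U. p x = x)" using projection_ex[OF assms] by metis
  from someI_ex[OF this, folded proj_def] show "clin (proj U)" "proj U x \<in> U" "x \<in> U \<Longrightarrow> proj U x = x" by auto
qed

context liemod begin

definition trf :: "'g \<Rightarrow> 'g \<Rightarrow> complex" where
  "trf x y = ctr V (\<lambda>v. ac (ac v (proj G x)) (proj G y))"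

lemma trf_eq: "x \<in> G \<Longrightarrow> y \<in> G \<Longrightarrow> trf x y = ctr V (\<lambda>v. ac (ac v x) y)"
  by (simp add: trf_def proj[OF G_sub])

lemma ac2_clin: "clin (\<lambda>v. ac (ac v x) y)" by (rule clin_compose[OF ac_left ac_left])

lemma ac2_closed: "v \<in> V \<Longrightarrow> x \<in> G \<Longrightarrow> y \<in> G \<Longrightarrow> ac (ac v x) y \<in> V" using ac_closed by blast

lemma trf_clin1: "clin (\<lambda>x. trf x y)"
proof (rule clinI)
  fix a b c
  note c1 = ac2_clin[of "proj G _" "proj G y"] and m1 = ac2_closed[OF _ proj(2)[OF G_sub] proj(2)[OF G_sub]]
  have "trf (a + b) y = ctr V (\<lambda>v. ac (ac v (proj G a)) (proj G y) + ac (ac v (proj G b)) (proj G y))"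
    unfolding trf_def by (rule ctr_cong[OF V_fds]) (simp add: clin_add[OF proj(1)[OF G_sub]] clin_add[OF ac_right] ac_left_simps)
  also have "\<dots> = trf a y + trf b y" unfolding trf_def by (rule ctr_add[OF V_fds c1 m1 c1 m1])
  finally show "trf (a + b) y = trf a y + trf b y" .
  have "trf (c *\<^sub>c a) y = ctr V (\<lambda>v. c *\<^sub>c ac (ac v (proj G a)) (proj G y))"
    unfolding trf_def by (rule ctr_cong[OF V_fds]) (simp add: clin_scale[OF proj(1)[OF G_sub]] clin_scale[OF ac_right] ac_left_simps)
  also have "\<dots> = c * trf a y" unfolding trf_def by (rule ctr_csc[OF V_fds c1 m1])
  finally show "trf (c *\<^sub>c a) y = c *\<^sub>c trf a y" by simp
qed

lemma trf_sym: "trf x y = trf y x"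
  unfolding trf_def by (rule ctr_comp[OF V_fds ac_left _ ac_left]) (rule ac_closed[OF _ proj(2)[OF G_sub]], assumption)+

lemma trf_clin2: "clin (trf x)"
proof -
  have "trf x = (\<lambda>y. trf y x)" by (rule ext) (rule trf_sym)
  then show ?thesis using trf_clin1[of x] by simp
qed

text \<open>Both sides expand into traces of triple products; one pair coincides outright and the
  other after a cyclic permutation.\<close>

lemma trf_invariant:
  assumes x: "x \<in> G" and y: "y \<in> G" and z: "z \<in> G"
  shows "trf (br y x) z = - trf y (br z x)"
proof -
  have c3: "clin (\<lambda>v. ac (ac (ac v a) b) c)" for a b c by (rule clin_compose[OF ac_left ac2_clin])
  have m3: "ac (ac (ac v a) b) c \<in> V" if "v \<in> V" "a \<in> G" "b \<in> G" "c \<in> G" for v a b c using that ac_closed by blast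
  have "trf (br y x) z = ctr V (\<lambda>v. ac (ac (ac v y) x) z - ac (ac (ac v x) y) z)"
    unfolding trf_eq[OF br_closed[OF y x] z] by (rule ctr_cong[OF V_fds]) (simp add: ac_br x y z ac_left_simps)
  also have "\<dots> = ctr V (\<lambda>v. ac (ac (ac v y) x) z) - ctr V (\<lambda>v. ac (ac (ac v x) y) z)"
    by (rule ctr_diff[OF V_fds c3 _ c3]) (use m3 x y z in blast)+
  finally have 1: "trf (br y x) z = \<dots>" .
  have "trf y (br z x) = ctr V (\<lambda>v. ac (ac (ac v y) z) x - ac (ac (ac v y) x) z)"
    unfolding trf_eq[OF y br_closed[OF z x]] by (rule ctr_cong[OF V_fds]) (simp add: ac_br ac_closed x y z)
  also have "\<dots> = ctr V (\<lambda>v. ac (ac (ac v y) z) x) - ctr V (\<lambda>v. ac (ac (ac v y) x) z)"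
    by (rule ctr_diff[OF V_fds c3 _ c3]) (use m3 x y z in blast)+
  finally have 2: "trf y (br z x) = \<dots>" .
  have "ctr V (\<lambda>v. ac (ac (ac v y) z) x) = ctr V (\<lambda>v. ac (ac (ac v x) y) z)"
    by (rule ctr_comp[OF V_fds ac_left _ ac2_clin]) (use ac_closed x y z in blast)+
  then show ?thesis unfolding 1 2 by simp
qed

text \<open>Cartan's criterion. With \<open>s\<close> the conjugate semisimple part of the action of \<open>x\<close>, the
  trace of the action of \<open>[a, b]\<close> composed with \<open>s\<close> is a multiple of the trace form at
  \<open>(a, b)\<close> when \<open>b\<close> is a generalized eigenvector of \<open>ad x\<close>.\<close>

lemma cartan_nilpotent:
  assumes perfect: "G \<subseteq> cvs.span {br a b | a b. a \<in> G \<and> b \<in> G}"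
    and zero: "\<And>a b. a \<in> G \<Longrightarrow> b \<in> G \<Longrightarrow> trf a b = 0" and x: "x \<in> G"
  shows "V \<subseteq> gsp V (\<lambda>v. ac v x) 0"
proof -
  let ?f = "\<lambda>v. ac v x"
  have fV: "\<forall>v\<in>V. ac v x \<in> V" using ac_closed x by blast
  obtain s r where s: "clin s" "\<And>w. w \<in> V \<Longrightarrow> s w \<in> V" "\<And>l v. v\<in>gsp V ?f l \<Longrightarrow> s v = cnj l *\<^sub>c v"
    and r: "ctr V (\<lambda>v. ac (s v) x) = complex_of_real r" "r = 0 \<Longrightarrow> V \<subseteq> gsp V ?f 0"
    using conjugate_semisimple_part[OF V_fds ac_left fV] by blast
  \<comment> \<open>The plan is that \<open>\<phi>\<close> vanishes on all brackets, hence on the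
    perfect algebra \<open>G\<close>, and its value at \<open>x\<close> is the real number
    \<open>r\<close> whose vanishing means nilpotency.\<close>
  define \<phi> where "\<phi> y = ctr V (\<lambda>v. ac (s v) (proj G y))" for y
  have cs: "clin (\<lambda>v. ac (s v) y)" for y by (rule clin_compose[OF ac_left s(1)])
  have ms: "ac (s v) y \<in> V" if "v \<in> V" "y \<in> G" for v y using ac_closed s(2) that by blast
  have \<phi>: "clin \<phi>"
  proof (rule clinI)
    fix a b c
    note m = ms[OF _ proj(2)[OF G_sub]]
    have "\<phi> (a + b) = ctr V (\<lambda>v. ac (s v) (proj G a) + ac (s v) (proj G b))"
      unfolding \<phi>_def by (rule ctr_cong[OF V_fds]) (simp add: clin_add[OF proj(1)[OF G_sub]] clin_add[OF ac_right] s)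
    also have "\<dots> = \<phi> a + \<phi> b" unfolding \<phi>_def by (rule ctr_add[OF V_fds cs m cs m])
    finally show "\<phi> (a + b) = \<phi> a + \<phi> b" .
    have "\<phi> (c *\<^sub>c a) = ctr V (\<lambda>v. c *\<^sub>c ac (s v) (proj G a))"
      unfolding \<phi>_def by (rule ctr_cong[OF V_fds]) (simp add: clin_scale[OF proj(1)[OF G_sub]] clin_scale[OF ac_right] s)
    also have "\<dots> = c * \<phi> a" unfolding \<phi>_def by (rule ctr_csc[OF V_fds cs m])
    finally show "\<phi> (c *\<^sub>c a) = c *\<^sub>c \<phi> a" by simp
  qed
  have key: "\<phi> (br a b) = 0" if a: "a \<in> G" and b: "b \<in> gsp G (\<lambda>b. br b x) n" for a b n
  proof -
    have bG: "b \<in> G" using b gsp_subset by blast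
    \<comment> \<open>Acting by \<open>b\<close> raises the eigenvalue by \<open>n\<close>, hence
      the conjugate eigenvalue by \<open>cnj n\<close>. Generalized eigenvectors span
      \<open>V\<close>, so the identity need only be checked on them.\<close>
    have sb: "ac (s v) b = s (ac v b) - cnj n *\<^sub>c ac v b" if v: "v \<in> V" for v
    proof (rule eq_on_span[where S = "\<Union>l. gsp V ?f l" and x = v and f = "\<lambda>v. ac (s v) b"
          and g = "\<lambda>v. s (ac v b) - cnj n *\<^sub>c ac v b"])
      show "v \<in> cvs.span (\<Union>l. gsp V ?f l)" using gsp_span[OF V_fds ac_left fV] v by blast
      show "clin (\<lambda>v. s (ac v b) - cnj n *\<^sub>c ac v b)" by (intro clin_intros clin_compose[OF s(1)] ac_left)
      fix v assume "v \<in> (\<Union>l. gsp V ?f l)"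
      then obtain l where l: "v \<in> gsp V ?f l" by blast
      then have "s (ac v b) = cnj (l + n) *\<^sub>c ac v b" using s(3) weight_space_action[OF x b] by blast
      moreover have "ac (s v) b = cnj l *\<^sub>c ac v b" using s(3)[OF l] by (simp add: ac_left_simps)
      ultimately show "ac (s v) b = s (ac v b) - cnj n *\<^sub>c ac v b" by (simp add: cvs.scale_left_distrib)
    qed (rule cs)
    \<comment> \<open>The first two terms have equal trace by cyclicity; what remains is
      \<open>cnj n\<close> times a value of the trace form, which is zero.\<close>
    have "\<phi> (br a b) = ctr V (\<lambda>v. (ac (ac (s v) a) b - ac (s (ac v b)) a) + cnj n *\<^sub>c ac (ac v b) a)"
      unfolding \<phi>_def proj(3)[OF G_sub br_closed[OF a bG]]
      by (rule ctr_cong[OF V_fds]) (simp add: ac_br s a bG sb ac_left_simps)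
    also have "\<dots> = (ctr V (\<lambda>v. ac (ac (s v) a) b) - ctr V (\<lambda>v. ac (s (ac v b)) a)) + cnj n * ctr V (\<lambda>v. ac (ac v b) a)"
    proof -
      have c: "clin (\<lambda>v. ac (ac (s v) a) b)" "clin (\<lambda>v. ac (s (ac v b)) a)"
        by (rule clin_compose[OF ac_left cs], rule clin_compose[OF cs ac_left])
      have m: "ac (ac (s v) a) b \<in> V" "ac (s (ac v b)) a \<in> V" "ac (ac v b) a \<in> V" if "v \<in> V" for v
        using that a bG ms ac_closed by blast+
      show ?thesis
        by (subst ctr_add[OF V_fds clin_minus[OF c] _ clin_csc[OF ac2_clin]])
          (use m cvs.subspace_diff[OF V_sub] cvs.subspace_scale[OF V_sub] in
            \<open>simp_all add: ctr_diff[OF V_fds c(1) _ c(2)] ctr_csc[OF V_fds ac2_clin]\<close>)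
    qed
    also have "ctr V (\<lambda>v. ac (ac (s v) a) b) = ctr V (\<lambda>v. ac (s (ac v b)) a)"
      by (rule ctr_comp[OF V_fds ac_left _ cs]) (use ac_closed ms a bG in blast)+
    also have "ctr V (\<lambda>v. ac (ac v b) a) = 0" using zero[OF bG a] trf_eq[OF bG a] by simp
    finally show ?thesis by simp
  qed
  have "\<phi> (br a b) = 0" if a: "a \<in> G" and b: "b \<in> G" for a b
  proof (rule eq_on_span[where S = "\<Union>l. gsp G (\<lambda>b. br b x) l" and x = b and f = "\<lambda>b. \<phi> (br a b)"
        and g = "\<lambda>b. 0"])
    show "clin (\<lambda>b. \<phi> (br a b))" by (rule clin_compose[OF \<phi> br_right])
    show "b \<in> cvs.span (\<Union>l. gsp G (\<lambda>b. br b x) l)" using gsp_span[OF G_fds br_left] br_closed x b by blast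
  qed (use key[OF a] in \<open>auto intro: clin_zero\<close>)
  then have "\<phi> y = 0" if "y \<in> G" for y
    using eq_on_span[OF \<phi> clin_zero, of "{br a b | a b. a \<in> G \<and> b \<in> G}" y] perfect that by blast
  then have "complex_of_real r = 0" using r(1) x by (simp add: \<phi>_def proj[OF G_sub])
  then show ?thesis using r(2) by simp
qed

end

subsection \<open>Engel's theorem\<close>

definition adnil :: "('g::cvs \<Rightarrow> 'g \<Rightarrow> 'g) \<Rightarrow> 'g set \<Rightarrow> bool" where
  "adnil br K \<longleftrightarrow> (\<forall>x\<in>K. \<forall>b\<in>K. \<exists>n. ((\<lambda>b. br b x) ^^ n) b = 0)"

text \<open>For a Lie algebra \<open>K\<close> this says that \<open>H\<close> is an ideal of
  codimension one, with \<open>z\<close> spanning a complement. It is the only structural input of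
  Engel's induction.\<close>

definition has_chain :: "('g::cvs \<Rightarrow> 'g \<Rightarrow> 'g) \<Rightarrow> 'g set \<Rightarrow> bool" where
  "has_chain br K \<longleftrightarrow> (\<exists>H z. subalg br H K \<and> H \<noteq> K \<and> z \<in> K \<and> (\<forall>k\<in>H. br z k \<in> H) \<and>
     (\<forall>x\<in>K. \<exists>k\<in>H. \<exists>c. x = k + c *\<^sub>c z))"

lemma adnil_mono: "adnil br K \<Longrightarrow> H \<subseteq> K \<Longrightarrow> adnil br H" by (auto simp: adnil_def)

text \<open>Since \<open>br z k\<close> stays in \<open>H\<close>, every iterate of
  \<open>v0\<close> under \<open>z\<close> is still mapped into \<open>U\<close> by
  \<open>H\<close>. The last iterate outside \<open>U\<close> is then mapped into \<open>U\<close>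
  by \<open>z\<close> as well.\<close>

lemma (in liemod) engel_step:
  assumes H: "subalg br H G" "z \<in> G" "\<And>k. k \<in> H \<Longrightarrow> br z k \<in> H" "\<And>x. x \<in> G \<Longrightarrow> \<exists>k\<in>H. \<exists>c. x = k + c *\<^sub>c z"
    and U: "cvs.subspace U" "U \<subseteq> V" "\<And>u x. u \<in> U \<Longrightarrow> x \<in> G \<Longrightarrow> ac u x \<in> U"
    and v0: "v0 \<in> V - U" "\<And>k. k \<in> H \<Longrightarrow> ac v0 k \<in> U"
    and nil: "\<exists>n. ((\<lambda>v. ac v z) ^^ n) v0 \<in> U"
  shows "\<exists>v\<in>V - U. \<forall>x\<in>G. ac v x \<in> U"
proof -
  let ?z = "\<lambda>v. ac v z"
  have HG: "H \<subseteq> G" using H(1) by (simp add: subalg_def)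
  define n where "n = (LEAST n. (?z ^^ n) v0 \<in> U)"
  have n: "(?z ^^ n) v0 \<in> U" unfolding n_def using nil by (rule LeastI_ex)
  then obtain m where m: "n = Suc m" using v0 by (cases n) auto
  define v where "v = (?z ^^ m) v0"
  have vU: "v \<notin> U" using not_less_Least[of m "\<lambda>n. (?z ^^ n) v0 \<in> U"] m by (simp add: v_def n_def)
  have vz: "ac v z \<in> U" using n m by (simp add: v_def)
  have W: "(?z ^^ j) v0 \<in> V \<and> (\<forall>k\<in>H. ac ((?z ^^ j) v0) k \<in> U)" for j
  proof (induction j)
    case 0 then show ?case using v0 by simp
  next
    case (Suc j)
    let ?w = "(?z ^^ j) v0"
    have "ac (ac ?w z) k \<in> U" if k: "k \<in> H" for k
    proof -
      have "ac (ac ?w z) k = ac ?w (br z k) + ac (ac ?w k) z" using ac_br[of ?w z k] Suc H(2) HG k by auto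
      then show ?thesis using Suc H(2) H(3)[OF k] U(3) k cvs.subspace_add[OF U(1)] by auto
    qed
    then show ?case using Suc ac_closed H(2) by simp
  qed
  have v: "v \<in> V" "\<And>k. k \<in> H \<Longrightarrow> ac v k \<in> U" using W[of m] by (auto simp: v_def)
  have "ac v x \<in> U" if x: "x \<in> G" for x
  proof -
    obtain k c where k: "k \<in> H" "x = k + c *\<^sub>c z" using H(4)[OF x] by blast
    then have "ac v x = ac v k + c *\<^sub>c ac v z" using clin_simps[OF ac_right[OF v(1)]] by simp
    then show ?thesis using v(2)[OF k(1)] vz cvs.subspace_add[OF U(1)] cvs.subspace_scale[OF U(1)] by simp
  qed
  then show ?thesis using v(1) vU by blast
qed

text \<open>This is Engel's theorem for \<open>V / U\<close> without a quotient. The relative form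
  is needed twice: for the adjoint action modulo a subalgebra, and modulo the vectors already killed
  by an ideal. The chains are a hypothesis because their existence is itself proved with this
  lemma.\<close>

lemma engel_of_chains:
  fixes ac :: "'v::cvs \<Rightarrow> 'g::cvs \<Rightarrow> 'v"
  assumes "liemod K br V ac" "\<And>H. subalg br H K \<Longrightarrow> H \<noteq> {0} \<Longrightarrow> has_chain br H"
    and U: "cvs.subspace U" "U \<subseteq> V" "U \<noteq> V" "\<And>u x. u \<in> U \<Longrightarrow> x \<in> K \<Longrightarrow> ac u x \<in> U"
    and nil: "\<And>v x. v \<in> V \<Longrightarrow> x \<in> K \<Longrightarrow> \<exists>n. ((\<lambda>v. ac v x) ^^ n) v \<in> U"
  shows "\<exists>v\<in>V - U. \<forall>x\<in>K. ac v x \<in> U"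
  using assms(1,2) U(4) nil
proof (induction "cvs.dim K" arbitrary: K rule: less_induct)
  case less
  interpret liemod K br V ac by (rule less(2))
  show ?case
  proof (cases "K = {0}")
    case True
    obtain v where v: "v \<in> V - U" using U by blast
    then have "ac v 0 = 0" using clin_0[OF ac_right] by blast
    then show ?thesis using True v cvs.subspace_0[OF U(1)] by (intro bexI[of _ v]) auto
  next
    case False
    have "subalg br K K" using G_sub br_closed by (simp add: subalg_def)
    then obtain H z where H: "subalg br H K" "H \<noteq> K" "z \<in> K" "\<forall>k\<in>H. br z k \<in> H"
      "\<forall>x\<in>K. \<exists>k\<in>H. \<exists>c. x = k + c *\<^sub>c z" using less(3)[OF _ False] unfolding has_chain_def by metis
    have HK: "cvs.subspace H" "H \<subseteq> K" using H(1) by (auto simp: subalg_def)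
    have "\<exists>v\<in>V - U. \<forall>x\<in>H. ac v x \<in> U"
    proof (rule less.hyps[OF fds_dim_less[OF G_fds HK H(2)] liemod_subalg[OF H(1)]])
      fix H' assume "subalg br H' H" "H' \<noteq> {0}"
      then show "has_chain br H'" using less(3)[of H'] HK(2) by (auto simp: subalg_def)
    qed (use less(4,5) HK in auto)
    then obtain v where v: "v \<in> V - U" "\<forall>x\<in>H. ac v x \<in> U" by blast
    show ?thesis
      by (rule engel_step[OF H(1,3) _ _ U(1,2) _ v(1)]) (use H less(4,5) v in auto)
  qed
qed

text \<open>Let \<open>H\<close> be a proper subalgebra of greatest dimension. It acts nilpotently
  on \<open>K\<close> modulo \<open>H\<close>, and its subalgebras have chains by induction, so
  \<open>engel_of_chains\<close> yields \<open>z\<close> outside \<open>H\<close> that normalises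
  \<open>H\<close>. The span of \<open>H\<close> and \<open>z\<close> is a larger subalgebra, hence
  all of \<open>K\<close>.\<close>

lemma has_chain_adnil:
  assumes "liealg K br" "adnil br K" "K \<noteq> {0}"
  shows "has_chain br K"
  using assms
proof (induction "cvs.dim K" arbitrary: K rule: less_induct)
  case less
  interpret liealg K br by (rule less(2))
  let ?P = "\<lambda>H. subalg br H K \<and> H \<noteq> K"
  have 0: "?P {0}" using less(4) cvs.subspace_0[OF G_sub] br_self by (auto simp: subalg_def)
  have "\<forall>H. ?P H \<longrightarrow> cvs.dim H < Suc (cvs.dim K)"
    using fds_dim_mono[OF G_fds] by (auto simp: subalg_def less_Suc_eq_le)
  from ex_has_greatest_nat[of ?P, OF 0 this]
  obtain H where "?P H \<and> (\<forall>H'. ?P H' \<longrightarrow> cvs.dim H' \<le> cvs.dim H)" ..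
  then have H: "subalg br H K" "H \<noteq> K" and max: "\<And>H'. ?P H' \<Longrightarrow> cvs.dim H' \<le> cvs.dim H"
    by simp_all
  have HK: "cvs.subspace H" "H \<subseteq> K" "\<And>x y. x \<in> H \<Longrightarrow> y \<in> H \<Longrightarrow> br x y \<in> H" using H(1) by (auto simp: subalg_def)
  interpret a: liemod K br K br by (rule adjoint)
  have "\<exists>v\<in>K - H. \<forall>x\<in>H. br v x \<in> H"
  proof (rule engel_of_chains[OF a.liemod_subalg[OF H(1)] _ HK(1,2) H(2) HK(3)])
    fix H' assume H': "subalg br H' H" "H' \<noteq> {0}"
    then have s: "subalg br H' K" using HK(2) by (auto simp: subalg_def)
    then have "cvs.dim H' < cvs.dim K"
      using fds_dim_mono[OF fds_mono[OF G_fds HK(1,2)], of H'] fds_dim_less[OF G_fds HK(1,2) H(2)] H'(1)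
      by (auto simp: subalg_def)
    then show "has_chain br H'" using less.hyps[OF _ liealg_subalg[OF s] adnil_mono[OF less(3)] H'(2)] s by (auto simp: subalg_def)
  next
    fix v x assume "v \<in> K" "x \<in> H"
    then obtain n where "((\<lambda>b. br b x) ^^ n) v = 0" using less(3) HK(2) unfolding adnil_def by blast
    then show "\<exists>n. ((\<lambda>b. br b x) ^^ n) v \<in> H" using cvs.subspace_0[OF HK(1)] by (intro exI[of _ n]) simp
  qed
  then obtain z where z: "z \<in> K" "z \<notin> H" "\<And>x. x \<in> H \<Longrightarrow> br z x \<in> H" by blast
  define H' where "H' = cvs.span (insert z H)"
  have in_H': "x \<in> H' \<longleftrightarrow> (\<exists>k\<in>H. \<exists>c. x = k + c *\<^sub>c z)" for x
    unfolding H'_def cvs.span_breakdown_eq using HK(1)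
    by (metis add.commute add_diff_cancel_left' cvs.span_eq_iff diff_add_cancel)
  have sub: "subalg br H' K" unfolding subalg_def
  proof (intro conjI ballI)
    show "cvs.subspace H'" by (simp add: H'_def)
    show "H' \<subseteq> K" unfolding H'_def by (rule cvs.span_minimal[OF _ G_sub]) (use z HK in auto)
    fix x y assume "x \<in> H'" "y \<in> H'"
    then obtain k c l d where k: "k \<in> H" "x = k + c *\<^sub>c z" and l: "l \<in> H" "y = l + d *\<^sub>c z" by (auto simp: in_H')
    have kz: "br k z = - br z k" using br_anti[of k z] k HK(2) z by auto
    have "br x y = br k l + d *\<^sub>c br k z + c *\<^sub>c br z l"
      unfolding k(2) l(2) by (simp add: br_simps br_self z algebra_simps cvs.scale_right_distrib)
    also have "\<dots> \<in> H" unfolding kz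
      using HK k l z(3) by (intro cvs.subspace_add[OF HK(1)] cvs.subspace_scale[OF HK(1)] cvs.subspace_neg[OF HK(1)]) auto
    finally show "br x y \<in> H'" unfolding H'_def using cvs.span_base by blast
  qed
  have "H' = K"
  proof (rule ccontr)
    assume "H' \<noteq> K"
    then have "cvs.dim H' \<le> cvs.dim H" using max sub by blast
    moreover have "z \<in> H'" "H \<subseteq> H'" unfolding H'_def using cvs.span_superset by blast+
    moreover have "fds H'" using sub fds_mono[OF G_fds] by (auto simp: subalg_def)
    ultimately show False using fds_dim_less[of H' H] HK(1) z(2) by fastforce
  qed
  then show ?case unfolding has_chain_def using H z in_H' by blast
qed

lemma engel:
  fixes ac :: "'v::cvs \<Rightarrow> 'g::cvs \<Rightarrow> 'v"
  assumes K: "liemod K br V ac" "adnil br K"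
    and U: "cvs.subspace U" "U \<subseteq> V" "U \<noteq> V" "\<And>u x. u \<in> U \<Longrightarrow> x \<in> K \<Longrightarrow> ac u x \<in> U"
    and nil: "\<And>v x. v \<in> V \<Longrightarrow> x \<in> K \<Longrightarrow> \<exists>n. ((\<lambda>v. ac v x) ^^ n) v \<in> U"
  shows "\<exists>v\<in>V - U. \<forall>x\<in>K. ac v x \<in> U"
proof (rule engel_of_chains[OF K(1) _ U nil])
  interpret liemod K br V ac by (rule K(1))
  fix H assume "subalg br H K" "H \<noteq> {0}"
  then show "has_chain br H"
    using has_chain_adnil[OF liealg_subalg adnil_mono[OF K(2)]] by (auto simp: subalg_def)
qed

subsection \<open>Lie algebras without abelian ideals\<close>

text \<open>Equivalent to having no nonzero solvable ideal, as the last nonzero term of a derived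
  series is an abelian ideal; see \<open>solvable_ideal_zero\<close> and
  \<open>aparam_ssalg\<close>.\<close>

locale ssalg = liealg +
  assumes no_abelian: "lie_ideal br J G \<Longrightarrow> (\<And>x y. x \<in> J \<Longrightarrow> y \<in> J \<Longrightarrow> br x y = 0) \<Longrightarrow> J = {0}"

text \<open>Choose a nonzero ideal \<open>J\<close> of least dimension inside \<open>R\<close>. It
  is not abelian, so it equals its own bracket span, and Cartan's criterion makes each of its
  elements nilpotent on \<open>V\<close>. Faithfulness turns this into nilpotency of the adjoint
  action, and Engel's theorem contradicts that \<open>J\<close> is perfect and acts
  faithfully.\<close>

lemma (in ssalg) isotropic_ideal:
  fixes ac :: "'v::cvs \<Rightarrow> 'a \<Rightarrow> 'v"
  assumes V: "liemod G br V ac" and faithful: "\<And>x. x \<in> G \<Longrightarrow> (\<And>v. v \<in> V \<Longrightarrow> ac v x = 0) \<Longrightarrow> x = 0"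
    and R: "lie_ideal br R G" and iso: "\<And>x y. x \<in> R \<Longrightarrow> y \<in> R \<Longrightarrow> liemod.trf G V ac x y = 0"
  shows "R = {0}"
proof (rule ccontr)
  interpret V: liemod G br V ac by (rule V)
  assume "R \<noteq> {0}"
  let ?P = "\<lambda>J. lie_ideal br J G \<and> J \<subseteq> R \<and> J \<noteq> {0}"
  have "?P R" using R \<open>R \<noteq> {0}\<close> by simp
  from ex_has_least_nat[of ?P, OF this, of cvs.dim]
  obtain J where "?P J \<and> (\<forall>J'. ?P J' \<longrightarrow> cvs.dim J \<le> cvs.dim J')" ..
  then have J: "lie_ideal br J G" "J \<subseteq> R" "J \<noteq> {0}" and min: "\<And>J'. ?P J' \<Longrightarrow> cvs.dim J \<le> cvs.dim J'"
    by simp_all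
  have Js: "cvs.subspace J" and JG: "J \<subseteq> G" using J(1) by (auto simp: lie_ideal_def)
  let ?D = "cvs.span {br a b | a b. a \<in> J \<and> b \<in> J}"
  have D: "lie_ideal br ?D G" "?D \<subseteq> J" using ideal_span_br[OF J(1)] by blast+
  have "?D \<noteq> {0}"
  proof
    assume D0: "?D = {0}"
    have "br a b = 0" if "a \<in> J" "b \<in> J" for a b
    proof -
      have "br a b \<in> ?D" by (rule cvs.span_base) (use that in blast)
      then show ?thesis using D0 by simp
    qed
    then show False using no_abelian[OF J(1)] J(3) by blast
  qed
  then have "cvs.dim J \<le> cvs.dim ?D" using min D J(2) by blast
  then have DJ: "?D = J" using fds_dim_eq[OF fds_mono[OF G_fds Js JG] _ D(2)] by simp
  interpret J: liemod J br V ac by (rule V.liemod_subalg[OF ideal_subalg[OF J(1)]])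
  have nil: "V \<subseteq> gsp V (\<lambda>v. ac v x) 0" if "x \<in> J" for x
  proof (rule J.cartan_nilpotent[OF _ _ that])
    show "J \<subseteq> ?D" using DJ by simp
    fix a b assume ab: "a \<in> J" "b \<in> J"
    then have "a \<in> R" "b \<in> R" "a \<in> G" "b \<in> G" using J(2) JG by blast+
    then show "J.trf a b = 0" using iso[of a b] V.trf_eq[of a b] J.trf_eq[OF ab] by simp
  qed
  have "adnil br J" unfolding adnil_def
  proof (intro ballI)
    fix x b assume x: "x \<in> J" and b: "b \<in> J"
    let ?E = "\<lambda>n. gsp J (\<lambda>b. br b x) n"
    \<comment> \<open>All of \<open>V\<close> has weight 0 for \<open>x\<close>. An element
      \<open>c\<close> of weight \<open>n \<noteq> 0\<close> sends \<open>V\<close> into weight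
      \<open>n\<close>, but also into \<open>V\<close>; so \<open>c\<close> acts as zero and
      faithfulness gives \<open>c = 0\<close>.\<close>
    have "?E n \<subseteq> ?E 0" for n
    proof (cases "n = 0")
      case False
      have "c = 0" if c: "c \<in> ?E n" for c
      proof (rule faithful)
        show "c \<in> G" using c gsp_subset JG by blast
        fix v assume v: "v \<in> V"
        have "ac v c \<in> gsp V (\<lambda>v. ac v x) (0 + n)" using J.weight_space_action[OF x c] nil[OF x] v by blast
        moreover have "ac v c \<in> gsp V (\<lambda>v. ac v x) 0" using nil[OF x] v J.ac_closed c gsp_subset by blast
        ultimately show "ac v c = 0" using gsp_disjoint[OF V.ac_left, of "0 + n" 0] False by simp
      qed
      then show ?thesis using cvs.subspace_0[OF subspace_gsp[OF br_left Js]] by blast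
    qed simp
    then have "(\<Union>n. ?E n) \<subseteq> ?E 0" by blast
    then have "cvs.span (\<Union>n. ?E n) \<subseteq> ?E 0" by (rule cvs.span_minimal[OF _ subspace_gsp[OF br_left Js]])
    then have "b \<in> ?E 0" using gsp_span[OF J.G_fds br_left] J.br_closed x b by blast
    then show "\<exists>n. ((\<lambda>b. br b x) ^^ n) b = 0" by (auto simp: gsp_def gker_def shift_def)
  qed
  \<comment> \<open>Engel modulo the vectors killed by \<open>J\<close> gives \<open>v\<close>
    outside \<open>?U\<close> with \<open>ac v x\<close> in \<open>?U\<close> for all
    \<open>x\<close> in \<open>J\<close>. Then every bracket of elements of \<open>J\<close> kills
    \<open>v\<close>, and these span \<open>J\<close>.\<close>
  let ?U = "{v \<in> V. \<forall>x\<in>J. ac v x = 0}"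
  have U: "cvs.subspace ?U"
    by (rule cvs.subspaceI) (auto simp: V.ac_left_simps cvs.subspace_0[OF V.V_sub] cvs.subspace_add[OF V.V_sub] cvs.subspace_scale[OF V.V_sub])
  show False
  proof (cases "?U = V")
    case True
    then have "x = 0" if "x \<in> J" for x using faithful[of x] that JG by blast
    then show False using J(3) cvs.subspace_0[OF Js] by blast
  next
    case False
    have "\<exists>v\<in>V - ?U. \<forall>x\<in>J. ac v x \<in> ?U"
    proof (rule engel[OF J.liemod_axioms \<open>adnil br J\<close> U _ False])
      fix v x assume "v \<in> V" "x \<in> J"
      then have "v \<in> gsp V (\<lambda>v. ac v x) 0" using nil by blast
      then obtain n where "((\<lambda>v. ac v x) ^^ n) v = 0" by (auto simp: gsp_def gker_def shift_def)
      then show "\<exists>n. ((\<lambda>v. ac v x) ^^ n) v \<in> ?U" using cvs.subspace_0[OF U] by (intro exI[of _ n]) simp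
    next
      fix u x assume "u \<in> ?U" "x \<in> J"
      then show "ac u x \<in> ?U" using cvs.subspace_0[OF U] by simp
    qed auto
    then obtain v where v: "v \<in> V" "v \<notin> ?U" "\<And>x. x \<in> J \<Longrightarrow> ac v x \<in> ?U" by blast
    have "ac v x = 0" if "x \<in> J" for x
    proof (rule eq_on_span[OF V.ac_right[OF v(1)] clin_zero])
      show "x \<in> ?D" using that DJ by simp
      fix u assume "u \<in> {br a b | a b. a \<in> J \<and> b \<in> J}"
      then obtain a b where "u = br a b" "a \<in> J" "b \<in> J" by blast
      then show "ac v u = 0" using J.ac_br[OF v(1)] v(3) by auto
    qed
    then show False using v by blast
  qed
qed

section \<open>Orthogonal complements of ideals for the Killing form\<close>

context ssalg begin

lemma G_ideal: "lie_ideal br G G" using G_sub br_closed by (simp add: lie_ideal_def)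

text \<open>Such elements form the centre, an abelian ideal.\<close>

lemma adjoint_faithful:
  assumes "x \<in> G" "\<And>v. v \<in> G \<Longrightarrow> br v x = 0" shows "x = 0"
proof -
  let ?Z = "{x \<in> G. \<forall>v\<in>G. br v x = 0}"
  have "?Z = {0}"
  proof (rule no_abelian)
    have "br x y \<in> ?Z" if x: "x \<in> ?Z" and y: "y \<in> G" for x y
    proof -
      have "br v (br x y) = 0" if v: "v \<in> G" for v
        using br_jacobi[of v x y] x y v br_closed[OF v y] clin_0[OF br_left] by simp
      then show ?thesis using x y br_closed by simp
    qed
    moreover have "cvs.subspace ?Z"
      by (rule cvs.subspaceI) (simp_all add: br_simps cvs.subspace_0[OF G_sub] cvs.subspace_add[OF G_sub] cvs.subspace_scale[OF G_sub])
    ultimately show "lie_ideal br ?Z G" unfolding lie_ideal_def by blast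
  qed simp
  then show ?thesis using assms by blast
qed

sublocale ad: liemod G br G br by (rule adjoint)

definition perp :: "'a set \<Rightarrow> 'a set" where
  "perp I = {x \<in> G. \<forall>y\<in>I. ad.trf x y = 0}"

lemma perp_ideal: assumes I: "lie_ideal br I G" shows "lie_ideal br (perp I) G"
proof -
  have IG: "I \<subseteq> G" using I by (simp add: lie_ideal_def)
  have "br x z \<in> perp I" if x: "x \<in> perp I" and z: "z \<in> G" for x z
  proof -
    have "ad.trf (br x z) y = 0" if y: "y \<in> I" for y
    proof -
      have "br y z \<in> I" "y \<in> G" "x \<in> G" using I x y z IG by (auto simp: lie_ideal_def perp_def)
      then show ?thesis using ad.trf_invariant[of z x y] x z by (simp add: perp_def)
    qed
    then show ?thesis using x z br_closed by (simp add: perp_def)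
  qed
  moreover have "cvs.subspace (perp I)"
    by (rule cvs.subspaceI) (simp_all add: perp_def cvs.subspace_0[OF G_sub] cvs.subspace_add[OF G_sub]
      cvs.subspace_scale[OF G_sub] clin_simps[OF ad.trf_clin1])
  ultimately show ?thesis unfolding lie_ideal_def by (auto simp: perp_def)
qed

text \<open>The intersection is an ideal on which the trace form of the faithful adjoint module
  vanishes.\<close>

lemma perp_Int: assumes I: "lie_ideal br I G" shows "I \<inter> perp I = {0}"
proof (rule isotropic_ideal[OF ad.liemod_axioms])
  show "lie_ideal br (I \<inter> perp I) G"
    using I perp_ideal[OF I] cvs.subspace_inter unfolding lie_ideal_def by blast
qed (use adjoint_faithful in \<open>auto simp: perp_def\<close>)

text \<open>By \<open>perp_Int\<close> the form is nondegenerate on \<open>I\<close>, so pairing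
  with \<open>x\<close> is represented on \<open>I\<close> by some \<open>a\<close> in
  \<open>I\<close>, and \<open>x - a\<close> is orthogonal to \<open>I\<close>.\<close>

lemma perp_decompose:
  assumes I: "lie_ideal br I G" and x: "x \<in> G"
  obtains a b where "a \<in> I" "b \<in> perp I" "x = a + b"
proof -
  have Is: "cvs.subspace I" "I \<subseteq> G" using I by (auto simp: lie_ideal_def)
  have nd: "a = 0" if "a \<in> I" "\<And>y. y \<in> I \<Longrightarrow> ad.trf a y = 0" for a
  proof -
    have "a \<in> I \<inter> perp I" using that Is by (auto simp: perp_def)
    then show ?thesis using perp_Int[OF I] by simp
  qed
  obtain a where "a \<in> I" "\<forall>y\<in>I. ad.trf a y = ad.trf x y"
    using functional_represented[OF fds_mono[OF G_fds Is] ad.trf_clin2 ad.trf_clin1 nd ad.trf_clin2] by blast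
  then have a: "a \<in> I" "\<And>y. y \<in> I \<Longrightarrow> ad.trf a y = ad.trf x y" by simp_all
  have "ad.trf (x - a) y = 0" if "y \<in> I" for y
    using a(2)[OF that] clin_diff[OF ad.trf_clin1] by simp
  then have "x - a \<in> perp I" using x a(1) Is cvs.subspace_diff[OF G_sub] by (auto simp: perp_def)
  then show ?thesis using that[OF a(1), of "x - a"] by simp
qed

lemma perp_commute:
  assumes I: "lie_ideal br I G" and a: "a \<in> I" and b: "b \<in> perp I"
  shows "br a b = 0" "br b a = 0"
proof -
  have G: "a \<in> G" "b \<in> G" using assms perp_ideal[OF I] by (auto simp: lie_ideal_def)
  have "br a b \<in> I" "br b a \<in> I"
    using I a G(2) ideal_left[OF I a G(2)] by (auto simp: lie_ideal_def)
  moreover have "br b a \<in> perp I" "br a b \<in> perp I"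
    using perp_ideal[OF I] b G(1) ideal_left[OF perp_ideal[OF I] b G(1)] by (auto simp: lie_ideal_def)
  ultimately show "br a b = 0" "br b a = 0" using perp_Int[OF I] by blast+
qed

text \<open>The orthogonal complement of \<open>I\<close> commutes with \<open>I\<close>, so only
  the component of \<open>y\<close> in \<open>I\<close> acts on \<open>J\<close>.\<close>

lemma ideal_trans:
  assumes I: "lie_ideal br I G" and J: "lie_ideal br J I" shows "lie_ideal br J G"
proof -
  have "br x y \<in> J" if x: "x \<in> J" and y: "y \<in> G" for x y
  proof -
    obtain a b where ab: "a \<in> I" "b \<in> perp I" "y = a + b" using perp_decompose[OF I y] .
    then have "br x y = br x a + br x b" by (simp add: br_simps)
    also have "br x b = 0" using perp_commute(1)[OF I _ ab(2)] x J by (auto simp: lie_ideal_def)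
    finally show ?thesis using J x ab(1) by (simp add: lie_ideal_def)
  qed
  then show ?thesis using I J by (auto simp: lie_ideal_def)
qed

lemma ssalg_ideal: assumes I: "lie_ideal br I G" shows "ssalg I br"
proof (intro ssalg.intro ssalg_axioms.intro liealg_subalg ideal_subalg[OF I])
  fix J assume "lie_ideal br J I" and a: "\<And>x y. x \<in> J \<Longrightarrow> y \<in> J \<Longrightarrow> br x y = 0"
  then show "J = {0}" by (intro no_abelian[OF ideal_trans[OF I]])
qed

text \<open>If \<open>x\<close> is orthogonal to all brackets, invariance makes every
  \<open>br x y\<close> orthogonal to \<open>G\<close>, hence zero. So \<open>x\<close> is central
  and vanishes.\<close>

lemma perfect: "G \<subseteq> cvs.span {br a b | a b. a \<in> G \<and> b \<in> G}"
proof -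
  let ?D = "cvs.span {br a b | a b. a \<in> G \<and> b \<in> G}"
  note D = ideal_span_br(1)[OF G_ideal]
  have 0: "x = 0" if x: "x \<in> perp ?D" for x
  proof (rule adjoint_faithful)
    show xG: "x \<in> G" using x by (simp add: perp_def)
    fix y assume y: "y \<in> G"
    have "ad.trf (br x y) z = 0" if z: "z \<in> G" for z
    proof -
      have "br z y \<in> ?D" by (rule cvs.span_base) (use y z in blast)
      then show ?thesis using ad.trf_invariant[OF y xG z] x by (simp add: perp_def)
    qed
    then have "br x y \<in> G \<inter> perp G" using br_closed[OF xG y] by (simp add: perp_def)
    then have "br x y = 0" using perp_Int[OF G_ideal] by simp
    then show "br y x = 0" using br_anti[OF y xG] by simp
  qed
  show ?thesis
  proof
    fix x assume "x \<in> G"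
    then obtain a b where ab: "a \<in> ?D" "b \<in> perp ?D" "x = a + b" by (rule perp_decompose[OF D])
    then show "x \<in> ?D" using 0[OF ab(2)] by simp
  qed
qed

end

subsection \<open>The Casimir operator and Whitehead's lemma\<close>

locale ssmod = ssalg G br + liemod G br V ac for G :: "'g::cvs set" and br and V :: "'v::cvs set" and ac
begin

lemma ssmod_submodule:
  assumes "cvs.subspace U" "U \<subseteq> V" "\<And>u x. u \<in> U \<Longrightarrow> x \<in> G \<Longrightarrow> ac u x \<in> U"
  shows "ssmod G br U ac"
  by (intro ssmod.intro ssalg_axioms liemod_submodule assms)

text \<open>\<open>C\<close> and \<open>y\<close> are dual bases for the trace form on the
  complement \<open>H\<close> of the kernel of the action, where the form is nondegenerate. The last
  clause is the invariance of the Casimir tensor, the sum of \<open>b\<close> tensor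
  \<open>y b\<close>, expressed by evaluating an arbitrary bilinear \<open>F\<close> on it.\<close>

lemma casimir_basis:
  assumes nontrivial: "v \<in> V" "x \<in> G" "ac v x \<noteq> 0"
  obtains C y where "finite C" "C \<noteq> {}" "C \<subseteq> G" "\<And>b. b \<in> C \<Longrightarrow> y b \<in> G" "\<And>b. b \<in> C \<Longrightarrow> trf b (y b) = 1"
    "\<And>x F. x \<in> G \<Longrightarrow> (\<And>p. p \<in> G \<Longrightarrow> clin (F p)) \<Longrightarrow> (\<And>q. clin (\<lambda>p. F p q)) \<Longrightarrow>
       (\<Sum>b\<in>C. F b (br (y b) x) + F (br b x) (y b)) = (0::'v)"
proof -
  let ?K = "{x \<in> G. \<forall>v\<in>V. ac v x = 0}"
  have K: "lie_ideal br ?K G"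
  proof -
    have "br x y \<in> ?K" if "x \<in> ?K" "y \<in> G" for x y
      using that br_closed ac_br ac_closed clin_0[OF ac_left] by simp
    moreover have "cvs.subspace ?K"
      by (rule cvs.subspaceI) (simp_all add: cvs.subspace_0[OF G_sub] cvs.subspace_add[OF G_sub]
        cvs.subspace_scale[OF G_sub] clin_0[OF ac_right] clin_add[OF ac_right] clin_scale[OF ac_right])
    ultimately show ?thesis unfolding lie_ideal_def by blast
  qed
  define H where "H = perp ?K"
  have Hi: "lie_ideal br H G" unfolding H_def by (rule perp_ideal[OF K])
  then have Hs: "cvs.subspace H" and HG: "H \<subseteq> G" and Hc: "\<And>x y. x \<in> H \<Longrightarrow> y \<in> G \<Longrightarrow> br x y \<in> H"
    by (auto simp: lie_ideal_def)
  have Hf: "fds H" by (rule fds_mono[OF G_fds Hs HG])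
  have faithful: "x = 0" if "x \<in> H" "\<And>v. v \<in> V \<Longrightarrow> ac v x = 0" for x
  proof -
    have "x \<in> ?K \<inter> perp ?K" using that HG by (auto simp: H_def)
    then show ?thesis using perp_Int[OF K] by blast
  qed
  interpret H: ssalg H br by (rule ssalg_ideal[OF Hi])
  interpret HV: liemod H br V ac by (rule liemod_subalg[OF ideal_subalg[OF Hi]])
  have tH: "HV.trf a b = trf a b" if "a \<in> H" "b \<in> H" for a b
    using that HG trf_eq[of a b] HV.trf_eq[OF that] by (simp add: subset_iff)
  \<comment> \<open>The radical of the trace form on \<open>H\<close>: an isotropic ideal, with
    \<open>V\<close> faithful over \<open>H\<close>.\<close>
  let ?R = "{x \<in> H. \<forall>y\<in>H. trf x y = 0}"
  have "?R = {0}"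
  proof (rule H.isotropic_ideal[OF HV.liemod_axioms faithful])
    have "br x z \<in> ?R" if x: "x \<in> ?R" and z: "z \<in> H" for x z
    proof -
      have "trf (br x z) y = 0" if y: "y \<in> H" for y
      proof -
        have "br y z \<in> H" "y \<in> G" "x \<in> G" "z \<in> G" using Hc x y z HG by auto
        then show ?thesis using trf_invariant[of z x y] x by simp
      qed
      then show ?thesis using x z Hc HG by blast
    qed
    moreover have "cvs.subspace ?R"
      by (rule cvs.subspaceI) (simp_all add: cvs.subspace_0[OF Hs] cvs.subspace_add[OF Hs]
        cvs.subspace_scale[OF Hs] clin_simps[OF trf_clin1])
    ultimately show "lie_ideal br ?R H" unfolding lie_ideal_def by blast
  qed (auto simp: tH)
  then have nd: "a = 0" if "a \<in> H" "\<And>y. y \<in> H \<Longrightarrow> trf a y = 0" for a using that by blast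
  have "H \<noteq> {0}"
  proof
    assume "H = {0}"
    obtain a b where "a \<in> ?K" "b \<in> perp ?K" "x = a + b" using perp_decompose[OF K nontrivial(2)] .
    then show False using \<open>H = {0}\<close> nontrivial by (simp add: H_def)
  qed
  obtain C where C: "is_basis H C" using basis_ex[OF Hf] .
  then have Cf: "finite C" "cvs.independent C" "cvs.span C = H" by (auto simp: is_basis_def)
  have CH: "b \<in> H" if "b \<in> C" for b using sub_basis[OF C that] .
  have "C \<noteq> {}" using Cf(3) \<open>H \<noteq> {0}\<close> by auto
  \<comment> \<open>The dual vector to \<open>b\<close> represents the coordinate functional of
    \<open>b\<close>.\<close>
  have "\<exists>y. y \<in> H \<and> (\<forall>z\<in>H. trf y z = cvs.representation C z b)" for b
  proof -
    have s: "proj H z \<in> cvs.span C" for z using proj(2)[OF Hs] Cf(3) by simp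
    have cl: "clin (\<lambda>z. cvs.representation C (proj H z) b)"
      by (rule clinI) (simp_all add: clin_simps[OF proj(1)[OF Hs]] cvs.representation_add[OF Cf(2) s s]
        cvs.representation_scale[OF Cf(2) s])
    obtain y where "y \<in> H" "\<forall>z\<in>H. trf y z = cvs.representation C (proj H z) b"
      using functional_represented[OF Hf trf_clin2 trf_clin1 nd cl] by blast
    then have y: "y \<in> H" "\<And>z. z \<in> H \<Longrightarrow> trf y z = cvs.representation C (proj H z) b" by simp_all
    then have "trf y z = cvs.representation C z b" if "z \<in> H" for z using that proj(3)[OF Hs that] by simp
    then show ?thesis using y(1) by blast
  qed
  then obtain y where y: "\<And>b. y b \<in> H" "\<And>b z. z \<in> H \<Longrightarrow> trf (y b) z = cvs.representation C z b" by metis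
  have ybc: "trf (y b) c = (if c = b then 1 else 0)" if "c \<in> C" for b c
    using y(2)[OF CH[OF that]] cvs.representation_basis[OF Cf(2) that] by simp
  have e1: "(\<Sum>b\<in>C. trf (y b) z *\<^sub>c b) = z" if z: "z \<in> H" for z
    using rep_sum[OF C z] y(2)[OF z] by simp
  have e2: "(\<Sum>b\<in>C. trf z b *\<^sub>c y b) = z" if z: "z \<in> H" for z
  proof -
    let ?d = "z - (\<Sum>b\<in>C. trf z b *\<^sub>c y b)"
    have dH: "?d \<in> H" by (intro cvs.subspace_diff[OF Hs] z cvs.subspace_sum[OF Hs] cvs.subspace_scale[OF Hs] y(1))
    have "trf ?d c = 0" if c: "c \<in> C" for c
    proof -
      have "trf ?d c = trf z c - (\<Sum>b\<in>C. trf z b * trf (y b) c)" by (simp add: clin_simps[OF trf_clin1])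
      also have "(\<Sum>b\<in>C. trf z b * trf (y b) c) = (\<Sum>b\<in>C. if c = b then trf z b else 0)"
        by (rule sum.cong) (simp_all add: ybc[OF c])
      finally show ?thesis using c Cf(1) by simp
    qed
    then have "trf ?d w = 0" if "w \<in> H" for w
      using eq_on_span[OF trf_clin2 clin_zero, of C ?d w] Cf(3) that by simp
    then have "?d = 0" by (rule nd[OF dH])
    then show ?thesis by simp
  qed
  show ?thesis
  proof (rule that[OF Cf(1) \<open>C \<noteq> {}\<close>])
    show "C \<subseteq> G" using CH HG by blast
    show "y b \<in> G" for b using y(1) HG by blast
    show "trf b (y b) = 1" if "b \<in> C" for b using ybc[OF that, of b] trf_sym[of b "y b"] by simp
    fix x and F :: "'g \<Rightarrow> 'g \<Rightarrow> 'v"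
    assume x: "x \<in> G" and F1: "\<And>p. p \<in> G \<Longrightarrow> clin (F p)" and F2: "\<And>q. clin (\<lambda>p. F p q)"
    have 1: "F b (br (y b) x) = (\<Sum>c\<in>C. trf (br (y b) x) c *\<^sub>c F b (y c))" if b: "b \<in> C" for b
    proof -
      have "F b (br (y b) x) = F b (\<Sum>c\<in>C. trf (br (y b) x) c *\<^sub>c y c)" using e2[OF Hc[OF y(1) x]] by simp
      also have "b \<in> G" using CH[OF b] HG by blast
      ultimately show ?thesis by (simp add: clin_sum[OF F1] clin_scale[OF F1])
    qed
    have 2: "F (br b x) (y b) = (\<Sum>c\<in>C. trf (y c) (br b x) *\<^sub>c F c (y b))" if b: "b \<in> C" for b
    proof -
      have "F (br b x) (y b) = F (\<Sum>c\<in>C. trf (y c) (br b x) *\<^sub>c c) (y b)" using e1[OF Hc[OF CH[OF b] x]] by simp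
      then show ?thesis by (simp add: clin_sum[OF F2] clin_scale[OF F2])
    qed
    have "(\<Sum>b\<in>C. F b (br (y b) x) + F (br b x) (y b)) =
        (\<Sum>b\<in>C. \<Sum>c\<in>C. trf (br (y b) x) c *\<^sub>c F b (y c)) + (\<Sum>b\<in>C. \<Sum>c\<in>C. trf (y c) (br b x) *\<^sub>c F c (y b))"
      unfolding sum.distrib using 1 2 by simp
    also have "(\<Sum>b\<in>C. \<Sum>c\<in>C. trf (y c) (br b x) *\<^sub>c F c (y b)) = (\<Sum>c\<in>C. \<Sum>b\<in>C. trf (y c) (br b x) *\<^sub>c F c (y b))"
      by (rule sum.swap)
    also have "(\<Sum>b\<in>C. \<Sum>c\<in>C. trf (br (y b) x) c *\<^sub>c F b (y c)) + \<dots> =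
        (\<Sum>b\<in>C. \<Sum>c\<in>C. (trf (br (y b) x) c + trf (y b) (br c x)) *\<^sub>c F b (y c))"
      by (simp add: sum.distrib csc_add_left)
    \<comment> \<open>After renaming the summation indices, the coefficient of
      \<open>F b (y c)\<close> is a sum of two values of the form that cancel by invariance.\<close>
    also have "\<dots> = 0"
    proof (intro sum.neutral ballI)
      fix b c assume "b \<in> C" "c \<in> C"
      then have "y b \<in> G" "c \<in> G" using y(1) CH HG by blast+
      then show "(trf (br (y b) x) c + trf (y b) (br c x)) *\<^sub>c F b (y c) = 0"
        using trf_invariant[OF x, of "y b" c] by simp
    qed
    finally show "(\<Sum>b\<in>C. F b (br (y b) x) + F (br b x) (y b)) = 0" .
  qed
qed

definition cocycle :: "('g \<Rightarrow> 'v) \<Rightarrow> bool" where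
  "cocycle \<theta> \<longleftrightarrow> clin \<theta> \<and> (\<forall>x\<in>G. \<theta> x \<in> V) \<and>
    (\<forall>x\<in>G. \<forall>y\<in>G. \<theta> (br x y) = ac (\<theta> x) y - ac (\<theta> y) x)"

text \<open>\<open>c\<close> is the Casimir operator, whose trace is the number of elements of the
  basis \<open>C\<close>. For a cocycle, invariance of the Casimir tensor with
  \<open>F p q = ac (\<theta> p) q\<close> leaves exactly
  \<open>ac (w \<theta>) x = c (\<theta> x)\<close>: after \<open>c\<close>, every cocycle is a
  coboundary. Taking \<open>\<theta> = ac v\<close> shows that \<open>c\<close> commutes with the
  action. The clause about \<open>U\<close> keeps \<open>w \<theta>\<close> inside a submodule that
  contains the values of \<open>\<theta>\<close>.\<close>

lemma casimir_ex:
  assumes nontrivial: "v \<in> V" "x \<in> G" "ac v x \<noteq> 0"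
  shows "\<exists>c w. clin c \<and> (\<forall>v\<in>V. c v \<in> V) \<and> ctr V c \<noteq> 0 \<and>
    (\<forall>\<theta> U. (\<forall>x\<in>G. \<theta> x \<in> U) \<and> cvs.subspace U \<and> (\<forall>u\<in>U. \<forall>x\<in>G. ac u x \<in> U) \<longrightarrow> w \<theta> \<in> U) \<and>
    (\<forall>\<theta>. cocycle \<theta> \<longrightarrow> (\<forall>x\<in>G. ac (w \<theta>) x = c (\<theta> x))) \<and>
    (\<forall>v\<in>V. \<forall>x\<in>G. c (ac v x) = ac (c v) x)"
proof -
  obtain C y where C: "finite C" "C \<noteq> {}" "C \<subseteq> G" "\<And>b. b \<in> C \<Longrightarrow> y b \<in> G" "\<And>b. b \<in> C \<Longrightarrow> trf b (y b) = 1"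
    and inv: "\<And>x F. x \<in> G \<Longrightarrow> (\<And>p. p \<in> G \<Longrightarrow> clin (F p)) \<Longrightarrow> (\<And>q. clin (\<lambda>p. F p q)) \<Longrightarrow>
       (\<Sum>b\<in>C. F b (br (y b) x) + F (br b x) (y b)) = (0::'v)"
    by (rule casimir_basis[OF nontrivial]) blast
  define c where "c = (\<lambda>v. \<Sum>b\<in>C. ac (ac v b) (y b))"
  define w where "w = (\<lambda>\<theta>. \<Sum>b\<in>C. ac (\<theta> b) (y b))"
  have CG: "b \<in> G" if "b \<in> C" for b using that C(3) by blast
  have coc: "ac (w \<theta>) x = c (\<theta> x)" if \<theta>: "cocycle \<theta>" and x: "x \<in> G" for \<theta> x
  proof -
    have t: "clin \<theta>" "\<And>x. x \<in> G \<Longrightarrow> \<theta> x \<in> V" "\<And>x y. x \<in> G \<Longrightarrow> y \<in> G \<Longrightarrow> \<theta> (br x y) = ac (\<theta> x) y - ac (\<theta> y) x"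
      using \<theta> by (simp_all add: cocycle_def)
    have "ac (w \<theta>) x = (\<Sum>b\<in>C. ac (ac (\<theta> b) (y b)) x)" by (simp add: w_def clin_sum[OF ac_left])
    also have "\<dots> = (\<Sum>b\<in>C. (ac (\<theta> b) (br (y b) x) + ac (\<theta> (br b x)) (y b)) + ac (ac (\<theta> x) b) (y b))"
    proof (rule sum.cong[OF refl])
      fix b assume b: "b \<in> C"
      show "ac (ac (\<theta> b) (y b)) x = ac (\<theta> b) (br (y b) x) + ac (\<theta> (br b x)) (y b) + ac (ac (\<theta> x) b) (y b)"
        unfolding t(3)[OF CG[OF b] x] ac_br[OF t(2)[OF CG[OF b]] C(4)[OF b] x] by (simp add: ac_left_simps)
    qed
    also have "\<dots> = (\<Sum>b\<in>C. ac (\<theta> b) (br (y b) x) + ac (\<theta> (br b x)) (y b)) + c (\<theta> x)"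
      by (simp add: sum.distrib c_def)
    also have "(\<Sum>b\<in>C. ac (\<theta> b) (br (y b) x) + ac (\<theta> (br b x)) (y b)) = 0"
      by (rule inv[OF x, of "\<lambda>p q. ac (\<theta> p) q"]) (use t(2) in \<open>auto intro: ac_right clin_compose[OF ac_left t(1)]\<close>)
    finally show ?thesis by simp
  qed
  show ?thesis
  proof (intro exI[of _ c] exI[of _ w] conjI ballI allI impI)
    show "clin c" unfolding c_def by (intro clin_sum_fun ac2_clin)
    show "c v \<in> V" if "v \<in> V" for v unfolding c_def
      by (intro cvs.subspace_sum[OF V_sub] ac2_closed that CG C(4))
    have "ctr V c = (\<Sum>b\<in>C. ctr V (\<lambda>v. ac (ac v b) (y b)))" unfolding c_def
      by (rule ctr_sum[OF V_fds ac2_clin]) (rule ac2_closed[OF _ CG C(4)])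
    also have "\<dots> = (\<Sum>b\<in>C. 1)" using C(4,5) CG by (intro sum.cong) (simp_all flip: trf_eq)
    finally show "ctr V c \<noteq> 0" using C(1,2) by simp
    show "w \<theta> \<in> U" if "(\<forall>x\<in>G. \<theta> x \<in> U) \<and> cvs.subspace U \<and> (\<forall>u\<in>U. \<forall>x\<in>G. ac u x \<in> U)" for \<theta> U
      unfolding w_def using that CG C(4) by (intro cvs.subspace_sum) auto
    show "c (ac v x) = ac (c v) x" if v: "v \<in> V" and x: "x \<in> G" for v x
    proof -
      have "cocycle (ac v)" unfolding cocycle_def using v ac_closed ac_br ac_right by simp
      from coc[OF this x] show ?thesis by (simp add: w_def c_def)
    qed
  qed (rule coc)
qed

end

text \<open>If the action is zero, a cocycle kills all brackets, hence \<open>G\<close>. Otherwise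
  take the Fitting decomposition of the Casimir operator \<open>c\<close>. Its null component is
  proper because \<open>c\<close> has nonzero trace, so induction handles the part of
  \<open>\<theta>\<close> there; on the other component \<open>c\<close> is invertible, and the
  identity of \<open>casimir_ex\<close> can be solved for \<open>\<theta>\<close>.\<close>

lemma whitehead:
  assumes "ssmod G br V ac" "ssmod.cocycle G br V ac \<theta>"
  shows "\<exists>m\<in>V. \<forall>x\<in>G. \<theta> x = ac m x"
  using assms
proof (induction "cvs.dim V" arbitrary: V \<theta> rule: less_induct)
  case less
  interpret ssmod G br V ac by (rule less(2))
  have t: "clin \<theta>" "\<And>x. x \<in> G \<Longrightarrow> \<theta> x \<in> V" "\<And>x y. x \<in> G \<Longrightarrow> y \<in> G \<Longrightarrow> \<theta> (br x y) = ac (\<theta> x) y - ac (\<theta> y) x"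
    using less(3) by (simp_all add: cocycle_def)
  show ?case
  proof (cases "\<exists>v\<in>V. \<exists>x\<in>G. ac v x \<noteq> 0")
    case False
    then have tr: "ac v x = 0" if "v \<in> V" "x \<in> G" for v x using that by blast
    have "\<theta> x = 0" if "x \<in> G" for x
    proof (rule eq_on_span[OF t(1) clin_zero])
      show "x \<in> cvs.span {br a b | a b. a \<in> G \<and> b \<in> G}" using perfect that by blast
      fix u assume "u \<in> {br a b | a b. a \<in> G \<and> b \<in> G}"
      then obtain a b where "u = br a b" "a \<in> G" "b \<in> G" by blast
      then show "\<theta> u = 0" using t(3)[of a b] t(2) tr by simp
    qed
    then show ?thesis using tr cvs.subspace_0[OF V_sub] by (intro bexI[of _ 0]) auto
  next
    case True
    then obtain v x where "v \<in> V" "x \<in> G" "ac v x \<noteq> 0" by blast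
    from casimir_ex[OF this] obtain c w where c1: "clin c" and c2: "\<forall>v\<in>V. c v \<in> V" and c3: "ctr V c \<noteq> 0"
      and w: "\<forall>\<theta> U. (\<forall>x\<in>G. \<theta> x \<in> U) \<and> cvs.subspace U \<and> (\<forall>u\<in>U. \<forall>x\<in>G. ac u x \<in> U) \<longrightarrow> w \<theta> \<in> U"
      and co: "\<forall>\<theta>. cocycle \<theta> \<longrightarrow> (\<forall>x\<in>G. ac (w \<theta>) x = c (\<theta> x))"
      and cm: "\<forall>v\<in>V. \<forall>x\<in>G. c (ac v x) = ac (c v) x"
      by (elim exE conjE) (rule that)
    have c: "clin c" "\<And>v. v \<in> V \<Longrightarrow> c v \<in> V" "ctr V c \<noteq> 0" using c1 c2 c3 by simp_all
    have coc: "ac (w \<theta>) x = c (\<theta> x)" if "cocycle \<theta>" "x \<in> G" for \<theta> x using co that by simp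
    have comm: "c (ac v x) = ac (c v) x" if "v \<in> V" "x \<in> G" for v x using cm that by simp
    from fitting[OF V_fds c1 c2]
    obtain N R where R: "R = (c ^^ N) ` V" "cvs.subspace R" "R \<subseteq> V" "c ` R = R" "gker V c \<inter> R = {0}"
      "\<forall>w\<in>V. \<exists>k\<in>gker V c. \<exists>r\<in>R. w = k + r"
      by (elim exE conjE) (rule that)
    let ?K = "gker V c"
    have Ks: "cvs.subspace ?K" and KV: "?K \<subseteq> V" using subspace_gker[OF c(1) V_sub] by (auto simp: gker_def)
    have Kac: "ac u x \<in> ?K" if "u \<in> ?K" "x \<in> G" for u x
      by (rule gker_commute[OF ac_left c(2) ac_closed[OF _ that(2)] comm[OF _ that(2), symmetric] that(1)])
    have Rac: "ac u x \<in> R" if u: "u \<in> R" and x: "x \<in> G" for u x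
    proof -
      obtain v where v: "v \<in> V" "u = (c ^^ N) v" using u unfolding R(1) by blast
      have "ac ((c ^^ N) v) x = (c ^^ N) (ac v x)"
        by (rule funpow_commute[of V c "\<lambda>v. ac v x", OF c(2) comm[OF _ x, symmetric] v(1)])
      then show ?thesis using v ac_closed[OF v(1) x] unfolding R(1) by blast
    qed
    have "?K \<noteq> V"
    proof
      assume "?K = V"
      then have "\<exists>n. (c ^^ n) v = 0" if "v \<in> V" for v using that by (auto simp: gker_def)
      then show False using ctr_nilpotent[OF V_fds c(1,2)] c(3) by blast
    qed
    obtain p where p: "clin p" "\<And>x. p x \<in> ?K" "\<And>x. x \<in> ?K \<Longrightarrow> p x = x" "\<And>x. x \<in> R \<Longrightarrow> p x = 0"
      by (rule projection_along_ex[OF Ks R(2)]) (use R(5) in auto)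
    have pR: "v - p v \<in> R" if v: "v \<in> V" for v
    proof -
      obtain k r where "k \<in> ?K" "r \<in> R" "v = k + r" using bspec[OF R(6) v] by blast
      then show ?thesis using p by (simp add: clin_simps)
    qed
    have pac: "p (ac v x) = ac (p v) x" if v: "v \<in> V" and x: "x \<in> G" for v x
    proof -
      have "p (ac (v - p v) x) = 0" by (rule p(4)[OF Rac[OF pR[OF v] x]])
      moreover have "p (ac (p v) x) = ac (p v) x" by (rule p(3)[OF Kac[OF p(2) x]])
      ultimately show ?thesis by (simp add: ac_left_simps clin_simps[OF p(1)])
    qed
    interpret K: ssmod G br ?K ac by (rule ssmod_submodule[OF Ks KV Kac])
    have "K.cocycle (\<lambda>x. p (\<theta> x))" unfolding K.cocycle_def
      using clin_compose[OF p(1) t(1)] p(2) by (simp add: t ac_closed clin_diff[OF p(1)] pac)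
    then obtain m0 where m0: "m0 \<in> ?K" "\<And>x. x \<in> G \<Longrightarrow> p (\<theta> x) = ac m0 x"
      using less.hyps[OF fds_dim_less[OF V_fds Ks KV \<open>?K \<noteq> V\<close>] K.ssmod_axioms] by blast
    define \<theta>' where "\<theta>' = (\<lambda>x. \<theta> x - p (\<theta> x))"
    have t': "\<theta>' x \<in> R" if "x \<in> G" for x unfolding \<theta>'_def by (rule pR[OF t(2)[OF that]])
    have "cocycle \<theta>'" unfolding cocycle_def
    proof (intro conjI ballI)
      show "clin \<theta>'" unfolding \<theta>'_def by (intro clin_intros t(1) clin_compose[OF p(1)])
      show "\<theta>' x \<in> V" if "x \<in> G" for x using t'[OF that] R(3) by blast
      show "\<theta>' (br x y) = ac (\<theta>' x) y - ac (\<theta>' y) x" if "x \<in> G" "y \<in> G" for x y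
        using that by (simp add: \<theta>'_def t ac_closed clin_diff[OF p(1)] pac ac_left_simps)
    qed
    note coc' = coc[OF this]
    have "w \<theta>' \<in> R" using w t' R(2) Rac by simp
    then obtain m1 where m1: "m1 \<in> R" "w \<theta>' = c m1" using R(4) by blast
    have m1V: "m1 \<in> V" using m1(1) R(3) by blast
    \<comment> \<open>Both sides have the same image under \<open>c\<close>, namely
      \<open>ac (w \<theta>') x\<close>, and \<open>c\<close> is injective on
      \<open>R\<close>.\<close>
    have eq1: "\<theta>' x = ac m1 x" if x: "x \<in> G" for x
    proof -
      have z: "c (ac m1 x - \<theta>' x) = 0" using coc'[OF x] comm[OF m1V x] m1(2) by (simp add: clin_diff[OF c(1)])
      have "ac m1 x - \<theta>' x \<in> R" by (rule cvs.subspace_diff[OF R(2) Rac[OF m1(1) x] t'[OF x]])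
      from surj_on_imp_inj_on[OF fds_mono[OF V_fds R(2,3)] c(1) R(4) this z] show ?thesis by simp
    qed
    have "\<theta> x = ac (m0 + m1) x" if x: "x \<in> G" for x
      using eq1[OF x] m0(2)[OF x] by (simp add: \<theta>'_def ac_left_simps algebra_simps)
    moreover have "m0 + m1 \<in> V" using m0(1) KV m1V cvs.subspace_add[OF V_sub] by blast
    ultimately show ?thesis by blast
  qed
qed

subsection \<open>Complete reducibility\<close>

text \<open>An equivariant projection onto \<open>U\<close> is obtained by correcting a linear projection
  \<open>p\<close>: the failure of \<open>p\<close> to be equivariant is a cocycle with values in the module of maps
  \<open>V \<rightarrow> U\<close> that vanish on \<open>U\<close>.\<close>

lemma (in ssmod) weyl:
  assumes U: "cvs.subspace U" "U \<subseteq> V" "\<And>u x. u \<in> U \<Longrightarrow> x \<in> G \<Longrightarrow> ac u x \<in> U"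
  obtains e where "clin e" "\<And>v. e v \<in> U" "\<And>u. u \<in> U \<Longrightarrow> e u = u"
    "\<And>v x. v \<in> V \<Longrightarrow> x \<in> G \<Longrightarrow> e (ac v x) = ac (e v) x"
proof -
  note P = proj[OF V_sub]
  let ?P = "proj V"
  \<comment> \<open>Invariance under precomposition with \<open>?P\<close> determines a function by
    its values on \<open>V\<close>; without it the functions on the whole type would not form a
    finite-dimensional space.\<close>
  define M where "M = {f. clin f \<and> (\<forall>v. f (?P v) = f v) \<and> (\<forall>v. f v \<in> U) \<and> (\<forall>u\<in>U. f u = (0::'v))}"
  define ac' where "ac' = (\<lambda>(f::'v \<Rightarrow> 'v) x v. ac (f (?P v)) x - f (ac (?P v) x))"
  have MD: "clin f" "\<And>v. f (?P v) = f v" "\<And>v. f v \<in> U" "\<And>u. u \<in> U \<Longrightarrow> f u = 0" if "f \<in> M" for f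
    using that by (simp_all add: M_def)
  have Ms: "cvs.subspace M"
  proof (rule cvs.subspaceI)
    show "0 \<in> M" using clin_zero cvs.subspace_0[OF U(1)] by (simp add: M_def zero_fun_def)
    fix f g c assume f: "f \<in> M"
    show "c *\<^sub>c f \<in> M" using MD[OF f] cvs.subspace_scale[OF U(1)] by (simp add: M_def csc_fun_def clin_csc)
    assume g: "g \<in> M"
    show "f + g \<in> M" using MD[OF f] MD[OF g] cvs.subspace_add[OF U(1)] by (simp add: M_def plus_fun_def clin_plus)
  qed
  have Mf: "fds M"
  proof -
    obtain B where B: "is_basis V B" using basis_ex[OF V_fds] .
    obtain C where C: "is_basis U C" using basis_ex[OF fds_mono[OF V_fds U(1,2)]] .
    \<comment> \<open>The rank-one maps that multiply the coordinate along \<open>b\<close> by a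
      fixed vector; with vectors from a basis of \<open>U\<close> they span a space containing
      \<open>M\<close>.\<close>
    define E where "E = (\<lambda>b u v. cvs.representation B (?P v) b *\<^sub>c (u::'v))"
    have cE: "clin (E b)" for b by (rule clinI; rule ext) (simp_all add: E_def cvs.scale_right_distrib cvs.scale_left_commute)
    let ?S = "\<Union>b\<in>B. E b ` C"
    have "f \<in> cvs.span ?S" if f: "f \<in> M" for f
    proof -
      have "f = (\<Sum>b\<in>B. E b (f b))"
      proof
        fix v
        have "f v = f (\<Sum>b\<in>B. cvs.representation B (?P v) b *\<^sub>c b)" using rep_sum[OF B P(2)] MD(2)[OF f] by simp
        also have "\<dots> = (\<Sum>b\<in>B. E b (f b)) v" by (simp add: clin_simps[OF MD(1)[OF f]] E_def sum_fun_apply)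
        finally show "f v = (\<Sum>b\<in>B. E b (f b)) v" .
      qed
      also have "\<dots> \<in> cvs.span ?S"
      proof (rule cvs.span_sum)
        fix b assume b: "b \<in> B"
        show "E b (f b) \<in> cvs.span ?S"
        proof (rule span_image_subset[OF cE cvs.subspace_span])
          show "f b \<in> cvs.span C" using MD(3)[OF f] C by (simp add: is_basis_def)
          show "E b u \<in> cvs.span ?S" if "u \<in> C" for u by (rule cvs.span_base) (use b that in blast)
        qed
      qed
      finally show ?thesis .
    qed
    moreover have "finite ?S" using B C by (auto simp: is_basis_def)
    ultimately show ?thesis using Ms unfolding fds_def by blast
  qed
  have ac'_right: "clin (ac' f)" if f: "clin f" "\<And>v. f v \<in> U" for f
  proof -
    have fV: "f v \<in> V" for v using f(2) U(2) by blast
    show ?thesis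
      by (rule clinI; rule ext) (simp_all add: ac'_def clin_add[OF ac_right[OF fV]] clin_scale[OF ac_right[OF fV]]
        clin_add[OF ac_right[OF P(2)]] clin_scale[OF ac_right[OF P(2)]] clin_simps[OF f(1)] cvs.scale_right_diff_distrib)
  qed
  have ac'_br: "ac' f (br x y) = ac' (ac' f x) y - ac' (ac' f y) x"
    if f: "clin f" "\<And>v. f v \<in> U" and x: "x \<in> G" and y: "y \<in> G" for f x y
  proof
    fix v
    have fV: "f v \<in> V" for v using f(2) U(2) by blast
    have PP: "?P (?P v) = ?P v" "?P (ac (?P v) x) = ac (?P v) x" "?P (ac (?P v) y) = ac (?P v) y"
      using P(3) P(2) ac_closed x y by simp_all
    show "ac' f (br x y) v = (ac' (ac' f x) y - ac' (ac' f y) x) v"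
      by (simp add: ac'_def PP ac_br[OF fV x y] ac_br[OF P(2) x y] clin_diff[OF f(1)] ac_left_simps)
  qed
  \<comment> \<open>The hypothesis is weaker than membership in \<open>M\<close>, since the
    statement is also applied to the projection \<open>p\<close>, which is the identity on
    \<open>U\<close> and still commutes with the action there.\<close>
  have ac'_M: "ac' f x \<in> M"
    if f: "clin f" "\<And>v. f v \<in> U" and z: "\<And>u. u \<in> U \<Longrightarrow> ac (f u) x - f (ac u x) = 0" and x: "x \<in> G" for f x
  proof -
    have "clin (ac' f x)" unfolding ac'_def
      by (intro clin_intros clin_compose[OF ac_left] clin_compose[OF f(1)] P(1))
    moreover have "ac' f x (?P v) = ac' f x v" for v by (simp add: ac'_def P)
    moreover have "ac' f x v \<in> U" for v unfolding ac'_def by (intro cvs.subspace_diff[OF U(1)] U(3) f(2) x)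
    moreover have "ac' f x u = 0" if "u \<in> U" for u
    proof -
      have "?P u = u" using that U(2) P(3) by blast
      then show ?thesis using z[OF that] by (simp add: ac'_def)
    qed
    ultimately show ?thesis by (simp add: M_def)
  qed
  interpret M: ssmod G br M ac'
  proof (intro ssmod.intro ssalg_axioms liemod.intro liealg_axioms liemod_axioms.intro)
    show "clin (\<lambda>f. ac' f x)" for x
      by (rule clinI; rule ext) (simp_all add: ac'_def ac_left_simps cvs.scale_right_diff_distrib)
    show "ac' f x \<in> M" if "f \<in> M" "x \<in> G" for f x
      by (rule ac'_M[OF MD(1,3)[OF that(1)] _ that(2)]) (simp add: MD(4)[OF that(1)] U(3) that(2) clin_0[OF ac_left])
    show "clin (ac' f)" if "f \<in> M" for f by (rule ac'_right[OF MD(1,3)[OF that]])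
    show "ac' f (br x y) = ac' (ac' f x) y - ac' (ac' f y) x" if "f \<in> M" "x \<in> G" "y \<in> G" for f x y
      by (rule ac'_br[OF MD(1,3)[OF that(1)] that(2,3)])
  qed (rule Mf)
  obtain p where p: "clin p" "\<And>x. p x \<in> U" "\<And>x. x \<in> U \<Longrightarrow> p x = x" by (rule projection_ex[OF U(1)]) blast
  \<comment> \<open>This would be the coboundary of \<open>p\<close> if \<open>p\<close> were in
    \<open>M\<close>. Replacing \<open>p\<close> by an element \<open>q\<close> of \<open>M\<close>
    with the same coboundary makes \<open>p - q\<close> equivariant without changing it on
    \<open>U\<close>.\<close>
  have "M.cocycle (ac' p)" unfolding M.cocycle_def
  proof (intro conjI ballI)
    show "ac' p x \<in> M" if "x \<in> G" for x by (rule ac'_M[OF p(1,2) _ that]) (simp add: p(3) U(3) that)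
  qed (rule ac'_right[OF p(1,2)], rule ac'_br[OF p(1,2)])
  then obtain q where q: "q \<in> M" "\<And>x. x \<in> G \<Longrightarrow> ac' p x = ac' q x" using whitehead[OF M.ssmod_axioms] by blast
  show ?thesis
  proof (rule that[of "\<lambda>v. p v - q v"])
    show "clin (\<lambda>v. p v - q v)" by (intro clin_intros p(1) MD(1)[OF q(1)])
    show "p v - q v \<in> U" for v by (intro cvs.subspace_diff[OF U(1)] p(2) MD(3)[OF q(1)])
    show "p u - q u = u" if "u \<in> U" for u using p(3)[OF that] MD(4)[OF q(1) that] by simp
    show "p (ac v x) - q (ac v x) = ac (p v - q v) x" if v: "v \<in> V" and x: "x \<in> G" for v x
      using fun_cong[OF q(2)[OF x], of v] P(3)[OF v] by (simp add: ac'_def ac_left_simps algebra_simps)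
  qed
qed

definition submod :: "'g set \<Rightarrow> ('v::cvs \<Rightarrow> 'g \<Rightarrow> 'v) \<Rightarrow> 'v set \<Rightarrow> bool" where
  "submod G ac U \<longleftrightarrow> cvs.subspace U \<and> (\<forall>u\<in>U. \<forall>x\<in>G. ac u x \<in> U)"

definition irrep :: "'g set \<Rightarrow> ('v::cvs \<Rightarrow> 'g \<Rightarrow> 'v) \<Rightarrow> 'v set \<Rightarrow> bool" where
  "irrep G ac U \<longleftrightarrow> submod G ac U \<and> U \<noteq> {0} \<and> (\<forall>W. submod G ac W \<and> W \<subseteq> U \<longrightarrow> W = {0} \<or> W = U)"

text \<open>Uniqueness is stated as independence of the summands;
  \<open>vparam_internal_direct_sum\<close> converts it into unique expansion.\<close>

definition dsum :: "'v::cvs set \<Rightarrow> 'i set \<Rightarrow> ('i \<Rightarrow> 'v set) \<Rightarrow> bool" where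
  "dsum V A W \<longleftrightarrow> finite A \<and> (\<forall>i\<in>A. cvs.subspace (W i) \<and> W i \<subseteq> V) \<and>
    (\<forall>v\<in>V. \<exists>w. (\<forall>i\<in>A. w i \<in> W i) \<and> v = (\<Sum>i\<in>A. w i)) \<and>
    (\<forall>w. (\<forall>i\<in>A. w i \<in> W i) \<and> (\<Sum>i\<in>A. w i) = 0 \<longrightarrow> (\<forall>i\<in>A. w i = 0))"

lemma irrep_ex:
  assumes V: "fds V" "submod G ac V" "V \<noteq> {0}"
  obtains U where "irrep G ac U" "U \<subseteq> V"
proof -
  let ?P = "\<lambda>U. submod G ac U \<and> U \<subseteq> V \<and> U \<noteq> {0}"
  have "?P V" using V by simp
  from ex_has_least_nat[of ?P, OF this, of cvs.dim]
  obtain U where "?P U \<and> (\<forall>U'. ?P U' \<longrightarrow> cvs.dim U \<le> cvs.dim U')" ..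
  then have U: "submod G ac U" "U \<subseteq> V" "U \<noteq> {0}" and min: "\<And>U'. ?P U' \<Longrightarrow> cvs.dim U \<le> cvs.dim U'"
    by simp_all
  have "W = {0} \<or> W = U" if W: "submod G ac W" "W \<subseteq> U" for W
  proof (cases "W = {0}")
    case False
    have "fds U" using fds_mono[OF V(1)] U by (simp add: submod_def)
    moreover have "cvs.dim U \<le> cvs.dim W" using min[of W] W U(2) False by blast
    ultimately show ?thesis using fds_dim_eq[of U W] W by (simp add: submod_def)
  qed simp
  then show ?thesis using that[of U] U by (simp add: irrep_def)
qed

text \<open>Split off an irreducible submodule; the kernel of the equivariant projection from
  \<open>weyl\<close> is a complementary submodule of smaller dimension.\<close>

lemma complete_reducibility:
  assumes "ssmod G br V ac"
  shows "\<exists>(n::nat) W. dsum V {1..n} W \<and> (\<forall>i\<in>{1..n}. irrep G ac (W i))"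
  using assms
proof (induction "cvs.dim V" arbitrary: V rule: less_induct)
  case less
  interpret ssmod G br V ac by (rule less(2))
  show ?case
  proof (cases "V = {0}")
    case True
    then show ?thesis by (intro exI[of _ 0]) (simp add: dsum_def)
  next
    case False
    have "submod G ac V" using V_sub ac_closed by (simp add: submod_def)
    then obtain U where U: "irrep G ac U" "U \<subseteq> V" using irrep_ex[OF V_fds _ False] by blast
    have Us: "cvs.subspace U" "\<And>u x. u \<in> U \<Longrightarrow> x \<in> G \<Longrightarrow> ac u x \<in> U" "U \<noteq> {0}"
      using U(1) by (auto simp: irrep_def submod_def)
    obtain e where e: "clin e" "\<And>v. e v \<in> U" "\<And>u. u \<in> U \<Longrightarrow> e u = u"
      "\<And>v x. v \<in> V \<Longrightarrow> x \<in> G \<Longrightarrow> e (ac v x) = ac (e v) x" by (rule weyl[OF Us(1) U(2) Us(2)]) blast+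
    let ?V = "{v \<in> V. e v = 0}"
    have V': "cvs.subspace ?V" "?V \<subseteq> V"
      using cvs.subspace_inter[OF V_sub subspace_Collect[OF e(1) cvs.subspace_single_0]] by (auto simp: Int_def)
    have ac': "ac v x \<in> ?V" if "v \<in> ?V" "x \<in> G" for v x
      using that e(4)[of v x] ac_closed clin_0[OF ac_left] by simp
    have "?V \<noteq> V"
    proof
      assume "?V = V"
      then have "e u = 0" if "u \<in> U" for u using that U(2) by blast
      then have "u = 0" if "u \<in> U" for u using e(3)[OF that] that by simp
      then show False using Us(1,3) cvs.subspace_0 by blast
    qed
    moreover have "ssmod G br ?V ac" by (rule ssmod_submodule[OF V']) (rule ac')
    ultimately obtain n :: nat and W where W: "dsum ?V {1..n} W" "\<forall>i\<in>{1..n}. irrep G ac (W i)"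
      using less.hyps[OF fds_dim_less[OF V_fds V']] by blast
    define W' where "W' = W(Suc n := U)"
    have WV: "cvs.subspace (W i)" "W i \<subseteq> ?V" if "i \<in> {1..n}" for i using W(1) that by (auto simp: dsum_def)
    have "dsum V {1..Suc n} W'" unfolding dsum_def
    proof (intro conjI ballI allI impI)
      fix i assume i: "i \<in> {1..Suc n}"
      show "cvs.subspace (W' i)" "W' i \<subseteq> V" using WV[of i] i Us(1) U(2) by (auto simp: W'_def)
    next
      fix v assume v: "v \<in> V"
      have "v - e v \<in> ?V" using v e(2)[of v] U(2) cvs.subspace_diff[OF V_sub] e(3)[OF e(2)] by (auto simp: clin_diff[OF e(1)])
      then obtain w where w: "\<forall>i\<in>{1..n}. w i \<in> W i" "v - e v = (\<Sum>i=1..n. w i)" using W(1) unfolding dsum_def by blast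
      have "(\<Sum>i=1..Suc n. (w(Suc n := e v)) i) = (\<Sum>i=1..n. w i) + e v"
        by simp
      then have "v = (\<Sum>i=1..Suc n. (w(Suc n := e v)) i)" using w(2) by (metis diff_add_cancel)
      moreover have "\<forall>i\<in>{1..Suc n}. (w(Suc n := e v)) i \<in> W' i" using w(1) e(2) by (auto simp: W'_def)
      ultimately show "\<exists>w. (\<forall>i\<in>{1..Suc n}. w i \<in> W' i) \<and> v = (\<Sum>i=1..Suc n. w i)" by blast
    next
      fix w i assume w: "(\<forall>i\<in>{1..Suc n}. w i \<in> W' i) \<and> (\<Sum>i=1..Suc n. w i) = 0" and i: "i \<in> {1..Suc n}"
      have w0: "w i \<in> W' i" if "i \<in> {1..Suc n}" for i using w that by blast
      have w1: "\<forall>i\<in>{1..n}. w i \<in> W i"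
      proof
        fix i assume "i \<in> {1..n}"
        then show "w i \<in> W i" using w0[of i] by (simp add: W'_def)
      qed
      have w2: "w (Suc n) \<in> U" using w0[of "Suc n"] by (simp add: W'_def)
      have "e (w i) = 0" if "i \<in> {1..n}" for i using w1 WV(2)[OF that] that by blast
      then have "e (\<Sum>i=1..n. w i) = 0" by (simp add: clin_sum[OF e(1)])
      moreover have s: "(\<Sum>i=1..n. w i) + w (Suc n) = 0" using w by simp
      ultimately have z: "w (Suc n) = 0" using e(3)[OF w2] clin_add[OF e(1), of "\<Sum>i=1..n. w i" "w (Suc n)"] clin_0[OF e(1)] by simp
      then have "(\<Sum>i=1..n. w i) = 0" using s by simp
      then have "\<forall>i\<in>{1..n}. w i = 0" using W(1) w1 unfolding dsum_def by blast
      then show "w i = 0" using z i by (cases "i = Suc n") auto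
    qed simp
    moreover have "\<forall>i\<in>{1..Suc n}. irrep G ac (W' i)" using W(2) U(1) by (auto simp: W'_def)
    ultimately show ?thesis by blast
  qed
qed

section \<open>Decomposition of a semisimple Lie algebra into simple ideals\<close>

lemma dsum_disjoint:
  assumes "dsum V A W" "i \<in> A" "j \<in> A" "i \<noteq> j" shows "W i \<inter> W j = {0}"
proof -
  have s: "cvs.subspace (W i)" "cvs.subspace (W j)" "finite A" using assms by (auto simp: dsum_def)
  have "x = 0" if x: "x \<in> W i" "x \<in> W j" for x
  proof -
    let ?w = "(\<lambda>k. 0)(i := x, j := - x)"
    have "(\<Sum>k\<in>A. ?w k) = (\<Sum>k\<in>{i, j}. ?w k)" by (rule sum.mono_neutral_right) (use assms s in auto)
    also have "\<dots> = 0" using assms(4) by simp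
    finally have "(\<Sum>k\<in>A. ?w k) = 0" .
    moreover have "\<forall>k\<in>A. ?w k \<in> W k"
      using assms x cvs.subspace_neg[OF s(2)] cvs.subspace_0 by (auto simp: dsum_def)
    ultimately have "?w i = 0" using assms(1,2) unfolding dsum_def by blast
    then show ?thesis using assms(4) by simp
  qed
  then show ?thesis using cvs.subspace_0 s by blast
qed

text \<open>The adjoint module is completely reducible and its submodules are the ideals. By
  \<open>ideal_trans\<close> an ideal of a summand is an ideal of \<open>G\<close>, so
  irreducibility means simplicity; brackets between two summands lie in both.\<close>

lemma (in ssalg) simple_ideals:
  obtains m :: nat and W where "dsum G {1..m} W" "\<And>i. i \<in> {1..m} \<Longrightarrow> lie_ideal br (W i) G"
    "\<And>i J. i \<in> {1..m} \<Longrightarrow> lie_ideal br J (W i) \<Longrightarrow> J = {0} \<or> J = W i" "\<And>i. i \<in> {1..m} \<Longrightarrow> W i \<noteq> {0}"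
    "\<And>i j x y. i \<in> {1..m} \<Longrightarrow> j \<in> {1..m} \<Longrightarrow> i \<noteq> j \<Longrightarrow> x \<in> W i \<Longrightarrow> y \<in> W j \<Longrightarrow> br x y = 0"
proof -
  obtain m :: nat and W where W: "dsum G {1..m} W" "\<And>i. i \<in> {1..m} \<Longrightarrow> irrep G br (W i)"
    using complete_reducibility[OF ssmod.intro[OF ssalg_axioms ad.liemod_axioms]] by blast
  have I: "lie_ideal br (W i) G" if "i \<in> {1..m}" for i
    using W(1) W(2)[OF that] that by (auto simp: irrep_def submod_def lie_ideal_def dsum_def)
  show ?thesis
  proof (rule that[OF W(1) I])
    fix i J assume i: "i \<in> {1..m}" and J: "lie_ideal br J (W i)"
    have "lie_ideal br J G" by (rule ideal_trans[OF I[OF i] J])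
    then have "submod G br J" by (simp add: lie_ideal_def submod_def)
    then show "J = {0} \<or> J = W i" using W(2)[OF i] J by (auto simp: irrep_def lie_ideal_def)
  next
    fix i j x y assume ij: "i \<in> {1..m}" "j \<in> {1..m}" "i \<noteq> j" and x: "x \<in> W i" and y: "y \<in> W j"
    have G: "x \<in> G" "y \<in> G" using I[OF ij(1)] I[OF ij(2)] x y by (auto simp: lie_ideal_def)
    have "br x y \<in> W i" using I[OF ij(1)] x G by (simp add: lie_ideal_def)
    moreover have "br x y \<in> W j" by (rule ideal_left[OF I[OF ij(2)] y G(1)])
    ultimately show "br x y = 0" using dsum_disjoint[OF W(1) ij] by blast
  qed (use W(2) in \<open>auto simp: irrep_def\<close>)
qed

subsection \<open>Irreducible modules over a product of commuting actions\<close>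

lemma submodD: "submod X ac U \<Longrightarrow> cvs.subspace U" "submod X ac U \<Longrightarrow> u \<in> U \<Longrightarrow> x \<in> X \<Longrightarrow> ac u x \<in> U"
  by (simp_all add: submod_def)

lemma irrepD:
  assumes "irrep X ac U"
  shows "submod X ac U" "U \<noteq> {0}" "submod X ac W \<Longrightarrow> W \<subseteq> U \<Longrightarrow> W = {0} \<or> W = U"
  using assms by (auto simp: irrep_def)

text \<open>An eigenspace of \<open>f\<close> is a nonzero submodule of \<open>U\<close>.\<close>

lemma schur_scalar:
  assumes U: "irrep X ac U" "fds U" and ac: "\<And>x. clin (\<lambda>v. ac v x)"
    and f: "clin f" "\<And>u. u \<in> U \<Longrightarrow> f u \<in> U" "\<And>u x. u \<in> U \<Longrightarrow> x \<in> X \<Longrightarrow> f (ac u x) = ac (f u) x"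
  obtains c where "\<And>u. u \<in> U \<Longrightarrow> f u = c *\<^sub>c u"
proof -
  note s = irrepD(1)[OF U(1)]
  obtain l u where u: "u \<in> U" "u \<noteq> 0" "f u = l *\<^sub>c u"
    using eigenvector_ex[OF U(2) irrepD(2)[OF U(1)] f(1,2)] by blast
  let ?E = "{v \<in> U. f v = l *\<^sub>c v}"
  have "submod X ac ?E" unfolding submod_def
  proof (intro conjI ballI)
    show "cvs.subspace ?E"
      by (rule cvs.subspaceI) (simp_all add: clin_simps[OF f(1)] cvs.subspace_0 cvs.subspace_add cvs.subspace_scale
        submodD(1)[OF s] cvs.scale_right_distrib cvs.scale_left_commute)
    show "ac v x \<in> ?E" if "v \<in> ?E" "x \<in> X" for v x
      using that f(3)[of v x] submodD(2)[OF s] clin_scale[OF ac] by simp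
  qed
  then have "?E = {0} \<or> ?E = U" by (rule irrepD(3)[OF U(1)]) blast
  then have "?E = U" using u by blast
  then show ?thesis using that[of l] by blast
qed

text \<open>Families instead of sets: tensors are indexed by tuples, and that distinct tuples give
  distinct vectors is part of what has to be proved.\<close>

definition lin_indep_family :: "'q set \<Rightarrow> ('q \<Rightarrow> 'v::cvs) \<Rightarrow> bool" where
  "lin_indep_family Q h \<longleftrightarrow> finite Q \<and> (\<forall>c. (\<Sum>q\<in>Q. c q *\<^sub>c h q) = 0 \<longrightarrow> (\<forall>q\<in>Q. c q = 0))"

definition basis_family :: "'v::cvs set \<Rightarrow> 'q set \<Rightarrow> ('q \<Rightarrow> 'v) \<Rightarrow> bool" where
  "basis_family W Q h \<longleftrightarrow> lin_indep_family Q h \<and> cvs.span (h ` Q) = W"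

lemma lin_indep_familyD:
  assumes "lin_indep_family Q h" "(\<Sum>q\<in>Q. c q *\<^sub>c h q) = 0" "q \<in> Q" shows "c q = 0"
proof -
  have "(\<Sum>q\<in>Q. c q *\<^sub>c h q) = 0 \<longrightarrow> (\<forall>q\<in>Q. c q = 0)"
    using assms(1) unfolding lin_indep_family_def by (elim conjE allE)
  then show ?thesis using assms(2,3) by blast
qed

lemma lin_indep_family_mono:
  assumes "lin_indep_family Q h" "R \<subseteq> Q" shows "lin_indep_family R h"
  unfolding lin_indep_family_def
proof (intro conjI allI impI ballI)
  have Q: "finite Q" using assms by (simp add: lin_indep_family_def)
  show "finite R" using Q assms(2) finite_subset by blast
  fix c q assume c: "(\<Sum>q\<in>R. c q *\<^sub>c h q) = 0" and q: "q \<in> R"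
  have "(\<Sum>q\<in>Q. (if q \<in> R then c q else 0) *\<^sub>c h q) = (\<Sum>q\<in>R. (if q \<in> R then c q else 0) *\<^sub>c h q)"
    by (rule sum.mono_neutral_right) (use Q assms(2) in auto)
  also have "\<dots> = (\<Sum>q\<in>R. c q *\<^sub>c h q)" by (rule sum.cong) auto
  finally have z: "(\<Sum>q\<in>Q. (if q \<in> R then c q else 0) *\<^sub>c h q) = 0" using c by simp
  have "(if q \<in> R then c q else 0) = 0" by (rule lin_indep_familyD[OF assms(1) z]) (use q assms(2) in blast)
  then show "c q = 0" using q by simp
qed

lemma lin_indep_family_basis: "finite B \<Longrightarrow> cvs.independent B \<Longrightarrow> lin_indep_family B (\<lambda>b. b)"
  unfolding lin_indep_family_def using cvs.independentD[of B B] by blast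

lemma basis_family_basis: "is_basis W B \<Longrightarrow> basis_family W B (\<lambda>b. b)"
  unfolding basis_family_def is_basis_def using lin_indep_family_basis by auto

lemma basis_family_mem: "basis_family W Q h \<Longrightarrow> q \<in> Q \<Longrightarrow> h q \<in> W"
  unfolding basis_family_def using cvs.span_base by blast

lemma span_family_expand:
  assumes "finite Q" "w \<in> cvs.span (h ` Q)" obtains c where "w = (\<Sum>q\<in>Q. c q *\<^sub>c h q)"
proof -
  from assms(2) have "\<exists>c. w = (\<Sum>q\<in>Q. c q *\<^sub>c h q)"
  proof (induction rule: cvs.span_induct_alt)
    case base
    show ?case by (intro exI[of _ "\<lambda>_. 0"]) simp
  next
    case (step a x y)
    then obtain q c where q: "x = h q" "q \<in> Q" "y = (\<Sum>q\<in>Q. c q *\<^sub>c h q)" by blast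
    have "(\<Sum>p\<in>Q. (if p = q then a else 0) *\<^sub>c h p) = (\<Sum>p\<in>{q}. (if p = q then a else 0) *\<^sub>c h p)"
      by (rule sum.mono_neutral_right) (use assms(1) q(2) in auto)
    then have "a *\<^sub>c x + y = (\<Sum>p\<in>Q. ((if p = q then a else 0) + c p) *\<^sub>c h p)"
      unfolding csc_add_left sum.distrib using q by simp
    then show ?case by (intro exI[of _ "\<lambda>p. (if p = q then a else 0) + c p"])
  qed
  then show ?thesis using that by blast
qed

lemma basis_family_expand:
  assumes "basis_family W Q h" "w \<in> W" obtains c where "w = (\<Sum>q\<in>Q. c q *\<^sub>c h q)"
  by (rule span_family_expand[of Q w h]) (use assms in \<open>auto simp: basis_family_def lin_indep_family_def\<close>)

text \<open>\<open>W\<close> is irreducible under the commuting operators from \<open>X\<close> and \<open>Y\<close>, and \<open>U\<close> is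
  an \<open>X\<close>-irreducible submodule with a nonzero vector \<open>u0\<close>. The space of \<open>X\<close>-maps
  \<open>\<phi> : U \<rightarrow> W\<close> is realised inside \<open>W\<close> through \<open>\<phi> \<mapsto> \<phi> u0\<close>, which is injective.\<close>

locale commuting_pair =
  fixes W U :: "'v::cvs set" and X Y :: "'g set" and ac :: "'v \<Rightarrow> 'g \<Rightarrow> 'v" and u0 :: 'v
  assumes W_fds: "fds W" and W_irr: "irrep (X \<union> Y) ac W"
    and ac_clin: "\<And>x. clin (\<lambda>v. ac v x)"
    and commute: "\<And>w x y. w \<in> W \<Longrightarrow> x \<in> X \<Longrightarrow> y \<in> Y \<Longrightarrow> ac (ac w x) y = ac (ac w y) x"
    and U_irr: "irrep X ac U" and UW: "U \<subseteq> W" and u0: "u0 \<in> U" "u0 \<noteq> 0"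
begin

lemmas W_submod = irrepD(1)[OF W_irr]
lemmas W_sub = submodD(1)[OF W_submod]
lemmas U_submod = irrepD(1)[OF U_irr]
lemmas U_sub = submodD(1)[OF U_submod]
lemmas ac_simps = clin_simps[OF ac_clin]

lemma W_ac: "w \<in> W \<Longrightarrow> x \<in> X \<Longrightarrow> ac w x \<in> W" "w \<in> W \<Longrightarrow> y \<in> Y \<Longrightarrow> ac w y \<in> W"
  using submodD(2)[OF W_submod] by auto

lemma U_fds: "fds U" by (rule fds_mono[OF W_fds U_sub UW])

definition xhom :: "('v \<Rightarrow> 'v) \<Rightarrow> bool" where
  "xhom f \<longleftrightarrow> clin f \<and> (\<forall>u\<in>U. f u \<in> W) \<and> (\<forall>u\<in>U. \<forall>x\<in>X. f (ac u x) = ac (f u) x)"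

lemma xhomD: "xhom f \<Longrightarrow> clin f" "xhom f \<Longrightarrow> u \<in> U \<Longrightarrow> f u \<in> W"
  "xhom f \<Longrightarrow> u \<in> U \<Longrightarrow> x \<in> X \<Longrightarrow> f (ac u x) = ac (f u) x"
  by (simp_all add: xhom_def)

lemma xhom_add: "xhom f \<Longrightarrow> xhom g \<Longrightarrow> xhom (\<lambda>u. f u + g u)"
  using clin_plus[of f g] cvs.subspace_add[OF W_sub] by (simp add: xhom_def ac_simps)

lemma xhom_scale: "xhom f \<Longrightarrow> xhom (\<lambda>u. c *\<^sub>c f u)"
  using clin_csc[of f] cvs.subspace_scale[OF W_sub] by (simp add: xhom_def ac_simps)

lemma xhom_act: "xhom f \<Longrightarrow> y \<in> Y \<Longrightarrow> xhom (\<lambda>u. ac (f u) y)"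
  using clin_compose[OF ac_clin, of f y] W_ac commute[of _ _ y] by (simp add: xhom_def)

lemma xhom_id: "xhom (\<lambda>u. u)"
  using clin_id UW by (auto simp: xhom_def)

text \<open>The kernel is an \<open>X\<close>-submodule of \<open>U\<close> that contains the
  nonzero vector \<open>u0\<close>. This is why evaluation at \<open>u0\<close> loses
  nothing.\<close>

lemma xhom_zero:
  assumes f: "xhom f" "f u0 = 0" and u: "u \<in> U" shows "f u = 0"
proof -
  let ?K = "{u \<in> U. f u = 0}"
  have "submod X ac ?K" unfolding submod_def
  proof (intro conjI ballI)
    show "cvs.subspace ?K"
      by (rule cvs.subspaceI) (simp_all add: clin_simps[OF xhomD(1)[OF f(1)]] cvs.subspace_0 cvs.subspace_add
        cvs.subspace_scale U_sub)
    show "ac v x \<in> ?K" if "v \<in> ?K" "x \<in> X" for v x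
      using that xhomD(3)[OF f(1), of v x] submodD(2)[OF U_submod] ac_simps(3) by simp
  qed
  then have "?K = {0} \<or> ?K = U" by (rule irrepD(3)[OF U_irr]) blast
  then have "?K = U" using u0 f(2) by blast
  then show ?thesis using u by blast
qed

definition M :: "'v set" where "M = {f u0 | f. xhom f}"

text \<open>The evaluation pairing of \<open>U\<close> with the \<open>X\<close>-maps from
  \<open>U\<close> to \<open>W\<close>, where a map is named by its value at \<open>u0\<close>. For
  \<open>m\<close> in \<open>M\<close> and \<open>u\<close> in \<open>U\<close> the choice is
  immaterial by \<open>tau_eq\<close>.\<close>

definition tau :: "'v \<Rightarrow> 'v \<Rightarrow> 'v" where
  "tau u m = (SOME f. xhom f \<and> f u0 = m) u"

lemma tau_xhom:
  assumes "m \<in> M" shows "xhom (\<lambda>u. tau u m)" "tau u0 m = m"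
proof -
  have "\<exists>f. xhom f \<and> f u0 = m" using assms by (auto simp: M_def)
  from someI_ex[OF this] show "xhom (\<lambda>u. tau u m)" "tau u0 m = m" by (simp_all add: tau_def)
qed

lemma M_iff: "xhom f \<Longrightarrow> f u0 \<in> M" by (auto simp: M_def)

lemma tau_eq:
  assumes f: "xhom f" and m: "m = f u0" and u: "u \<in> U" shows "tau u m = f u"
proof -
  have "m \<in> M" using M_iff[OF f] m by simp
  note t = tau_xhom[OF this]
  have "xhom (\<lambda>u. tau u m + (-1) *\<^sub>c f u)" by (rule xhom_add[OF t(1) xhom_scale[OF f]])
  from xhom_zero[OF this _ u] show ?thesis using t(2) m by simp
qed

lemma tau_W: "u \<in> U \<Longrightarrow> m \<in> M \<Longrightarrow> tau u m \<in> W"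
  using xhomD(2)[OF tau_xhom(1)] by blast

lemma tau_left: "m \<in> M \<Longrightarrow> clin (\<lambda>u. tau u m)" by (rule xhomD(1)[OF tau_xhom(1)])

lemma M_sub: "cvs.subspace M"
proof (rule cvs.subspaceI)
  show "0 \<in> M" using M_iff[OF xhom_scale[OF xhom_id, of 0]] by simp
  show "x + y \<in> M" if "x \<in> M" "y \<in> M" for x y
    using M_iff[OF xhom_add[OF tau_xhom(1) tau_xhom(1)], OF that] that by (simp add: tau_xhom)
  show "c *\<^sub>c x \<in> M" if "x \<in> M" for c x
    using M_iff[OF xhom_scale[OF tau_xhom(1)], OF that] that by (simp add: tau_xhom)
qed

lemma tau_add: "u \<in> U \<Longrightarrow> m \<in> M \<Longrightarrow> m' \<in> M \<Longrightarrow> tau u (m + m') = tau u m + tau u m'"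
  by (rule tau_eq[OF xhom_add[OF tau_xhom(1) tau_xhom(1)]]) (simp_all add: tau_xhom)

lemma tau_scale: "u \<in> U \<Longrightarrow> m \<in> M \<Longrightarrow> tau u (c *\<^sub>c m) = c *\<^sub>c tau u m"
  by (rule tau_eq[OF xhom_scale[OF tau_xhom(1)]]) (simp_all add: tau_xhom)

lemma tau_sum:
  "u \<in> U \<Longrightarrow> (\<And>q. q \<in> Q \<Longrightarrow> h q \<in> M) \<Longrightarrow> tau u (\<Sum>q\<in>Q. c q *\<^sub>c h q) = (\<Sum>q\<in>Q. c q *\<^sub>c tau u (h q))"
proof (induction Q rule: infinite_finite_induct)
  case (insert q Q)
  have "(\<Sum>q\<in>Q. c q *\<^sub>c h q) \<in> M" using insert by (intro cvs.subspace_sum[OF M_sub] cvs.subspace_scale[OF M_sub]) simp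
  then show ?case using insert by (simp add: tau_add tau_scale cvs.subspace_scale[OF M_sub])
qed (use tau_scale[of u 0 0] cvs.subspace_0[OF M_sub] in simp_all)

lemma tau_actX: "u \<in> U \<Longrightarrow> m \<in> M \<Longrightarrow> x \<in> X \<Longrightarrow> tau (ac u x) m = ac (tau u m) x"
  by (rule xhomD(3)[OF tau_xhom(1)])

lemma M_ac: "m \<in> M \<Longrightarrow> y \<in> Y \<Longrightarrow> ac m y \<in> M"
  using M_iff[OF xhom_act[OF tau_xhom(1)], of m y] by (simp add: tau_xhom)

lemma tau_actY: "u \<in> U \<Longrightarrow> m \<in> M \<Longrightarrow> y \<in> Y \<Longrightarrow> tau u (ac m y) = ac (tau u m) y"
  by (rule tau_eq[OF xhom_act[OF tau_xhom(1)]]) (simp_all add: tau_xhom)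

lemma MW: "M \<subseteq> W" using xhomD(2) u0 by (auto simp: M_def)

lemma M_fds: "fds M" by (rule fds_mono[OF W_fds M_sub MW])

lemma u0_M: "u0 \<in> M" using M_iff[OF xhom_id] by simp

text \<open>This makes evaluation on the tensor product of \<open>U\<close> and \<open>M\<close>
  injective. In the induction, the \<open>v\<close> in \<open>U\<close> for which
  \<open>tau v (h m)\<close> is a combination of the other terms form an \<open>X\<close>-submodule.
  If it were \<open>U\<close>, the coefficients would be \<open>X\<close>-endomorphisms of
  \<open>U\<close>, hence scalars by Schur's lemma, and \<open>h m\<close> would depend on the rest
  of the family.\<close>

lemma tau_indep:
  assumes "lin_indep_family Q h" "\<And>q. q \<in> Q \<Longrightarrow> h q \<in> M" "\<And>q. q \<in> Q \<Longrightarrow> u q \<in> U"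
    "(\<Sum>q\<in>Q. tau (u q) (h q)) = 0" "q \<in> Q"
  shows "u q = 0"
proof -
  have "finite Q" using assms(1) by (simp add: lin_indep_family_def)
  then show ?thesis using assms
  proof (induction Q arbitrary: u q rule: finite_induct)
    case empty then show ?case by simp
  next
    case (insert m F)
    have indF: "lin_indep_family F h" using lin_indep_family_mono[OF insert.prems(1)] by blast
    have hM: "h p \<in> M" if "p \<in> insert m F" for p using insert.prems(2) that by blast
    have lin: "clin (\<lambda>u. tau u (h p))" if "p \<in> insert m F" for p by (rule tau_left[OF hM[OF that]])
    have IH: "u q = 0" if "\<forall>q\<in>F. u q \<in> U" "(\<Sum>q\<in>F. tau (u q) (h q)) = 0" "q \<in> F" for u q
      by (rule insert.IH[OF indF _ _ that(2,3)]) (use hM that(1) in simp_all)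
    have uniq: "w p = w' p" if w: "\<And>p. p \<in> F \<Longrightarrow> w p \<in> U" "\<And>p. p \<in> F \<Longrightarrow> w' p \<in> U"
      "(\<Sum>p\<in>F. tau (w p) (h p)) = (\<Sum>p\<in>F. tau (w' p) (h p))" and p: "p \<in> F" for w w' p
    proof -
      have "(\<Sum>p\<in>F. tau (w p - w' p) (h p)) = (\<Sum>p\<in>F. tau (w p) (h p) - tau (w' p) (h p))"
        by (rule sum.cong) (simp_all add: clin_diff[OF lin])
      then have "(\<Sum>p\<in>F. tau (w p - w' p) (h p)) = 0" using w(3) by (simp add: sum_subtractf)
      moreover have "\<forall>p\<in>F. w p - w' p \<in> U" using w(1,2) cvs.subspace_diff[OF U_sub] by simp
      ultimately have "w p - w' p = 0" using IH[of "\<lambda>p. w p - w' p" p] p by simp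
      then show ?thesis by simp
    qed
    define R where "R v w \<longleftrightarrow> (\<forall>p\<in>F. w p \<in> U) \<and> tau v (h m) = (\<Sum>p\<in>F. tau (w p) (h p))" for v w
    let ?D = "{v \<in> U. \<exists>w. R v w}"
    have R_add: "R (v + v') (\<lambda>p. w p + w' p)" if "R v w" "R v' w'" for v v' w w'
    proof -
      have "tau (v + v') (h m) = (\<Sum>p\<in>F. tau (w p) (h p) + tau (w' p) (h p))"
        using that by (simp add: R_def clin_add[OF lin] sum.distrib)
      also have "\<dots> = (\<Sum>p\<in>F. tau (w p + w' p) (h p))" by (rule sum.cong) (simp_all add: clin_add[OF lin])
      finally show ?thesis using that cvs.subspace_add[OF U_sub] by (simp add: R_def)
    qed
    have R_scale: "R (c *\<^sub>c v) (\<lambda>p. c *\<^sub>c w p)" if "R v w" for c v w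
    proof -
      have "tau (c *\<^sub>c v) (h m) = (\<Sum>p\<in>F. c *\<^sub>c tau (w p) (h p))"
        using that by (simp add: R_def clin_scale[OF lin] cvs.scale_sum_right)
      also have "\<dots> = (\<Sum>p\<in>F. tau (c *\<^sub>c w p) (h p))" by (rule sum.cong) (simp_all add: clin_scale[OF lin])
      finally show ?thesis using that cvs.subspace_scale[OF U_sub] by (simp add: R_def)
    qed
    have R_act: "R (ac v x) (\<lambda>p. ac (w p) x)" if R: "R v w" and v: "v \<in> U" and x: "x \<in> X" for v w x
    proof -
      have "tau (ac v x) (h m) = ac (\<Sum>p\<in>F. tau (w p) (h p)) x"
        using R tau_actX[OF v hM x] by (simp add: R_def)
      also have "\<dots> = (\<Sum>p\<in>F. ac (tau (w p) (h p)) x)" by (simp add: ac_simps)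
      also have "\<dots> = (\<Sum>p\<in>F. tau (ac (w p) x) (h p))"
        by (rule sum.cong) (use R hM x in \<open>simp_all add: R_def tau_actX\<close>)
      finally show ?thesis using R submodD(2)[OF U_submod _ x] by (simp add: R_def)
    qed
    have "submod X ac ?D" unfolding submod_def
    proof (intro conjI ballI)
      show "cvs.subspace ?D"
      proof (rule cvs.subspaceI)
        have "R 0 (\<lambda>p. 0)" using cvs.subspace_0[OF U_sub] by (simp add: R_def clin_0[OF lin])
        then show "0 \<in> ?D" using cvs.subspace_0[OF U_sub] by blast
        show "v + v' \<in> ?D" if "v \<in> ?D" "v' \<in> ?D" for v v'
          using that R_add cvs.subspace_add[OF U_sub] by blast
        show "c *\<^sub>c v \<in> ?D" if "v \<in> ?D" for c v using that R_scale cvs.subspace_scale[OF U_sub] by blast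
      qed
      show "ac v x \<in> ?D" if "v \<in> ?D" "x \<in> X" for v x
        using that R_act submodD(2)[OF U_submod] by blast
    qed
    then have D: "?D = {0} \<or> ?D = U" by (rule irrepD(3)[OF U_irr]) blast
    have "?D \<noteq> U"
    proof
      assume DU: "?D = U"
      \<comment> \<open>Precomposing with \<open>proj U\<close> makes each coefficient a linear map
        on the whole type; uniqueness of the coefficients gives linearity and equivariance.\<close>
      define w where "w = (\<lambda>v. SOME w. R (proj U v) w)"
      have w: "R (proj U v) (w v)" for v
      proof -
        have "proj U v \<in> ?D" using proj(2)[OF U_sub] DU by simp
        then have "\<exists>w. R (proj U v) w" by blast
        from someI_ex[OF this] show ?thesis by (simp only: w_def)
      qed
      have weq: "w v p = w' p" if "R (proj U v) w'" "p \<in> F" for v w' p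
        using uniq[of "w v" w' p] w[of v] that by (simp add: R_def)
      have "\<exists>c. \<forall>v\<in>U. w v p = c *\<^sub>c v" if p: "p \<in> F" for p
      proof -
        have "clin (\<lambda>v. w v p)"
        proof (rule clinI)
          fix v v' c
          show "w (v + v') p = w v p + w v' p"
            by (rule weq[OF _ p, of "v + v'" "\<lambda>p. w v p + w v' p"]) (use R_add[OF w[of v] w[of v']] in \<open>simp add: clin_add[OF proj(1)[OF U_sub]]\<close>)
          show "w (c *\<^sub>c v) p = c *\<^sub>c w v p"
            by (rule weq[OF _ p, of "c *\<^sub>c v" "\<lambda>p. c *\<^sub>c w v p"]) (use R_scale[OF w[of v]] in \<open>simp add: clin_scale[OF proj(1)[OF U_sub]]\<close>)
        qed
        moreover have "w v p \<in> U" for v using w[of v] p by (simp add: R_def)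
        moreover have "w (ac v x) p = ac (w v p) x" if v: "v \<in> U" and x: "x \<in> X" for v x
          by (rule weq[OF _ p, of "ac v x" "\<lambda>p. ac (w v p) x"])
            (use R_act[OF w[of v] proj(2)[OF U_sub] x] v submodD(2)[OF U_submod v x] in \<open>simp add: proj(3)[OF U_sub]\<close>)
        ultimately obtain c where "\<And>v. v \<in> U \<Longrightarrow> w v p = c *\<^sub>c v"
          using schur_scalar[OF U_irr U_fds ac_clin, of "\<lambda>v. w v p"] by blast
        then show ?thesis by blast
      qed
      then obtain c where c: "\<And>p v. p \<in> F \<Longrightarrow> v \<in> U \<Longrightarrow> w v p = c p *\<^sub>c v" by metis
      \<comment> \<open>Evaluating at \<open>u0\<close> turns scalar coefficients into a linear
        relation in \<open>M\<close>.\<close>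
      have "h m = (\<Sum>p\<in>F. tau (c p *\<^sub>c u0) (h p))"
        using w[of u0] proj(3)[OF U_sub u0(1)] tau_xhom(2)[OF hM] c u0 by (simp add: R_def)
      also have "\<dots> = (\<Sum>p\<in>F. c p *\<^sub>c h p)"
        by (rule sum.cong) (use hM in \<open>simp_all add: clin_scale[OF lin] tau_xhom(2)\<close>)
      finally have e: "h m = (\<Sum>p\<in>F. c p *\<^sub>c h p)" .
      have "(\<Sum>p\<in>insert m F. (if p = m then -1 else c p) *\<^sub>c h p) = - h m + (\<Sum>p\<in>F. (if p = m then -1 else c p) *\<^sub>c h p)"
        using insert.hyps by simp
      also have "(\<Sum>p\<in>F. (if p = m then -1 else c p) *\<^sub>c h p) = (\<Sum>p\<in>F. c p *\<^sub>c h p)"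
        using insert.hyps by (intro sum.cong) auto
      finally have "(\<Sum>p\<in>insert m F. (if p = m then -1 else c p) *\<^sub>c h p) = 0" using e by simp
      from lin_indep_familyD[OF insert.prems(1) this, of m] show False by simp
    qed
    with D have D0: "?D = {0}" by blast
    have s: "tau (u m) (h m) + (\<Sum>p\<in>F. tau (u p) (h p)) = 0" using insert.prems(4) insert.hyps by simp
    have "R (- u m) u" using insert.prems(3) s by (simp add: R_def clin_neg[OF lin] eq_neg_iff_add_eq_0 neg_eq_iff_add_eq_0)
    moreover have "- u m \<in> U" using insert.prems(3) cvs.subspace_neg[OF U_sub] by blast
    ultimately have "- u m \<in> ?D" by blast
    then have um: "u m = 0" using D0 by simp
    then have "(\<Sum>p\<in>F. tau (u p) (h p)) = 0" using s by (simp add: clin_0[OF lin])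
    then have "u p = 0" if "p \<in> F" for p using IH[of u p] that insert.prems(3) by simp
    then show ?case using um insert.prems(5) by blast
  qed
qed

lemma tau_span:
  assumes N: "submod Y ac N" "N \<subseteq> M" "N \<noteq> {0}"
  shows "cvs.span {tau u n | u n. u \<in> U \<and> n \<in> N} = W"
proof -
  let ?T = "{tau u n | u n. u \<in> U \<and> n \<in> N}"
  have TW: "cvs.span ?T \<subseteq> W" by (rule cvs.span_minimal[OF _ W_sub]) (use tau_W N(2) in blast)
  have "submod (X \<union> Y) ac (cvs.span ?T)" unfolding submod_def
  proof (intro conjI ballI)
    fix v x assume v: "v \<in> cvs.span ?T" and x: "x \<in> X \<union> Y"
    show "ac v x \<in> cvs.span ?T"
    proof (rule span_image_subset[OF ac_clin cvs.subspace_span _ v])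
      fix t assume "t \<in> ?T"
      then obtain u n where t: "t = tau u n" "u \<in> U" "n \<in> N" by blast
      then have nM: "n \<in> M" using N(2) by blast
      from x have "ac t x \<in> ?T"
      proof
        assume x: "x \<in> X"
        have "ac t x = tau (ac u x) n" using tau_actX[OF t(2) nM x] t(1) by simp
        moreover have "ac u x \<in> U" by (rule submodD(2)[OF U_submod t(2) x])
        ultimately show ?thesis using t(3) by blast
      next
        assume x: "x \<in> Y"
        have "ac t x = tau u (ac n x)" using tau_actY[OF t(2) nM x] t(1) by simp
        moreover have "ac n x \<in> N" by (rule submodD(2)[OF N(1) t(3) x])
        ultimately show ?thesis using t(2) by blast
      qed
      then show "ac t x \<in> cvs.span ?T" by (rule cvs.span_base)
    qed
  qed simp
  then have "cvs.span ?T = {0} \<or> cvs.span ?T = W" by (rule irrepD(3)[OF W_irr _ TW])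
  moreover obtain n where n: "n \<in> N" "n \<noteq> 0" using N(3) cvs.subspace_0[OF submodD(1)[OF N(1)]] by blast
  have "tau u0 n \<in> cvs.span ?T" by (rule cvs.span_base) (use n u0 in blast)
  moreover have "tau u0 n = n" using tau_xhom(2) n N(2) by blast
  ultimately show ?thesis using n(2) by auto
qed

lemma tau_basis_family:
  assumes g: "basis_family U P g" and h: "basis_family M Q h"
  shows "basis_family W (P \<times> Q) (\<lambda>(p, q). tau (g p) (h q))"
  unfolding basis_family_def lin_indep_family_def
proof (intro conjI allI impI ballI)
  have fin: "finite P" "finite Q" using g h by (auto simp: basis_family_def lin_indep_family_def)
  then show "finite (P \<times> Q)" by simp
  have gU: "g p \<in> U" if "p \<in> P" for p by (rule basis_family_mem[OF g that])
  have hM: "h q \<in> M" if "q \<in> Q" for q by (rule basis_family_mem[OF h that])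
  {
    fix c r assume c: "(\<Sum>r\<in>P \<times> Q. c r *\<^sub>c (case r of (p, q) \<Rightarrow> tau (g p) (h q))) = 0" and r: "r \<in> P \<times> Q"
    have "(\<Sum>r\<in>P \<times> Q. c r *\<^sub>c (case r of (p, q) \<Rightarrow> tau (g p) (h q))) = (\<Sum>p\<in>P. \<Sum>q\<in>Q. c (p, q) *\<^sub>c tau (g p) (h q))"
      unfolding sum.cartesian_product by (rule sum.cong) auto
    also have "\<dots> = (\<Sum>q\<in>Q. \<Sum>p\<in>P. c (p, q) *\<^sub>c tau (g p) (h q))" by (rule sum.swap)
    also have "\<dots> = (\<Sum>q\<in>Q. tau (\<Sum>p\<in>P. c (p, q) *\<^sub>c g p) (h q))"
      by (rule sum.cong) (simp_all add: clin_sum[OF tau_left[OF hM]] clin_scale[OF tau_left[OF hM]])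
    finally have s: "(\<Sum>q\<in>Q. tau (\<Sum>p\<in>P. c (p, q) *\<^sub>c g p) (h q)) = 0" using c by simp
    obtain p q where pq: "r = (p, q)" "p \<in> P" "q \<in> Q" using r by blast
    have z: "(\<Sum>p\<in>P. c (p, q) *\<^sub>c g p) = 0"
      by (rule tau_indep[of Q h "\<lambda>q. \<Sum>p\<in>P. c (p, q) *\<^sub>c g p", OF _ hM _ s pq(3)])
        (use h gU in \<open>auto simp: basis_family_def intro!: cvs.subspace_sum[OF U_sub] cvs.subspace_scale[OF U_sub]\<close>)
    have "lin_indep_family P g" using g by (simp add: basis_family_def)
    from lin_indep_familyD[OF this z pq(2)] show "c r = 0" using pq by simp
  }
  let ?I = "(\<lambda>(p, q). tau (g p) (h q)) ` (P \<times> Q)"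
  have "?I \<subseteq> W" using tau_W[OF gU hM] by auto
  then have "cvs.span ?I \<subseteq> W" by (rule cvs.span_minimal[OF _ W_sub])
  moreover have "W \<subseteq> cvs.span ?I"
  proof -
    have "tau u m \<in> cvs.span ?I" if u: "u \<in> U" and m: "m \<in> M" for u m
    proof -
      obtain c where c: "m = (\<Sum>q\<in>Q. c q *\<^sub>c h q)" by (rule basis_family_expand[OF h m])
      have "tau u (h q) \<in> cvs.span ?I" if q: "q \<in> Q" for q
      proof -
        obtain d where d: "u = (\<Sum>p\<in>P. d p *\<^sub>c g p)" by (rule basis_family_expand[OF g u])
        have "tau u (h q) = (\<Sum>p\<in>P. d p *\<^sub>c tau (g p) (h q))" unfolding d by (simp add: clin_sum[OF tau_left[OF hM[OF q]]] clin_scale[OF tau_left[OF hM[OF q]]])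
        also have "\<dots> \<in> cvs.span ?I"
          by (intro cvs.span_sum cvs.span_scale cvs.span_base) (use q in force)
        finally show ?thesis .
      qed
      moreover have "tau u m = (\<Sum>q\<in>Q. c q *\<^sub>c tau u (h q))" unfolding c by (rule tau_sum[OF u]) (rule hM)
      ultimately show ?thesis by (simp add: cvs.span_sum cvs.span_scale)
    qed
    then have "cvs.span {tau u n | u n. u \<in> U \<and> n \<in> M} \<subseteq> cvs.span ?I" by (intro cvs.span_minimal) auto
    moreover have "M \<noteq> {0}" using u0_M u0 by blast
    ultimately show ?thesis using tau_span[of M] M_sub M_ac by (simp add: submod_def)
  qed
  ultimately show "cvs.span ?I = W" by blast
qed

text \<open>A nonzero \<open>Y\<close>-submodule \<open>N\<close> already generates \<open>W\<close>
  by \<open>tau_span\<close>. An \<open>m\<close> in \<open>M\<close> outside \<open>N\<close> would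
  thus be a sum of values \<open>tau (u b) b\<close> over a basis of \<open>N\<close>; since also
  \<open>m = tau u0 m\<close>, this contradicts \<open>tau_indep\<close> for that basis enlarged by
  \<open>m\<close>.\<close>

lemma M_irr: "irrep Y ac M"
  unfolding irrep_def
proof (intro conjI allI impI)
  show "submod Y ac M" using M_sub M_ac by (simp add: submod_def)
  show "M \<noteq> {0}" using u0_M u0 by blast
  fix N assume N: "submod Y ac N \<and> N \<subseteq> M"
  show "N = {0} \<or> N = M"
  proof (rule ccontr)
    assume "\<not> (N = {0} \<or> N = M)"
    then obtain m where m: "m \<in> M" "m \<notin> N" and N0: "N \<noteq> {0}" using N by blast
    have Ns: "cvs.subspace N" using N by (simp add: submod_def)
    obtain B where B: "is_basis N B" using basis_ex[OF fds_mono[OF M_fds Ns]] N by blast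
    then have Bf: "finite B" "cvs.independent B" "cvs.span B = N" by (auto simp: is_basis_def)
    have "m \<notin> B" using m(2) sub_basis[OF B] by blast
    have ind: "lin_indep_family (insert m B) (\<lambda>b. b)"
      by (rule lin_indep_family_basis) (use Bf m cvs.independent_insertI[of m B] in auto)
    have BM: "b \<in> M" if "b \<in> insert m B" for b using that m N sub_basis[OF B] by blast
    have "\<exists>u. (\<forall>b\<in>B. u b \<in> U) \<and> w = (\<Sum>b\<in>B. tau (u b) b)"
      if "w \<in> cvs.span {tau u n | u n. u \<in> U \<and> n \<in> N}" for w
      using that
    proof (induction rule: cvs.span_induct_alt)
      case base
      show ?case using cvs.subspace_0[OF U_sub] BM
        by (intro exI[of _ "\<lambda>_. 0"]) (simp add: clin_0[OF tau_left])
    next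
      case (step c x y)
      then obtain u n v where x: "x = tau u n" "u \<in> U" "n \<in> N" and y: "\<forall>b\<in>B. v b \<in> U" "y = (\<Sum>b\<in>B. tau (v b) b)"
        by blast
      have nB: "n = (\<Sum>b\<in>B. cvs.representation B n b *\<^sub>c b)" using rep_sum[OF B x(3)] by simp
      let ?r = "cvs.representation B n"
      have "x = (\<Sum>b\<in>B. ?r b *\<^sub>c tau u b)"
        using tau_sum[OF x(2), of B "\<lambda>b. b" ?r] BM nB x(1) by simp
      then have "c *\<^sub>c x + y = (\<Sum>b\<in>B. c *\<^sub>c ?r b *\<^sub>c tau u b + tau (v b) b)"
        using y(2) by (simp add: cvs.scale_sum_right sum.distrib)
      also have "\<dots> = (\<Sum>b\<in>B. tau (c *\<^sub>c ?r b *\<^sub>c u + v b) b)"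
        by (rule sum.cong) (use BM in \<open>simp_all add: clin_add[OF tau_left] clin_scale[OF tau_left]\<close>)
      finally show ?case using x(2) y(1) cvs.subspace_add[OF U_sub] cvs.subspace_scale[OF U_sub]
        by (intro exI[of _ "\<lambda>b. c *\<^sub>c ?r b *\<^sub>c u + v b"]) simp
    qed
    moreover have "m \<in> cvs.span {tau u n | u n. u \<in> U \<and> n \<in> N}" using tau_span[of N] N N0 m(1) MW by blast
    ultimately obtain u where u: "\<forall>b\<in>B. u b \<in> U" "m = (\<Sum>b\<in>B. tau (u b) b)" by blast
    have "(\<Sum>b\<in>insert m B. tau ((u(m := - u0)) b) b) = tau (- u0) m + (\<Sum>b\<in>B. tau ((u(m := - u0)) b) b)"
      using Bf(1) \<open>m \<notin> B\<close> by simp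
    also have "(\<Sum>b\<in>B. tau ((u(m := - u0)) b) b) = m"
      unfolding u(2) by (rule sum.cong) (use \<open>m \<notin> B\<close> u(2) in auto)
    also have "tau (- u0) m = - m" using tau_xhom(2)[OF m(1)] by (simp add: clin_neg[OF tau_left[OF m(1)]])
    finally have z: "(\<Sum>b\<in>insert m B. tau ((u(m := - u0)) b) b) = 0" by simp
    have "(u(m := - u0)) m = 0"
      by (rule tau_indep[OF ind BM _ z]) (use u(1) u0 cvs.subspace_neg[OF U_sub] in auto)
    then show False using u0 by simp
  qed
qed

end

section \<open>Splitting an irreducible module into tensor factors, one family at a time\<close>

definition multilinear_on :: "'i set \<Rightarrow> ('i \<Rightarrow> 'v::cvs set) \<Rightarrow> (('i \<Rightarrow> 'v) \<Rightarrow> 'w::cvs) \<Rightarrow> bool" where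
  "multilinear_on A V \<mu> \<longleftrightarrow> (\<forall>v\<in>Pi\<^sub>E A V. \<forall>j\<in>A. \<forall>x\<in>V j.
     (\<forall>y\<in>V j. \<mu> (v(j := x + y)) = \<mu> (v(j := x)) + \<mu> (v(j := y))) \<and>
     (\<forall>c. \<mu> (v(j := c *\<^sub>c x)) = c *\<^sub>c \<mu> (v(j := x))))"

text \<open>For the first family choose \<open>U\<close> as in \<open>commuting_pair\<close>; then
  \<open>M\<close> is irreducible for the remaining families and lies in \<open>W\<close>, so the
  induction stays inside \<open>W\<close>. That \<open>\<mu>\<close> is a tensor product is
  expressed by sending tuples of basis vectors to a basis of \<open>W\<close>, which postpones the
  quotient construction of the tensor product.\<close>

lemma irreducible_tensor_decomposition:
  fixes ac :: "'v::cvs \<Rightarrow> 'g \<Rightarrow> 'v" and X :: "'i \<Rightarrow> 'g set"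
  assumes "finite A" "fds W" "irrep (\<Union>j\<in>A. X j) ac W" and ac: "\<And>x. clin (\<lambda>v. ac v x)"
    and "\<forall>i\<in>A. \<forall>j\<in>A. i \<noteq> j \<longrightarrow> (\<forall>w\<in>W. \<forall>x\<in>X i. \<forall>y\<in>X j. ac (ac w x) y = ac (ac w y) x)"
  shows "\<exists>V \<mu>. (\<forall>j\<in>A. irrep (X j) ac (V j) \<and> V j \<subseteq> W) \<and> multilinear_on A V \<mu> \<and>
    (\<forall>v\<in>Pi\<^sub>E A V. \<forall>j\<in>A. \<forall>x\<in>X j. ac (\<mu> v) x = \<mu> (v(j := ac (v j) x))) \<and>
    (\<forall>B. (\<forall>j\<in>A. is_basis (V j) (B j)) \<longrightarrow> basis_family W (Pi\<^sub>E A B) \<mu>) \<and>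
    (\<forall>v\<in>Pi\<^sub>E A V. \<mu> v \<in> W)"
  using assms(1,2,3,5)
proof (induction A arbitrary: W rule: finite_induct)
  case empty
  \<comment> \<open>Without operators every subspace is a submodule, so \<open>W\<close> is a line.
    The only tuple is the empty one, and a constant \<open>\<mu>\<close> sends it to a spanning
    vector.\<close>
  obtain w where w: "w \<in> W" "w \<noteq> 0" using empty(2) cvs.subspace_0 by (auto simp: irrep_def submod_def)
  have "cvs.span {w} \<subseteq> W" using w(1) empty(2) by (intro cvs.span_minimal) (auto simp: irrep_def submod_def)
  then have "cvs.span {w} = {0} \<or> cvs.span {w} = W" by (intro irrepD(3)[OF empty(2)]) (simp_all add: submod_def)
  then have sw: "cvs.span {w} = W" using w cvs.span_base[of w "{w}"] by blast
  show ?case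
    by (intro exI[of _ "\<lambda>_. W"] exI[of _ "\<lambda>_. w"])
      (use w in \<open>simp add: multilinear_on_def basis_family_def lin_indep_family_def sw\<close>)
next
  case (insert a A)
  have Wirr: "irrep (X a \<union> (\<Union>j\<in>A. X j)) ac W" using insert.prems(2) by simp
  have Ws: "submod (X a) ac W" using irrepD(1)[OF Wirr] by (simp add: submod_def)
  obtain U where U: "irrep (X a) ac U" "U \<subseteq> W"
    by (rule irrep_ex[OF insert.prems(1) Ws irrepD(2)[OF Wirr]])
  have "0 \<in> U" by (rule cvs.subspace_0[OF submodD(1)[OF irrepD(1)[OF U(1)]]])
  then obtain u0 where u0: "u0 \<in> U" "u0 \<noteq> 0" using irrepD(2)[OF U(1)] by auto
  interpret commuting_pair W U "X a" "\<Union>j\<in>A. X j" ac u0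
  proof (rule commuting_pair.intro)
    fix w x y assume w: "w \<in> W" and x: "x \<in> X a" and y: "y \<in> (\<Union>j\<in>A. X j)"
    obtain j where j: "j \<in> A" "y \<in> X j" using y by blast
    then have "a \<noteq> j" using insert.hyps(2) by blast
    then show "ac (ac w x) y = ac (ac w y) x"
      using insert.prems(3)[rule_format, of a j w x y] w x j by simp
  next
  qed (rule Wirr insert.prems(1) ac U u0)+
  have "\<forall>i\<in>A. \<forall>j\<in>A. i \<noteq> j \<longrightarrow> (\<forall>w\<in>M. \<forall>x\<in>X i. \<forall>y\<in>X j. ac (ac w x) y = ac (ac w y) x)"
    using insert.prems(3) MW by blast
  from insert.IH[OF M_fds M_irr this] obtain V \<mu> where V: "\<forall>j\<in>A. irrep (X j) ac (V j) \<and> V j \<subseteq> M"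
    and ml: "multilinear_on A V \<mu>"
    and eq: "\<forall>v\<in>Pi\<^sub>E A V. \<forall>j\<in>A. \<forall>x\<in>X j. ac (\<mu> v) x = \<mu> (v(j := ac (v j) x))"
    and bf: "\<forall>B. (\<forall>j\<in>A. is_basis (V j) (B j)) \<longrightarrow> basis_family M (Pi\<^sub>E A B) \<mu>"
    and mM: "\<forall>v\<in>Pi\<^sub>E A V. \<mu> v \<in> M"
    by (elim exE conjE) (rule that)
  define V' where "V' = V(a := U)"
  \<comment> \<open>The new factor is paired with the tensor of the old ones, which lies in
    \<open>M\<close>.\<close>
  define \<mu>' where "\<mu>' = (\<lambda>v. tau (v a) (\<mu> (restrict v A)))"
  have a: "a \<notin> A" by (rule insert.hyps)
  have V'A: "V' j = V j" if "j \<in> A" for j using that a by (auto simp: V'_def)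
  have V'a: "V' a = U" by (simp add: V'_def)
  have res: "restrict v A \<in> Pi\<^sub>E A V" and va: "v a \<in> U" if "v \<in> Pi\<^sub>E (insert a A) V'" for v
    using that V'A V'a by (auto simp: PiE_iff)
  have up_a: "restrict (v(a := x)) A = restrict v A" for v x using a by (auto simp: restrict_def)
  have up_A: "restrict (v(j := x)) A = (restrict v A)(j := x)" if "j \<in> A" for v x j using that by (auto simp: restrict_def)
  have up_aj: "(v(j := x)) a = v a" if "j \<in> A" for v x j using that a by auto
  have "multilinear_on (insert a A) V' \<mu>'" unfolding multilinear_on_def
  proof (intro ballI)
    fix v j x assume v: "v \<in> Pi\<^sub>E (insert a A) V'" and j: "j \<in> insert a A" and x: "x \<in> V' j"
    show "(\<forall>y\<in>V' j. \<mu>' (v(j := x + y)) = \<mu>' (v(j := x)) + \<mu>' (v(j := y))) \<and> (\<forall>c. \<mu>' (v(j := c *\<^sub>c x)) = c *\<^sub>c \<mu>' (v(j := x)))"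
    proof (cases "j = a")
      case True
      have "\<mu> (restrict v A) \<in> M" using mM res[OF v] by blast
      then show ?thesis using True by (simp add: \<mu>'_def up_a clin_simps[OF tau_left])
    next
      case False
      then have j: "j \<in> A" using j by simp
      have x: "x \<in> V j" using x V'A[OF j] by simp
      let ?v = "restrict v A"
      have m: "\<mu> (?v(j := x)) \<in> M" if "x \<in> V j" for x
      proof -
        have "?v(j := x) \<in> Pi\<^sub>E A V" using res[OF v] that j by (auto simp: PiE_iff extensional_def)
        then show ?thesis using mM by blast
      qed
      have "\<mu> (?v(j := x + y)) = \<mu> (?v(j := x)) + \<mu> (?v(j := y))" if "y \<in> V j" for y
        using ml res[OF v] j x that unfolding multilinear_on_def by blast
      moreover have "\<mu> (?v(j := c *\<^sub>c x)) = c *\<^sub>c \<mu> (?v(j := x))" for c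
        using ml res[OF v] j x unfolding multilinear_on_def by blast
      ultimately show ?thesis
        using V'A[OF j] m x va[OF v] False by (simp add: \<mu>'_def up_A[OF j] up_aj[OF j] tau_add tau_scale)
    qed
  qed
  moreover have "\<forall>v\<in>Pi\<^sub>E (insert a A) V'. \<forall>j\<in>insert a A. \<forall>x\<in>X j. ac (\<mu>' v) x = \<mu>' (v(j := ac (v j) x))"
  proof (intro ballI)
    fix v j x assume v: "v \<in> Pi\<^sub>E (insert a A) V'" and j: "j \<in> insert a A" and x: "x \<in> X j"
    have m: "\<mu> (restrict v A) \<in> M" using mM res[OF v] by blast
    show "ac (\<mu>' v) x = \<mu>' (v(j := ac (v j) x))"
    proof (cases "j = a")
      case True
      then show ?thesis using tau_actX[OF va[OF v] m] x by (simp add: \<mu>'_def up_a)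
    next
      case False
      then have j: "j \<in> A" using j by simp
      have "x \<in> (\<Union>j\<in>A. X j)" using x j by blast
      then have "ac (\<mu>' v) x = tau (v a) (ac (\<mu> (restrict v A)) x)"
        using tau_actY[OF va[OF v] m, of x] unfolding \<mu>'_def by simp
      also have "ac (\<mu> (restrict v A)) x = \<mu> ((restrict v A)(j := ac (v j) x))"
        using eq res[OF v] j x by simp
      finally show ?thesis using False by (simp add: \<mu>'_def up_A[OF j] up_aj[OF j])
    qed
  qed
  moreover have "\<forall>B. (\<forall>j\<in>insert a A. is_basis (V' j) (B j)) \<longrightarrow> basis_family W (Pi\<^sub>E (insert a A) B) \<mu>'"
  proof (intro allI impI)
    fix B assume B: "\<forall>j\<in>insert a A. is_basis (V' j) (B j)"
    have "basis_family M (Pi\<^sub>E A B) \<mu>" using bf B V'A by simp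
    moreover have "basis_family U (B a) (\<lambda>b. b)" using B V'a basis_family_basis by auto
    ultimately have bW: "basis_family W (B a \<times> Pi\<^sub>E A B) (\<lambda>(b, g). tau b (\<mu> g))"
      using tau_basis_family by fastforce
    let ?e = "\<lambda>(y, g). g(a := y)"
    have e: "Pi\<^sub>E (insert a A) B = ?e ` (B a \<times> Pi\<^sub>E A B)" by (rule PiE_insert_eq)
    have inj: "inj_on ?e (B a \<times> Pi\<^sub>E A B)" by (rule inj_combinator[OF a])
    have me: "\<mu>' (?e r) = (\<lambda>(b, g). tau b (\<mu> g)) r" if r: "r \<in> B a \<times> Pi\<^sub>E A B" for r
    proof -
      obtain b g where "r = (b, g)" "g \<in> Pi\<^sub>E A B" using r by blast
      then show ?thesis by (simp add: \<mu>'_def up_a PiE_restrict)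
    qed
    show "basis_family W (Pi\<^sub>E (insert a A) B) \<mu>'" unfolding basis_family_def lin_indep_family_def
    proof (intro conjI allI impI ballI)
      show "finite (Pi\<^sub>E (insert a A) B)"
        unfolding e using bW by (simp add: basis_family_def lin_indep_family_def)
      have "\<mu>' ` Pi\<^sub>E (insert a A) B = (\<lambda>(b, g). tau b (\<mu> g)) ` (B a \<times> Pi\<^sub>E A B)"
        unfolding e image_image by (rule image_cong[OF refl me])
      then show "cvs.span (\<mu>' ` Pi\<^sub>E (insert a A) B) = W" using bW by (simp add: basis_family_def)
      fix c v assume c: "(\<Sum>q\<in>Pi\<^sub>E (insert a A) B. c q *\<^sub>c \<mu>' q) = 0" and v: "v \<in> Pi\<^sub>E (insert a A) B"
      have "(\<Sum>r\<in>B a \<times> Pi\<^sub>E A B. c (?e r) *\<^sub>c (\<lambda>(b, g). tau b (\<mu> g)) r) = (\<Sum>r\<in>B a \<times> Pi\<^sub>E A B. c (?e r) *\<^sub>c \<mu>' (?e r))"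
        by (rule sum.cong) (simp_all only: me)
      also have "\<dots> = (\<Sum>q\<in>Pi\<^sub>E (insert a A) B. c q *\<^sub>c \<mu>' q)" unfolding e using sum.reindex[OF inj, of "\<lambda>q. c q *\<^sub>c \<mu>' q"] by simp
      finally have z: "(\<Sum>r\<in>B a \<times> Pi\<^sub>E A B. c (?e r) *\<^sub>c (\<lambda>(b, g). tau b (\<mu> g)) r) = 0" using c by simp
      have "lin_indep_family (B a \<times> Pi\<^sub>E A B) (\<lambda>(b, g). tau b (\<mu> g))" using bW by (simp add: basis_family_def)
      from lin_indep_familyD[OF this z] show "c v = 0" using v unfolding e by blast
    qed
  qed
  moreover have "\<forall>v\<in>Pi\<^sub>E (insert a A) V'. \<mu>' v \<in> W"
    using mM res va by (auto simp: \<mu>'_def intro!: tau_W)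
  moreover have "\<forall>j\<in>insert a A. irrep (X j) ac (V' j) \<and> V' j \<subseteq> W"
  proof
    fix j assume "j \<in> insert a A"
    then consider "j = a" | "j \<in> A" by blast
    then show "irrep (X j) ac (V' j) \<and> V' j \<subseteq> W"
    proof cases
      case 1 then show ?thesis using U V'a by simp
    next
      case 2 then show ?thesis using bspec[OF V 2] V'A[OF 2] MW by auto
    qed
  qed
  ultimately show ?case by (intro exI[of _ V'] exI[of _ \<mu>'] conjI)
qed

subsection \<open>Record-based vector spaces parametrized by subspaces\<close>

lemma dsum_zeroD:
  assumes "dsum V A W" "\<And>i. i \<in> A \<Longrightarrow> w i \<in> W i" "(\<Sum>i\<in>A. w i) = 0" "i \<in> A"
  shows "w i = 0"
proof -
  have "\<forall>w. (\<forall>i\<in>A. w i \<in> W i) \<and> (\<Sum>i\<in>A. w i) = 0 \<longrightarrow> (\<forall>i\<in>A. w i = 0)"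
    using assms(1) unfolding dsum_def by (elim conjE)
  from spec[OF this, of w] show ?thesis using assms(2-4) by simp
qed

text \<open>The linear algebra above lives on subsets of total vector spaces. It is carried over to
  records along a linear bijection \<open>\<psi>\<close> from a subspace \<open>K\<close> of such a space; every record of
  finite dimension \<open>n\<close> has one with \<open>K\<close> the copy \<open>coord_space n\<close> of \<open>\<complex>\<^sup>n\<close> in \<open>nat \<Rightarrow> complex\<close>.\<close>

definition vparam ::
  "(complex, 'a, 'x) module_scheme \<Rightarrow> 'v::cvs set \<Rightarrow> ('v \<Rightarrow> 'a) \<Rightarrow> bool" where
  "vparam N K \<psi> \<longleftrightarrow> cvs.subspace K \<and> bij_betw \<psi> K (carrier N) \<and> \<zero>\<^bsub>N\<^esub> = \<psi> 0 \<and>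
    (\<forall>x\<in>K. \<forall>y\<in>K. \<psi> (x + y) = \<psi> x \<oplus>\<^bsub>N\<^esub> \<psi> y) \<and> (\<forall>c. \<forall>x\<in>K. \<psi> (c *\<^sub>c x) = c \<odot>\<^bsub>N\<^esub> \<psi> x)"

lemma complex_field_field: "field complex_field"
  by (rule class_field.field_axioms)

lemma vparamD:
  assumes "vparam N K \<psi>"
  shows "cvs.subspace K" "carrier N = \<psi> ` K" "inj_on \<psi> K" "\<zero>\<^bsub>N\<^esub> = \<psi> 0"
    "x \<in> K \<Longrightarrow> y \<in> K \<Longrightarrow> \<psi> x \<oplus>\<^bsub>N\<^esub> \<psi> y = \<psi> (x + y)" "x \<in> K \<Longrightarrow> c \<odot>\<^bsub>N\<^esub> \<psi> x = \<psi> (c *\<^sub>c x)"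
  using assms by (simp_all add: vparam_def bij_betw_def)

lemma vparam_vectorspace:
  assumes P: "vparam N K \<psi>" shows "vectorspace complex_field N"
proof -
  note K = vparamD(1)[OF P] and c = vparamD(2)[OF P] and z = vparamD(4)[OF P] and a = vparamD(5)[OF P] and s = vparamD(6)[OF P]
  have K0: "0 \<in> K" and Ka: "\<And>x y. x \<in> K \<Longrightarrow> y \<in> K \<Longrightarrow> x + y \<in> K" and Ks: "\<And>c x. x \<in> K \<Longrightarrow> c *\<^sub>c x \<in> K"
    and Kn: "\<And>x. x \<in> K \<Longrightarrow> - x \<in> K"
    using cvs.subspace_0[OF K] cvs.subspace_add[OF K] cvs.subspace_scale[OF K] cvs.subspace_neg[OF K] by blast+
  show ?thesis
  proof (rule vs_criteria[OF complex_field_field])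
    show "\<forall>v\<in>carrier N. \<exists>w\<in>carrier N. v \<oplus>\<^bsub>N\<^esub> w = \<zero>\<^bsub>N\<^esub>"
    proof
      fix v assume "v \<in> carrier N"
      then obtain x where x: "x \<in> K" "v = \<psi> x" unfolding c by blast
      then have "v \<oplus>\<^bsub>N\<^esub> \<psi> (- x) = \<zero>\<^bsub>N\<^esub>" using a[OF x(1) Kn[OF x(1)]] z by simp
      then show "\<exists>w\<in>carrier N. v \<oplus>\<^bsub>N\<^esub> w = \<zero>\<^bsub>N\<^esub>" unfolding c using Kn[OF x(1)] by blast
    qed
  qed (auto simp: c z a s K0 Ka Ks algebra_simps cvs.scale_right_distrib csc_add_left csc_csc csc_one)
qed

lemma vparam_minus:
  assumes P: "vparam N K \<psi>" and x: "x \<in> K" and y: "y \<in> K"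
  shows "\<psi> x \<ominus>\<^bsub>N\<^esub> \<psi> y = \<psi> (x - y)"
proof -
  interpret vectorspace complex_field N by (rule vparam_vectorspace[OF P])
  have my: "- y \<in> K" by (rule cvs.subspace_neg[OF vparamD(1)[OF P] y])
  have "\<psi> (- y) \<oplus>\<^bsub>N\<^esub> \<psi> y = \<zero>\<^bsub>N\<^esub>" using vparamD(5)[OF P my y] vparamD(4)[OF P] by simp
  moreover have "\<psi> y \<in> carrier N" "\<psi> (- y) \<in> carrier N" using y my vparamD(2)[OF P] by auto
  ultimately have "\<ominus>\<^bsub>N\<^esub> \<psi> y = \<psi> (- y)" by (rule M.minus_equality)
  then show ?thesis using vparamD(5)[OF P x my] by (simp add: a_minus_def)
qed

lemma vparam_finsum:
  assumes P: "vparam N K \<psi>" and f: "\<And>i. i \<in> A \<Longrightarrow> f i \<in> K"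
  shows "finsum N (\<lambda>i. \<psi> (f i)) A = \<psi> (\<Sum>i\<in>A. f i)"
proof -
  interpret vectorspace complex_field N by (rule vparam_vectorspace[OF P])
  show ?thesis using f
  proof (induction A rule: infinite_finite_induct)
    case (insert i A)
    have "(\<lambda>i. \<psi> (f i)) \<in> A \<rightarrow> carrier N" "\<psi> (f i) \<in> carrier N" using insert vparamD(2)[OF P] by auto
    moreover have "(\<Sum>i\<in>A. f i) \<in> K" using insert cvs.subspace_sum[OF vparamD(1)[OF P]] by blast
    ultimately show ?case using insert vparamD(5)[OF P] by (simp add: M.finsum_insert)
  qed (use vparamD(4)[OF P] in simp_all)
qed

lemma vparam_sub:
  assumes P: "vparam N K \<psi>" and H: "cvs.subspace H" "H \<subseteq> K"
  shows "vparam (N\<lparr>carrier := \<psi> ` H\<rparr>) H \<psi>"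
proof -
  have "inj_on \<psi> H" using vparamD(3)[OF P] H(2) by (rule inj_on_subset)
  then show ?thesis using assms by (auto simp: vparam_def bij_betw_def subset_iff)
qed

lemma vparam_subspace:
  assumes P: "vparam N K \<psi>" and H: "cvs.subspace H" "H \<subseteq> K"
  shows "VectorSpace.subspace complex_field (\<psi> ` H) N"
proof (rule VectorSpace.subspace.intro[OF vparam_vectorspace[OF P]])
  interpret vectorspace complex_field N by (rule vparam_vectorspace[OF P])
  show "submodule complex_field (\<psi> ` H) N"
  proof (rule submodule.intro)
    show "Module.module complex_field N" by (rule module_axioms)
    show "\<psi> ` H \<subseteq> carrier N" using H(2) vparamD(2)[OF P] by blast
    show "\<zero>\<^bsub>N\<^esub> \<in> \<psi> ` H" using vparamD(4)[OF P] cvs.subspace_0[OF H(1)] by blast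
    show "v \<oplus>\<^bsub>N\<^esub> w \<in> \<psi> ` H" if vw: "v \<in> \<psi> ` H" "w \<in> \<psi> ` H" for v w
    proof -
      obtain x y where "v = \<psi> x" "w = \<psi> y" "x \<in> H" "y \<in> H" using vw by blast
      then show ?thesis using vparamD(5)[OF P, of x y] cvs.subspace_add[OF H(1)] H(2) by blast
    qed
    show "c \<odot>\<^bsub>N\<^esub> v \<in> \<psi> ` H" if v: "v \<in> \<psi> ` H" for c v
    proof -
      obtain x where "v = \<psi> x" "x \<in> H" using v by blast
      then show ?thesis using vparamD(6)[OF P, of x c] cvs.subspace_scale[OF H(1)] H(2) by blast
    qed
  qed
qed

lemma vparam_subspace_ex:
  assumes P: "vparam N K \<psi>" and W: "VectorSpace.subspace complex_field W N"
  obtains H where "cvs.subspace H" "H \<subseteq> K" "W = \<psi> ` H"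
proof -
  interpret submodule complex_field W N using W by (simp add: VectorSpace.subspace_def)
  let ?H = "{x \<in> K. \<psi> x \<in> W}"
  have "cvs.subspace ?H"
  proof (rule cvs.subspaceI)
    show "0 \<in> ?H" using cvs.subspace_0[OF vparamD(1)[OF P]] zero_closed vparamD(4)[OF P] by simp
    show "x + y \<in> ?H" if "x \<in> ?H" "y \<in> ?H" for x y
      using that m_closed[of "\<psi> x" "\<psi> y"] vparamD(5)[OF P] cvs.subspace_add[OF vparamD(1)[OF P]] by simp
    show "c *\<^sub>c x \<in> ?H" if "x \<in> ?H" for c x
      using that smult_closed[of c "\<psi> x"] vparamD(6)[OF P] cvs.subspace_scale[OF vparamD(1)[OF P]] by simp
  qed
  moreover have "W = \<psi> ` ?H" using subset vparamD(2)[OF P] by auto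
  ultimately show ?thesis using that[of ?H] by blast
qed

lemma vparam_span:
  assumes P: "vparam N K \<psi>" and X: "X \<subseteq> K"
  shows "LinearCombinations.module.span complex_field N (\<psi> ` X) = \<psi> ` cvs.span X"
proof -
  interpret vectorspace complex_field N by (rule vparam_vectorspace[OF P])
  have XN: "\<psi> ` X \<subseteq> carrier N" using X vparamD(2)[OF P] by blast
  have XK: "cvs.span X \<subseteq> K" by (rule cvs.span_minimal[OF X vparamD(1)[OF P]])
  have "VectorSpace.subspace complex_field (\<psi> ` cvs.span X) N" by (rule vparam_subspace[OF P _ XK]) simp
  then have "span (\<psi> ` X) \<subseteq> \<psi> ` cvs.span X"
    by (intro span_is_subset) (auto simp: VectorSpace.subspace_def intro: cvs.span_base)
  moreover have "\<psi> ` cvs.span X \<subseteq> span (\<psi> ` X)"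
  proof -
    have "VectorSpace.subspace complex_field (span (\<psi> ` X)) N" by (rule span_is_subspace[OF XN])
    then obtain H where H: "cvs.subspace H" "H \<subseteq> K" "span (\<psi> ` X) = \<psi> ` H" by (rule vparam_subspace_ex[OF P])
    have "x \<in> H" if x: "x \<in> X" for x
    proof -
      have "\<psi> x \<in> \<psi> ` H" using in_own_span[OF XN] x H(3) by blast
      then show ?thesis using inj_on_image_mem_iff[OF vparamD(3)[OF P] _ H(2)] x X by blast
    qed
    then have "cvs.span X \<subseteq> H" by (intro cvs.span_minimal[OF _ H(1)]) blast
    then show ?thesis using H(3) by blast
  qed
  ultimately show ?thesis by blast
qed

lemma vparam_fin_dim:
  assumes P: "vparam N K \<psi>" and K: "fds K"
  shows "vectorspace.fin_dim complex_field N"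
proof -
  interpret vectorspace complex_field N by (rule vparam_vectorspace[OF P])
  obtain B where B: "is_basis K B" by (rule basis_ex[OF K])
  then have BK: "B \<subseteq> K" using sub_basis[OF B] by blast
  have "span (\<psi> ` B) = carrier N" using vparam_span[OF P BK] B vparamD(2)[OF P] by (simp add: is_basis_def)
  then show ?thesis unfolding fin_dim_def
    using B BK vparamD(2)[OF P] by (intro exI[of _ "\<psi> ` B"]) (auto simp: is_basis_def)
qed

section \<open>Coordinates on a finite-dimensional record\<close>

definition coord_space :: "nat \<Rightarrow> (nat \<Rightarrow> complex) set" where
  "coord_space n = {f. \<forall>i\<ge>n. f i = 0}"

lemma coord_space: "fds (coord_space n)"
proof -
  let ?e = "\<lambda>i j. if j = i then 1 else 0 :: complex"
  have s: "cvs.subspace (coord_space n)" by (rule cvs.subspaceI) (simp_all add: coord_space_def)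
  have "f \<in> cvs.span (?e ` {..<n})" if "f \<in> coord_space n" for f
  proof -
    have "f = (\<Sum>i<n. f i *\<^sub>c ?e i)"
    proof
      fix j
      have "(\<Sum>i<n. f i *\<^sub>c ?e i) j = (\<Sum>i<n. if j = i then f i else 0)"
        unfolding sum_fun_apply by (rule sum.cong) auto
      also have "\<dots> = f j" using that by (simp add: coord_space_def)
      finally show "f j = (\<Sum>i<n. f i *\<^sub>c ?e i) j" by simp
    qed
    also have "\<dots> \<in> cvs.span (?e ` {..<n})" by (intro cvs.span_sum cvs.span_scale cvs.span_base) blast
    finally show ?thesis .
  qed
  then show ?thesis unfolding fds_def using s by (intro conjI exI[of _ "?e ` {..<n}"]) auto
qed

lemma vparam_ex:
  assumes "vectorspace complex_field N" "vectorspace.fin_dim complex_field N"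
  obtains n \<psi> where "vparam N (coord_space n) \<psi>"
proof -
  interpret vectorspace complex_field N by (rule assms(1))
  obtain \<beta> where \<beta>: "finite \<beta>" "basis \<beta>" using finite_basis_exists[OF assms(2)] by blast
  then have \<beta>N: "\<beta> \<subseteq> carrier N" by (simp add: basis_def)
  obtain e where e: "bij_betw e \<beta> {0..<card \<beta>}" using ex_bij_betw_finite_nat[OF \<beta>(1)] by blast
  let ?n = "card \<beta>"
  define \<psi> where "\<psi> f = lincomb (\<lambda>x. f (e x)) \<beta>" for f :: "nat \<Rightarrow> complex"
  have uniq: "\<exists>!a. a \<in> \<beta> \<rightarrow>\<^sub>E carrier complex_field \<and> lincomb a \<beta> = v" if "v \<in> carrier N" for v
    using basis_criterion[OF \<beta>(1) \<beta>N] \<beta>(2) that by blast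
  have res: "lincomb (restrict a \<beta>) \<beta> = lincomb a \<beta>" for a :: "'a \<Rightarrow> complex"
    by (rule lincomb_cong) (use \<beta>N in auto)
  have "vparam N (coord_space ?n) \<psi>" unfolding vparam_def
  proof (intro conjI ballI allI)
    show "cvs.subspace (coord_space ?n)" using coord_space by (simp add: fds_def)
    show "\<psi> (x + y) = \<psi> x \<oplus>\<^bsub>N\<^esub> \<psi> y" for x y
      using lincomb_sum[OF \<beta>(1) \<beta>N, of "\<lambda>v. x (e v)" "\<lambda>v. y (e v)"] by (simp add: \<psi>_def)
    show smult: "\<psi> (c *\<^sub>c x) = c \<odot>\<^bsub>N\<^esub> \<psi> x" for c x
      using lincomb_smult[OF \<beta>N, of "\<lambda>v. x (e v)" c] by (simp add: \<psi>_def)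
    have "\<psi> (0 *\<^sub>c 0) = 0 \<odot>\<^bsub>N\<^esub> \<psi> 0" by (rule smult)
    moreover have cl: "\<psi> f \<in> carrier N" for f unfolding \<psi>_def using \<beta>N by (intro lincomb_closed) auto
    ultimately show "\<zero>\<^bsub>N\<^esub> = \<psi> 0" using lmult_0[OF cl[of 0]] by simp
    show "bij_betw \<psi> (coord_space ?n) (carrier N)" unfolding bij_betw_def
    proof
      show "inj_on \<psi> (coord_space ?n)"
      proof (rule inj_onI)
        fix f g assume f: "f \<in> coord_space ?n" and g: "g \<in> coord_space ?n" and eq: "\<psi> f = \<psi> g"
        have "lincomb (restrict (\<lambda>x. f (e x)) \<beta>) \<beta> = \<psi> f" "lincomb (restrict (\<lambda>x. g (e x)) \<beta>) \<beta> = \<psi> f"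
          unfolding res using eq by (simp_all add: \<psi>_def)
        then have r: "restrict (\<lambda>x. f (e x)) \<beta> = restrict (\<lambda>x. g (e x)) \<beta>"
          using uniq[OF cl[of f]] by (smt (verit, best) PiE_restrict restrict_PiE UNIV_I partial_object.select_convs(1) restrict_PiE_iff)
        show "f = g"
        proof
          fix i show "f i = g i"
          proof (cases "i < ?n")
            case True
            then have "i \<in> e ` \<beta>" using e by (simp add: bij_betw_def)
            then obtain x where x: "x \<in> \<beta>" "i = e x" by blast
            then show ?thesis using fun_cong[OF r, of x] by simp
          qed (use f g in \<open>simp add: coord_space_def\<close>)
        qed
      qed
      show "\<psi> ` coord_space ?n = carrier N"
      proof
        show "\<psi> ` coord_space ?n \<subseteq> carrier N" using cl by blast
        show "carrier N \<subseteq> \<psi> ` coord_space ?n"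
        proof
          fix v assume "v \<in> carrier N"
          then obtain a where a: "lincomb a \<beta> = v" using uniq by blast
          let ?f = "\<lambda>i. if i < ?n then a (inv_into \<beta> e i) else 0"
          have "\<psi> ?f = lincomb a \<beta>" unfolding \<psi>_def
          proof (rule lincomb_cong[OF refl \<beta>N])
            fix x assume x: "x \<in> \<beta>"
            then have "e x < ?n" using e by (auto simp: bij_betw_def)
            then show "?f (e x) = a x" using x inv_into_f_f[of e \<beta> x] e by (simp add: bij_betw_def)
          qed simp
          then show "v \<in> \<psi> ` coord_space ?n" using a by (intro image_eqI[of _ _ ?f]) (auto simp: coord_space_def)
        qed
      qed
    qed
  qed
  then show ?thesis using that by blast
qed

lemma vparam_linear_map:
  assumes P: "vparam N K \<psi>" and Q: "vparam N' K \<chi>" and f: "\<And>x. x \<in> K \<Longrightarrow> f (\<psi> x) = \<chi> x"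
  shows "linear_map complex_field N N' f" "bij_betw f (carrier N) (carrier N')"
proof -
  note v = vparam_vectorspace[OF P] vparam_vectorspace[OF Q]
  have "f \<in> LinearCombinations.module_hom complex_field N N'" unfolding LinearCombinations.module_hom_def
    using f vparamD[OF P] vparamD[OF Q]
    by (auto simp: cvs.subspace_add cvs.subspace_scale)
  then show "linear_map complex_field N N' f"
    using v by (simp add: linear_map_def mod_hom_def mod_hom_axioms_def vectorspace_def)
  have "bij_betw (f \<circ> \<psi>) K (carrier N')"
    using Q bij_betw_cong[of K "f \<circ> \<psi>" \<chi>] f by (simp add: vparam_def)
  then show "bij_betw f (carrier N) (carrier N')"
    using bij_betw_comp_iff[of \<psi> K "carrier N" f "carrier N'"] P by (simp add: vparam_def)
qed

section \<open>Direct sums, components and quotients in coordinates\<close>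

lemma vparam_internal_direct_sum:
  assumes P: "vparam N K \<psi>" and D: "dsum K A W"
  shows "internal_direct_sum N A (\<lambda>i. \<psi> ` W i)"
  unfolding internal_direct_sum_def
proof (intro conjI ballI)
  have W: "finite A" "\<And>i. i \<in> A \<Longrightarrow> cvs.subspace (W i)" "\<And>i. i \<in> A \<Longrightarrow> W i \<subseteq> K" using D by (auto simp: dsum_def)
  show "finite A" by (rule W)
  show "VectorSpace.subspace complex_field (\<psi> ` W i) N" if "i \<in> A" for i by (rule vparam_subspace[OF P W(2)[OF that] W(3)[OF that]])
  fix x assume "x \<in> carrier N"
  then obtain k where k: "k \<in> K" "x = \<psi> k" using vparamD(2)[OF P] by blast
  obtain w where w: "\<forall>i\<in>A. w i \<in> W i" "k = (\<Sum>i\<in>A. w i)" using D k(1) unfolding dsum_def by blast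
  have fs: "finsum N w' A = \<psi> (\<Sum>i\<in>A. u i)" if "\<And>i. i \<in> A \<Longrightarrow> u i \<in> K" "\<And>i. i \<in> A \<Longrightarrow> w' i = \<psi> (u i)" for w' u
  proof -
    interpret vectorspace complex_field N by (rule vparam_vectorspace[OF P])
    have "finsum N w' A = finsum N (\<lambda>i. \<psi> (u i)) A"
      by (rule M.finsum_cong') (use that vparamD(2)[OF P] in auto)
    then show ?thesis using vparam_finsum[OF P, of A u] that(1) by simp
  qed
  show "\<exists>!w. w \<in> (\<Pi>\<^sub>E i\<in>A. \<psi> ` W i) \<and> x = finsum N w A"
  proof (rule ex1I[of _ "\<lambda>i\<in>A. \<psi> (w i)"])
    have "w i \<in> K" if "i \<in> A" for i using w(1) W(3) that by blast
    then have "finsum N (\<lambda>i\<in>A. \<psi> (w i)) A = \<psi> (\<Sum>i\<in>A. w i)" by (rule fs) simp_all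
    then show "(\<lambda>i\<in>A. \<psi> (w i)) \<in> (\<Pi>\<^sub>E i\<in>A. \<psi> ` W i) \<and> x = finsum N (\<lambda>i\<in>A. \<psi> (w i)) A"
      using w k by auto
    fix w' assume w': "w' \<in> (\<Pi>\<^sub>E i\<in>A. \<psi> ` W i) \<and> x = finsum N w' A"
    then have "\<forall>i\<in>A. \<exists>y. y \<in> W i \<and> w' i = \<psi> y" by (auto simp: PiE_iff)
    then obtain u where u: "\<forall>i\<in>A. u i \<in> W i \<and> w' i = \<psi> (u i)" by metis
    have uK: "u i \<in> K" if "i \<in> A" for i using u W(3) that by blast
    have "finsum N w' A = \<psi> (\<Sum>i\<in>A. u i)" by (rule fs) (use u uK in auto)
    then have "\<psi> (\<Sum>i\<in>A. u i) = \<psi> k" using w' k by simp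
    moreover have "(\<Sum>i\<in>A. u i) \<in> K" by (rule cvs.subspace_sum[OF vparamD(1)[OF P]]) (rule uK)
    ultimately have "(\<Sum>i\<in>A. u i) = k" using inj_onD[OF vparamD(3)[OF P]] k(1) by blast
    then have "(\<Sum>i\<in>A. u i - w i) = 0" using w(2) by (simp add: sum_subtractf)
    moreover have "u i - w i \<in> W i" if "i \<in> A" for i
      using u w(1) cvs.subspace_diff[OF W(2)[OF that]] that by simp
    ultimately have "u i - w i = 0" if "i \<in> A" for i using dsum_zeroD[OF D, of "\<lambda>i. u i - w i" i] that by simp
    then have "\<forall>i\<in>A. u i = w i" by simp
    then show "w' = (\<lambda>i\<in>A. \<psi> (w i))" using w' u by (auto simp: PiE_iff extensional_def fun_eq_iff)
  qed
qed

lemma vparam_component: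
  assumes P: "vparam N K \<psi>" and D: "dsum K A W" and w: "\<And>i. i \<in> A \<Longrightarrow> w i \<in> W i" and j: "j \<in> A"
  shows "component N A (\<lambda>i. \<psi> ` W i) j (\<psi> (\<Sum>i\<in>A. w i)) = \<psi> (w j)"
proof -
  have wK: "w i \<in> K" if "i \<in> A" for i using w[OF that] D that by (auto simp: dsum_def)
  have "(\<Sum>i\<in>A. w i) \<in> K" by (rule cvs.subspace_sum[OF vparamD(1)[OF P]]) (rule wK)
  then have xN: "\<psi> (\<Sum>i\<in>A. w i) \<in> carrier N" using vparamD(2)[OF P] by blast
  have ex1: "\<exists>!v. v \<in> (\<Pi>\<^sub>E i\<in>A. \<psi> ` W i) \<and> \<psi> (\<Sum>i\<in>A. w i) = finsum N v A"
    using vparam_internal_direct_sum[OF P D] xN unfolding internal_direct_sum_def by blast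
  interpret vectorspace complex_field N by (rule vparam_vectorspace[OF P])
  have "finsum N (\<lambda>i\<in>A. \<psi> (w i)) A = finsum N (\<lambda>i. \<psi> (w i)) A"
    by (rule M.finsum_cong') (use wK vparamD(2)[OF P] in auto)
  then have "\<psi> (\<Sum>i\<in>A. w i) = finsum N (\<lambda>i\<in>A. \<psi> (w i)) A" using vparam_finsum[OF P, of A w] wK by simp
  moreover have "(\<lambda>i\<in>A. \<psi> (w i)) \<in> (\<Pi>\<^sub>E i\<in>A. \<psi> ` W i)" using w by auto
  ultimately have "(THE v. v \<in> (\<Pi>\<^sub>E i\<in>A. \<psi> ` W i) \<and> \<psi> (\<Sum>i\<in>A. w i) = finsum N v A) = (\<lambda>i\<in>A. \<psi> (w i))"
    by (intro the1_equality[OF ex1] conjI)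
  then show ?thesis using j by (simp add: component_def)
qed

lemma vparam_coset:
  assumes P: "vparam N K \<psi>" and J: "J \<subseteq> K" and x: "x \<in> K"
  shows "(\<psi> ` J) +>\<^bsub>N\<^esub> \<psi> x = \<psi> ` {j + x | j. j \<in> J}"
proof -
  have "(\<psi> ` J) +>\<^bsub>N\<^esub> \<psi> x = (\<lambda>j. \<psi> j \<oplus>\<^bsub>N\<^esub> \<psi> x) ` J" unfolding a_r_coset_def' by blast
  also have "\<dots> = (\<lambda>j. \<psi> (j + x)) ` J" by (rule image_cong[OF refl]) (use vparamD(5)[OF P] J x in blast)
  finally show ?thesis by blast
qed

text \<open>The first isomorphism theorem: a linear \<open>r\<close> on \<open>K\<close> with kernel
  \<open>J\<close> and image \<open>H\<close> parametrizes the quotient by \<open>H\<close>, each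
  \<open>h\<close> naming its fibre. It serves the quotient by the Leibniz kernel and the tensor
  product. Linearity is asked only on \<open>K\<close>, since in the second case \<open>r\<close> is
  a sum over a support that is finite only for elements of \<open>K\<close>.\<close>

lemma vparam_quotient:
  fixes r :: "'v::cvs \<Rightarrow> 'w::cvs"
  assumes P: "vparam N K \<psi>" and J: "J \<subseteq> K" and H: "cvs.subspace H"
    and r: "\<And>x y. x \<in> K \<Longrightarrow> y \<in> K \<Longrightarrow> r (x + y) = r x + r y" "\<And>c x. x \<in> K \<Longrightarrow> r (c *\<^sub>c x) = c *\<^sub>c r x"
    and rH: "r ` K = H" and ker: "\<And>x. x \<in> K \<Longrightarrow> r x = 0 \<longleftrightarrow> x \<in> J"
  shows "vparam (quotient_space N (\<psi> ` J)) H (\<lambda>h. \<psi> ` {x \<in> K. r x = h})"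
    and "\<And>x. x \<in> K \<Longrightarrow> (\<psi> ` J) +>\<^bsub>N\<^esub> \<psi> x = \<psi> ` {y \<in> K. r y = r x}"
proof -
  let ?c = "\<lambda>h. \<psi> ` {x \<in> K. r x = h}"
  note K = vparamD(1)[OF P]
  have rd: "r (x - y) = r x - r y" if "x \<in> K" "y \<in> K" for x y
    using r(1)[OF that(1), of "(-1) *\<^sub>c y"] r(2)[OF that(2), of "-1"] cvs.subspace_neg[OF K that(2)] by simp
  show cos: "(\<psi> ` J) +>\<^bsub>N\<^esub> \<psi> x = ?c (r x)" if x: "x \<in> K" for x
  proof -
    have "{j + x | j. j \<in> J} = {y \<in> K. r y = r x}"
    proof (intro equalityI subsetI)
      fix y assume "y \<in> {j + x | j. j \<in> J}"
      then obtain j where "j \<in> J" "y = j + x" by blast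
      then show "y \<in> {y \<in> K. r y = r x}" using J x r(1)[of j x] ker[of j] cvs.subspace_add[OF K] by auto
    next
      fix y assume y: "y \<in> {y \<in> K. r y = r x}"
      then have "y - x \<in> J" using ker[of "y - x"] rd[of y x] x cvs.subspace_diff[OF K] by auto
      then show "y \<in> {j + x | j. j \<in> J}" by (intro CollectI exI[of _ "y - x"]) simp
    qed
    then show ?thesis using vparam_coset[OF P J x] by simp
  qed
  show "vparam (quotient_space N (\<psi> ` J)) H ?c" unfolding vparam_def
  proof (intro conjI ballI allI)
    show "cvs.subspace H" by (rule H)
    have inj: "inj_on ?c H"
    proof (rule inj_onI)
      fix h h' assume h: "h \<in> H" "h' \<in> H" "?c h = ?c h'"
      obtain x where x: "x \<in> K" "r x = h" using h(1) rH by blast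
      then have "\<psi> x \<in> ?c h'" using h(3) by blast
      then obtain y where "y \<in> K" "r y = h'" "\<psi> y = \<psi> x" by auto
      then show "h = h'" using x vparamD(3)[OF P] by (auto dest: inj_onD)
    qed
    have "carrier (quotient_space N (\<psi> ` J)) = (\<lambda>a. (\<psi> ` J) +>\<^bsub>N\<^esub> a) ` carrier N"
      unfolding quotient_space_def A_RCOSETS_def' by auto
    also have "\<dots> = (\<lambda>x. ?c (r x)) ` K" unfolding vparamD(2)[OF P] image_image by (rule image_cong[OF refl cos])
    also have "\<dots> = ?c ` H" using rH by blast
    finally show "bij_betw ?c H (carrier (quotient_space N (\<psi> ` J)))" using inj by (simp add: bij_betw_def)
    have "{x \<in> K. r x = 0} = J" using ker J by blast
    then show "\<zero>\<^bsub>quotient_space N (\<psi> ` J)\<^esub> = ?c 0" by (simp add: quotient_space_def)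
    fix h assume h: "h \<in> H"
    then obtain x where x: "x \<in> K" "r x = h" using rH by blast
    show "?c (c *\<^sub>c h) = c \<odot>\<^bsub>quotient_space N (\<psi> ` J)\<^esub> ?c h" for c
    proof -
      have "c \<odot>\<^bsub>quotient_space N (\<psi> ` J)\<^esub> ?c h = (\<Union>y\<in>{y \<in> K. r y = h}. (\<psi> ` J) +>\<^bsub>N\<^esub> (c \<odot>\<^bsub>N\<^esub> \<psi> y))"
        by (simp add: quotient_space_def)
      \<comment> \<open>Every representative produces the same coset, so the union is that coset
        once the fibre is known to be nonempty.\<close>
      also have "\<dots> = (\<Union>y\<in>{y \<in> K. r y = h}. ?c (c *\<^sub>c h))"
      proof (rule SUP_cong[OF refl])
        fix y assume y: "y \<in> {y \<in> K. r y = h}"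
        then show "(\<psi> ` J) +>\<^bsub>N\<^esub> (c \<odot>\<^bsub>N\<^esub> \<psi> y) = ?c (c *\<^sub>c h)"
          using vparamD(6)[OF P, of y c] cos[of "c *\<^sub>c y"] r(2)[of y c] cvs.subspace_scale[OF K] by simp
      qed
      also have "\<dots> = ?c (c *\<^sub>c h)" using x by auto
      finally show ?thesis by simp
    qed
    fix h' assume h': "h' \<in> H"
    have "?c h <+>\<^bsub>N\<^esub> ?c h' = ?c (h + h')"
    proof (intro equalityI subsetI)
      fix z assume "z \<in> ?c h <+>\<^bsub>N\<^esub> ?c h'"
      then obtain y y' where y: "y \<in> K" "r y = h" "y' \<in> K" "r y' = h'" "z = \<psi> y \<oplus>\<^bsub>N\<^esub> \<psi> y'"
        unfolding set_add_def' by blast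
      then have "z = \<psi> (y + y')" "y + y' \<in> K" "r (y + y') = h + h'"
        using vparamD(5)[OF P] r(1) cvs.subspace_add[OF K] by simp_all
      then show "z \<in> ?c (h + h')" by blast
    next
      fix z assume "z \<in> ?c (h + h')"
      then obtain y where y: "y \<in> K" "r y = h + h'" "z = \<psi> y" by blast
      have d: "y - x \<in> K" by (rule cvs.subspace_diff[OF K y(1) x(1)])
      have "z = \<psi> x \<oplus>\<^bsub>N\<^esub> \<psi> (y - x)" using vparamD(5)[OF P x(1) d] y(3) by simp
      moreover have "r (y - x) = h'" using rd[OF y(1) x(1)] y x by simp
      ultimately show "z \<in> ?c h <+>\<^bsub>N\<^esub> ?c h'" unfolding set_add_def' using x d by blast
    qed
    then show "?c (h + h') = ?c h \<oplus>\<^bsub>quotient_space N (\<psi> ` J)\<^esub> ?c h'" by (simp add: quotient_space_def)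
  qed
qed

instantiation prod :: (cvs, cvs) cvs
begin
definition csc_prod :: "complex \<Rightarrow> 'a \<times> 'b \<Rightarrow> 'a \<times> 'b" where "csc_prod c p = (c *\<^sub>c fst p, c *\<^sub>c snd p)"
instance by standard (simp_all add: csc_prod_def prod_eq_iff csc_add_right csc_add_left csc_csc csc_one)
end

subsection \<open>Transfer of algebras and modules\<close>

locale leibalg =
  fixes K :: "'v::cvs set" and br :: "'v \<Rightarrow> 'v \<Rightarrow> 'v"
  assumes K_fds: "fds K"
    and br_left: "clin (\<lambda>x. br x y)"
    and br_right: "clin (br x)"
    and br_closed: "x \<in> K \<Longrightarrow> y \<in> K \<Longrightarrow> br x y \<in> K"
    and leibniz: "x \<in> K \<Longrightarrow> y \<in> K \<Longrightarrow> z \<in> K \<Longrightarrow> br x (br y z) = br (br x y) z - br (br x z) y"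
begin

lemmas K_sub = fds_subspace[OF K_fds]
lemmas br_simps = clin_simps[OF br_left] clin_simps[OF br_right]

lemma leibalg_sub:
  assumes "subalg br H K" shows "leibalg H br"
proof -
  have H: "cvs.subspace H" "H \<subseteq> K" "\<And>x y. x \<in> H \<Longrightarrow> y \<in> H \<Longrightarrow> br x y \<in> H"
    using assms by (auto simp: subalg_def)
  show ?thesis
    by (rule leibalg.intro)
      (rule fds_mono[OF K_fds H(1,2)] br_left br_right H(3)
        leibniz[OF subsetD[OF H(2)] subsetD[OF H(2)] subsetD[OF H(2)]]; assumption?)+
qed

end

definition aparam ::
  "('a, 'x) bracket_algebra_scheme \<Rightarrow> 'v::cvs set \<Rightarrow> ('v \<Rightarrow> 'a) \<Rightarrow> ('v \<Rightarrow> 'v \<Rightarrow> 'v) \<Rightarrow> bool" where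
  "aparam N K \<psi> br \<longleftrightarrow> vparam N K \<psi> \<and> (\<forall>x\<in>K. \<forall>y\<in>K. \<lbrace>\<psi> x, \<psi> y\<rbrace>\<^bsub>N\<^esub> = \<psi> (br x y))"

lemma aparamD:
  assumes "aparam N K \<psi> br"
  shows "vparam N K \<psi>" "x \<in> K \<Longrightarrow> y \<in> K \<Longrightarrow> \<lbrace>\<psi> x, \<psi> y\<rbrace>\<^bsub>N\<^esub> = \<psi> (br x y)"
  using assms by (simp_all add: aparam_def)

lemma aparam_sub:
  assumes "aparam N K \<psi> br" "cvs.subspace H" "H \<subseteq> K"
  shows "aparam (N\<lparr>carrier := \<psi> ` H\<rparr>) H \<psi> br"
  using assms vparam_sub[OF _ assms(2,3)] by (auto simp: aparam_def subset_iff)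

lemma leibalg_of_liealg: "liealg G br \<Longrightarrow> leibalg G br"
  by (auto simp: liealg_def leibalg_def)

lemma aparam_leibniz_algebra:
  assumes P: "aparam N K \<psi> br" and K: "leibalg K br"
  shows "leibniz_algebra N"
proof -
  interpret leibalg K br by (rule K)
  note v = aparamD(1)[OF P]
  note c = vparamD(2)[OF v] and a = vparamD(5)[OF v] and s = vparamD(6)[OF v] and b = aparamD(2)[OF P]
    and m = vparam_minus[OF v]
  note cl = cvs.subspace_add[OF K_sub] cvs.subspace_scale[OF K_sub] br_closed
  show ?thesis
  proof (intro leibniz_algebra.intro leibniz_algebra_axioms.intro)
    show "vectorspace complex_field N" by (rule vparam_vectorspace[OF v])
    show "vectorspace.fin_dim complex_field N" by (rule vparam_fin_dim[OF v K_fds])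
    fix x y z d assume "x \<in> carrier N" "y \<in> carrier N"
    then obtain x' y' where xy: "x' \<in> K" "x = \<psi> x'" "y' \<in> K" "y = \<psi> y'" unfolding c by blast
    show "\<lbrace>x, y\<rbrace>\<^bsub>N\<^esub> \<in> carrier N" using xy b cl by (simp add: c)
    show "\<lbrace>d \<odot>\<^bsub>N\<^esub> x, y\<rbrace>\<^bsub>N\<^esub> = d \<odot>\<^bsub>N\<^esub> \<lbrace>x, y\<rbrace>\<^bsub>N\<^esub>" using xy by (simp add: b s cl br_simps)
    show "\<lbrace>x, d \<odot>\<^bsub>N\<^esub> y\<rbrace>\<^bsub>N\<^esub> = d \<odot>\<^bsub>N\<^esub> \<lbrace>x, y\<rbrace>\<^bsub>N\<^esub>" using xy by (simp add: b s cl br_simps)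
    assume "z \<in> carrier N"
    then obtain z' where z: "z' \<in> K" "z = \<psi> z'" unfolding c by blast
    show "\<lbrace>x \<oplus>\<^bsub>N\<^esub> y, z\<rbrace>\<^bsub>N\<^esub> = \<lbrace>x, z\<rbrace>\<^bsub>N\<^esub> \<oplus>\<^bsub>N\<^esub> \<lbrace>y, z\<rbrace>\<^bsub>N\<^esub>" using xy z by (simp add: a b cl br_simps)
    show "\<lbrace>x, y \<oplus>\<^bsub>N\<^esub> z\<rbrace>\<^bsub>N\<^esub> = \<lbrace>x, y\<rbrace>\<^bsub>N\<^esub> \<oplus>\<^bsub>N\<^esub> \<lbrace>x, z\<rbrace>\<^bsub>N\<^esub>" using xy z by (simp add: a b cl br_simps)
    show "\<lbrace>x, \<lbrace>y, z\<rbrace>\<^bsub>N\<^esub>\<rbrace>\<^bsub>N\<^esub> = \<lbrace>\<lbrace>x, y\<rbrace>\<^bsub>N\<^esub>, z\<rbrace>\<^bsub>N\<^esub> \<ominus>\<^bsub>N\<^esub> \<lbrace>\<lbrace>x, z\<rbrace>\<^bsub>N\<^esub>, y\<rbrace>\<^bsub>N\<^esub>"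
      using xy z by (simp add: b cl m leibniz)
  qed
qed

lemma aparam_lie_algebra:
  assumes P: "aparam N G \<psi> br" and G: "liealg G br"
  shows "lie_algebra N"
proof (intro lie_algebra.intro lie_algebra_axioms.intro)
  interpret liealg G br by (rule G)
  show "leibniz_algebra N" by (rule aparam_leibniz_algebra[OF P leibalg_of_liealg[OF G]])
  note v = aparamD(1)[OF P]
  fix x assume "x \<in> carrier N"
  then obtain x' where "x' \<in> G" "x = \<psi> x'" using vparamD(2)[OF v] by blast
  then show "\<lbrace>x, x\<rbrace>\<^bsub>N\<^esub> = \<zero>\<^bsub>N\<^esub>" using aparamD(2)[OF P] vparamD(4)[OF v] br_self by simp
qed

lemma aparam_ex:
  assumes "leibniz_algebra N"
  obtains n \<psi> br where "aparam N (coord_space n) \<psi> br" "leibalg (coord_space n) br"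
proof -
  interpret N: leibniz_algebra N by (rule assms)
  obtain n \<psi> where v: "vparam N (coord_space n) \<psi>"
    by (rule vparam_ex[OF N.vectorspace_axioms N.fin_dim])
  let ?K = "coord_space n"
  have Ks: "cvs.subspace ?K" by (rule vparamD(1)[OF v])
  note P = proj[OF Ks]
  define \<phi> where "\<phi> = inv_into ?K \<psi>"
  have \<phi>\<psi>: "\<phi> (\<psi> x) = x" if "x \<in> ?K" for x using inv_into_f_f[OF vparamD(3)[OF v] that] by (simp add: \<phi>_def)
  have \<psi>\<phi>: "\<psi> (\<phi> a) = a" and \<phi>K: "\<phi> a \<in> ?K" if "a \<in> carrier N" for a
    using that vparamD(2)[OF v] by (auto simp: \<phi>_def f_inv_into_f inv_into_into)
  have \<phi>_add: "\<phi> (a \<oplus>\<^bsub>N\<^esub> b) = \<phi> a + \<phi> b" if "a \<in> carrier N" "b \<in> carrier N" for a b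
  proof -
    have "a \<oplus>\<^bsub>N\<^esub> b = \<psi> (\<phi> a + \<phi> b)" using vparamD(5)[OF v \<phi>K[OF that(1)] \<phi>K[OF that(2)]] \<psi>\<phi> that by simp
    then show ?thesis using \<phi>\<psi> cvs.subspace_add[OF Ks \<phi>K[OF that(1)] \<phi>K[OF that(2)]] by simp
  qed
  have \<phi>_scale: "\<phi> (c \<odot>\<^bsub>N\<^esub> a) = c *\<^sub>c \<phi> a" if "a \<in> carrier N" for a c
  proof -
    have "c \<odot>\<^bsub>N\<^esub> a = \<psi> (c *\<^sub>c \<phi> a)" using vparamD(6)[OF v \<phi>K[OF that]] \<psi>\<phi> that by simp
    then show ?thesis using \<phi>\<psi> cvs.subspace_scale[OF Ks \<phi>K[OF that]] by simp
  qed
  \<comment> \<open>Projecting both arguments first extends the transported bracket bilinearly to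
    all functions, as \<open>leibalg\<close> demands.\<close>
  define br where "br x y = \<phi> \<lbrace>\<psi> (proj ?K x), \<psi> (proj ?K y)\<rbrace>\<^bsub>N\<^esub>" for x y
  have pc: "\<psi> (proj ?K x) \<in> carrier N" for x using P(2) vparamD(2)[OF v] by blast
  have pa: "\<psi> (proj ?K (x + y)) = \<psi> (proj ?K x) \<oplus>\<^bsub>N\<^esub> \<psi> (proj ?K y)" for x y
    using vparamD(5)[OF v P(2) P(2)] by (simp add: clin_add[OF P(1)])
  have ps: "\<psi> (proj ?K (c *\<^sub>c x)) = c \<odot>\<^bsub>N\<^esub> \<psi> (proj ?K x)" for x c
    using vparamD(6)[OF v P(2)] by (simp add: clin_scale[OF P(1)])
  have \<psi>br: "\<psi> (br x y) = \<lbrace>\<psi> x, \<psi> y\<rbrace>\<^bsub>N\<^esub>" if "x \<in> ?K" "y \<in> ?K" for x y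
  proof -
    have "\<psi> x \<in> carrier N" "\<psi> y \<in> carrier N" using that vparamD(2)[OF v] by auto
    from \<psi>\<phi>[OF N.bracket_closed[OF this]] show ?thesis using P(3) that by (simp add: br_def)
  qed
  have brK: "br x y \<in> ?K" for x y unfolding br_def by (rule \<phi>K[OF N.bracket_closed[OF pc pc]])
  have "aparam N ?K \<psi> br" using v \<psi>br by (simp add: aparam_def)
  moreover have "leibalg ?K br"
  proof (rule leibalg.intro)
    show "fds ?K" by (rule coord_space)
    show "clin (\<lambda>x. br x y)" for y
      by (rule clinI) (simp_all add: br_def pa ps N.bracket_add_left N.bracket_smult_left pc \<phi>_add \<phi>_scale N.bracket_closed)
    show "clin (br x)" for x
      by (rule clinI) (simp_all add: br_def pa ps N.bracket_add_right N.bracket_smult_right pc \<phi>_add \<phi>_scale N.bracket_closed)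
    show "br x y \<in> ?K" for x y by (rule brK)
    fix x y z assume xyz: "x \<in> ?K" "y \<in> ?K" "z \<in> ?K"
    then have c: "\<psi> x \<in> carrier N" "\<psi> y \<in> carrier N" "\<psi> z \<in> carrier N" using vparamD(2)[OF v] by auto
    have "\<psi> (br x (br y z)) = \<psi> (br (br x y) z - br (br x z) y)"
      using N.leibniz_identity[OF c] xyz brK by (simp add: \<psi>br vparam_minus[OF v, symmetric])
    then show "br x (br y z) = br (br x y) z - br (br x z) y"
      using inj_onD[OF vparamD(3)[OF v]] brK cvs.subspace_diff[OF Ks] by blast
  qed
  ultimately show ?thesis by (rule that)
qed

lemma aparam_bracket_span:
  assumes P: "aparam N K \<psi> br" and K: "leibalg K br" and A: "A \<subseteq> K" and B: "B \<subseteq> K"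
  shows "bracket_span N (\<psi> ` A) (\<psi> ` B) = \<psi> ` cvs.span {br a b | a b. a \<in> A \<and> b \<in> B}"
proof -
  interpret leibalg K br by (rule K)
  have "{\<lbrace>x, y\<rbrace>\<^bsub>N\<^esub> | x y. x \<in> \<psi> ` A \<and> y \<in> \<psi> ` B} = \<psi> ` {br a b | a b. a \<in> A \<and> b \<in> B}" (is "?l = ?r")
  proof (intro equalityI subsetI)
    fix z assume "z \<in> ?l"
    then obtain a b where "z = \<lbrace>\<psi> a, \<psi> b\<rbrace>\<^bsub>N\<^esub>" "a \<in> A" "b \<in> B" by blast
    moreover from this have "z = \<psi> (br a b)" using aparamD(2)[OF P, of a b] A B by blast
    ultimately show "z \<in> ?r" by blast
  next
    fix z assume "z \<in> ?r"
    then obtain a b where "z = \<psi> (br a b)" "a \<in> A" "b \<in> B" by blast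
    moreover from this have "z = \<lbrace>\<psi> a, \<psi> b\<rbrace>\<^bsub>N\<^esub>" using aparamD(2)[OF P, of a b] subsetD[OF A] subsetD[OF B] by simp
    ultimately show "z \<in> ?l" by blast
  qed
  moreover have "{br a b | a b. a \<in> A \<and> b \<in> B} \<subseteq> K" using br_closed A B by blast
  ultimately show ?thesis unfolding bracket_span_def using vparam_span[OF aparamD(1)[OF P]] by simp
qed

lemma aparam_leibniz_kernel:
  assumes P: "aparam N K \<psi> br" and K: "leibalg K br"
  shows "leibniz_kernel N = \<psi> ` cvs.span {br x x | x. x \<in> K}"
proof -
  interpret leibalg K br by (rule K)
  have "{\<lbrace>x, x\<rbrace>\<^bsub>N\<^esub> | x. x \<in> carrier N} = \<psi> ` {br x x | x. x \<in> K}"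
    unfolding vparamD(2)[OF aparamD(1)[OF P]] using aparamD(2)[OF P] by force
  moreover have "{br x x | x. x \<in> K} \<subseteq> K" using br_closed by blast
  ultimately show ?thesis unfolding leibniz_kernel_def using vparam_span[OF aparamD(1)[OF P]] by simp
qed

lemma aparam_bracket_ideal:
  assumes P: "aparam N K \<psi> br" and J: "cvs.subspace J" "J \<subseteq> K"
    "\<And>x y. x \<in> K \<Longrightarrow> y \<in> J \<Longrightarrow> br x y \<in> J" "\<And>x y. x \<in> J \<Longrightarrow> y \<in> K \<Longrightarrow> br x y \<in> J"
  shows "bracket_ideal (\<psi> ` J) N"
  unfolding bracket_ideal_def
proof (intro conjI ballI)
  note v = aparamD(1)[OF P]
  show "VectorSpace.subspace complex_field (\<psi> ` J) N" by (rule vparam_subspace[OF v J(1,2)])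
  fix x y assume "x \<in> carrier N" "y \<in> \<psi> ` J"
  then obtain x' y' where xy: "x = \<psi> x'" "y = \<psi> y'" "x' \<in> K" "y' \<in> J" using vparamD(2)[OF v] by blast
  then have "y' \<in> K" using J(2) by blast
  then show "\<lbrace>x, y\<rbrace>\<^bsub>N\<^esub> \<in> \<psi> ` J" "\<lbrace>y, x\<rbrace>\<^bsub>N\<^esub> \<in> \<psi> ` J"
    using xy aparamD(2)[OF P] J(3,4) by simp_all
qed

lemma aparam_bracket_ideal_ex:
  assumes P: "aparam N G \<psi> br" and G: "liealg G br" and X: "bracket_ideal X N"
  obtains J where "lie_ideal br J G" "X = \<psi> ` J"
proof -
  interpret liealg G br by (rule G)
  note v = aparamD(1)[OF P]
  have Xs: "VectorSpace.subspace complex_field X N" using X by (simp add: bracket_ideal_def)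
  obtain J where J: "cvs.subspace J" "J \<subseteq> G" "X = \<psi> ` J" by (rule vparam_subspace_ex[OF v Xs])
  have "br x y \<in> J" if x: "x \<in> J" and y: "y \<in> G" for x y
  proof -
    have xG: "x \<in> G" using x J(2) by blast
    have "\<lbrace>\<psi> x, \<psi> y\<rbrace>\<^bsub>N\<^esub> \<in> X" using X x y J(3) vparamD(2)[OF v] by (auto simp: bracket_ideal_def)
    then have "\<psi> (br x y) \<in> \<psi> ` J" using aparamD(2)[OF P xG y] J(3) by simp
    then show ?thesis using inj_on_image_mem_iff[OF vparamD(3)[OF v] br_closed[OF xG y] J(2)] by simp
  qed
  then show ?thesis using that[of J] J by (simp add: lie_ideal_def)
qed

primrec dser :: "('v::cvs \<Rightarrow> 'v \<Rightarrow> 'v) \<Rightarrow> 'v set \<Rightarrow> nat \<Rightarrow> 'v set" where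
  "dser br J 0 = J"
| "dser br J (Suc k) = cvs.span {br a b | a b. a \<in> dser br J k \<and> b \<in> dser br J k}"

lemma (in liealg) dser_ideal: "lie_ideal br J G \<Longrightarrow> lie_ideal br (dser br J k) G"
  by (induction k) (auto intro: ideal_span_br)

text \<open>If a term of the derived series is zero, the preceding term is an abelian ideal and so
  zero as well; descend to \<open>J\<close>.\<close>

lemma (in ssalg) solvable_ideal_zero:
  assumes "lie_ideal br J G" "dser br J k = {0}" shows "J = {0}"
  using assms(2)
proof (induction k)
  case (Suc k)
  have "dser br J k = {0}"
  proof (rule no_abelian[OF dser_ideal[OF assms(1)]])
    fix x y assume "x \<in> dser br J k" "y \<in> dser br J k"
    then have "br x y \<in> dser br J (Suc k)" unfolding dser.simps by (intro cvs.span_base) blast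
    then show "br x y = 0" using Suc(2) by simp
  qed
  then show ?case by (rule Suc.IH)
qed simp

lemma aparam_derived_series:
  assumes P: "aparam N G \<psi> br" and G: "liealg G br" and J: "lie_ideal br J G"
  shows "derived_series N (\<psi> ` J) k = \<psi> ` dser br J k"
proof (induction k)
  case (Suc k)
  interpret liealg G br by (rule G)
  have "dser br J k \<subseteq> G" using dser_ideal[OF J, of k] by (simp add: lie_ideal_def)
  then show ?case using Suc aparam_bracket_span[OF P leibalg_of_liealg[OF G]] by simp
qed simp

lemma aparam_semisimple_lie:
  assumes P: "aparam N G \<psi> br" and G: "ssalg G br"
  shows "semisimple_lie N"
  unfolding semisimple_lie_def
proof (intro conjI allI impI)
  interpret ssalg G br by (rule G)
  note v = aparamD(1)[OF P]
  show "lie_algebra N" by (rule aparam_lie_algebra[OF P liealg_axioms])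
  fix X assume X: "bracket_ideal X N \<and> (\<exists>k. derived_series N X k = {\<zero>\<^bsub>N\<^esub>})"
  then obtain k where k: "derived_series N X k = {\<zero>\<^bsub>N\<^esub>}" by blast
  have Xi: "bracket_ideal X N" using X by simp
  obtain J where J: "lie_ideal br J G" "X = \<psi> ` J" by (rule aparam_bracket_ideal_ex[OF P liealg_axioms Xi])
  have d: "\<psi> ` dser br J k = {\<psi> 0}" using k aparam_derived_series[OF P liealg_axioms J(1)] J(2) vparamD(4)[OF v] by simp
  have sub: "dser br J k \<subseteq> G" "0 \<in> G" using dser_ideal[OF J(1), of k] cvs.subspace_0[OF G_sub] by (auto simp: lie_ideal_def)
  have "x = 0" if "x \<in> dser br J k" for x
    using d that sub inj_onD[OF vparamD(3)[OF v], of x 0] by blast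
  moreover have "0 \<in> dser br J k" using dser_ideal[OF J(1), of k] cvs.subspace_0 by (auto simp: lie_ideal_def)
  ultimately have "dser br J k = {0}" by blast
  then have "J = {0}" by (rule solvable_ideal_zero[OF J(1)])
  then show "X = {\<zero>\<^bsub>N\<^esub>}" using J(2) vparamD(4)[OF v] by simp
qed

lemma aparam_ssalg:
  assumes P: "aparam N G \<psi> br" and G: "leibalg G br" and N: "semisimple_lie N"
  shows "ssalg G br"
proof -
  interpret leibalg G br by (rule G)
  interpret N: lie_algebra N using N by (simp add: semisimple_lie_def)
  note v = aparamD(1)[OF P]
  have inj: "x = y" if "x \<in> G" "y \<in> G" "\<psi> x = \<psi> y" for x y using inj_onD[OF vparamD(3)[OF v] that(3,1,2)] .
  have "liealg G br"
  proof (rule liealg.intro)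
    show "br x x = 0" if x: "x \<in> G" for x
    proof (rule inj[OF br_closed[OF x x] cvs.subspace_0[OF K_sub]])
      have "\<psi> x \<in> carrier N" using x vparamD(2)[OF v] by blast
      then show "\<psi> (br x x) = \<psi> 0" using N.bracket_self aparamD(2)[OF P x x] vparamD(4)[OF v] by simp
    qed
  qed (rule K_fds br_left br_right br_closed leibniz; assumption)+
  then interpret liealg G br .
  show ?thesis
  proof (intro ssalg.intro ssalg_axioms.intro liealg_axioms)
    fix J assume J: "lie_ideal br J G" and ab: "\<And>x y. x \<in> J \<Longrightarrow> y \<in> J \<Longrightarrow> br x y = 0"
    have Js: "cvs.subspace J" "J \<subseteq> G" using J by (auto simp: lie_ideal_def)
    have "bracket_ideal (\<psi> ` J) N"
      by (rule aparam_bracket_ideal[OF P Js]) (use ideal_left[OF J] J in \<open>auto simp: lie_ideal_def\<close>)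
    moreover have "derived_series N (\<psi> ` J) 1 = {\<zero>\<^bsub>N\<^esub>}"
    proof -
      have "{br a b | a b. a \<in> J \<and> b \<in> J} \<subseteq> {0}" using ab by blast
      then have "cvs.span {br a b | a b. a \<in> J \<and> b \<in> J} \<subseteq> {0}" by (rule cvs.span_minimal) simp
      then have "dser br J 1 = {0}" using cvs.span_zero by auto
      then show ?thesis using aparam_derived_series[OF P liealg_axioms J, of 1] vparamD(4)[OF v] by simp
    qed
    ultimately have "\<psi> ` J = {\<psi> 0}" using N vparamD(4)[OF v] unfolding semisimple_lie_def by metis
    then have "x = 0" if "x \<in> J" for x using that Js(2) inj[of x 0] cvs.subspace_0[OF G_sub] by blast
    then show "J = {0}" using cvs.subspace_0[OF Js(1)] by blast
  qed
qed

lemma aparam_simple_lie: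
  assumes P: "aparam N G \<psi> br" and G: "liealg G br" and xy: "x \<in> G" "y \<in> G" "br x y \<noteq> 0"
    and simple: "\<And>J. lie_ideal br J G \<Longrightarrow> J = {0} \<or> J = G"
  shows "simple_lie N"
  unfolding simple_lie_def
proof (intro conjI allI impI)
  interpret liealg G br by (rule G)
  note v = aparamD(1)[OF P]
  show "lie_algebra N" by (rule aparam_lie_algebra[OF P G])
  have "\<psi> (br x y) \<noteq> \<psi> 0"
    using xy inj_onD[OF vparamD(3)[OF v]] br_closed[OF xy(1,2)] cvs.subspace_0[OF G_sub] by blast
  then show "\<exists>x\<in>carrier N. \<exists>y\<in>carrier N. \<lbrace>x, y\<rbrace>\<^bsub>N\<^esub> \<noteq> \<zero>\<^bsub>N\<^esub>"
    using xy aparamD(2)[OF P xy(1,2)] vparamD(2,4)[OF v] by (intro bexI[of _ "\<psi> x"] bexI[of _ "\<psi> y"]) simp_all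
  fix X assume X: "bracket_ideal X N"
  obtain J where J: "lie_ideal br J G" "X = \<psi> ` J" by (rule aparam_bracket_ideal_ex[OF P G X])
  then show "X = {\<zero>\<^bsub>N\<^esub>} \<or> X = carrier N" using simple[OF J(1)] vparamD(2,4)[OF v] by auto
qed

section \<open>Modules, semidirect products and quotient algebras in coordinates\<close>

lemma aparam_lie_module:
  assumes P: "aparam N G \<psi> br" and V: "liemod G br V ac" and Q: "vparam M V \<chi>"
    and act: "\<And>v x. v \<in> V \<Longrightarrow> x \<in> G \<Longrightarrow> act M (\<chi> v) (\<psi> x) = \<chi> (ac v x)"
  shows "lie_module N M"
proof -
  interpret liemod G br V ac by (rule V)
  note v = aparamD(1)[OF P]
  note cl = cvs.subspace_add[OF V_sub] cvs.subspace_scale[OF V_sub] ac_closed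
    cvs.subspace_add[OF G_sub] cvs.subspace_scale[OF G_sub] br_closed
  note sim = act vparamD(5)[OF Q] vparamD(6)[OF Q] vparamD(5)[OF v] vparamD(6)[OF v] aparamD(2)[OF P] cl
    ac_left_simps vparam_minus[OF Q]
  show ?thesis
  proof (intro lie_module.intro lie_module_axioms.intro)
    show "lie_algebra N" by (rule aparam_lie_algebra[OF P liealg_axioms])
    show "vectorspace complex_field M" by (rule vparam_vectorspace[OF Q])
    show "vectorspace.fin_dim complex_field M" by (rule vparam_fin_dim[OF Q V_fds])
    fix m g c assume "m \<in> carrier M" "g \<in> carrier N"
    then obtain u x where u: "u \<in> V" "m = \<chi> u" and x: "x \<in> G" "g = \<psi> x"
      using vparamD(2)[OF Q] vparamD(2)[OF v] by blast
    note ar = clin_add[OF ac_right[OF u(1)]] clin_scale[OF ac_right[OF u(1)]]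
    show "act M m g \<in> carrier M" using u x by (simp add: sim vparamD(2)[OF Q])
    show "act M (c \<odot>\<^bsub>M\<^esub> m) g = c \<odot>\<^bsub>M\<^esub> act M m g" using u x by (simp add: sim)
    show "act M m (c \<odot>\<^bsub>N\<^esub> g) = c \<odot>\<^bsub>M\<^esub> act M m g" using u x by (simp add: sim ar)
    {
      fix m' assume "m' \<in> carrier M"
      then obtain u' where "u' \<in> V" "m' = \<chi> u'" using vparamD(2)[OF Q] by blast
      then show "act M (m \<oplus>\<^bsub>M\<^esub> m') g = act M m g \<oplus>\<^bsub>M\<^esub> act M m' g" using u x by (simp add: sim)
    }
    fix h assume "h \<in> carrier N"
    then obtain y where "y \<in> G" "h = \<psi> y" using vparamD(2)[OF v] by blast
    then show "act M m (g \<oplus>\<^bsub>N\<^esub> h) = act M m g \<oplus>\<^bsub>M\<^esub> act M m h"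
      "act M m \<lbrace>g, h\<rbrace>\<^bsub>N\<^esub> = act M (act M m g) h \<ominus>\<^bsub>M\<^esub> act M (act M m h) g"
      using u x by (simp_all add: sim ar ac_br)
  qed
qed

lemma aparam_irreducible_module:
  assumes P: "aparam N G \<psi> br" and V: "liemod G br V ac" and Q: "vparam M V \<chi>"
    and act: "\<And>v x. v \<in> V \<Longrightarrow> x \<in> G \<Longrightarrow> act M (\<chi> v) (\<psi> x) = \<chi> (ac v x)"
    and irr: "irrep G ac V"
  shows "irreducible_module N M"
  unfolding irreducible_module_def
proof (intro conjI allI impI)
  interpret liemod G br V ac by (rule V)
  note v = aparamD(1)[OF P]
  show "lie_module N M" by (rule aparam_lie_module[OF P V Q]) (rule act)
  have V0: "0 \<in> V" by (rule cvs.subspace_0[OF V_sub])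
  show "carrier M \<noteq> {\<zero>\<^bsub>M\<^esub>}"
  proof
    assume e: "carrier M = {\<zero>\<^bsub>M\<^esub>}"
    have "x = 0" if x: "x \<in> V" for x
    proof -
      have "\<chi> x = \<chi> 0" using e x vparamD(2,4)[OF Q] by auto
      then show ?thesis using inj_onD[OF vparamD(3)[OF Q]] x V0 by blast
    qed
    then show False using irrepD(2)[OF irr] V0 by blast
  qed
  fix X assume X: "VectorSpace.subspace complex_field X M \<and> (\<forall>w\<in>X. \<forall>g\<in>carrier N. act M w g \<in> X)"
  then have Xs: "VectorSpace.subspace complex_field X M" by simp
  obtain U where U: "cvs.subspace U" "U \<subseteq> V" "X = \<chi> ` U" by (rule vparam_subspace_ex[OF Q Xs])
  have "ac u x \<in> U" if u: "u \<in> U" and x: "x \<in> G" for u x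
  proof -
    have uV: "u \<in> V" using u U(2) by blast
    have "act M (\<chi> u) (\<psi> x) \<in> X" using X u x U(3) vparamD(2)[OF v] by auto
    then have "\<chi> (ac u x) \<in> \<chi> ` U" using act[OF uV x] U(3) by simp
    then show ?thesis using inj_on_image_mem_iff[OF vparamD(3)[OF Q] ac_closed[OF uV x] U(2)] by simp
  qed
  then have "submod G ac U" using U(1) by (simp add: submod_def)
  then have "U = {0} \<or> U = V" by (rule irrepD(3)[OF irr _ U(2)])
  then show "X = {\<zero>\<^bsub>M\<^esub>} \<or> X = carrier M" using U(3) vparamD(2,4)[OF Q] by auto
qed

lemma bracket_module_simps [simp]:
  "carrier (bracket_module L W) = W" "zero (bracket_module L W) = zero L" "add (bracket_module L W) = add L"
  "Module.module.smult (bracket_module L W) = Module.module.smult L" "act (bracket_module L W) = bracket L"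
  by (simp_all add: bracket_module_def module.extend_def module.truncate_def right_module.fields_def)

lemma vparam_bracket_module:
  assumes P: "vparam L K \<psi>" and W: "cvs.subspace W" "W \<subseteq> K"
  shows "vparam (bracket_module L (\<psi> ` W)) W \<psi>"
  using vparam_sub[OF assms] by (simp add: vparam_def)

lemma semidirect_simps [simp]:
  "carrier (semidirect G V) = carrier G \<times> carrier V" "zero (semidirect G V) = (zero G, zero V)"
  "add (semidirect G V) = (\<lambda>v w. (fst v \<oplus>\<^bsub>G\<^esub> fst w, snd v \<oplus>\<^bsub>V\<^esub> snd w))"
  "Module.module.smult (semidirect G V) = (\<lambda>c v. (c \<odot>\<^bsub>G\<^esub> fst v, c \<odot>\<^bsub>V\<^esub> snd v))"
  "bracket (semidirect G V) = (\<lambda>(g, v) (h, w). (\<lbrace>g, h\<rbrace>\<^bsub>G\<^esub>, act V v h))"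
  by (simp_all add: semidirect_def module.extend_def bracket_algebra.fields_def direct_sum_def)

text \<open>Brackets with a right argument in \<open>I\<close> vanish, so the bracket of
  \<open>g + u\<close> with \<open>h + w\<close> is \<open>br g h + br u h\<close>, the semidirect
  product formula. Both algebras are parametrized by \<open>G \<times> I\<close>.\<close>

lemma semidirect_iso:
  assumes P: "aparam L K \<psi> br" and K: "leibalg K br"
    and G: "cvs.subspace G" "G \<subseteq> K" and I: "cvs.subspace I" "I \<subseteq> K" "G \<inter> I = {0}"
    and GI: "\<And>x. x \<in> K \<Longrightarrow> \<exists>g\<in>G. \<exists>v\<in>I. x = g + v"
    and zero: "\<And>x v. x \<in> K \<Longrightarrow> v \<in> I \<Longrightarrow> br x v = 0"
    and cl: "\<And>x y. x \<in> G \<Longrightarrow> y \<in> G \<Longrightarrow> br x y \<in> G" "\<And>v x. v \<in> I \<Longrightarrow> x \<in> G \<Longrightarrow> br v x \<in> I"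
  shows "algebra_iso (semidirect (L\<lparr>carrier := \<psi> ` G\<rparr>) (bracket_module L (\<psi> ` I))) L (\<lambda>(g, v). g \<oplus>\<^bsub>L\<^esub> v)"
    (is "algebra_iso ?S L ?f")
proof -
  interpret leibalg K br by (rule K)
  note v = aparamD(1)[OF P]
  have prod: "cvs.subspace (G \<times> I)"
    by (rule cvs.subspaceI) (use G(1) I(1) cvs.subspace_0 cvs.subspace_add cvs.subspace_scale in
      \<open>auto simp: zero_prod_def plus_prod_def csc_prod_def\<close>)
  have inG: "inj_on \<psi> G" "inj_on \<psi> I" using inj_on_subset[OF vparamD(3)[OF v]] G(2) I(2) by blast+
  have S: "vparam ?S (G \<times> I) (map_prod \<psi> \<psi>)"
    unfolding vparam_def
  proof (intro conjI ballI allI)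
    show "bij_betw (map_prod \<psi> \<psi>) (G \<times> I) (carrier ?S)"
      using map_prod_inj_on[OF inG] by (simp add: bij_betw_def map_prod_surj_on[OF refl refl])
    show "\<zero>\<^bsub>?S\<^esub> = map_prod \<psi> \<psi> 0" using vparamD(4)[OF v] by (simp add: zero_prod_def)
    fix p assume p: "p \<in> G \<times> I"
    then have p': "fst p \<in> K" "snd p \<in> K" using G I by auto
    show "map_prod \<psi> \<psi> (c *\<^sub>c p) = c \<odot>\<^bsub>?S\<^esub> map_prod \<psi> \<psi> p" for c
      using vparamD(6)[OF v p'(1)] vparamD(6)[OF v p'(2)] by (simp add: csc_prod_def map_prod_def split_beta)
    fix q assume q: "q \<in> G \<times> I"
    then have q': "fst q \<in> K" "snd q \<in> K" using G I by auto
    show "map_prod \<psi> \<psi> (p + q) = map_prod \<psi> \<psi> p \<oplus>\<^bsub>?S\<^esub> map_prod \<psi> \<psi> q"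
      using vparamD(5)[OF v p'(1) q'(1)] vparamD(5)[OF v p'(2) q'(2)] by (simp add: plus_prod_def map_prod_def split_beta)
  qed (rule prod)
  have L: "vparam L (G \<times> I) (\<lambda>p. \<psi> (fst p + snd p))" unfolding vparam_def
  proof (intro conjI ballI allI)
    have mem: "fst p + snd p \<in> K" if "p \<in> G \<times> I" for p
      using that subsetD[OF G(2)] subsetD[OF I(2)] cvs.subspace_add[OF K_sub] by auto
    show "bij_betw (\<lambda>p. \<psi> (fst p + snd p)) (G \<times> I) (carrier L)" unfolding bij_betw_def
    proof
      show "inj_on (\<lambda>p. \<psi> (fst p + snd p)) (G \<times> I)"
      proof (rule inj_onI)
        fix p q assume p: "p \<in> G \<times> I" and q: "q \<in> G \<times> I" and e: "\<psi> (fst p + snd p) = \<psi> (fst q + snd q)"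
        have "fst p + snd p = fst q + snd q" using inj_onD[OF vparamD(3)[OF v] e mem[OF p] mem[OF q]] .
        then have d: "fst p - fst q = snd q - snd p" by (simp add: algebra_simps)
        moreover have "fst p - fst q \<in> G" "snd q - snd p \<in> I" using p q cvs.subspace_diff[OF G(1)] cvs.subspace_diff[OF I(1)] by auto
        ultimately have "fst p - fst q \<in> G \<inter> I" by simp
        then have "fst p - fst q = 0" using I(3) by simp
        then show "p = q" using d by (simp add: prod_eq_iff)
      qed
      show "(\<lambda>p. \<psi> (fst p + snd p)) ` (G \<times> I) = carrier L" unfolding vparamD(2)[OF v]
      proof (intro equalityI subsetI)
        fix z assume "z \<in> \<psi> ` K"
        then obtain x where x: "x \<in> K" "z = \<psi> x" by blast
        then obtain g u where "g \<in> G" "u \<in> I" "x = g + u" using GI by blast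
        then show "z \<in> (\<lambda>p. \<psi> (fst p + snd p)) ` (G \<times> I)" using x by (intro image_eqI[of _ _ "(g, u)"]) auto
      qed (use mem in blast)
    qed
    show "\<zero>\<^bsub>L\<^esub> = \<psi> (fst 0 + snd 0)" using vparamD(4)[OF v] by simp
    fix p assume p: "p \<in> G \<times> I"
    show "\<psi> (fst (c *\<^sub>c p) + snd (c *\<^sub>c p)) = c \<odot>\<^bsub>L\<^esub> \<psi> (fst p + snd p)" for c
      using vparamD(6)[OF v mem[OF p]] by (simp add: csc_prod_def cvs.scale_right_distrib)
    fix q assume q: "q \<in> G \<times> I"
    show "\<psi> (fst (p + q) + snd (p + q)) = \<psi> (fst p + snd p) \<oplus>\<^bsub>L\<^esub> \<psi> (fst q + snd q)"
      using vparamD(5)[OF v mem[OF p] mem[OF q]] by (simp add: algebra_simps)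
  qed (rule prod)
  have f: "?f (map_prod \<psi> \<psi> p) = \<psi> (fst p + snd p)" if "p \<in> G \<times> I" for p
    using that subsetD[OF G(2)] subsetD[OF I(2)] vparamD(5)[OF v] by auto
  show ?thesis unfolding algebra_iso_def
  proof (intro conjI ballI)
    show "linear_map complex_field ?S L ?f" "bij_betw ?f (carrier ?S) (carrier L)"
      by (rule vparam_linear_map[OF S L f], assumption)+
    fix s t assume "s \<in> carrier ?S" "t \<in> carrier ?S"
    then obtain g u h w where gu: "g \<in> G" "u \<in> I" "h \<in> G" "w \<in> I" "s = (\<psi> g, \<psi> u)" "t = (\<psi> h, \<psi> w)" by auto
    then have inK0: "g \<in> K" "u \<in> K" "h \<in> K" "w \<in> K" using G(2) I(2) by blast+
    then have inK: "g \<in> K" "u \<in> K" "h \<in> K" "w \<in> K" "br g h \<in> K" "br u h \<in> K" "g + u \<in> K" "h + w \<in> K"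
      by (simp_all add: br_closed cvs.subspace_add[OF K_sub])
    have "br (g + u) (h + w) = br g h + br u h" using zero[OF _ gu(4)] inK by (simp add: br_simps)
    then show "?f \<lbrace>s, t\<rbrace>\<^bsub>?S\<^esub> = \<lbrace>?f s, ?f t\<rbrace>\<^bsub>L\<^esub>"
      using inK by (simp add: gu aparamD(2)[OF P] vparamD(5)[OF v])
  qed
qed

lemma quotient_algebra_simps:
  "carrier (quotient_algebra L J) = carrier (quotient_space L J)" "zero (quotient_algebra L J) = zero (quotient_space L J)"
  "add (quotient_algebra L J) = add (quotient_space L J)" "Module.module.smult (quotient_algebra L J) = Module.module.smult (quotient_space L J)"
  "bracket (quotient_algebra L J) = (\<lambda>X Y. \<Union>x\<in>X. \<Union>y\<in>Y. J +>\<^bsub>L\<^esub> \<lbrace>x, y\<rbrace>\<^bsub>L\<^esub>)"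
  by (simp_all add: quotient_algebra_def module.extend_def bracket_algebra.fields_def)

text \<open>The projection \<open>r\<close> onto \<open>H\<close> along the ideal \<open>J\<close>
  respects brackets and has kernel \<open>J\<close>, so the liezation is a copy of \<open>H\<close>.
  The criterion is applied to ideals of \<open>L\<close>, whose own kernel has to be identified
  first.\<close>

lemma semisimple_leibniz_of_split:
  assumes P: "aparam N K \<psi> br" and K: "leibalg K br"
    and J: "J = cvs.span {br x x | x. x \<in> K}"
    and H: "ssalg H br" "H \<subseteq> K" "H \<inter> J = {0}" and HJ: "\<And>x. x \<in> K \<Longrightarrow> \<exists>h\<in>H. \<exists>j\<in>J. x = h + j"
    and cl: "\<And>x y. x \<in> K \<Longrightarrow> y \<in> J \<Longrightarrow> br x y \<in> J" "\<And>x y. x \<in> J \<Longrightarrow> y \<in> K \<Longrightarrow> br x y \<in> J"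
  shows "semisimple_leibniz N"
  unfolding semisimple_leibniz_def
proof
  interpret leibalg K br by (rule K)
  interpret H: ssalg H br by (rule H(1))
  note v = aparamD(1)[OF P]
  show "leibniz_algebra N" by (rule aparam_leibniz_algebra[OF P K])
  have kerN: "leibniz_kernel N = \<psi> ` J" using aparam_leibniz_kernel[OF P K] J by simp
  have Js: "cvs.subspace J" using J by simp
  have JK: "J \<subseteq> K" unfolding J by (rule cvs.span_minimal[OF _ K_sub]) (use br_closed in blast)
  obtain r where r: "clin r" "\<And>x. r x \<in> H" "\<And>x. x \<in> H \<Longrightarrow> r x = x" "\<And>x. x \<in> J \<Longrightarrow> r x = 0"
    using projection_along_ex[OF H.G_sub Js] H(3) by blast
  have rJ: "x - r x \<in> J" if x: "x \<in> K" for x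
  proof -
    obtain h j where "h \<in> H" "j \<in> J" "x = h + j" using HJ[OF x] by blast
    then show ?thesis using r by (simp add: clin_simps)
  qed
  have ker: "r x = 0 \<longleftrightarrow> x \<in> J" if x: "x \<in> K" for x using rJ[OF x] r(4) by auto
  have img: "r ` K = H" using r(2,3) H(2) by force
  let ?\<chi> = "\<lambda>h. \<psi> ` {x \<in> K. r x = h}"
  have Q: "vparam (quotient_space N (\<psi> ` J)) H ?\<chi>"
    by (rule vparam_quotient(1)[OF v JK H.G_sub _ _ img ker]) (simp_all add: clin_simps[OF r(1)])
  have cos: "(\<psi> ` J) +>\<^bsub>N\<^esub> \<psi> x = ?\<chi> (r x)" if "x \<in> K" for x
    by (rule vparam_quotient(2)[OF v JK H.G_sub _ _ img ker that]) (simp_all add: clin_simps[OF r(1)])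
  have rbr: "r (br x y) = br (r x) (r y)" if x: "x \<in> K" and y: "y \<in> K" for x y
  proof -
    have "br x y = br (r x) (r y) + (br (r x) (y - r y) + br (x - r x) y)" by (simp add: br_simps)
    moreover have inJ: "br (r x) (y - r y) + br (x - r x) y \<in> J"
      using cl(1)[OF _ rJ[OF y]] cl(2)[OF rJ[OF x] y] r(2) H(2) by (intro cvs.subspace_add[OF Js]) blast+
    ultimately have "r (br x y) = r (br (r x) (r y)) + r (br (r x) (y - r y) + br (x - r x) y)"
      using clin_add[OF r(1)] by metis
    then have "r (br x y) = r (br (r x) (r y))" using r(4)[OF inJ] by simp
    then show ?thesis using r(3) H.br_closed[OF r(2) r(2)] by simp
  qed
  have "aparam (quotient_algebra N (\<psi> ` J)) H ?\<chi> br" unfolding aparam_def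
  proof (intro conjI ballI)
    show "vparam (quotient_algebra N (\<psi> ` J)) H ?\<chi>" using Q by (simp add: vparam_def quotient_algebra_simps)
    fix h h' assume h: "h \<in> H" "h' \<in> H"
    have "\<lbrace>?\<chi> h, ?\<chi> h'\<rbrace>\<^bsub>quotient_algebra N (\<psi> ` J)\<^esub> =
        (\<Union>x\<in>{x \<in> K. r x = h}. \<Union>y\<in>{y \<in> K. r y = h'}. (\<psi> ` J) +>\<^bsub>N\<^esub> \<lbrace>\<psi> x, \<psi> y\<rbrace>\<^bsub>N\<^esub>)"
      by (simp add: quotient_algebra_simps)
    also have "\<dots> = (\<Union>x\<in>{x \<in> K. r x = h}. \<Union>y\<in>{y \<in> K. r y = h'}. ?\<chi> (br h h'))"
    proof (intro SUP_cong refl)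
      fix x y assume "x \<in> {x \<in> K. r x = h}" "y \<in> {y \<in> K. r y = h'}"
      then show "(\<psi> ` J) +>\<^bsub>N\<^esub> \<lbrace>\<psi> x, \<psi> y\<rbrace>\<^bsub>N\<^esub> = ?\<chi> (br h h')"
        using aparamD(2)[OF P, of x y] cos[OF br_closed, of x y] rbr[of x y] by simp
    qed
    also have "\<dots> = ?\<chi> (br h h')" using h r(3) H(2) by blast
    finally show "\<lbrace>?\<chi> h, ?\<chi> h'\<rbrace>\<^bsub>quotient_algebra N (\<psi> ` J)\<^esub> = ?\<chi> (br h h')" .
  qed
  then show "semisimple_lie (quotient_algebra N (leibniz_kernel N))"
    unfolding kerN by (rule aparam_semisimple_lie[OF _ H(1)])
qed

subsection \<open>Tensor products\<close>

text \<open>A multilinear \<open>\<mu>\<close> that takes tuples of basis vectors to a basis of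
  \<open>W\<close> makes \<open>W\<close> a model of the tensor product. The aim is to identify
  \<open>W\<close> with the quotient of the free space by the multilinear relations.\<close>

locale tensor_decomp =
  fixes A :: "'i set" and Vc :: "'i \<Rightarrow> 'v::cvs set" and W :: "'w::cvs set" and \<mu> :: "('i \<Rightarrow> 'v) \<Rightarrow> 'w"
    and V :: "'i \<Rightarrow> (complex, 'b, 'y) module_scheme" and \<chi> :: "'v \<Rightarrow> 'b" and B :: "'i \<Rightarrow> 'v set"
  assumes A_fin: "finite A"
    and V_param: "\<And>j. j \<in> A \<Longrightarrow> vparam (V j) (Vc j) \<chi>"
    and B_basis: "\<And>j. j \<in> A \<Longrightarrow> is_basis (Vc j) (B j)"
    and mu_ml: "multilinear_on A Vc \<mu>"
    and mu_W: "\<And>v. v \<in> Pi\<^sub>E A Vc \<Longrightarrow> \<mu> v \<in> W"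
    and mu_basis: "basis_family W (Pi\<^sub>E A B) \<mu>"
    and W_sub: "cvs.subspace W"
begin

abbreviation tuples :: "('i \<Rightarrow> 'b) set" where "tuples \<equiv> (\<Pi>\<^sub>E i\<in>A. carrier (V i))"

definition tup :: "('i \<Rightarrow> 'v) \<Rightarrow> 'i \<Rightarrow> 'b" where "tup v = (\<lambda>j\<in>A. \<chi> (v j))"

definition untup :: "('i \<Rightarrow> 'b) \<Rightarrow> 'i \<Rightarrow> 'v" where "untup u = (\<lambda>j\<in>A. inv_into (Vc j) \<chi> (u j))"

lemma Vc_sub: "j \<in> A \<Longrightarrow> cvs.subspace (Vc j)" by (rule vparamD(1)[OF V_param])
lemma V_carrier: "j \<in> A \<Longrightarrow> carrier (V j) = \<chi> ` Vc j" by (rule vparamD(2)[OF V_param])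

lemma tup_mem: "v \<in> Pi\<^sub>E A Vc \<Longrightarrow> tup v \<in> tuples"
  by (auto simp: tup_def V_carrier PiE_iff)

lemma untup_mem: "u \<in> tuples \<Longrightarrow> untup u \<in> Pi\<^sub>E A Vc"
  by (auto simp: untup_def V_carrier PiE_iff inv_into_into)

lemma tup_untup: assumes u: "u \<in> tuples" shows "tup (untup u) = u"
proof
  fix j show "tup (untup u) j = u j"
  proof (cases "j \<in> A")
    case True
    then have "u j \<in> \<chi> ` Vc j" using u V_carrier[OF True] by (auto simp: PiE_iff)
    then show ?thesis using True by (simp add: tup_def untup_def f_inv_into_f)
  qed (use u in \<open>simp add: tup_def PiE_iff extensional_def\<close>)
qed

lemma untup_tup: assumes v: "v \<in> Pi\<^sub>E A Vc" shows "untup (tup v) = v"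
proof
  fix j show "untup (tup v) j = v j"
  proof (cases "j \<in> A")
    case True
    then have "v j \<in> Vc j" using v by (auto simp: PiE_iff)
    then show ?thesis using True inv_into_f_f[OF vparamD(3)[OF V_param[OF True]]] by (simp add: tup_def untup_def)
  qed (use v in \<open>simp add: untup_def PiE_iff extensional_def\<close>)
qed

lemma tup_upd: "j \<in> A \<Longrightarrow> tup (v(j := x)) = (tup v)(j := \<chi> x)"
  by (auto simp: tup_def)

lemma upd_mem: "v \<in> Pi\<^sub>E A Vc \<Longrightarrow> j \<in> A \<Longrightarrow> x \<in> Vc j \<Longrightarrow> v(j := x) \<in> Pi\<^sub>E A Vc"
  by (auto simp: PiE_iff extensional_def)

definition F :: "(('i \<Rightarrow> 'b) \<Rightarrow> complex) set" where
  "F = {f. finite {b. f b \<noteq> 0} \<and> {b. f b \<noteq> 0} \<subseteq> tuples}"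

lemma F_sub: "cvs.subspace F"
proof (rule cvs.subspaceI)
  show "0 \<in> F" by (simp add: F_def)
  show "f + g \<in> F" if "f \<in> F" "g \<in> F" for f g
  proof -
    have "{b. (f + g) b \<noteq> 0} \<subseteq> {b. f b \<noteq> 0} \<union> {b. g b \<noteq> 0}" by auto
    moreover have "finite ({b. f b \<noteq> 0} \<union> {b. g b \<noteq> 0})" "{b. f b \<noteq> 0} \<union> {b. g b \<noteq> 0} \<subseteq> tuples"
      using that by (auto simp: F_def)
    ultimately show ?thesis unfolding F_def using finite_subset[of "{b. (f + g) b \<noteq> 0}"] by blast
  qed
  show "c *\<^sub>c f \<in> F" if "f \<in> F" for c f
  proof -
    have "{b. (c *\<^sub>c f) b \<noteq> 0} \<subseteq> {b. f b \<noteq> 0}" by auto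
    moreover have "finite {b. f b \<noteq> 0}" "{b. f b \<noteq> 0} \<subseteq> tuples" using that by (auto simp: F_def)
    ultimately show ?thesis unfolding F_def using finite_subset[of "{b. (c *\<^sub>c f) b \<noteq> 0}"] by blast
  qed
qed

lemma free_param: "vparam (free_space tuples) F (\<lambda>f. f)"
  unfolding vparam_def
proof (intro conjI ballI allI)
  show "bij_betw (\<lambda>f. f) F (carrier (free_space tuples))" by (simp add: free_space_def F_def bij_betw_def)
qed (simp_all add: F_sub free_space_def zero_fun_def plus_fun_def csc_fun_def)

lemma free_gen_mem: "u \<in> tuples \<Longrightarrow> free_gen u \<in> F"
  by (auto simp: F_def free_gen_def)

text \<open>The linear extension of \<open>\<mu>\<close> to the free space, read through the
  coordinates; its kernel turns out to be the span of the relations.\<close>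

definition h :: "(('i \<Rightarrow> 'b) \<Rightarrow> complex) \<Rightarrow> 'w" where
  "h f = (\<Sum>u | f u \<noteq> 0. f u *\<^sub>c \<mu> (untup u))"

lemma h_superset: "finite S \<Longrightarrow> {u. f u \<noteq> 0} \<subseteq> S \<Longrightarrow> h f = (\<Sum>u\<in>S. f u *\<^sub>c \<mu> (untup u))"
  unfolding h_def by (rule sum.mono_neutral_left) auto

lemma h_add: assumes "f \<in> F" "g \<in> F" shows "h (f + g) = h f + h g"
proof -
  let ?S = "{b. f b \<noteq> 0} \<union> {b. g b \<noteq> 0}"
  have S: "finite ?S" using assms by (simp add: F_def)
  have "h (f + g) = (\<Sum>u\<in>?S. (f + g) u *\<^sub>c \<mu> (untup u))" by (rule h_superset[OF S]) auto
  also have "\<dots> = (\<Sum>u\<in>?S. f u *\<^sub>c \<mu> (untup u)) + (\<Sum>u\<in>?S. g u *\<^sub>c \<mu> (untup u))"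
    by (simp add: csc_add_left sum.distrib)
  also have "\<dots> = h f + h g" using h_superset[OF S, of f] h_superset[OF S, of g] by auto
  finally show ?thesis .
qed

lemma h_scale: assumes "f \<in> F" shows "h (c *\<^sub>c f) = c *\<^sub>c h f"
proof -
  have S: "finite {b. f b \<noteq> 0}" using assms by (simp add: F_def)
  have "h (c *\<^sub>c f) = (\<Sum>u | f u \<noteq> 0. (c *\<^sub>c f) u *\<^sub>c \<mu> (untup u))" by (rule h_superset[OF S]) auto
  then show ?thesis by (simp add: h_def cvs.scale_sum_right csc_csc)
qed

lemma h_0: "h 0 = 0" by (simp add: h_def)

lemma h_sum: "(\<And>i. i \<in> S \<Longrightarrow> f i \<in> F) \<Longrightarrow> h (\<Sum>i\<in>S. f i) = (\<Sum>i\<in>S. h (f i))"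
proof (induction S rule: infinite_finite_induct)
  case (insert i S)
  have "(\<Sum>i\<in>S. f i) \<in> F" using insert by (intro cvs.subspace_sum[OF F_sub]) simp
  then have "h (f i + (\<Sum>i\<in>S. f i)) = h (f i) + h (\<Sum>i\<in>S. f i)" using insert by (intro h_add) simp_all
  then show ?case using insert by (simp only: sum.insert insert_iff simp_thms)
qed (simp_all add: h_0)

lemma h_diff: "f \<in> F \<Longrightarrow> g \<in> F \<Longrightarrow> h (f - g) = h f - h g"
  using h_add[of f "(-1) *\<^sub>c g"] h_scale[of g "-1"] cvs.subspace_neg[OF F_sub, of g] by simp

lemma h_free_gen: "h (free_gen u) = \<mu> (untup u)"
  using h_superset[of "{u}" "free_gen u"] by (simp add: free_gen_def csc_one)

lemma h_tup: "v \<in> Pi\<^sub>E A Vc \<Longrightarrow> h (free_gen (tup v)) = \<mu> v"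
  by (simp add: h_free_gen untup_tup)

definition Rel :: "(('i \<Rightarrow> 'b) \<Rightarrow> complex) set" where
  "Rel = {(\<lambda>u. free_gen (v(j := x \<oplus>\<^bsub>V j\<^esub> y)) u - free_gen (v(j := x)) u - free_gen (v(j := y)) u)
          | v j x y. v \<in> tuples \<and> j \<in> A \<and> x \<in> carrier (V j) \<and> y \<in> carrier (V j)} \<union>
       {(\<lambda>u. free_gen (v(j := c \<odot>\<^bsub>V j\<^esub> x)) u - c * free_gen (v(j := x)) u)
          | v j x c. v \<in> tuples \<and> j \<in> A \<and> x \<in> carrier (V j)}"

abbreviation gen :: "('i \<Rightarrow> 'v) \<Rightarrow> ('i \<Rightarrow> 'b) \<Rightarrow> complex" where "gen v \<equiv> free_gen (tup v)"

lemma gen_mem: "v \<in> Pi\<^sub>E A Vc \<Longrightarrow> gen v \<in> F" by (rule free_gen_mem[OF tup_mem])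

lemma Rel_add:
  assumes "v \<in> Pi\<^sub>E A Vc" "j \<in> A" "x \<in> Vc j" "y \<in> Vc j"
  shows "gen (v(j := x + y)) - gen (v(j := x)) - gen (v(j := y)) \<in> Rel"
proof -
  have "gen (v(j := x + y)) - gen (v(j := x)) - gen (v(j := y)) =
     (\<lambda>u. free_gen ((tup v)(j := \<chi> x \<oplus>\<^bsub>V j\<^esub> \<chi> y)) u - free_gen ((tup v)(j := \<chi> x)) u - free_gen ((tup v)(j := \<chi> y)) u)"
    using vparamD(5)[OF V_param[OF assms(2)] assms(3,4)] by (simp add: tup_upd[OF assms(2)] fun_diff_def)
  moreover have "tup v \<in> tuples" "\<chi> x \<in> carrier (V j)" "\<chi> y \<in> carrier (V j)" using assms tup_mem V_carrier by auto
  ultimately show ?thesis unfolding Rel_def using assms(2) by blast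
qed

lemma Rel_scale:
  assumes "v \<in> Pi\<^sub>E A Vc" "j \<in> A" "x \<in> Vc j"
  shows "gen (v(j := c *\<^sub>c x)) - c *\<^sub>c gen (v(j := x)) \<in> Rel"
proof -
  have "gen (v(j := c *\<^sub>c x)) - c *\<^sub>c gen (v(j := x)) =
     (\<lambda>u. free_gen ((tup v)(j := c \<odot>\<^bsub>V j\<^esub> \<chi> x)) u - c * free_gen ((tup v)(j := \<chi> x)) u)"
    using vparamD(6)[OF V_param[OF assms(2)] assms(3)] by (simp add: tup_upd[OF assms(2)] fun_diff_def csc_fun_def)
  moreover have "tup v \<in> tuples" "\<chi> x \<in> carrier (V j)" using assms tup_mem V_carrier by auto
  ultimately show ?thesis unfolding Rel_def using assms(2) by blast
qed

text \<open>Puts every relation into coordinates, where the multilinearity of \<open>\<mu>\<close>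
  applies directly.\<close>

lemma Rel_cases:
  assumes "r \<in> Rel"
  obtains v j x y where "v \<in> Pi\<^sub>E A Vc" "j \<in> A" "x \<in> Vc j" "y \<in> Vc j"
      "r = gen (v(j := x + y)) - gen (v(j := x)) - gen (v(j := y))"
    | v j x c where "v \<in> Pi\<^sub>E A Vc" "j \<in> A" "x \<in> Vc j" "r = gen (v(j := c *\<^sub>c x)) - c *\<^sub>c gen (v(j := x))"
proof -
  from assms consider
    (1) v j x y where "v \<in> tuples" "j \<in> A" "x \<in> carrier (V j)" "y \<in> carrier (V j)"
      "r = (\<lambda>u. free_gen (v(j := x \<oplus>\<^bsub>V j\<^esub> y)) u - free_gen (v(j := x)) u - free_gen (v(j := y)) u)"
  | (2) v j x c where "v \<in> tuples" "j \<in> A" "x \<in> carrier (V j)"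
      "r = (\<lambda>u. free_gen (v(j := c \<odot>\<^bsub>V j\<^esub> x)) u - c * free_gen (v(j := x)) u)"
    unfolding Rel_def by blast
  then show ?thesis
  proof cases
    case 1
    obtain x' y' where x: "x' \<in> Vc j" "x = \<chi> x'" "y' \<in> Vc j" "y = \<chi> y'" using 1 V_carrier by auto
    show ?thesis
      by (rule that(1)[OF untup_mem[OF 1(1)] 1(2) x(1,3)])
        (use 1 x vparamD(5)[OF V_param[OF 1(2)] x(1,3)] in \<open>simp add: tup_upd tup_untup fun_diff_def\<close>)
  next
    case 2
    obtain x' where x: "x' \<in> Vc j" "x = \<chi> x'" using 2 V_carrier by auto
    show ?thesis
      by (rule that(2)[OF untup_mem[OF 2(1)] 2(2) x(1), of c])
        (use 2 x vparamD(6)[OF V_param[OF 2(2)] x(1)] in \<open>simp add: tup_upd tup_untup fun_diff_def csc_fun_def\<close>)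
  qed
qed

lemma Rel_F: "Rel \<subseteq> F"
proof
  fix r assume "r \<in> Rel"
  then show "r \<in> F"
  proof (cases rule: Rel_cases)
    case (1 v j x y)
    then show ?thesis using gen_mem upd_mem cvs.subspace_add[OF Vc_sub] cvs.subspace_diff[OF F_sub] by simp
  next
    case (2 v j x c)
    then show ?thesis using gen_mem upd_mem cvs.subspace_scale[OF Vc_sub] cvs.subspace_diff[OF F_sub] cvs.subspace_scale[OF F_sub] by simp
  qed
qed

definition J :: "(('i \<Rightarrow> 'b) \<Rightarrow> complex) set" where "J = cvs.span Rel"

lemma relations_eq: "multilinear_relations A V = J"
  using vparam_span[OF free_param Rel_F] by (simp add: multilinear_relations_def Rel_def J_def)

lemma J_F: "J \<subseteq> F" unfolding J_def by (rule cvs.span_minimal[OF Rel_F F_sub])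

lemma h_J: assumes "f \<in> J" shows "h f = 0"
proof -
  have "cvs.subspace {f \<in> F. h f = 0}"
    by (rule cvs.subspaceI) (simp_all add: cvs.subspace_0[OF F_sub] cvs.subspace_add[OF F_sub] cvs.subspace_scale[OF F_sub] h_0 h_add h_scale)
  moreover have "Rel \<subseteq> {f \<in> F. h f = 0}"
  proof
    fix r assume r: "r \<in> Rel"
    then have "h r = 0"
    proof (cases rule: Rel_cases)
      case (1 v j x y)
      have m: "v(j := x + y) \<in> Pi\<^sub>E A Vc" "v(j := x) \<in> Pi\<^sub>E A Vc" "v(j := y) \<in> Pi\<^sub>E A Vc"
        using 1 upd_mem cvs.subspace_add[OF Vc_sub] by simp_all
      have "\<mu> (v(j := x + y)) = \<mu> (v(j := x)) + \<mu> (v(j := y))"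
        using mu_ml 1 unfolding multilinear_on_def by blast
      then show ?thesis using m 1(5) by (simp add: h_diff gen_mem cvs.subspace_diff[OF F_sub] h_tup)
    next
      case (2 v j x c)
      have m: "v(j := c *\<^sub>c x) \<in> Pi\<^sub>E A Vc" "v(j := x) \<in> Pi\<^sub>E A Vc"
        using 2 upd_mem cvs.subspace_scale[OF Vc_sub] by simp_all
      have "\<mu> (v(j := c *\<^sub>c x)) = c *\<^sub>c \<mu> (v(j := x))"
        using mu_ml 2 unfolding multilinear_on_def by blast
      then show ?thesis using m 2(4) by (simp add: h_diff h_scale gen_mem cvs.subspace_scale[OF F_sub] h_tup)
    qed
    then show "r \<in> {f \<in> F. h f = 0}" using r Rel_F by blast
  qed
  ultimately have "J \<subseteq> {f \<in> F. h f = 0}" unfolding J_def by (intro cvs.span_minimal)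
  then show ?thesis using assms by blast
qed

text \<open>What is reached from tuples of basis vectors modulo the relations; \<open>F_T\<close>
  shows that it contains the whole free space.\<close>

definition T :: "(('i \<Rightarrow> 'b) \<Rightarrow> complex) set" where "T = cvs.span (gen ` Pi\<^sub>E A B \<union> J)"

lemma T_sub: "cvs.subspace T" by (simp add: T_def)
lemma J_T: "f \<in> J \<Longrightarrow> f \<in> T" by (simp add: T_def cvs.span_base)
lemma Rel_T: "f \<in> Rel \<Longrightarrow> f \<in> T" by (rule J_T) (simp add: J_def cvs.span_base)

lemma gen_combination:
  assumes v: "v \<in> Pi\<^sub>E A Vc" and j: "j \<in> A" and "finite S" "S \<subseteq> Vc j" "\<And>b. b \<in> S \<Longrightarrow> gen (v(j := b)) \<in> T"
  shows "gen (v(j := (\<Sum>b\<in>S. c b *\<^sub>c b))) \<in> T"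
  using assms(3,4,5)
proof (induction S rule: finite_induct)
  case empty
  have "0 \<in> Vc j" by (rule cvs.subspace_0[OF Vc_sub[OF j]])
  \<comment> \<open>The scaling relation with factor 0 says that a generator with a zero entry is
    itself a relation.\<close>
  from Rel_T[OF Rel_scale[OF v j this, of 0]] show ?case
    by (simp only: sum.empty cvs.scale_zero_left diff_zero)
next
  case (insert b S)
  let ?s = "\<Sum>b\<in>S. c b *\<^sub>c b"
  have b: "b \<in> Vc j" using insert by blast
  have s: "?s \<in> Vc j" "c b *\<^sub>c b \<in> Vc j"
    using insert by (auto intro!: cvs.subspace_sum[OF Vc_sub[OF j]] cvs.subspace_scale[OF Vc_sub[OF j]])
  have "gen (v(j := c b *\<^sub>c b)) = (gen (v(j := c b *\<^sub>c b)) - c b *\<^sub>c gen (v(j := b))) + c b *\<^sub>c gen (v(j := b))" by simp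
  also have "\<dots> \<in> T"
    by (intro cvs.subspace_add[OF T_sub] cvs.subspace_scale[OF T_sub] Rel_T[OF Rel_scale[OF v j b]] insert.prems(2) insertI1)
  finally have 1: "gen (v(j := c b *\<^sub>c b)) \<in> T" .
  have 2: "gen (v(j := ?s)) \<in> T" by (rule insert.IH) (use insert.prems in blast)+
  have "gen (v(j := c b *\<^sub>c b + ?s)) = (gen (v(j := c b *\<^sub>c b + ?s)) - gen (v(j := c b *\<^sub>c b)) - gen (v(j := ?s)))
      + (gen (v(j := c b *\<^sub>c b)) + gen (v(j := ?s)))" by simp
  also have "\<dots> \<in> T" by (intro cvs.subspace_add[OF T_sub] 1 2 Rel_T[OF Rel_add[OF v j s(2,1)]])
  finally show ?case by (simp only: sum.insert[OF insert.hyps])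
qed

text \<open>Induction on the set \<open>C\<close> of positions whose entries need not be basis
  vectors; each step expands one entry by \<open>gen_combination\<close>.\<close>

lemma gen_T: assumes "v \<in> Pi\<^sub>E A Vc" shows "gen v \<in> T"
proof -
  have "gen v \<in> T" if "finite C" "C \<subseteq> A" "v \<in> Pi\<^sub>E A Vc" "\<forall>j\<in>A - C. v j \<in> B j" for C v
    using that
  proof (induction C arbitrary: v rule: finite_induct)
    case empty
    then have "v \<in> Pi\<^sub>E A B" by (auto simp: PiE_iff)
    then show ?case unfolding T_def by (intro cvs.span_base) blast
  next
    case (insert j C)
    have j: "j \<in> A" using insert by blast
    have vj: "v j \<in> Vc j" using insert.prems(2) j by (auto simp: PiE_iff)
    note Bj = B_basis[OF j]
    have BV: "B j \<subseteq> Vc j" using sub_basis[OF Bj] by blast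
    have "gen (v(j := b)) \<in> T" if b: "b \<in> B j" for b
    proof (rule insert.IH)
      show "v(j := b) \<in> Pi\<^sub>E A Vc" using upd_mem[OF insert.prems(2) j] b BV by blast
      show "\<forall>k\<in>A - C. (v(j := b)) k \<in> B k" using insert.prems(3) b by auto
    qed (use insert in blast)
    then have "gen (v(j := (\<Sum>b\<in>B j. cvs.representation (B j) (v j) b *\<^sub>c b))) \<in> T"
      using Bj by (intro gen_combination[OF insert.prems(2) j _ BV]) (simp_all add: is_basis_def)
    then show ?case using rep_sum[OF Bj vj] by simp
  qed
  from this[OF A_fin order_refl assms] show ?thesis by simp
qed

lemma F_T: assumes f: "f \<in> F" shows "f \<in> T"
proof -
  let ?S = "{u. f u \<noteq> 0}"
  have S: "finite ?S" "?S \<subseteq> tuples" using f by (simp_all add: F_def)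
  have "f = (\<Sum>u\<in>?S. f u *\<^sub>c free_gen u)"
  proof
    fix t
    have "(\<Sum>u\<in>?S. f u *\<^sub>c free_gen u) t = (\<Sum>u\<in>?S. if t = u then f u else 0)"
      unfolding sum_fun_apply by (rule sum.cong) (auto simp: free_gen_def)
    also have "\<dots> = f t" using S(1) by simp
    finally show "f t = (\<Sum>u\<in>?S. f u *\<^sub>c free_gen u) t" by simp
  qed
  also have "\<dots> \<in> T"
  proof (intro cvs.subspace_sum[OF T_sub] cvs.subspace_scale[OF T_sub])
    fix u assume "u \<in> ?S"
    then have "u \<in> tuples" using S(2) by blast
    then show "free_gen u \<in> T" using gen_T[OF untup_mem] tup_untup by metis
  qed
  finally show ?thesis .
qed

lemma basis_tuple: "b \<in> Pi\<^sub>E A B \<Longrightarrow> b \<in> Pi\<^sub>E A Vc"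
  using sub_basis[OF B_basis] by (auto simp: PiE_iff)

lemma basis_fin: "finite (Pi\<^sub>E A B)" using mu_basis by (simp add: basis_family_def lin_indep_family_def)

lemma h_combination: "h (\<Sum>b\<in>Pi\<^sub>E A B. c b *\<^sub>c gen b) = (\<Sum>b\<in>Pi\<^sub>E A B. c b *\<^sub>c \<mu> b)"
  by (subst h_sum) (simp_all add: h_scale h_tup gen_mem basis_tuple cvs.subspace_scale[OF F_sub])

text \<open>By \<open>F_T\<close>, \<open>f\<close> is a combination of basis generators plus a
  relation. Relations go to 0 and basis generators to independent vectors, so in the kernel the
  combination vanishes.\<close>

lemma h_kernel: assumes f: "f \<in> F" shows "h f = 0 \<longleftrightarrow> f \<in> J"
proof
  assume h0: "h f = 0"
  have "f \<in> cvs.span (gen ` Pi\<^sub>E A B \<union> J)" using F_T[OF f] by (simp add: T_def)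
  then obtain x y where xy: "f = x + y" "x \<in> cvs.span (gen ` Pi\<^sub>E A B)" "y \<in> cvs.span J" unfolding cvs.span_Un by blast
  then have yJ: "y \<in> J" by (simp add: J_def cvs.span_span)
  obtain c where c: "x = (\<Sum>b\<in>Pi\<^sub>E A B. c b *\<^sub>c gen b)" by (rule span_family_expand[OF basis_fin xy(2)])
  have xF: "x \<in> F" unfolding c by (intro cvs.subspace_sum[OF F_sub] cvs.subspace_scale[OF F_sub] gen_mem basis_tuple)
  have "(\<Sum>b\<in>Pi\<^sub>E A B. c b *\<^sub>c \<mu> b) = 0"
    using h0 h_add[OF xF, of y] h_J[OF yJ] J_F yJ xy(1) h_combination[of c] c by auto
  then have "c b = 0" if "b \<in> Pi\<^sub>E A B" for b
    using lin_indep_familyD[of "Pi\<^sub>E A B" \<mu> c b] mu_basis that by (simp add: basis_family_def)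
  then have "x = 0" unfolding c by (intro sum.neutral) simp
  then show "f \<in> J" using xy(1) yJ by simp
qed (rule h_J)

lemma h_image: "h ` F = W"
proof (intro equalityI subsetI)
  fix w assume "w \<in> h ` F"
  then obtain f where f: "f \<in> F" "w = h f" by blast
  then have "untup u \<in> Pi\<^sub>E A Vc" if "f u \<noteq> 0" for u using that untup_mem by (auto simp: F_def)
  then show "w \<in> W" unfolding f(2) h_def by (intro cvs.subspace_sum[OF W_sub] cvs.subspace_scale[OF W_sub] mu_W) simp
next
  fix w assume "w \<in> W"
  then obtain c where c: "w = (\<Sum>b\<in>Pi\<^sub>E A B. c b *\<^sub>c \<mu> b)" by (rule basis_family_expand[OF mu_basis])
  have "(\<Sum>b\<in>Pi\<^sub>E A B. c b *\<^sub>c gen b) \<in> F" by (intro cvs.subspace_sum[OF F_sub] cvs.subspace_scale[OF F_sub] gen_mem basis_tuple)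
  then show "w \<in> h ` F" unfolding c h_combination[of c, symmetric] by (rule imageI)
qed

definition cls :: "'w \<Rightarrow> (('i \<Rightarrow> 'b) \<Rightarrow> complex) set" where "cls w = {f \<in> F. h f = w}"

lemma tensor_space_param: "vparam (tensor_space A V) W cls"
  and coset_cls: "f \<in> F \<Longrightarrow> J +>\<^bsub>free_space tuples\<^esub> f = cls (h f)"
proof -
  have "vparam (quotient_space (free_space tuples) ((\<lambda>f. f) ` J)) W (\<lambda>w. (\<lambda>f. f) ` {f \<in> F. h f = w})"
    by (rule vparam_quotient(1)[OF free_param J_F W_sub h_add h_scale h_image h_kernel])
  then show "vparam (tensor_space A V) W cls" by (simp add: tensor_space_def relations_eq cls_def[abs_def])
  show "J +>\<^bsub>free_space tuples\<^esub> f = cls (h f)" if "f \<in> F"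
    using vparam_quotient(2)[OF free_param J_F W_sub h_add h_scale h_image h_kernel that] by (simp add: cls_def)
qed

end

lemma tensor_module_simps:
  "carrier (tensor_module G A H V) = carrier (tensor_space A V)" "zero (tensor_module G A H V) = zero (tensor_space A V)"
  "add (tensor_module G A H V) = add (tensor_space A V)"
  "Module.module.smult (tensor_module G A H V) = Module.module.smult (tensor_space A V)"
  "act (tensor_module G A H V) = (\<lambda>X x. \<Union>f\<in>X. multilinear_relations A V
            +>\<^bsub>free_space (\<Pi>\<^sub>E i\<in>A. carrier (V i))\<^esub> free_action G A H V f x)"
  by (simp_all add: tensor_module_def module.extend_def right_module.fields_def)

text \<open>\<open>a j\<close> is the action on the \<open>j\<close>-th factor of the
  \<open>j\<close>-th component of the algebra element, and \<open>aw\<close> the action on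
  \<open>W\<close>. The assumption \<open>aw\<close> says that \<open>\<mu>\<close> intertwines the
  sum of the factor actions with it.\<close>

locale tensor_module_decomp = tensor_decomp A Vc W \<mu> V \<chi> B
  for A :: "'i set" and Vc :: "'i \<Rightarrow> 'v::cvs set" and W :: "'w::cvs set" and \<mu>
    and V :: "'i \<Rightarrow> ('g, 'b, 'y) right_module_scheme" and \<chi> and B +
  fixes G :: "('g, 'x) bracket_algebra_scheme" and H :: "'i \<Rightarrow> 'g set"
    and a :: "'i \<Rightarrow> 'v \<Rightarrow> 'g \<Rightarrow> 'v" and aw :: "'w \<Rightarrow> 'g \<Rightarrow> 'w"
  assumes act_V: "\<And>j u x. j \<in> A \<Longrightarrow> u \<in> Vc j \<Longrightarrow> x \<in> carrier G \<Longrightarrow> act (V j) (\<chi> u) (component G A H j x) = \<chi> (a j u x)"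
    and a_closed: "\<And>j u x. j \<in> A \<Longrightarrow> u \<in> Vc j \<Longrightarrow> x \<in> carrier G \<Longrightarrow> a j u x \<in> Vc j"
    and aw: "\<And>v x. v \<in> Pi\<^sub>E A Vc \<Longrightarrow> x \<in> carrier G \<Longrightarrow> (\<Sum>j\<in>A. \<mu> (v(j := a j (v j) x))) = aw (\<mu> v) x"
    and aw_clin: "\<And>x. clin (\<lambda>w. aw w x)"
begin

lemma free_action_mem:
  assumes f: "f \<in> F" and x: "x \<in> carrier G"
  shows "free_action G A H V f x \<in> F" "h (free_action G A H V f x) = aw (h f) x"
proof -
  let ?S = "{u. f u \<noteq> 0}"
  let ?t = "\<lambda>u j. u(j := act (V j) (u j) (component G A H j x))"
  have S: "finite ?S" "?S \<subseteq> tuples" using f by (simp_all add: F_def)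
  have e: "free_action G A H V f x = (\<Sum>u\<in>?S. f u *\<^sub>c (\<Sum>j\<in>A. free_gen (?t u j)))"
    by (rule ext) (simp add: free_action_def sum_fun_apply)
  have t: "?t u j = tup ((untup u)(j := a j (untup u j) x))" "(untup u)(j := a j (untup u j) x) \<in> Pi\<^sub>E A Vc"
    if u: "u \<in> ?S" and j: "j \<in> A" for u j
  proof -
    have uT: "u \<in> tuples" using u S(2) by blast
    have uj: "untup u j \<in> Vc j" using untup_mem[OF uT] j by (auto simp: PiE_iff)
    have "u j = \<chi> (untup u j)" using fun_cong[OF tup_untup[OF uT], of j] j by (simp add: tup_def)
    then show "?t u j = tup ((untup u)(j := a j (untup u j) x))"
      using act_V[OF j uj x] tup_untup[OF uT] by (simp add: tup_upd[OF j])
    show "(untup u)(j := a j (untup u j) x) \<in> Pi\<^sub>E A Vc"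
      by (rule upd_mem[OF untup_mem[OF uT] j a_closed[OF j uj x]])
  qed
  have g: "free_gen (?t u j) \<in> F" "h (free_gen (?t u j)) = \<mu> ((untup u)(j := a j (untup u j) x))"
    if "u \<in> ?S" "j \<in> A" for u j
    unfolding t(1)[OF that] by (rule gen_mem[OF t(2)[OF that]], rule h_tup[OF t(2)[OF that]])
  have s: "(\<Sum>j\<in>A. free_gen (?t u j)) \<in> F" "h (\<Sum>j\<in>A. free_gen (?t u j)) = aw (\<mu> (untup u)) x" if u: "u \<in> ?S" for u
  proof -
    show "(\<Sum>j\<in>A. free_gen (?t u j)) \<in> F" by (intro cvs.subspace_sum[OF F_sub] g(1)[OF u])
    have "h (\<Sum>j\<in>A. free_gen (?t u j)) = (\<Sum>j\<in>A. \<mu> ((untup u)(j := a j (untup u j) x)))"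
      using h_sum[of A "\<lambda>j. free_gen (?t u j)"] g[OF u] by simp
    then show "h (\<Sum>j\<in>A. free_gen (?t u j)) = aw (\<mu> (untup u)) x"
      using aw[OF untup_mem x, of u] u S(2) by auto
  qed
  show "free_action G A H V f x \<in> F" unfolding e
    by (intro cvs.subspace_sum[OF F_sub] cvs.subspace_scale[OF F_sub] s(1))
  have "h (free_action G A H V f x) = (\<Sum>u\<in>?S. h (f u *\<^sub>c (\<Sum>j\<in>A. free_gen (?t u j))))"
    unfolding e by (rule h_sum) (rule cvs.subspace_scale[OF F_sub s(1)])
  also have "\<dots> = (\<Sum>u\<in>?S. f u *\<^sub>c aw (\<mu> (untup u)) x)"
    by (rule sum.cong[OF refl]) (use h_scale[OF s(1)] s(2) in simp)
  also have "\<dots> = aw (h f) x" by (simp add: h_def clin_sum[OF aw_clin] clin_scale[OF aw_clin])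
  finally show "h (free_action G A H V f x) = aw (h f) x" .
qed

lemma tensor_module_act:
  assumes w: "w \<in> W" and x: "x \<in> carrier G"
  shows "act (tensor_module G A H V) (cls w) x = cls (aw w x)"
proof -
  have "act (tensor_module G A H V) (cls w) x = (\<Union>f\<in>cls w. J +>\<^bsub>free_space tuples\<^esub> free_action G A H V f x)"
    by (simp add: tensor_module_simps relations_eq)
  also have "\<dots> = (\<Union>f\<in>cls w. cls (aw w x))"
    by (rule SUP_cong[OF refl]) (use coset_cls free_action_mem x in \<open>auto simp: cls_def\<close>)
  also have "\<dots> = cls (aw w x)"
  proof -
    obtain f where "f \<in> F" "h f = w" using w h_image by blast
    then have "cls w \<noteq> {}" by (auto simp: cls_def)
    then show ?thesis by simp
  qed
  finally show ?thesis .
qed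

lemma isomorphic_tensor_module:
  assumes M: "vparam M W \<psi>" and act_M: "\<And>w x. w \<in> W \<Longrightarrow> x \<in> carrier G \<Longrightarrow> act M (\<psi> w) x = \<psi> (aw w x)"
    and aw_W: "\<And>w x. w \<in> W \<Longrightarrow> x \<in> carrier G \<Longrightarrow> aw w x \<in> W"
  shows "isomorphic_modules G M (tensor_module G A H V)"
proof -
  let ?f = "\<lambda>m. cls (inv_into W \<psi> m)"
  have T: "vparam (tensor_module G A H V) W cls" using tensor_space_param by (simp add: vparam_def tensor_module_simps)
  have f: "?f (\<psi> w) = cls w" if "w \<in> W" for w using inv_into_f_f[OF vparamD(3)[OF M] that] by simp
  have "?f (act M v g) = act (tensor_module G A H V) (?f v) g" if v: "v \<in> carrier M" and g: "g \<in> carrier G" for v g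
  proof -
    obtain w where w: "w \<in> W" "v = \<psi> w" using v vparamD(2)[OF M] by blast
    show ?thesis using f[OF w(1)] f[OF aw_W[OF w(1) g]] act_M[OF w(1) g] tensor_module_act[OF w(1) g] w(2) by simp
  qed
  moreover have "linear_map complex_field M (tensor_module G A H V) ?f"
    "bij_betw ?f (carrier M) (carrier (tensor_module G A H V))"
    by (rule vparam_linear_map[OF M T f], assumption)+
  ultimately show ?thesis unfolding isomorphic_modules_def by blast
qed

end

subsection \<open>Levi decompositions of semisimple Leibniz algebras\<close>

lemma span_UN_expand:
  assumes "finite B" "\<And>i. i \<in> B \<Longrightarrow> cvs.subspace (W i)" "x \<in> cvs.span (\<Union>i\<in>B. W i)"
  obtains w where "\<And>i. i \<in> B \<Longrightarrow> w i \<in> W i" "x = (\<Sum>i\<in>B. w i)"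
proof -
  have "\<exists>w. (\<forall>i\<in>B. w i \<in> W i) \<and> x = (\<Sum>i\<in>B. w i)"
    using assms(3)
  proof (induction rule: cvs.span_induct_alt)
    case base
    show ?case using cvs.subspace_0[OF assms(2)] by (intro exI[of _ "\<lambda>_. 0"]) simp
  next
    case (step c x y)
    then obtain i w where i: "i \<in> B" "x \<in> W i" and w: "\<forall>i\<in>B. w i \<in> W i" "y = (\<Sum>i\<in>B. w i)" by blast
    let ?u = "\<lambda>k. if k = i then c *\<^sub>c x else 0"
    have "(\<Sum>k\<in>B. ?u k + w k) = c *\<^sub>c x + y" using i(1) assms(1) w(2) by (simp add: sum.distrib)
    moreover have "\<forall>k\<in>B. ?u k + w k \<in> W k"
      using w(1) i cvs.subspace_add[OF assms(2)] cvs.subspace_scale[OF assms(2)] by simp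
    ultimately show ?case by (intro exI[of _ "\<lambda>k. ?u k + w k"]) simp
  qed
  then show ?thesis using that by blast
qed

lemma sum_in_span_UN: "(\<And>i. i \<in> B \<Longrightarrow> w i \<in> W i) \<Longrightarrow> (\<Sum>i\<in>B. w i) \<in> cvs.span (\<Union>i\<in>B. W i)"
  by (intro cvs.span_sum cvs.span_base) blast

lemma dsumD:
  assumes "dsum V A W"
  shows "finite A" "i \<in> A \<Longrightarrow> cvs.subspace (W i)" "i \<in> A \<Longrightarrow> W i \<subseteq> V"
  using assms by (auto simp: dsum_def)

lemma dsum_expand:
  assumes "dsum V A W" "x \<in> V"
  obtains w where "\<And>i. i \<in> A \<Longrightarrow> w i \<in> W i" "x = (\<Sum>i\<in>A. w i)"
  using assms unfolding dsum_def by blast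

lemma dsum_span_subset:
  assumes "dsum V A W" "B \<subseteq> A" "cvs.subspace V" shows "cvs.span (\<Union>i\<in>B. W i) \<subseteq> V"
  by (rule cvs.span_minimal[OF _ assms(3)]) (use dsumD(3)[OF assms(1)] assms(2) in blast)

lemma dsum_span_disjoint:
  assumes D: "dsum V A W" and BC: "B \<subseteq> A" "C \<subseteq> A" "B \<inter> C = {}"
    and x: "x \<in> cvs.span (\<Union>i\<in>B. W i)" "x \<in> cvs.span (\<Union>i\<in>C. W i)"
  shows "x = 0"
proof -
  note fin = dsumD(1)[OF D]
  have fB: "finite B" and fC: "finite C" using BC(1,2) fin finite_subset by blast+
  have s: "cvs.subspace (W i)" if "i \<in> A" for i by (rule dsumD(2)[OF D that])
  obtain w where w: "\<And>i. i \<in> B \<Longrightarrow> w i \<in> W i" "x = (\<Sum>i\<in>B. w i)"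
    using span_UN_expand[OF fB _ x(1)] s BC(1) by blast
  obtain u where u: "\<And>i. i \<in> C \<Longrightarrow> u i \<in> W i" "x = (\<Sum>i\<in>C. u i)"
    using span_UN_expand[OF fC _ x(2)] s BC(2) by blast
  let ?z = "\<lambda>i. (if i \<in> B then w i else 0) - (if i \<in> C then u i else 0)"
  have "(\<Sum>i\<in>A. ?z i) = (\<Sum>i\<in>A \<inter> B. w i) - (\<Sum>i\<in>A \<inter> C. u i)"
    unfolding sum_subtractf sum.inter_restrict[OF fin] ..
  also have "\<dots> = 0" using w(2) u(2) BC by (simp add: Int_absorb1)
  finally have z: "(\<Sum>i\<in>A. ?z i) = 0" .
  have "?z i \<in> W i" if "i \<in> A" for i
    using w(1) u(1) cvs.subspace_0[OF s[OF that]] by (intro cvs.subspace_diff[OF s[OF that]]) auto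
  from dsum_zeroD[OF D this z] have "?z i = 0" if "i \<in> A" for i using that by simp
  then have "w i = 0" if "i \<in> B" for i using that BC by fastforce
  then show ?thesis using w(2) by simp
qed

lemma dsum_split:
  assumes D: "dsum V A W" and BC: "A = B \<union> C" "B \<inter> C = {}" and x: "x \<in> V"
  obtains a b where "a \<in> cvs.span (\<Union>i\<in>B. W i)" "b \<in> cvs.span (\<Union>i\<in>C. W i)" "x = a + b"
proof -
  obtain w where w: "\<And>i. i \<in> A \<Longrightarrow> w i \<in> W i" "x = (\<Sum>i\<in>A. w i)" by (rule dsum_expand[OF D x]) blast
  have "finite A" by (rule dsumD(1)[OF D])
  then have "x = (\<Sum>i\<in>B. w i) + (\<Sum>i\<in>C. w i)" unfolding w(2) BC(1) by (intro sum.union_disjoint) (use BC in auto)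
  moreover have "(\<Sum>i\<in>B. w i) \<in> cvs.span (\<Union>i\<in>B. W i)" "(\<Sum>i\<in>C. w i) \<in> cvs.span (\<Union>i\<in>C. W i)"
    by (rule sum_in_span_UN; use w(1) BC(1) in blast)+
  ultimately show ?thesis by (intro that)
qed

text \<open>The coordinate form of a Levi decomposition. \<open>I\<close> enters only as a span of
  squares; that it is an ideal annihilated from the left is derived from the Leibniz
  identity.\<close>

locale levi = leibalg K br for K :: "'v::cvs set" and br +
  fixes G I :: "'v set"
  assumes G_ss: "ssalg G br" and GK: "G \<subseteq> K" and I_def: "I = cvs.span {br x x | x. x \<in> K}"
    and GI0: "G \<inter> I = {0}" and GI: "x \<in> K \<Longrightarrow> \<exists>g\<in>G. \<exists>v\<in>I. x = g + v"
begin

sublocale G: ssalg G br by (rule G_ss)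

lemma I_sub: "cvs.subspace I" by (simp add: I_def)

lemma IK: "I \<subseteq> K" unfolding I_def by (rule cvs.span_minimal[OF _ K_sub]) (use br_closed in blast)

lemma square_I: "x \<in> K \<Longrightarrow> br x x \<in> I" unfolding I_def by (rule cvs.span_base) blast

text \<open>For a square \<open>br y y\<close> the two terms on the right of the Leibniz identity
  are equal.\<close>

lemma right_zero: assumes x: "x \<in> K" and v: "v \<in> I" shows "br x v = 0"
proof (rule eq_on_span[OF br_right clin_zero])
  show "v \<in> cvs.span {br x x | x. x \<in> K}" using v I_def by simp
  fix u assume "u \<in> {br x x | x. x \<in> K}"
  then obtain y where "u = br y y" "y \<in> K" by blast
  then show "br x u = 0" using leibniz[OF x] by simp
qed

lemma I_closed: assumes v: "v \<in> I" and x: "x \<in> K" shows "br v x \<in> I"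
proof (rule span_image_subset[OF br_left I_sub])
  show "v \<in> cvs.span {br x x | x. x \<in> K}" using v I_def by simp
  fix u assume "u \<in> {br x x | x. x \<in> K}"
  then obtain y where y: "u = br y y" "y \<in> K" by blast
  let ?b = "br y x"
  have b: "?b \<in> K" using br_closed y x by blast
  have "br u x = br y ?b + br ?b y" using leibniz[OF y(2) y(2) x] y(1) by simp
  \<comment> \<open>Polarization: the symmetric expression is a combination of three
    squares.\<close>
  also have "\<dots> = br (y + ?b) (y + ?b) - br y y - br ?b ?b" by (simp add: br_simps)
  also have "\<dots> \<in> I" by (intro cvs.subspace_diff[OF I_sub] square_I cvs.subspace_add[OF K_sub] y(2) b)
  finally show "br u x \<in> I" .
qed

lemma I_fds: "fds I" by (rule fds_mono[OF K_fds I_sub IK])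

sublocale GI: ssmod G br I br
proof (intro ssmod.intro G_ss liemod.intro G.liealg_axioms liemod_axioms.intro I_fds br_left br_right)
  show "br v x \<in> I" if "v \<in> I" "x \<in> G" for v x using I_closed that GK by blast
  show "br v (br x y) = br (br v x) y - br (br v y) x" if "v \<in> I" "x \<in> G" "y \<in> G" for v x y
    using leibniz that GK IK by blast
qed

lemma square: assumes g: "g \<in> G" and v: "v \<in> I" shows "br (g + v) (g + v) = br v g"
proof -
  have "g \<in> K" "v \<in> K" using g v GK IK by blast+
  then show ?thesis using G.br_self[OF g] right_zero[OF _ v] by (simp add: br_simps)
qed

lemma I_generated: "I \<subseteq> cvs.span {br v x | v x. v \<in> I \<and> x \<in> G}"
proof -
  let ?T = "cvs.span {br v x | v x. v \<in> I \<and> x \<in> G}"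
  have "{br x x | x. x \<in> K} \<subseteq> ?T"
  proof
    fix u assume "u \<in> {br x x | x. x \<in> K}"
    then obtain y where y: "u = br y y" "y \<in> K" by blast
    obtain g v where gv: "g \<in> G" "v \<in> I" "y = g + v" using GI[OF y(2)] by blast
    then have "u = br v g" using square[OF gv(1,2)] y(1) by simp
    then show "u \<in> ?T" using gv by (intro cvs.span_base) blast
  qed
  then show ?thesis unfolding I_def[symmetric] using cvs.span_minimal[of "{br x x | x. x \<in> K}" ?T] I_def by simp
qed

end

section \<open>Simple ideals acting on the irreducible submodules of the kernel\<close>

locale levi_split = levi K br G I for K :: "'v::cvs set" and br and G and I +
  fixes m n :: nat and S V :: "nat \<Rightarrow> 'v set"
  assumes S_dsum: "dsum G {1..m} S" and S_ideal: "\<And>j. j \<in> {1..m} \<Longrightarrow> lie_ideal br (S j) G"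
    and S_simple: "\<And>j J. j \<in> {1..m} \<Longrightarrow> lie_ideal br J (S j) \<Longrightarrow> J = {0} \<or> J = S j"
    and S_nonzero: "\<And>j. j \<in> {1..m} \<Longrightarrow> S j \<noteq> {0}"
    and S_commute: "\<And>i j x y. i \<in> {1..m} \<Longrightarrow> j \<in> {1..m} \<Longrightarrow> i \<noteq> j \<Longrightarrow> x \<in> S i \<Longrightarrow> y \<in> S j \<Longrightarrow> br x y = 0"
    and V_dsum: "dsum I {1..n} V" and V_irr: "\<And>k. k \<in> {1..n} \<Longrightarrow> irrep G br (V k)"
begin

lemma SG: "j \<in> {1..m} \<Longrightarrow> S j \<subseteq> G" by (rule dsumD(3)[OF S_dsum])
lemma SK: "j \<in> {1..m} \<Longrightarrow> S j \<subseteq> K" using SG GK by blast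
lemma S_sub: "j \<in> {1..m} \<Longrightarrow> cvs.subspace (S j)" by (rule dsumD(2)[OF S_dsum])
lemma VI: "k \<in> {1..n} \<Longrightarrow> V k \<subseteq> I" by (rule dsumD(3)[OF V_dsum])
lemma VK: "k \<in> {1..n} \<Longrightarrow> V k \<subseteq> K" using VI IK by blast
lemma V_sub: "k \<in> {1..n} \<Longrightarrow> cvs.subspace (V k)" by (rule dsumD(2)[OF V_dsum])
lemma V_closed: "k \<in> {1..n} \<Longrightarrow> v \<in> V k \<Longrightarrow> x \<in> G \<Longrightarrow> br v x \<in> V k"
  by (rule submodD(2)[OF irrepD(1)[OF V_irr]])

lemma S_nonabelian: assumes j: "j \<in> {1..m}" shows "\<exists>x\<in>S j. \<exists>y\<in>S j. br x y \<noteq> 0"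
  using G.no_abelian[OF S_ideal[OF j]] S_nonzero[OF j] by blast

text \<open>The brackets span a submodule, hence 0 or \<open>V k\<close>. If it were 0, brackets
  with \<open>I\<close> would involve only the other summands; but these brackets span
  \<open>I\<close> by \<open>I_generated\<close>, so \<open>V k\<close> would lie in the sum of the
  others.\<close>

lemma V_bracket: assumes k: "k \<in> {1..n}" shows "cvs.span {br v x | v x. v \<in> V k \<and> x \<in> G} = V k"
proof -
  let ?D = "cvs.span {br v x | v x. v \<in> V k \<and> x \<in> G}"
  have sub: "?D \<subseteq> V k" by (rule cvs.span_minimal[OF _ V_sub[OF k]]) (use V_closed[OF k] in blast)
  have "br u y \<in> ?D" if "u \<in> ?D" "y \<in> G" for u y
    using sub that by (intro cvs.span_base) blast
  then have "submod G br ?D" by (simp add: submod_def)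
  then have "?D = {0} \<or> ?D = V k" by (rule irrepD(3)[OF V_irr[OF k] _ sub])
  moreover have "?D \<noteq> {0}"
  proof
    assume D0: "?D = {0}"
    have z: "br v x = 0" if "v \<in> V k" "x \<in> G" for v x
    proof -
      have "br v x \<in> ?D" by (rule cvs.span_base) (use that in blast)
      then show ?thesis using D0 by simp
    qed
    let ?R = "cvs.span (\<Union>i\<in>{1..n} - {k}. V i)"
    have "{br v x | v x. v \<in> I \<and> x \<in> G} \<subseteq> ?R"
    proof
      fix u assume "u \<in> {br v x | v x. v \<in> I \<and> x \<in> G}"
      then obtain v x where u: "u = br v x" "v \<in> I" "x \<in> G" by blast
      obtain w where w: "\<And>i. i \<in> {1..n} \<Longrightarrow> w i \<in> V i" "v = (\<Sum>i\<in>{1..n}. w i)" by (rule dsum_expand[OF V_dsum u(2)]) blast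
      have "u = (\<Sum>i\<in>{1..n}. br (w i) x)" using u(1) w(2) by (simp add: br_simps)
      also have "\<dots> = (\<Sum>i\<in>{1..n} - {k}. br (w i) x)"
        by (rule sum.mono_neutral_right) (use z[OF w(1)[OF k] u(3)] in auto)
      also have "\<dots> \<in> ?R" by (rule sum_in_span_UN) (use V_closed w(1) u(3) in blast)
      finally show "u \<in> ?R" .
    qed
    then have "cvs.span {br v x | v x. v \<in> I \<and> x \<in> G} \<subseteq> ?R" by (rule cvs.span_minimal) simp
    then have IR: "I \<subseteq> ?R" using I_generated by blast
    have "u = 0" if u: "u \<in> V k" for u
    proof (rule dsum_span_disjoint[OF V_dsum, of "{k}" "{1..n} - {k}"])
      show "u \<in> cvs.span (\<Union>i\<in>{k}. V i)" using u by (intro cvs.span_base) simp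
      show "u \<in> ?R" using u VI[OF k] IR by blast
    qed (use k in auto)
    then have "V k = {0}" using cvs.subspace_0[OF V_sub[OF k]] by blast
    then show False using irrepD(2)[OF V_irr[OF k]] by simp
  qed
  ultimately show ?thesis by blast
qed

definition nontriv :: "nat \<Rightarrow> nat \<Rightarrow> bool" where
  "nontriv k j \<longleftrightarrow> (\<exists>v\<in>V k. \<exists>x\<in>S j. br v x \<noteq> 0)"

text \<open>Since \<open>S j\<close> is an ideal, the brackets span a \<open>G\<close>-submodule. A
  single nonzero bracket therefore yields the equality used in the definition of adjacency.\<close>

lemma nontriv_bracket:
  assumes k: "k \<in> {1..n}" and j: "j \<in> {1..m}" and nt: "nontriv k j"
  shows "cvs.span {br v x | v x. v \<in> V k \<and> x \<in> S j} = V k"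
proof -
  let ?X = "{br v x | v x. v \<in> V k \<and> x \<in> S j}"
  let ?D = "cvs.span ?X"
  have sub: "?D \<subseteq> V k" by (rule cvs.span_minimal[OF _ V_sub[OF k]]) (use V_closed[OF k] SG[OF j] in blast)
  have "br u y \<in> ?D" if u: "u \<in> ?D" and y: "y \<in> G" for u y
  proof (rule span_image_subset[OF br_left cvs.subspace_span _ u])
    fix t assume "t \<in> ?X"
    then obtain v x where t: "t = br v x" "v \<in> V k" "x \<in> S j" by blast
    then have "v \<in> K" "x \<in> K" "y \<in> K" using VK[OF k] SK[OF j] GK y by blast+
    then have e: "br t y = br v (br x y) + br (br v y) x" using leibniz t(1) by simp
    have "br x y \<in> S j" "br v y \<in> V k" using S_ideal[OF j] t(3) y V_closed[OF k t(2) y] by (auto simp: lie_ideal_def)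
    then have "br v (br x y) \<in> ?D" "br (br v y) x \<in> ?D" using t by (auto intro!: cvs.span_base)
    then show "br t y \<in> ?D" unfolding e by (rule cvs.span_add)
  qed
  then have "submod G br ?D" by (simp add: submod_def)
  then have "?D = {0} \<or> ?D = V k" by (rule irrepD(3)[OF V_irr[OF k] _ sub])
  moreover obtain v x where vx: "v \<in> V k" "x \<in> S j" "br v x \<noteq> 0" using nt by (auto simp: nontriv_def)
  have "br v x \<in> ?D" by (rule cvs.span_base) (use vx in blast)
  ultimately show ?thesis using vx(3) by auto
qed

text \<open>\<open>G\<close> is the sum of the \<open>S j\<close>, so \<open>V k\<close> is
  irreducible under their union. Elements of different \<open>S i\<close> and \<open>S j\<close>
  have bracket 0, and the Leibniz identity then says that their actions commute.\<close>

lemma V_tensor: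
  assumes k: "k \<in> {1..n}"
  shows "\<exists>Vc \<mu>. (\<forall>j\<in>{1..m}. irrep (S j) br (Vc j) \<and> Vc j \<subseteq> V k) \<and> multilinear_on {1..m} Vc \<mu> \<and>
    (\<forall>v\<in>Pi\<^sub>E {1..m} Vc. \<forall>j\<in>{1..m}. \<forall>x\<in>S j. br (\<mu> v) x = \<mu> (v(j := br (v j) x))) \<and>
    (\<forall>B. (\<forall>j\<in>{1..m}. is_basis (Vc j) (B j)) \<longrightarrow> basis_family (V k) (Pi\<^sub>E {1..m} B) \<mu>) \<and>
    (\<forall>v\<in>Pi\<^sub>E {1..m} Vc. \<mu> v \<in> V k)"
proof (rule irreducible_tensor_decomposition)
  show "fds (V k)" by (rule fds_mono[OF K_fds V_sub[OF k] VK[OF k]])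
  show "irrep (\<Union>j\<in>{1..m}. S j) br (V k)" unfolding irrep_def
  proof (intro conjI allI impI)
    show "submod (\<Union>j\<in>{1..m}. S j) br (V k)"
      using V_sub[OF k] V_closed[OF k] SG unfolding submod_def by blast
    show "V k \<noteq> {0}" by (rule irrepD(2)[OF V_irr[OF k]])
    fix W assume W: "submod (\<Union>j\<in>{1..m}. S j) br W \<and> W \<subseteq> V k"
    then have Ws: "cvs.subspace W" by (simp add: submod_def)
    have "br w x \<in> W" if w: "w \<in> W" and x: "x \<in> G" for w x
    proof -
      obtain y where y: "\<And>i. i \<in> {1..m} \<Longrightarrow> y i \<in> S i" "x = (\<Sum>i\<in>{1..m}. y i)" by (rule dsum_expand[OF S_dsum x]) blast
      have "br w x = (\<Sum>i\<in>{1..m}. br w (y i))" unfolding y(2) by (simp add: br_simps)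
      also have "\<dots> \<in> W" using W w y(1) by (intro cvs.subspace_sum[OF Ws]) (auto simp: submod_def)
      finally show ?thesis .
    qed
    then have "submod G br W" using Ws by (simp add: submod_def)
    then show "W = {0} \<or> W = V k" using irrepD(3)[OF V_irr[OF k]] W by blast
  qed
  show "\<forall>i\<in>{1..m}. \<forall>j\<in>{1..m}. i \<noteq> j \<longrightarrow> (\<forall>w\<in>V k. \<forall>x\<in>S i. \<forall>y\<in>S j. br (br w x) y = br (br w y) x)"
  proof (intro ballI impI)
    fix i j w x y assume ij: "i \<in> {1..m}" "j \<in> {1..m}" "i \<noteq> j" and w: "w \<in> V k" and x: "x \<in> S i" and y: "y \<in> S j"
    have "w \<in> K" "x \<in> K" "y \<in> K" using w x y VK[OF k] SK ij by blast+
    then show "br (br w x) y = br (br w y) x"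
      using leibniz[of w x y] S_commute[OF ij x y] by (simp add: br_simps)
  qed
qed (simp_all add: br_left)

end

text \<open>One of the two summands of the decomposition of \<open>K\<close> belonging to a set \<open>C\<close> of simple
  ideals that is closed under adjacency; \<open>C'\<close> is the complement of \<open>C\<close>, and \<open>N\<close>
  collects the irreducible submodules on which some ideal from \<open>C\<close> acts nontrivially.\<close>

locale levi_part = levi_split K br G I m n S V
  for K :: "'v::cvs set" and br and G and I and m n :: nat and S V :: "nat \<Rightarrow> 'v set" +
  fixes C C' N N' :: "nat set"
  assumes CC: "{1..m} = C \<union> C'" "C \<inter> C' = {}" and NN: "{1..n} = N \<union> N'" "N \<inter> N' = {}"
    and zero1: "\<And>k j v x. k \<in> N \<Longrightarrow> j \<in> C' \<Longrightarrow> v \<in> V k \<Longrightarrow> x \<in> S j \<Longrightarrow> br v x = 0"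
    and zero2: "\<And>k j v x. k \<in> N' \<Longrightarrow> j \<in> C \<Longrightarrow> v \<in> V k \<Longrightarrow> x \<in> S j \<Longrightarrow> br v x = 0"
begin

definition "HC = cvs.span (\<Union>j\<in>C. S j)"
definition "HD = cvs.span (\<Union>j\<in>C'. S j)"
definition "IC = cvs.span (\<Union>k\<in>N. V k)"
definition "ID = cvs.span (\<Union>k\<in>N'. V k)"
definition "P = {h + v | h v. h \<in> HC \<and> v \<in> IC}"

lemma subs: "cvs.subspace HC" "cvs.subspace HD" "cvs.subspace IC" "cvs.subspace ID"
  by (simp_all add: HC_def HD_def IC_def ID_def)

lemma HG: "HC \<subseteq> G" "HD \<subseteq> G"
  unfolding HC_def HD_def by (rule dsum_span_subset[OF S_dsum _ G.G_sub]; use CC(1) in blast)+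

lemma II: "IC \<subseteq> I" "ID \<subseteq> I"
  unfolding IC_def ID_def by (rule dsum_span_subset[OF V_dsum _ I_sub]; use NN(1) in blast)+

lemma P_sub: "cvs.subspace P" unfolding P_def by (rule cvs.subspace_sums[OF subs(1,3)])

lemma PK: "P \<subseteq> K"
proof
  fix p assume "p \<in> P"
  then obtain h v where "p = h + v" "h \<in> HC" "v \<in> IC" unfolding P_def by blast
  then show "p \<in> K" using HG(1) II(1) GK IK cvs.subspace_add[OF K_sub] by blast
qed

lemma bilinear_zero:
  assumes "\<And>a b. a \<in> X \<Longrightarrow> b \<in> Y \<Longrightarrow> br a b = 0" "a \<in> cvs.span X" "b \<in> cvs.span Y" shows "br a b = 0"
proof -
  have "br a b = 0" if "a \<in> X" for a
    using eq_on_span[OF br_right clin_zero, of Y a b] assms(1)[OF that] assms(3) by blast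
  then show ?thesis using eq_on_span[OF br_left[of b] clin_zero, of X a] assms(2) by blast
qed

lemma br_ID_HC: "v \<in> ID \<Longrightarrow> h \<in> HC \<Longrightarrow> br v h = 0"
  unfolding ID_def HC_def
  by (rule bilinear_zero[of "\<Union>k\<in>N'. V k" "\<Union>j\<in>C. S j"]) (assumption | use zero2 in blast)+

lemma br_IC_HD: "v \<in> IC \<Longrightarrow> h \<in> HD \<Longrightarrow> br v h = 0"
  unfolding IC_def HD_def
  by (rule bilinear_zero[of "\<Union>k\<in>N. V k" "\<Union>j\<in>C'. S j"]) (assumption | use zero1 in blast)+

lemma br_HC_HD: "h \<in> HC \<Longrightarrow> h' \<in> HD \<Longrightarrow> br h h' = 0"
  unfolding HC_def HD_def
proof (rule bilinear_zero[of "\<Union>j\<in>C. S j" "\<Union>j\<in>C'. S j"])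
  fix a b assume "a \<in> (\<Union>j\<in>C. S j)" "b \<in> (\<Union>j\<in>C'. S j)"
  then obtain i j where "i \<in> C" "a \<in> S i" "j \<in> C'" "b \<in> S j" by blast
  then show "br a b = 0" using S_commute[of i j a b] CC by blast
qed

lemma br_IC_G: "v \<in> IC \<Longrightarrow> x \<in> G \<Longrightarrow> br v x \<in> IC"
proof -
  assume v: "v \<in> IC" and x: "x \<in> G"
  show "br v x \<in> IC" unfolding IC_def
  proof (rule span_image_subset[OF br_left cvs.subspace_span _ v[unfolded IC_def]])
    fix u assume "u \<in> (\<Union>k\<in>N. V k)"
    then obtain k where "k \<in> N" "u \<in> V k" by blast
    then show "br u x \<in> cvs.span (\<Union>k\<in>N. V k)" using V_closed[of k u x] NN(1) x by (intro cvs.span_base) blast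
  qed
qed

lemma HC_ideal: "lie_ideal br HC G"
proof -
  have "br h x \<in> HC" if h: "h \<in> HC" and x: "x \<in> G" for h x
    unfolding HC_def
  proof (rule span_image_subset[OF br_left cvs.subspace_span _ h[unfolded HC_def]])
    fix u assume "u \<in> (\<Union>j\<in>C. S j)"
    then obtain j where j: "j \<in> C" "u \<in> S j" by blast
    have "j \<in> {1..m}" using j(1) CC(1) by blast
    then have "br u x \<in> S j" using S_ideal[of j] x j(2) by (auto simp: lie_ideal_def)
    then show "br u x \<in> cvs.span (\<Union>j\<in>C. S j)" using j(1) by (intro cvs.span_base) blast
  qed
  then show ?thesis using subs(1) HG(1) by (simp add: lie_ideal_def)
qed

lemma G_split: "x \<in> G \<Longrightarrow> \<exists>a\<in>HC. \<exists>b\<in>HD. x = a + b"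
  unfolding HC_def HD_def using dsum_split[OF S_dsum CC] by blast

lemma I_split: "x \<in> I \<Longrightarrow> \<exists>a\<in>IC. \<exists>b\<in>ID. x = a + b"
  unfolding IC_def ID_def using dsum_split[OF V_dsum NN] by blast

text \<open>Split \<open>x\<close> into parts from \<open>HC\<close>, \<open>HD\<close>,
  \<open>IC\<close>, \<open>ID\<close>. Against \<open>p\<close> the \<open>HD\<close> part
  contributes nothing because distinct simple ideals commute and by \<open>zero1\<close>, the
  \<open>ID\<close> part nothing by \<open>zero2\<close> and \<open>right_zero\<close>; the other
  terms stay in \<open>HC\<close> or \<open>IC\<close>.\<close>

lemma P_ideal:
  assumes x: "x \<in> K" and p: "p \<in> P" shows "br x p \<in> P" "br p x \<in> P"
proof -
  obtain g v where gv: "g \<in> G" "v \<in> I" "x = g + v" using GI[OF x] by blast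
  obtain a b where ab: "a \<in> HC" "b \<in> HD" "g = a + b" using G_split[OF gv(1)] by blast
  obtain c d where cd: "c \<in> IC" "d \<in> ID" "v = c + d" using I_split[OF gv(2)] by blast
  obtain h u where hu: "h \<in> HC" "u \<in> IC" "p = h + u" using p unfolding P_def by blast
  have uI: "u \<in> I" using hu(2) II by blast
  have pK: "p \<in> K" using p PK by blast
  have hG: "h \<in> G" "a \<in> G" "b \<in> G" using hu(1) ab HG by blast+
  have "br b h = 0" using br_HC_HD[OF hu(1) ab(2)] G.br_anti[OF hG(3,1)] by simp
  moreover have "br x u = 0" by (rule right_zero[OF x uI])
  ultimately have "br x p = br a h + br c h"
    unfolding hu(3) using br_ID_HC[OF cd(2) hu(1)] by (simp add: gv(3) ab(3) cd(3) br_simps)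
  moreover have "br a h \<in> HC" using HC_ideal ab(1) hG(1) by (simp add: lie_ideal_def)
  moreover have "br c h \<in> IC" by (rule br_IC_G[OF cd(1) hG(1)])
  ultimately show "br x p \<in> P" unfolding P_def by blast
  have "br p v = 0" by (rule right_zero[OF pK gv(2)])
  moreover have "br h b = 0" "br u b = 0" by (rule br_HC_HD[OF hu(1) ab(2)], rule br_IC_HD[OF hu(2) ab(2)])
  ultimately have "br p x = br h a + br u a"
    unfolding gv(3) by (simp add: ab(3) hu(3) br_simps)
  moreover have "br h a \<in> HC" using HC_ideal hu(1) hG(2) by (simp add: lie_ideal_def)
  moreover have "br u a \<in> IC" by (rule br_IC_G[OF hu(2) hG(2)])
  ultimately show "br p x \<in> P" unfolding P_def by blast
qed

lemma HC_P: "HC \<subseteq> P" unfolding P_def using cvs.subspace_0[OF subs(3)] by force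

text \<open>This is the Leibniz kernel computed inside \<open>P\<close>. For the harder inclusion,
  \<open>V k\<close> is spanned by brackets \<open>br v x\<close>; only the \<open>HC\<close> part
  \<open>a\<close> of \<open>x\<close> acts on \<open>v\<close>, and \<open>br v a\<close> is the
  square of \<open>a + v\<close>, an element of \<open>P\<close>.\<close>

lemma IC_eq: "IC = cvs.span {br x x | x. x \<in> P}"
proof
  have "{br x x | x. x \<in> P} \<subseteq> IC"
  proof
    fix u assume "u \<in> {br x x | x. x \<in> P}"
    then obtain h v where hv: "u = br (h + v) (h + v)" "h \<in> HC" "v \<in> IC" unfolding P_def by blast
    then have "h \<in> G" "v \<in> I" using HG II by blast+
    then show "u \<in> IC" using square[of h v] br_IC_G[OF hv(3)] hv(1) by simp
  qed
  then show "cvs.span {br x x | x. x \<in> P} \<subseteq> IC" by (rule cvs.span_minimal[OF _ subs(3)])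
  have "V k \<subseteq> cvs.span {br x x | x. x \<in> P}" if k: "k \<in> N" for k
  proof -
    have kn: "k \<in> {1..n}" using k NN by blast
    have "{br v x | v x. v \<in> V k \<and> x \<in> G} \<subseteq> cvs.span {br x x | x. x \<in> P}"
    proof
      fix u assume "u \<in> {br v x | v x. v \<in> V k \<and> x \<in> G}"
      then obtain v x where u: "u = br v x" "v \<in> V k" "x \<in> G" by blast
      obtain a b where ab: "a \<in> HC" "b \<in> HD" "x = a + b" using G_split[OF u(3)] by blast
      have v: "v \<in> IC" unfolding IC_def using u(2) k by (intro cvs.span_base) blast
      have "u = br v a" using u(1) ab(3) br_IC_HD[OF v ab(2)] by (simp add: br_simps)
      moreover have "a \<in> G" "v \<in> I" using ab(1) v HG II by blast+
      ultimately have "u = br (a + v) (a + v)" using square by simp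
      moreover have "a + v \<in> P" unfolding P_def using ab(1) v by blast
      ultimately show "u \<in> cvs.span {br x x | x. x \<in> P}" by (intro cvs.span_base) blast
    qed
    then have "cvs.span {br v x | v x. v \<in> V k \<and> x \<in> G} \<subseteq> cvs.span {br x x | x. x \<in> P}" by (rule cvs.span_minimal) simp
    then show ?thesis using V_bracket[OF kn] by simp
  qed
  then show "IC \<subseteq> cvs.span {br x x | x. x \<in> P}" unfolding IC_def by (intro cvs.span_minimal) auto
qed

lemma part_ideal:
  assumes L: "aparam L K \<psi> br"
  shows "bracket_ideal (\<psi> ` P) L" "semisimple_leibniz (L\<lparr>carrier := \<psi> ` P\<rparr>)"
proof -
  show "bracket_ideal (\<psi> ` P) L" by (rule aparam_bracket_ideal[OF L P_sub PK]) (use P_ideal in blast)+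
  have "subalg br P K" using P_sub PK P_ideal by (auto simp: subalg_def)
  then have leib: "leibalg P br" by (rule leibalg_sub)
  show "semisimple_leibniz (L\<lparr>carrier := \<psi> ` P\<rparr>)"
  proof (rule semisimple_leibniz_of_split[OF aparam_sub[OF L P_sub PK] leib IC_eq])
    show "ssalg HC br" by (rule G.ssalg_ideal[OF HC_ideal])
    show "HC \<subseteq> P" by (rule HC_P)
    show "HC \<inter> IC = {0}" using GI0 HG(1) II(1) cvs.subspace_0[OF subs(1)] cvs.subspace_0[OF subs(3)] by blast
    show "\<exists>h\<in>HC. \<exists>j\<in>IC. x = h + j" if "x \<in> P" for x using that unfolding P_def by blast
    show "br x y \<in> IC" if x: "x \<in> P" and y: "y \<in> IC" for x y
    proof -
      have "x \<in> K" "y \<in> I" using x y PK II by blast+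
      then show ?thesis using right_zero[of x y] cvs.subspace_0[OF subs(3)] by simp
    qed
    show "br x y \<in> IC" if x: "x \<in> IC" and y: "y \<in> P" for x y
    proof -
      obtain h v where hv: "y = h + v" "h \<in> HC" "v \<in> IC" using y unfolding P_def by blast
      have "x \<in> K" "v \<in> I" "h \<in> G" using x hv II IK HG by blast+
      then show ?thesis using right_zero[of x v] br_IC_G[OF x, of h] hv(1) by (simp add: br_simps)
    qed
  qed
qed

end

context levi_split begin

text \<open>If \<open>j\<close> is not reached from \<open>i\<close>, the component of
  \<open>i\<close> and its complement define two nonzero complementary ideals that are semisimple
  Leibniz algebras.\<close>

lemma connected:
  assumes L: "aparam L K \<psi> br" and indec: "\<not> decomposable L" and i: "i \<in> {1..m}" and j: "j \<in> {1..m}"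
  shows "connected_summands L {1..n} (\<lambda>k. \<psi> ` V k) {1..m} (\<lambda>j. \<psi> ` S j) i j"
proof (rule ccontr)
  let ?R = "{(a, b). a \<in> {1..m} \<and> b \<in> {1..m} \<and> adjacent L {1..n} (\<lambda>k. \<psi> ` V k) (\<psi> ` S a) (\<psi> ` S b)}"
  assume "\<not> ?thesis"
  then have nc: "(i, j) \<notin> ?R\<^sup>*" by (simp add: connected_summands_def)
  have adj: "(a, b) \<in> ?R" if "a \<in> {1..m}" "b \<in> {1..m}" "k \<in> {1..n}" "nontriv k a" "nontriv k b" for a b k
  proof -
    have "bracket_span L (\<psi> ` V k) (\<psi> ` S c) = \<psi> ` V k" if "c \<in> {1..m}" "nontriv k c" for c
      using aparam_bracket_span[OF L leibalg_axioms VK[OF \<open>k \<in> {1..n}\<close>] SK[OF that(1)]]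
        nontriv_bracket[OF \<open>k \<in> {1..n}\<close> that] by simp
    then show ?thesis using that unfolding adjacent_def by blast
  qed
  define C where "C = {b \<in> {1..m}. (i, b) \<in> ?R\<^sup>*}"
  define C' where "C' = {1..m} - C"
  define N where "N = {k \<in> {1..n}. \<exists>b\<in>C. nontriv k b}"
  define N' where "N' = {1..n} - N"
  have iC: "i \<in> C" using i by (simp add: C_def)
  have jC: "j \<in> C'" using j nc by (simp add: C_def C'_def)
  \<comment> \<open>An ideal outside the component acting nontrivially on a module in
    \<open>N\<close> would be adjacent to a member of the component and hence belong to it.\<close>
  have z1: "br v x = 0" if h: "k \<in> N" "b \<in> C'" "v \<in> V k" "x \<in> S b" for k b v x
  proof (rule ccontr)
    assume "br v x \<noteq> 0"
    then have "nontriv k b" using h by (auto simp: nontriv_def)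
    moreover obtain c where c: "c \<in> C" "nontriv k c" "k \<in> {1..n}" using h(1) by (auto simp: N_def)
    moreover have "b \<in> {1..m}" "c \<in> {1..m}" using h(2) c(1) by (auto simp: C'_def C_def)
    ultimately have "(c, b) \<in> ?R" using adj[of c b k] by blast
    moreover have "(i, c) \<in> ?R\<^sup>*" using c(1) by (simp add: C_def)
    ultimately have "(i, b) \<in> ?R\<^sup>*" by (rule rtrancl_into_rtrancl[rotated])
    then show False using h(2) \<open>b \<in> {1..m}\<close> unfolding C'_def C_def by blast
  qed
  have z2: "br v x = 0" if "k \<in> N'" "b \<in> C" "v \<in> V k" "x \<in> S b" for k b v x
    using that unfolding N'_def N_def nontriv_def by blast
  have CC: "{1..m} = C \<union> C'" "C \<inter> C' = {}" "{1..n} = N \<union> N'" "N \<inter> N' = {}"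
    by (auto simp: C_def C'_def N_def N'_def)
  interpret A: levi_part K br G I m n S V C C' N N'
    by (intro levi_part.intro levi_split_axioms levi_part_axioms.intro CC z1 z2)
  have CC': "{1..m} = C' \<union> C" "C' \<inter> C = {}" "{1..n} = N' \<union> N" "N' \<inter> N = {}" using CC by blast+
  \<comment> \<open>The vanishing conditions are symmetric under exchanging the two index sets, so
    the complementary summand is the same construction with the roles swapped.\<close>
  interpret B: levi_part K br G I m n S V C' C N' N
    by (intro levi_part.intro levi_split_axioms levi_part_axioms.intro CC' z1 z2)
  have eq: "B.HC = A.HD" "B.HD = A.HC" "B.IC = A.ID" "B.ID = A.IC"
    by (simp_all add: A.HC_def A.HD_def A.IC_def A.ID_def B.HC_def B.HD_def B.IC_def B.ID_def)
  note v = aparamD(1)[OF L]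
  have S_ne: "\<psi> ` Q \<noteq> {\<zero>\<^bsub>L\<^esub>}" if c: "c \<in> {1..m}" "S c \<subseteq> Q" "Q \<subseteq> K" for c Q
  proof
    assume e: "\<psi> ` Q = {\<zero>\<^bsub>L\<^esub>}"
    have "x = 0" if x: "x \<in> S c" for x
    proof -
      have "\<psi> x = \<psi> 0" using e x c(2) vparamD(4)[OF v] by auto
      then show ?thesis using inj_onD[OF vparamD(3)[OF v]] x c cvs.subspace_0[OF K_sub] by blast
    qed
    then show False using S_nonzero[OF c(1)] cvs.subspace_0[OF S_sub[OF c(1)]] by blast
  qed
  have SA: "S i \<subseteq> A.P" using A.HC_P iC cvs.span_superset[of "\<Union>j\<in>C. S j"] unfolding A.HC_def by blast
  have SB: "S j \<subseteq> B.P" using B.HC_P jC cvs.span_superset[of "\<Union>j\<in>C'. S j"] unfolding B.HC_def by blast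
  have int: "x = 0" if xA: "x \<in> A.P" and xB: "x \<in> B.P" for x
  proof -
    obtain a c where a: "x = a + c" "a \<in> A.HC" "c \<in> A.IC" using xA unfolding A.P_def by blast
    obtain b d where b: "x = b + d" "b \<in> A.HD" "d \<in> A.ID" using xB unfolding B.P_def eq by blast
    have "a - b = d - c" using a(1) b(1) by (simp add: algebra_simps)
    moreover have "a - b \<in> G" using a(2) b(2) A.HG cvs.subspace_diff[OF G.G_sub] by blast
    moreover have "d - c \<in> I" using a(3) b(3) A.II cvs.subspace_diff[OF I_sub] by blast
    ultimately have "a - b \<in> G \<inter> I" by simp
    then have "a - b = 0" using GI0 by simp
    then have ab: "a = b" "c = d" using a(1) b(1) by simp_all
    have "a = 0" using dsum_span_disjoint[OF S_dsum, of C C' a] CC a(2) b(2) ab(1) unfolding A.HC_def A.HD_def by blast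
    moreover have "c = 0" using dsum_span_disjoint[OF V_dsum, of N N' c] CC a(3) b(3) ab(2) unfolding A.IC_def A.ID_def by blast
    ultimately show ?thesis using a(1) by simp
  qed
  have sum: "\<exists>a\<in>A.P. \<exists>b\<in>B.P. x = a + b" if x: "x \<in> K" for x
  proof -
    obtain g v where gv: "g \<in> G" "v \<in> I" "x = g + v" using GI[OF x] by blast
    obtain a b where ab: "a \<in> A.HC" "b \<in> A.HD" "g = a + b" using A.G_split[OF gv(1)] by blast
    obtain c d where cd: "c \<in> A.IC" "d \<in> A.ID" "v = c + d" using A.I_split[OF gv(2)] by blast
    have "a + c \<in> A.P" "b + d \<in> B.P" unfolding A.P_def B.P_def eq using ab cd by blast+
    moreover have "x = (a + c) + (b + d)" using gv ab cd by (simp add: algebra_simps)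
    ultimately show ?thesis by blast
  qed
  have "complementary L (\<psi> ` A.P) (\<psi> ` B.P)" unfolding complementary_def
  proof (intro conjI)
    show "VectorSpace.subspace complex_field (\<psi> ` A.P) L" "VectorSpace.subspace complex_field (\<psi> ` B.P) L"
      by (rule vparam_subspace[OF v A.P_sub A.PK], rule vparam_subspace[OF v B.P_sub B.PK])
    have "\<psi> ` A.P \<inter> \<psi> ` B.P = \<psi> ` (A.P \<inter> B.P)"
      using inj_on_image_Int[OF vparamD(3)[OF v] A.PK B.PK] by simp
    also have "A.P \<inter> B.P = {0}" using int cvs.subspace_0[OF A.P_sub] cvs.subspace_0[OF B.P_sub] by blast
    finally show "\<psi> ` A.P \<inter> \<psi> ` B.P = {\<zero>\<^bsub>L\<^esub>}" using vparamD(4)[OF v] by simp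
    show "(\<psi> ` A.P) <+>\<^bsub>L\<^esub> (\<psi> ` B.P) = carrier L"
    proof (intro equalityI subsetI)
      fix z assume "z \<in> (\<psi> ` A.P) <+>\<^bsub>L\<^esub> (\<psi> ` B.P)"
      then obtain a b where ab: "a \<in> A.P" "b \<in> B.P" "z = \<psi> a \<oplus>\<^bsub>L\<^esub> \<psi> b" unfolding set_add_def' by blast
      then have "a \<in> K" "b \<in> K" using A.PK B.PK by blast+
      then show "z \<in> carrier L" using ab(3) vparamD(5)[OF v] vparamD(2)[OF v] cvs.subspace_add[OF K_sub] by simp
    next
      fix z assume "z \<in> carrier L"
      then obtain x where x: "x \<in> K" "z = \<psi> x" using vparamD(2)[OF v] by blast
      obtain a b where ab: "a \<in> A.P" "b \<in> B.P" "x = a + b" using sum[OF x(1)] by blast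
      then have "a \<in> K" "b \<in> K" using A.PK B.PK by blast+
      then have "z = \<psi> a \<oplus>\<^bsub>L\<^esub> \<psi> b" using x(2) ab(3) vparamD(5)[OF v] by simp
      then show "z \<in> (\<psi> ` A.P) <+>\<^bsub>L\<^esub> (\<psi> ` B.P)" unfolding set_add_def' using ab by blast
    qed
  qed
  then have "decomposable L" unfolding decomposable_def
    using A.part_ideal[OF L] B.part_ideal[OF L] S_ne[OF i SA A.PK] S_ne[OF j SB B.PK] by blast
  then show False using indec by simp
qed

end

text \<open>These constants would shadow the record fields of the same name.\<close>

hide_const (open) Multiset.mult Polynomial.smult

text \<open>Copies a subspace of \<open>coord_space d\<close> into \<open>complex vec\<close>, the
  type prescribed for the tensor factors. The action reads a vector back as a function with value 0
  from index \<open>d\<close> on, which by \<open>unvec_vec\<close> inverts \<open>vec d\<close> on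
  \<open>coord_space d\<close>.\<close>

definition vec_module ::
  "nat \<Rightarrow> ((nat \<Rightarrow> complex) \<Rightarrow> 'g \<Rightarrow> nat \<Rightarrow> complex) \<Rightarrow> (nat \<Rightarrow> complex) set \<Rightarrow> ('g, complex vec) right_module" where
  "vec_module d f U = \<lparr>carrier = vec d ` U, mult = undefined, one = undefined, zero = 0\<^sub>v d,
    add = (+), smult = (\<cdot>\<^sub>v), act = (\<lambda>v g. vec d (f (\<lambda>i. if i < d then v $ i else 0) g))\<rparr>"

lemma unvec_vec: "u \<in> coord_space d \<Longrightarrow> (\<lambda>i. if i < d then vec d u $ i else 0) = u"
  by (auto simp: coord_space_def fun_eq_iff)

lemma vec_module_param:
  assumes U: "cvs.subspace U" "U \<subseteq> coord_space d"
  shows "vparam (vec_module d f U) U (vec d)"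
  unfolding vparam_def
proof (intro conjI ballI allI)
  have "inj_on (vec d :: _ \<Rightarrow> complex vec) U"
  proof (rule inj_onI)
    fix x y assume xy: "x \<in> U" "y \<in> U" "vec d x = vec d y"
    have "x = (\<lambda>i. if i < d then vec d y $ i else 0)"
      unfolding xy(3)[symmetric] by (rule unvec_vec[OF subsetD[OF U(2) xy(1)], symmetric])
    also have "\<dots> = y" by (rule unvec_vec[OF subsetD[OF U(2) xy(2)]])
    finally show "x = y" .
  qed
  then show "bij_betw (vec d) U (carrier (vec_module d f U))" by (simp add: bij_betw_def vec_module_def)
  show "\<zero>\<^bsub>vec_module d f U\<^esub> = vec d 0" by (intro eq_vecI) (auto simp: vec_module_def)
  show "vec d (x + y) = vec d x \<oplus>\<^bsub>vec_module d f U\<^esub> vec d y" for x y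
    by (intro eq_vecI) (auto simp: vec_module_def)
  show "vec d (c *\<^sub>c x) = c \<odot>\<^bsub>vec_module d f U\<^esub> vec d x" for c x
    by (intro eq_vecI) (auto simp: vec_module_def)
qed (rule U)

lemma vec_module_act:
  assumes "u \<in> coord_space d" shows "act (vec_module d f U) (vec d u) g = vec d (f u g)"
  using unvec_vec[OF assms] by (simp add: vec_module_def)

text \<open>Every factor from \<open>V_tensor\<close> is a subspace of \<open>V k\<close>, hence of
  \<open>coord_space d\<close>, so a single dimension \<open>d\<close> serves all of them. Elements
  of the record act through their coordinates \<open>inv_into K \<psi> g\<close>.\<close>

lemma levi_split_tensor_factors:
  assumes split: "levi_split K br G I m n S V" and L: "aparam L K \<psi> br" and K: "K = coord_space d" and k: "k \<in> {1..n}"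
  shows "\<exists>Vc. (\<forall>j\<in>{1..m}. irreducible_module (L\<lparr>carrier := \<psi> ` S j\<rparr>) (vec_module d (\<lambda>u g. br u (inv_into K \<psi> g)) (Vc j))) \<and>
    isomorphic_modules (L\<lparr>carrier := \<psi> ` G\<rparr>) (bracket_module L (\<psi> ` V k))
      (tensor_module (L\<lparr>carrier := \<psi> ` G\<rparr>) {1..m} (\<lambda>j. \<psi> ` S j) (\<lambda>j. vec_module d (\<lambda>u g. br u (inv_into K \<psi> g)) (Vc j)))"
proof -
  interpret levi_split K br G I m n S V by (rule split)
  let ?f = "\<lambda>u g. br u (inv_into K \<psi> g)"
  let ?G = "L\<lparr>carrier := \<psi> ` G\<rparr>"
  note v = aparamD(1)[OF L]
  have inv: "inv_into K \<psi> (\<psi> x) = x" if "x \<in> K" for x by (rule inv_into_f_f[OF vparamD(3)[OF v] that])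
  from V_tensor[OF k] obtain Vc \<mu> where Vc: "\<forall>j\<in>{1..m}. irrep (S j) br (Vc j) \<and> Vc j \<subseteq> V k"
    and ml: "multilinear_on {1..m} Vc \<mu>"
    and eq: "\<forall>v\<in>Pi\<^sub>E {1..m} Vc. \<forall>j\<in>{1..m}. \<forall>x\<in>S j. br (\<mu> v) x = \<mu> (v(j := br (v j) x))"
    and bf: "\<forall>B. (\<forall>j\<in>{1..m}. is_basis (Vc j) (B j)) \<longrightarrow> basis_family (V k) (Pi\<^sub>E {1..m} B) \<mu>"
    and mV: "\<forall>v\<in>Pi\<^sub>E {1..m} Vc. \<mu> v \<in> V k"
    by (elim exE conjE) (rule that)
  have Vi: "irrep (S j) br (Vc j)" and VcV: "Vc j \<subseteq> V k" if "j \<in> {1..m}" for j using Vc that by blast+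
  have Vs: "cvs.subspace (Vc j)" "\<And>u x. u \<in> Vc j \<Longrightarrow> x \<in> S j \<Longrightarrow> br u x \<in> Vc j" if "j \<in> {1..m}" for j
    using submodD[OF irrepD(1)[OF Vi[OF that]]] by blast+
  have VcK: "Vc j \<subseteq> K" if "j \<in> {1..m}" for j using VcV[OF that] VK[OF k] by blast
  have VcF: "fds (Vc j)" if "j \<in> {1..m}" for j by (rule fds_mono[OF K_fds Vs(1)[OF that] VcK[OF that]])
  have par: "vparam (vec_module d ?f (Vc j)) (Vc j) (vec d)" if "j \<in> {1..m}" for j
    by (rule vec_module_param[OF Vs(1)[OF that]]) (use VcK[OF that] K in simp)
  have actv: "act (vec_module d ?f (Vc j)) (vec d u) (\<psi> x) = vec d (br u x)" if "j \<in> {1..m}" "u \<in> Vc j" "x \<in> K" for j u x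
    using vec_module_act[of u d ?f "Vc j" "\<psi> x"] inv[OF that(3)] VcK[OF that(1)] that(2) K by auto
  have irr: "irreducible_module (L\<lparr>carrier := \<psi> ` S j\<rparr>) (vec_module d ?f (Vc j))" if j: "j \<in> {1..m}" for j
  proof (rule aparam_irreducible_module[OF aparam_sub[OF L S_sub[OF j] SK[OF j]] _ par[OF j] _ Vi[OF j]])
    interpret Sj: liealg "S j" br by (rule G.liealg_subalg[OF G.ideal_subalg[OF S_ideal[OF j]]])
    show "liemod (S j) br (Vc j) br"
    proof (intro liemod.intro Sj.liealg_axioms liemod_axioms.intro VcF[OF j] br_left br_right)
      show "br u x \<in> Vc j" if "u \<in> Vc j" "x \<in> S j" for u x by (rule Vs(2)[OF j that])
      show "br u (br x y) = br (br u x) y - br (br u y) x" if "u \<in> Vc j" "x \<in> S j" "y \<in> S j" for u x y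
        using leibniz that VcK[OF j] SK[OF j] by blast
    qed
    show "act (vec_module d ?f (Vc j)) (vec d u) (\<psi> x) = vec d (br u x)" if "u \<in> Vc j" "x \<in> S j" for u x
      using actv[OF j that(1)] that(2) SK[OF j] by blast
  qed
  obtain B where B: "\<And>j. j \<in> {1..m} \<Longrightarrow> is_basis (Vc j) (B j)"
  proof -
    have "\<forall>j\<in>{1..m}. \<exists>B. is_basis (Vc j) B" using basis_ex[OF VcF] by metis
    then obtain B where "\<forall>j\<in>{1..m}. is_basis (Vc j) (B j)" by (rule bchoice[THEN exE])
    then show ?thesis using that by blast
  qed
  have GP: "vparam ?G G \<psi>" by (rule vparam_sub[OF v G.G_sub GK])
  \<comment> \<open>The \<open>j\<close>-th component of \<open>g\<close> in the internal direct
    sum, pulled back to coordinates and acting by the bracket; \<open>aeq\<close> evaluates it on a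
    sum of elements of the simple ideals.\<close>
  define a where "a = (\<lambda>j u g. br u (inv_into K \<psi> (component ?G {1..m} (\<lambda>j. \<psi> ` S j) j g)))"
  have comp: "component ?G {1..m} (\<lambda>j. \<psi> ` S j) j (\<psi> (\<Sum>i\<in>{1..m}. w i)) = \<psi> (w j)"
    if "\<And>i. i \<in> {1..m} \<Longrightarrow> w i \<in> S i" "j \<in> {1..m}" for w j
    by (rule vparam_component[OF GP S_dsum that(1) that(2)])
  have exw: "\<exists>w. (\<forall>i\<in>{1..m}. w i \<in> S i) \<and> g = \<psi> (\<Sum>i\<in>{1..m}. w i)" if g: "g \<in> carrier ?G" for g
  proof -
    obtain x where x: "x \<in> G" "g = \<psi> x" using g by auto
    obtain w where "\<And>i. i \<in> {1..m} \<Longrightarrow> w i \<in> S i" "x = (\<Sum>i\<in>{1..m}. w i)" by (rule dsum_expand[OF S_dsum x(1)]) blast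
    then show ?thesis using x(2) by blast
  qed
  have aeq: "a j u (\<psi> (\<Sum>i\<in>{1..m}. w i)) = br u (w j)"
    if "\<forall>i\<in>{1..m}. w i \<in> S i" "j \<in> {1..m}" for w j u
  proof -
    have "w j \<in> K" using that SK by blast
    then show ?thesis unfolding a_def using comp[of w j] that inv by simp
  qed
  interpret T: tensor_module_decomp "{1..m}" Vc "V k" \<mu> "\<lambda>j. vec_module d ?f (Vc j)" "vec d" B ?G "\<lambda>j. \<psi> ` S j" a "\<lambda>w g. br w (inv_into K \<psi> g)"
  proof (intro tensor_module_decomp.intro tensor_decomp.intro tensor_module_decomp_axioms.intro)
    show "basis_family (V k) (Pi\<^sub>E {1..m} B) \<mu>" using bf B by blast
    show "\<mu> v \<in> V k" if "v \<in> Pi\<^sub>E {1..m} Vc" for v using mV that by blast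
    fix j u g assume j: "j \<in> {1..m}" and u: "u \<in> Vc j" and g: "g \<in> carrier ?G"
    obtain w where w: "\<forall>i\<in>{1..m}. w i \<in> S i" "g = \<psi> (\<Sum>i\<in>{1..m}. w i)" using exw[OF g] by blast
    have wj: "w j \<in> S j" "w j \<in> K" using w(1) j SK[OF j] by blast+
    have c: "component ?G {1..m} (\<lambda>j. \<psi> ` S j) j g = \<psi> (w j)" unfolding w(2) by (rule comp[OF _ j]) (use w(1) in blast)
    show "act (vec_module d ?f (Vc j)) (vec d u) (component ?G {1..m} (\<lambda>j. \<psi> ` S j) j g) = vec d (a j u g)"
      using c actv[OF j u wj(2)] aeq[OF w(1) j, of u] w(2) by simp
    show "a j u g \<in> Vc j" using aeq[OF w(1) j, of u] w(2) Vs(2)[OF j u wj(1)] by simp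
  next
    fix v g assume v: "v \<in> Pi\<^sub>E {1..m} Vc" and g: "g \<in> carrier ?G"
    obtain w where w: "\<forall>i\<in>{1..m}. w i \<in> S i" "g = \<psi> (\<Sum>i\<in>{1..m}. w i)" using exw[OF g] by blast
    have "(\<Sum>i\<in>{1..m}. w i) \<in> K" using w(1) SK by (intro cvs.subspace_sum[OF K_sub]) blast
    then have "br (\<mu> v) (inv_into K \<psi> g) = (\<Sum>j\<in>{1..m}. br (\<mu> v) (w j))" using inv w(2) by (simp add: br_simps)
    also have "\<dots> = (\<Sum>j\<in>{1..m}. \<mu> (v(j := a j (v j) g)))"
      by (rule sum.cong[OF refl]) (use eq v w aeq in simp)
    finally show "(\<Sum>j\<in>{1..m}. \<mu> (v(j := a j (v j) g))) = br (\<mu> v) (inv_into K \<psi> g)" by simp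
  qed (rule finite_atLeastAtMost par B ml V_sub[OF k] br_left | assumption)+
  have "isomorphic_modules ?G (bracket_module L (\<psi> ` V k)) (tensor_module ?G {1..m} (\<lambda>j. \<psi> ` S j) (\<lambda>j. vec_module d ?f (Vc j)))"
  proof (rule T.isomorphic_tensor_module[OF vparam_bracket_module[OF v V_sub[OF k] VK[OF k]]])
    fix w g assume w: "w \<in> V k" and g: "g \<in> carrier ?G"
    obtain x where x: "x \<in> G" "g = \<psi> x" using g by auto
    have xK: "x \<in> K" "w \<in> K" using x(1) GK w VK[OF k] by blast+
    show "act (bracket_module L (\<psi> ` V k)) (\<psi> w) g = \<psi> (br w (inv_into K \<psi> g))"
      using aparamD(2)[OF L xK(2,1)] x(2) inv[OF xK(1)] by simp
    show "br w (inv_into K \<psi> g) \<in> V k" using V_closed[OF k w x(1)] x(2) inv[OF xK(1)] by simp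
  qed
  then show ?thesis using irr by blast
qed

theorem theorem3p5:
  fixes L :: "'a bracket_algebra" and S :: "'a set"
  assumes "semisimple_leibniz L"
    and "\<not> decomposable L"
    and "leibniz_kernel L \<noteq> {\<zero>\<^bsub>L\<^esub>}"
    and "levi_decomposition L S"
  shows "\<exists>(m::nat) (Ss :: nat \<Rightarrow> 'a set) (n::nat) (Is :: nat \<Rightarrow> 'a set).
    internal_direct_sum (L\<lparr>carrier := S\<rparr>) {1..m} Ss \<and>
    (\<forall>j\<in>{1..m}. bracket_ideal (Ss j) (L\<lparr>carrier := S\<rparr>) \<and> simple_lie (L\<lparr>carrier := Ss j\<rparr>)) \<and>
    internal_direct_sum (L\<lparr>carrier := leibniz_kernel L\<rparr>) {1..n} Is \<and>
    (\<forall>i\<in>{1..n}. irreducible_module (L\<lparr>carrier := S\<rparr>) (bracket_module L (Is i)) \<and>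
       bracket_span L (Is i) S = Is i) \<and>
    lie_module (L\<lparr>carrier := S\<rparr>) (bracket_module L (leibniz_kernel L)) \<and>
    algebra_iso (semidirect (L\<lparr>carrier := S\<rparr>) (bracket_module L (leibniz_kernel L))) L
      (\<lambda>(g, v). g \<oplus>\<^bsub>L\<^esub> v) \<and>
    (\<exists>J :: nat \<Rightarrow> nat \<Rightarrow> ('a, complex vec) right_module.
       (\<forall>i\<in>{1..n}. \<forall>j\<in>{1..m}. irreducible_module (L\<lparr>carrier := Ss j\<rparr>) (J i j)) \<and>
       (\<forall>i\<in>{1..n}. isomorphic_modules (L\<lparr>carrier := S\<rparr>) (bracket_module L (Is i))
          (tensor_module (L\<lparr>carrier := S\<rparr>) {1..m} Ss (J i)))) \<and>
    (\<forall>i\<in>{1..m}. \<forall>j\<in>{1..m}. connected_summands L {1..n} Is {1..m} Ss i j)"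
proof -
  have "leibniz_algebra L" using assms(1) by (simp add: semisimple_leibniz_def)
  then obtain d \<psi> br where L: "aparam L (coord_space d) \<psi> br" and leib: "leibalg (coord_space d) br" by (rule aparam_ex)
  define K where "K = coord_space d"
  interpret leibalg K br using leib by (simp add: K_def)
  have L: "aparam L K \<psi> br" using L by (simp add: K_def)
  note v = aparamD(1)[OF L]
  have sub: "subalgebra S L" and ss: "semisimple_lie (L\<lparr>carrier := S\<rparr>)" and co: "complementary L S (leibniz_kernel L)"
    using assms(4) by (auto simp: levi_decomposition_def)
  have "VectorSpace.subspace complex_field S L" using sub by (simp add: subalgebra_def)
  then obtain G where G: "cvs.subspace G" "G \<subseteq> K" "S = \<psi> ` G" by (rule vparam_subspace_ex[OF v])
  have "br x y \<in> G" if x: "x \<in> G" and y: "y \<in> G" for x y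
  proof -
    have xy: "x \<in> K" "y \<in> K" using x y G(2) by blast+
    have "\<lbrace>\<psi> x, \<psi> y\<rbrace>\<^bsub>L\<^esub> \<in> S" using sub x y G(3) by (auto simp: subalgebra_def)
    then have "\<psi> (br x y) \<in> \<psi> ` G" using aparamD(2)[OF L xy] G(3) by simp
    then show ?thesis using inj_on_image_mem_iff[OF vparamD(3)[OF v] br_closed[OF xy] G(2)] by simp
  qed
  then have "subalg br G K" using G by (simp add: subalg_def)
  then have Gl: "leibalg G br" by (rule leibalg_sub)
  have LG: "aparam (L\<lparr>carrier := S\<rparr>) G \<psi> br" unfolding G(3) by (rule aparam_sub[OF L G(1,2)])
  have Gss: "ssalg G br" by (rule aparam_ssalg[OF LG Gl ss])
  define I where "I = cvs.span {br x x | x. x \<in> K}"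
  have ker: "leibniz_kernel L = \<psi> ` I" unfolding I_def by (rule aparam_leibniz_kernel[OF L leibalg_axioms])
  have IK: "I \<subseteq> K" unfolding I_def by (rule cvs.span_minimal[OF _ K_sub]) (use br_closed in blast)
  have I0: "0 \<in> I" unfolding I_def by (rule cvs.span_zero)
  interpret levi K br G I
  proof (intro levi.intro leibalg_axioms levi_axioms.intro Gss G(2) I_def)
    have "x = 0" if x: "x \<in> G" "x \<in> I" for x
    proof -
      have "\<psi> x \<in> S \<inter> leibniz_kernel L" using x G(3) ker by blast
      also have "S \<inter> leibniz_kernel L = {\<psi> 0}" using co vparamD(4)[OF v] by (simp only: complementary_def)
      finally have "\<psi> x = \<psi> 0" by (rule singletonD)
      then show ?thesis using inj_onD[OF vparamD(3)[OF v]] x IK I0 by blast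
    qed
    then show "G \<inter> I = {0}" using cvs.subspace_0[OF G(1)] I0 by blast
    fix x assume x: "x \<in> K"
    have "\<psi> x \<in> S <+>\<^bsub>L\<^esub> leibniz_kernel L" using co x vparamD(2)[OF v] by (simp add: complementary_def)
    then obtain g u where gu: "g \<in> G" "u \<in> I" "\<psi> x = \<psi> g \<oplus>\<^bsub>L\<^esub> \<psi> u" unfolding G(3) ker set_add_def' by blast
    then have K: "g \<in> K" "u \<in> K" using G(2) IK by blast+
    then have "\<psi> x = \<psi> (g + u)" using gu(3) vparamD(5)[OF v] by simp
    \<comment> \<open>Coordinates are injective, so the decomposition of \<open>L\<close> into
      \<open>S\<close> and the kernel pulls back to one of \<open>K\<close>.\<close>
    then have "x = g + u" using inj_onD[OF vparamD(3)[OF v]] x cvs.subspace_add[OF K_sub K] by blast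
    then show "\<exists>g\<in>G. \<exists>v\<in>I. x = g + v" using gu by blast
  qed
  obtain m :: nat and W where W: "dsum G {1..m} W" "\<And>i. i \<in> {1..m} \<Longrightarrow> lie_ideal br (W i) G"
    "\<And>i J. i \<in> {1..m} \<Longrightarrow> lie_ideal br J (W i) \<Longrightarrow> J = {0} \<or> J = W i" "\<And>i. i \<in> {1..m} \<Longrightarrow> W i \<noteq> {0}"
    "\<And>i j x y. i \<in> {1..m} \<Longrightarrow> j \<in> {1..m} \<Longrightarrow> i \<noteq> j \<Longrightarrow> x \<in> W i \<Longrightarrow> y \<in> W j \<Longrightarrow> br x y = 0"
    by (rule G.simple_ideals) blast
  obtain n :: nat and V where V: "dsum I {1..n} V" "\<forall>i\<in>{1..n}. irrep G br (V i)"
    using complete_reducibility[OF GI.ssmod_axioms] by blast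
  interpret levi_split K br G I m n W V
    by (intro levi_split.intro levi_axioms levi_split_axioms.intro W V(1) V(2)[rule_format])
  have "\<forall>k\<in>{1..n}. \<exists>Vc. (\<forall>j\<in>{1..m}. irreducible_module (L\<lparr>carrier := \<psi> ` W j\<rparr>) (vec_module d (\<lambda>u g. br u (inv_into K \<psi> g)) (Vc j))) \<and>
    isomorphic_modules (L\<lparr>carrier := \<psi> ` G\<rparr>) (bracket_module L (\<psi> ` V k))
      (tensor_module (L\<lparr>carrier := \<psi> ` G\<rparr>) {1..m} (\<lambda>j. \<psi> ` W j) (\<lambda>j. vec_module d (\<lambda>u g. br u (inv_into K \<psi> g)) (Vc j)))"
    using levi_split_tensor_factors[OF levi_split_axioms L K_def] by blast
  from bchoice[OF this] obtain Vc where Vc: "\<forall>k\<in>{1..n}. (\<forall>j\<in>{1..m}. irreducible_module (L\<lparr>carrier := \<psi> ` W j\<rparr>) (vec_module d (\<lambda>u g. br u (inv_into K \<psi> g)) (Vc k j))) \<and>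
    isomorphic_modules (L\<lparr>carrier := \<psi> ` G\<rparr>) (bracket_module L (\<psi> ` V k))
      (tensor_module (L\<lparr>carrier := \<psi> ` G\<rparr>) {1..m} (\<lambda>j. \<psi> ` W j) (\<lambda>j. vec_module d (\<lambda>u g. br u (inv_into K \<psi> g)) (Vc k j)))" ..
  have act: "act (bracket_module L (\<psi> ` U)) (\<psi> u) (\<psi> x) = \<psi> (br u x)" if "U \<subseteq> K" "u \<in> U" "x \<in> G" for U u x
    using aparamD(2)[OF L, of u x] that GK by auto
  have ideals: "bracket_ideal (\<psi> ` W j) (L\<lparr>carrier := S\<rparr>)" "simple_lie (L\<lparr>carrier := \<psi> ` W j\<rparr>)" if j: "j \<in> {1..m}" for j
  proof -
    show "bracket_ideal (\<psi> ` W j) (L\<lparr>carrier := S\<rparr>)"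
      by (rule aparam_bracket_ideal[OF LG S_sub[OF j] SG[OF j]])
        (use G.ideal_left[OF W(2)[OF j]] W(2)[OF j] in \<open>auto simp: lie_ideal_def\<close>)
    obtain x y where xy: "x \<in> W j" "y \<in> W j" "br x y \<noteq> 0" using S_nonabelian[OF j] by blast
    show "simple_lie (L\<lparr>carrier := \<psi> ` W j\<rparr>)"
      by (rule aparam_simple_lie[OF aparam_sub[OF L S_sub[OF j] SK[OF j]] _ xy W(3)[OF j]])
        (rule G.liealg_subalg[OF G.ideal_subalg[OF W(2)[OF j]]])
  qed
  have irreducibles: "irreducible_module (L\<lparr>carrier := S\<rparr>) (bracket_module L (\<psi> ` V k))" "bracket_span L (\<psi> ` V k) S = \<psi> ` V k"
    if k: "k \<in> {1..n}" for k
  proof -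
    show "irreducible_module (L\<lparr>carrier := S\<rparr>) (bracket_module L (\<psi> ` V k))"
    proof (rule aparam_irreducible_module[OF LG _ vparam_bracket_module[OF v V_sub[OF k] VK[OF k]] _ V(2)[rule_format, OF k]])
      show "liemod G br (V k) br" by (rule GI.liemod_submodule[OF V_sub[OF k] VI[OF k] V_closed[OF k]])
    qed (rule act[OF VK[OF k]])
    show "bracket_span L (\<psi> ` V k) S = \<psi> ` V k"
      unfolding G(3) aparam_bracket_span[OF L leibalg_axioms VK[OF k] GK] V_bracket[OF k] ..
  qed
  have sum_S: "internal_direct_sum (L\<lparr>carrier := S\<rparr>) {1..m} (\<lambda>j. \<psi> ` W j)"
    by (rule vparam_internal_direct_sum[OF aparamD(1)[OF LG] W(1)])
  have sum_I: "internal_direct_sum (L\<lparr>carrier := leibniz_kernel L\<rparr>) {1..n} (\<lambda>k. \<psi> ` V k)"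
    unfolding ker by (rule vparam_internal_direct_sum[OF vparam_sub[OF v I_sub IK] V(1)])
  have mod: "lie_module (L\<lparr>carrier := S\<rparr>) (bracket_module L (leibniz_kernel L))"
    unfolding ker by (rule aparam_lie_module[OF LG GI.liemod_axioms vparam_bracket_module[OF v I_sub IK]]) (rule act[OF IK])
  have iso: "algebra_iso (semidirect (L\<lparr>carrier := S\<rparr>) (bracket_module L (leibniz_kernel L))) L (\<lambda>(g, v). g \<oplus>\<^bsub>L\<^esub> v)"
    unfolding ker G(3)
    by (rule semidirect_iso[OF L leibalg_axioms G(1,2) I_sub IK GI0 GI right_zero G.br_closed GI.ac_closed])
  have tensor: "\<exists>J :: nat \<Rightarrow> nat \<Rightarrow> ('a, complex vec) right_module.
       (\<forall>i\<in>{1..n}. \<forall>j\<in>{1..m}. irreducible_module (L\<lparr>carrier := \<psi> ` W j\<rparr>) (J i j)) \<and>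
       (\<forall>i\<in>{1..n}. isomorphic_modules (L\<lparr>carrier := S\<rparr>) (bracket_module L (\<psi> ` V i))
          (tensor_module (L\<lparr>carrier := S\<rparr>) {1..m} (\<lambda>j. \<psi> ` W j) (J i)))"
    unfolding G(3) using Vc by (intro exI[of _ "\<lambda>k j. vec_module d (\<lambda>u g. br u (inv_into K \<psi> g)) (Vc k j)"]) blast
  show ?thesis
    by (rule exI[of _ m], rule exI[of _ "\<lambda>j. \<psi> ` W j"], rule exI[of _ n], rule exI[of _ "\<lambda>k. \<psi> ` V k"],
        intro conjI ballI sum_S sum_I mod iso tensor)
      (assumption | rule ideals irreducibles connected[OF L assms(2)])+
qed

end
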